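(* (1) The functor $\mathcal{SM}on\to\Pi\text{-}\mathcal{SM}on$, $\mathcal A\mapsto\mathcal A_\pi$, $F\mapsto F_\pi$, given by the $\Pi$-envelope is left 2-adjoint to the forgetful functor $\nu:\Pi\text{-}\mathcal{SM}on\to\mathcal{SM}on$, in the sense that for every monoidal supercategory $\mathcal A$ and every monoidal $\Pi$-supercategory $\mathcal B$ there is an equivalence $\mathcal Hom(\mathcal A,\nu\mathcal B)\to\mathcal Hom(\mathcal A_\pi,\mathcal B)$ between the categories of monoidal superfunctors and monoidal natural transformations. (2) The functor $\Pi\text{-}\mathcal{SM}on\to\Pi\text{-}\mathcal Mon$ sending $(\mathcal A,\pi,\zeta)$ to the underlying monoidal $\Pi$-category $(\underline{\mathcal A},\pi,\beta,\xi)$, and a monoidal superfunctor $F:\mathcal A\to\mathcal B$ to $\underline F$ with the additional coherence map $j:=(F\zeta_{\mathcal A})^{-1}\circ i\circ\zeta_{\mathcal B}:\pi_{\mathcal B}\to F\pi_{\mathcal A}$, is an equivalence of categories.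
   Context: Let $k$ be a field of characteristic different from 2. A superspace is a $\mathbb Z/2$-graded $k$-vector space; $|v|$ denotes parity. A supercategory is a category whose morphism sets are superspaces, with bilinear composition inducing an even (parity-preserving) linear map. A superfunctor is a functor inducing even linear maps on morphism superspaces. An even supernatural transformation between superfunctors is a family of even morphisms natural in the usual sense. The underlying category $\underline{\mathcal A}$ has the same objects and only the even morphisms; $\underline F$ is the restriction of $F$. For supercategories $\mathcal A,\mathcal B$, $\mathcal A\boxtimes\mathcal B$ has objects pairs, $\mathrm{Hom}((\lambda,\mu),(\sigma,\tau)):=\mathrm{Hom}_{\mathcal A}(\lambda,\sigma)\otimes\mathrm{Hom}_{\mathcal B}(\mu,\tau)$ and composition $(f\otimes g)\circ(h\otimes k)=(-1)^{|g||h|}(f\circ h)\otimes(g\circ k)$. A monoidal supercategory is a supercategory $\mathcal A$ with a superfunctor $\otimes:\mathcal A\boxtimes\mathcal A\to\mathcal A$, a unit object $\mathbf 1$, and even supernatural isomorphisms $a,l,r$ (associator, left and right unitors) satisfying the usual pentagon and triangle axioms. A monoidal superfunctor is a superfunctor $F$ with an even supernatural isomorphism $c:(F-)\otimes(F-)\Rightarrow F(-\otimes-)$ and an even isomorphism $i:\mathbf 1_{\mathcal B}\to F\mathbf 1_{\mathcal A}$ satisfying the usual axioms of a (strong) monoidal functor. A monoidal natural transformation $x:F\Rightarrow G$ is an even supernatural transformation with $x_{\lambda\otimes\mu}\circ c_F=c_G\circ(x_\lambda\otimes x_\mu)$ and $x_{\mathbf 1}\circ i_F=i_G$. A monoidal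 $\Pi$-supercategory $(\mathcal A,\pi,\zeta)$ is a monoidal supercategory with a distinguished object $\pi$ and an odd isomorphism $\zeta:\pi\to\mathbf 1$. Its underlying category becomes a monoidal $\Pi$-category via $\beta_\lambda:=(1_\lambda\otimes\zeta^{-1})\circ r_\lambda^{-1}\circ l_\lambda\circ(\zeta\otimes1_\lambda):\pi\otimes\lambda\to\lambda\otimes\pi$ and $\xi:=l_{\mathbf 1}\circ(\zeta\otimes\zeta):\pi\otimes\pi\to\mathbf 1$. A monoidal $\Pi$-category $(\mathcal A,\pi,\beta,\xi)$ is a $k$-linear monoidal category with an object $(\pi,\beta)$ of its Drinfeld center, i.e. a natural isomorphism $\beta_\lambda:\pi\otimes\lambda\to\lambda\otimes\pi$ with $l_\pi\circ\beta_{\mathbf 1}=r_\pi$ and $a_{\lambda,\mu,\pi}\circ\beta_{\lambda\otimes\mu}\circ a_{\pi,\lambda,\mu}=(1_\lambda\otimes\beta_\mu)\circ a_{\lambda,\pi,\mu}\circ(\beta_\lambda\otimes1_\mu)$, such that $\beta_\pi=-1_{\pi\otimes\pi}$, together with an isomorphism $\xi:\pi\otimes\pi\to\mathbf 1$ such that $$(1_\lambda\otimes\xi^{-1})\circ r_\lambda^{-1}\circ l_\lambda\circ(\xi\otimes1_\lambda)=a_{\lambda,\pi,\pi}\circ(\beta_\lambda\otimes1_\pi)\circ a_{\pi,\lambda,\pi}^{-1}\circ(1_\pi\otimes\beta_\lambda)\circ a_{\pi,\pi,\lambda}.$$ A monoidal $\Pi$-functor $\mathcal A\to\mathcal B$ is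 a $k$-linear (strong) monoidal functor $(F,c,i)$ with an isomorphism $j:\pi_{\mathcal B}\to F\pi_{\mathcal A}$ such that $F(\beta_{\mathcal A})_\lambda\circ c_{\pi_{\mathcal A},\lambda}\circ(j\otimes1_{F\lambda})=c_{\lambda,\pi_{\mathcal A}}\circ(1_{F\lambda}\otimes j)\circ(\beta_{\mathcal B})_{F\lambda}$ and $i\circ\xi_{\mathcal B}=F\xi_{\mathcal A}\circ c_{\pi_{\mathcal A},\pi_{\mathcal A}}\circ(j\otimes j)$. $\mathcal{SM}on$, $\Pi\text{-}\mathcal{SM}on$, $\Pi\text{-}\mathcal Mon$ are the categories of monoidal supercategories, monoidal $\Pi$-supercategories and monoidal $\Pi$-categories; morphisms in the first two are monoidal superfunctors, and in the third monoidal $\Pi$-functors. The functor $\nu$ forgets $\pi$ and $\zeta$. The $\Pi$-envelope of a monoidal supercategory $\mathcal A$ is the monoidal $\Pi$-supercategory $(\mathcal A_\pi,\pi,\zeta)$ with objects $\Pi^a\lambda$ ($\lambda\in\mathrm{ob}\,\mathcal A$, $a\in\mathbb Z/2$); a homogeneous $f:\lambda\to\mu$ in $\mathcal A$ gives $f_a^b:\Pi^a\lambda\to\Pi^b\mu$ of parity $|f|+a+b$, and $\mathrm{Hom}_{\mathcal A_\pi}(\Pi^a\lambda,\Pi^b\mu)$ is $\mathrm{Hom}_{\mathcal A}(\lambda,\mu)$ with parity shifted by $a+b$. Composition: $f_b^c\circ g_a^b=(f\circ g)_a^c$. Tensor product: $(\Pi^a\lambda)\otimes(\Pi^b\mu):=\Pi^{a+b}(\lambda\otimes\mu)$,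 $f_a^b\otimes g_c^d:=(-1)^{a|g|+|f|d+ad+ac}(f\otimes g)_{a+c}^{b+d}$. The unit is $\Pi^{\bar0}\mathbf 1$, the coherence maps are the evident extensions of those of $\mathcal A$, $\pi:=\Pi^{\bar1}\mathbf 1$, $\zeta:=(1_{\mathbf 1})_{\bar1}^{\bar0}$. For a monoidal superfunctor $F$, $F_\pi$ sends $\Pi^a\lambda\mapsto\Pi^aF\lambda$, $f_a^b\mapsto(Ff)_a^b$, with coherence maps $(c_{\lambda,\mu})_{a+b}^{a+b}$ and $i_{\bar0}^{\bar0}$. *)

theory Defs
  imports "HOL-Algebra.Module" "HOL-Library.Z2" "HOL-Library.FuncSet"
begin

section \<open>Categories, functors, equivalences\<close>

record ('o, 'm) cat =
  ob :: "'o set"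
  arr :: "'o \<Rightarrow> 'o \<Rightarrow> 'm set"
  cmp :: "'m \<Rightarrow> 'm \<Rightarrow> 'm"
  idn :: "'o \<Rightarrow> 'm"

locale category =
  fixes C :: "('o, 'm) cat"
  assumes cmp_closed:
      "\<lbrakk>x \<in> ob C; y \<in> ob C; z \<in> ob C; f \<in> arr C x y; g \<in> arr C y z\<rbrakk> \<Longrightarrow> cmp C g f \<in> arr C x z"
    and idn_closed: "x \<in> ob C \<Longrightarrow> idn C x \<in> arr C x x"
    and cmp_assoc:
      "\<lbrakk>w \<in> ob C; x \<in> ob C; y \<in> ob C; z \<in> ob C; f \<in> arr C w x; g \<in> arr C x y; h \<in> arr C y z\<rbrakk>
        \<Longrightarrow> cmp C (cmp C h g) f = cmp C h (cmp C g f)"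
    and idn_left: "\<lbrakk>x \<in> ob C; y \<in> ob C; f \<in> arr C x y\<rbrakk> \<Longrightarrow> cmp C (idn C y) f = f"
    and idn_right: "\<lbrakk>x \<in> ob C; y \<in> ob C; f \<in> arr C x y\<rbrakk> \<Longrightarrow> cmp C f (idn C x) = f"
    and arr_disjoint:
      "\<lbrakk>x \<in> ob C; y \<in> ob C; x' \<in> ob C; y' \<in> ob C; f \<in> arr C x y; f \<in> arr C x' y'\<rbrakk>
        \<Longrightarrow> x = x' \<and> y = y'"

record ('o, 'm, 'p, 'n) fun_data =
  fob :: "'o \<Rightarrow> 'p"
  fmor :: "'m \<Rightarrow> 'n"

locale is_functor =
  fixes C :: "('o, 'm) cat" and D :: "('p, 'n) cat" and F :: "('o, 'm, 'p, 'n, 'z) fun_data_scheme"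
  assumes fob_closed: "x \<in> ob C \<Longrightarrow> fob F x \<in> ob D"
    and fmor_closed:
      "\<lbrakk>x \<in> ob C; y \<in> ob C; f \<in> arr C x y\<rbrakk> \<Longrightarrow> fmor F f \<in> arr D (fob F x) (fob F y)"
    and fmor_cmp:
      "\<lbrakk>x \<in> ob C; y \<in> ob C; z \<in> ob C; f \<in> arr C x y; g \<in> arr C y z\<rbrakk>
        \<Longrightarrow> fmor F (cmp C g f) = cmp D (fmor F g) (fmor F f)"
    and fmor_idn: "x \<in> ob C \<Longrightarrow> fmor F (idn C x) = idn D (fob F x)"

definition cat_iso :: "('o, 'm) cat \<Rightarrow> 'o \<Rightarrow> 'o \<Rightarrow> 'm \<Rightarrow> bool" where
  "cat_iso C x y f \<longleftrightarrow> f \<in> arr C x y \<and> (\<exists>g \<in> arr C y x. cmp C g f = idn C x \<and> cmp C f g = idn C y)"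

definition nat_iso :: "('o, 'm) cat \<Rightarrow> ('p, 'n) cat \<Rightarrow> ('o, 'm, 'p, 'n) fun_data
    \<Rightarrow> ('o, 'm, 'p, 'n) fun_data \<Rightarrow> ('o \<Rightarrow> 'n) \<Rightarrow> bool" where
  "nat_iso C D F G t \<longleftrightarrow>
     (\<forall>x \<in> ob C. cat_iso D (fob F x) (fob G x) (t x)) \<and>
     (\<forall>x \<in> ob C. \<forall>y \<in> ob C. \<forall>f \<in> arr C x y.
        cmp D (t y) (fmor F f) = cmp D (fmor G f) (t x))"

definition id_fun :: "('o, 'm, 'o, 'm) fun_data" where
  "id_fun = \<lparr>fob = id, fmor = id\<rparr>"

definition comp_fun :: "('p, 'n, 'q, 'l) fun_data \<Rightarrow> ('o, 'm, 'p, 'n) fun_data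
    \<Rightarrow> ('o, 'm, 'q, 'l) fun_data" where
  "comp_fun G F = \<lparr>fob = fob G \<circ> fob F, fmor = fmor G \<circ> fmor F\<rparr>"

definition is_equivalence ::
    "('o, 'm) cat \<Rightarrow> ('p, 'n) cat \<Rightarrow> ('o, 'm, 'p, 'n) fun_data \<Rightarrow> bool" where
  "is_equivalence C D F \<longleftrightarrow> is_functor C D F \<and>
     (\<exists>G. is_functor D C G \<and>
          (\<exists>t. nat_iso C C (comp_fun G F) id_fun t) \<and>
          (\<exists>s. nat_iso D D (comp_fun F G) id_fun s))"


section \<open>Superspaces\<close>

text \<open>Parities live in \<^typ>\<open>bit\<close>, the integers mod 2.\<close>

record ('k, 'm) superspace = "('k, 'm) module" +
  hpart :: "bit \<Rightarrow> 'm set"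

locale superspace = module K V
  for K :: "'k ring" and V :: "('k, 'm, 'z) superspace_scheme" +
  assumes submodule_hpart: "submodule (hpart V p) K V"
    and direct_sum: "v \<in> carrier V \<Longrightarrow>
      \<exists>!(u, w). u \<in> hpart V 0 \<and> w \<in> hpart V 1 \<and> v = u \<oplus>\<^bsub>V\<^esub> w"

text \<open>The parity \<open>p\<close> component of a vector; formulas given on homogeneous vectors only are
  extended to all vectors through these components.\<close>

definition hcomp :: "('k, 'm, 'z) superspace_scheme \<Rightarrow> bit \<Rightarrow> 'm \<Rightarrow> 'm" where
  "hcomp V p v = (THE u. u \<in> hpart V p \<and> (\<exists>w \<in> hpart V (p + 1). v = u \<oplus>\<^bsub>V\<^esub> w))"

definition signed :: "('k, 'm, 'z) module_scheme \<Rightarrow> bit \<Rightarrow> 'm \<Rightarrow> 'm" where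
  "signed V e v = (if e = 0 then v else \<ominus>\<^bsub>V\<^esub> v)"

definition linear_map ::
    "'k ring \<Rightarrow> ('k, 'm, 'y) module_scheme \<Rightarrow> ('k, 'n, 'z) module_scheme \<Rightarrow> ('m \<Rightarrow> 'n) \<Rightarrow> bool" where
  "linear_map K V W f \<longleftrightarrow> f \<in> carrier V \<rightarrow> carrier W \<and>
     (\<forall>u \<in> carrier V. \<forall>v \<in> carrier V. f (u \<oplus>\<^bsub>V\<^esub> v) = f u \<oplus>\<^bsub>W\<^esub> f v) \<and>
     (\<forall>a \<in> carrier K. \<forall>v \<in> carrier V. f (a \<odot>\<^bsub>V\<^esub> v) = a \<odot>\<^bsub>W\<^esub> f v)"

definition bilinear_map ::
    "'k ring \<Rightarrow> ('k, 'm, 'x) module_scheme \<Rightarrow> ('k, 'n, 'y) module_scheme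
      \<Rightarrow> ('k, 'l, 'z) module_scheme \<Rightarrow> ('m \<Rightarrow> 'n \<Rightarrow> 'l) \<Rightarrow> bool" where
  "bilinear_map K U V W b \<longleftrightarrow>
     (\<forall>u \<in> carrier U. linear_map K V W (b u)) \<and>
     (\<forall>v \<in> carrier V. linear_map K U W (\<lambda>u. b u v))"


subsection \<open>Tensor product of superspaces\<close>

text \<open>A list \<open>[(u\<^sub>1, v\<^sub>1), \<dots>, (u\<^sub>n, v\<^sub>n)]\<close> stands for the formal sum of the pairs
  \<open>(u\<^sub>i, v\<^sub>i)\<close>; the tensor product consists of the formal sums modulo the congruence
  generated by commutativity and bilinearity.\<close>

inductive tensor_eq ::
    "'k ring \<Rightarrow> ('k, 'm, 'y) module_scheme \<Rightarrow> ('k, 'n, 'z) module_scheme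
      \<Rightarrow> ('m \<times> 'n) list \<Rightarrow> ('m \<times> 'n) list \<Rightarrow> bool"
  for K U V where
    refl: "xs \<in> lists (carrier U \<times> carrier V) \<Longrightarrow> tensor_eq K U V xs xs"
  | sym: "tensor_eq K U V xs ys \<Longrightarrow> tensor_eq K U V ys xs"
  | trans: "\<lbrakk>tensor_eq K U V xs ys; tensor_eq K U V ys zs\<rbrakk> \<Longrightarrow> tensor_eq K U V xs zs"
  | append: "\<lbrakk>tensor_eq K U V xs xs'; tensor_eq K U V ys ys'\<rbrakk>
      \<Longrightarrow> tensor_eq K U V (xs @ ys) (xs' @ ys')"
  | commute: "\<lbrakk>xs \<in> lists (carrier U \<times> carrier V); ys \<in> lists (carrier U \<times> carrier V)\<rbrakk>
      \<Longrightarrow> tensor_eq K U V (xs @ ys) (ys @ xs)"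
  | add_left: "\<lbrakk>u \<in> carrier U; u' \<in> carrier U; v \<in> carrier V\<rbrakk>
      \<Longrightarrow> tensor_eq K U V [(u \<oplus>\<^bsub>U\<^esub> u', v)] [(u, v), (u', v)]"
  | add_right: "\<lbrakk>u \<in> carrier U; v \<in> carrier V; v' \<in> carrier V\<rbrakk>
      \<Longrightarrow> tensor_eq K U V [(u, v \<oplus>\<^bsub>V\<^esub> v')] [(u, v), (u, v')]"
  | scalar: "\<lbrakk>a \<in> carrier K; u \<in> carrier U; v \<in> carrier V\<rbrakk>
      \<Longrightarrow> tensor_eq K U V [(a \<odot>\<^bsub>U\<^esub> u, v)] [(u, a \<odot>\<^bsub>V\<^esub> v)]"
  | zero: "v \<in> carrier V \<Longrightarrow> tensor_eq K U V [(\<zero>\<^bsub>U\<^esub>, v)] []"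

definition tensor_class ::
    "'k ring \<Rightarrow> ('k, 'm, 'y) module_scheme \<Rightarrow> ('k, 'n, 'z) module_scheme
      \<Rightarrow> ('m \<times> 'n) list \<Rightarrow> ('m \<times> 'n) list set" where
  "tensor_class K U V xs = {ys. tensor_eq K U V xs ys}"

text \<open>The unions below are over the representatives of a class and are unions of equal sets, as
  usual for operations on quotients. The multiplicative fields of a module record are irrelevant.\<close>

definition tensor_space ::
    "'k ring \<Rightarrow> ('k, 'm) superspace \<Rightarrow> ('k, 'n) superspace \<Rightarrow> ('k, ('m \<times> 'n) list set) superspace" where
  "tensor_space K U V =
    \<lparr>carrier = tensor_class K U V ` lists (carrier U \<times> carrier V),
     monoid.mult = undefined, one = undefined,
     ring.zero = tensor_class K U V [],
     add = (\<lambda>C D. \<Union>xs \<in> C. \<Union>ys \<in> D. tensor_class K U V (xs @ ys)),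
     smult = (\<lambda>a C. \<Union>xs \<in> C. tensor_class K U V (map (\<lambda>(u, v). (a \<odot>\<^bsub>U\<^esub> u, v)) xs)),
     hpart = (\<lambda>p. tensor_class K U V ` lists (\<Union>q. hpart U q \<times> hpart V (p + q)))\<rparr>"


section \<open>Linear categories and supercategories\<close>

record ('k, 'o, 'm, 'h) lincat =
  Obj :: "'o set"
  Hom :: "'o \<Rightarrow> 'o \<Rightarrow> ('k, 'm, 'h) module_scheme"
  Comp :: "'m \<Rightarrow> 'm \<Rightarrow> 'm" (infixr \<open>\<cdot>\<index>\<close> 60)
  Ident :: "'o \<Rightarrow> 'm"

type_synonym ('k, 'o, 'm) supercat = "('k, 'o, 'm, ('m, unit) superspace_ext) lincat"

abbreviation homset :: "('k, 'o, 'm, 'h, 'z) lincat_scheme \<Rightarrow> 'o \<Rightarrow> 'o \<Rightarrow> 'm set" where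
  "homset A x y \<equiv> carrier (Hom A x y)"

definition cat_of :: "('k, 'o, 'm, 'h, 'z) lincat_scheme \<Rightarrow> ('o, 'm) cat" where
  "cat_of A = \<lparr>ob = Obj A, arr = homset A, cmp = Comp A, idn = Ident A\<rparr>"

definition arrows :: "('k, 'o, 'm, 'h, 'z) lincat_scheme \<Rightarrow> 'm set" where
  "arrows A = (\<Union>x \<in> Obj A. \<Union>y \<in> Obj A. homset A x y)"

text \<open>The morphism space to which a morphism belongs; it is unique, as morphism sets are disjoint.\<close>

definition source :: "('k, 'o, 'm, 'h, 'z) lincat_scheme \<Rightarrow> 'm \<Rightarrow> 'o" where
  "source A f = (THE x. x \<in> Obj A \<and> (\<exists>y \<in> Obj A. f \<in> homset A x y))"

definition target :: "('k, 'o, 'm, 'h, 'z) lincat_scheme \<Rightarrow> 'm \<Rightarrow> 'o" where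
  "target A f = (THE y. y \<in> Obj A \<and> (\<exists>x \<in> Obj A. f \<in> homset A x y))"

definition hom_of :: "('k, 'o, 'm, 'h, 'z) lincat_scheme \<Rightarrow> 'm \<Rightarrow> ('k, 'm, 'h) module_scheme" where
  "hom_of A f = Hom A (source A f) (target A f)"

abbreviation isom :: "('k, 'o, 'm, 'h, 'z) lincat_scheme \<Rightarrow> 'o \<Rightarrow> 'o \<Rightarrow> 'm \<Rightarrow> bool" where
  "isom A x y f \<equiv> cat_iso (cat_of A) x y f"

definition inverse_of :: "('k, 'o, 'm, 'h, 'z) lincat_scheme \<Rightarrow> 'm \<Rightarrow> 'm" where
  "inverse_of A f = (THE g. g \<in> homset A (target A f) (source A f) \<and>
     g \<cdot>\<^bsub>A\<^esub> f = Ident A (source A f) \<and> f \<cdot>\<^bsub>A\<^esub> g = Ident A (target A f))"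

locale linear_category = category "cat_of A"
  for K :: "'k ring" and A :: "('k, 'o, 'm, 'h, 'z) lincat_scheme" +
  assumes module_Hom: "\<lbrakk>x \<in> Obj A; y \<in> Obj A\<rbrakk> \<Longrightarrow> module K (Hom A x y)"
    and bilinear_Comp: "\<lbrakk>x \<in> Obj A; y \<in> Obj A; z \<in> Obj A\<rbrakk>
      \<Longrightarrow> bilinear_map K (Hom A y z) (Hom A x y) (Hom A x z) (Comp A)"

locale linear_functor = is_functor "cat_of A" "cat_of B" F
  for K :: "'k ring" and A :: "('k, 'o, 'm, 'h, 'y) lincat_scheme"
    and B :: "('k, 'p, 'n, 'i, 'z) lincat_scheme" and F :: "('o, 'm, 'p, 'n, 'w) fun_data_scheme" +
  assumes linear_fmor: "\<lbrakk>x \<in> Obj A; y \<in> Obj A\<rbrakk>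
    \<Longrightarrow> linear_map K (Hom A x y) (Hom B (fob F x) (fob F y)) (fmor F)"

locale supercategory = linear_category K A
  for K :: "'k ring" and A :: "('k, 'o, 'm, ('m, unit) superspace_ext, 'z) lincat_scheme" +
  assumes superspace_Hom: "\<lbrakk>x \<in> Obj A; y \<in> Obj A\<rbrakk> \<Longrightarrow> superspace K (Hom A x y)"
    and parity_Comp: "\<lbrakk>x \<in> Obj A; y \<in> Obj A; z \<in> Obj A;
        g \<in> hpart (Hom A y z) p; f \<in> hpart (Hom A x y) q\<rbrakk>
      \<Longrightarrow> g \<cdot>\<^bsub>A\<^esub> f \<in> hpart (Hom A x z) (p + q)"

locale superfunctor = linear_functor K A B F
  for K :: "'k ring" and A :: "('k, 'o, 'm, ('m, unit) superspace_ext, 'y) lincat_scheme"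
    and B :: "('k, 'p, 'n, ('n, unit) superspace_ext, 'z) lincat_scheme"
    and F :: "('o, 'm, 'p, 'n, 'w) fun_data_scheme" +
  assumes parity_fmor: "\<lbrakk>x \<in> Obj A; y \<in> Obj A; f \<in> hpart (Hom A x y) p\<rbrakk>
    \<Longrightarrow> fmor F f \<in> hpart (Hom B (fob F x) (fob F y)) p"


subsection \<open>The product of two supercategories\<close>

text \<open>\<open>(f \<otimes> g) \<circ> (h \<otimes> k) = (-1)\<^bsup>|g||h|\<^esup> (f \<circ> h) \<otimes> (g \<circ> k)\<close>, extended bilinearly to formal sums.\<close>

definition comp_sums ::
    "('k, 'o, 'm, ('m, unit) superspace_ext, 'y) lincat_scheme
      \<Rightarrow> ('k, 'p, 'n, ('n, unit) superspace_ext, 'z) lincat_scheme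
      \<Rightarrow> ('m \<times> 'n) list \<Rightarrow> ('m \<times> 'n) list \<Rightarrow> ('m \<times> 'n) list" where
  "comp_sums A B xs ys =
     [(f \<cdot>\<^bsub>A\<^esub> hcomp (hom_of A h) q h,
       (let g' = hcomp (hom_of B g) p g \<cdot>\<^bsub>B\<^esub> k in signed (hom_of B g') (p * q) g')).
      (f, g) \<leftarrow> xs, (h, k) \<leftarrow> ys, p \<leftarrow> [0, 1], q \<leftarrow> [0, 1]]"

text \<open>In the composition below \<open>x, x', x''\<close> and \<open>y, y', y''\<close> are determined by \<open>C\<close> and \<open>D\<close>.\<close>

definition product_supercat ::
    "'k ring \<Rightarrow> ('k, 'o, 'm, ('m, unit) superspace_ext, 'y) lincat_scheme
      \<Rightarrow> ('k, 'p, 'n, ('n, unit) superspace_ext, 'z) lincat_scheme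
      \<Rightarrow> ('k, 'o \<times> 'p, ('m \<times> 'n) list set) supercat" where
  "product_supercat K A B =
    \<lparr>Obj = Obj A \<times> Obj B,
     Hom = (\<lambda>(x, y) (x', y'). tensor_space K (Hom A x x') (Hom B y y')),
     Comp = (\<lambda>D C. \<Union> {tensor_class K (Hom A x x'') (Hom B y y'') (comp_sums A B ds cs) |
        x x' x'' y y' y'' cs ds.
          x \<in> Obj A \<and> x' \<in> Obj A \<and> x'' \<in> Obj A \<and> y \<in> Obj B \<and> y' \<in> Obj B \<and> y'' \<in> Obj B \<and>
          C \<in> carrier (tensor_space K (Hom A x x') (Hom B y y')) \<and>
          D \<in> carrier (tensor_space K (Hom A x' x'') (Hom B y' y'')) \<and>
          cs \<in> C \<and> ds \<in> D}),
     Ident = (\<lambda>(x, y). tensor_class K (Hom A x x) (Hom B y y) [(Ident A x, Ident B y)])\<rparr>"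

definition pure_tensor ::
    "'k ring \<Rightarrow> ('k, 'o, 'm, 'h, 'y) lincat_scheme \<Rightarrow> ('k, 'p, 'n, 'i, 'z) lincat_scheme
      \<Rightarrow> 'm \<Rightarrow> 'n \<Rightarrow> ('m \<times> 'n) list set" where
  "pure_tensor K A B f g = tensor_class K (hom_of A f) (hom_of B g) [(f, g)]"


section \<open>Monoidal structures\<close>

text \<open>The same record serves linear monoidal categories and monoidal supercategories; \<open>f \<bullet> g\<close> is
  the tensor product \<open>f \<otimes> g\<close> of morphisms and \<open>x \<star> y\<close> that of objects.\<close>

record ('k, 'o, 'm, 'h) moncat = "('k, 'o, 'm, 'h) lincat" +
  TensO :: "'o \<Rightarrow> 'o \<Rightarrow> 'o" (infixl \<open>\<star>\<index>\<close> 70)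
  TensM :: "'m \<Rightarrow> 'm \<Rightarrow> 'm" (infixl \<open>\<bullet>\<index>\<close> 70)
  Unit :: "'o"
  Assoc :: "'o \<Rightarrow> 'o \<Rightarrow> 'o \<Rightarrow> 'm"
  Lun :: "'o \<Rightarrow> 'm"
  Run :: "'o \<Rightarrow> 'm"

type_synonym ('k, 'o, 'm) monsupercat = "('k, 'o, 'm, ('m, unit) superspace_ext) moncat"

text \<open>Everything in the definition of a monoidal (super)category except that the tensor product is
  a (super)functor. Naturality of the associator need only be required on pure tensors
  \<open>(f \<otimes> g) \<otimes> h\<close>, because a general morphism of a product of supercategories is a sum of pure
  tensors.\<close>

locale monoidal_coherence =
  fixes A :: "('k, 'o, 'm, 'h, 'z) moncat_scheme" (structure)
  assumes TensO_closed: "\<lbrakk>x \<in> Obj A; y \<in> Obj A\<rbrakk> \<Longrightarrow> x \<star> y \<in> Obj A"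
    and Unit_closed: "Unit A \<in> Obj A"
    and Assoc_iso: "\<lbrakk>x \<in> Obj A; y \<in> Obj A; z \<in> Obj A\<rbrakk>
      \<Longrightarrow> isom A ((x \<star> y) \<star> z) (x \<star> (y \<star> z)) (Assoc A x y z)"
    and Lun_iso: "x \<in> Obj A \<Longrightarrow> isom A (Unit A \<star> x) x (Lun A x)"
    and Run_iso: "x \<in> Obj A \<Longrightarrow> isom A (x \<star> Unit A) x (Run A x)"
    and Assoc_natural:
      "\<lbrakk>x \<in> Obj A; y \<in> Obj A; z \<in> Obj A; x' \<in> Obj A; y' \<in> Obj A; z' \<in> Obj A;
        f \<in> homset A x x'; g \<in> homset A y y'; h \<in> homset A z z'\<rbrakk>
      \<Longrightarrow> Assoc A x' y' z' \<cdot> ((f \<bullet> g) \<bullet> h) = (f \<bullet> (g \<bullet> h)) \<cdot> Assoc A x y z"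
    and Lun_natural: "\<lbrakk>x \<in> Obj A; y \<in> Obj A; f \<in> homset A x y\<rbrakk>
      \<Longrightarrow> Lun A y \<cdot> (Ident A (Unit A) \<bullet> f) = f \<cdot> Lun A x"
    and Run_natural: "\<lbrakk>x \<in> Obj A; y \<in> Obj A; f \<in> homset A x y\<rbrakk>
      \<Longrightarrow> Run A y \<cdot> (f \<bullet> Ident A (Unit A)) = f \<cdot> Run A x"
    and pentagon: "\<lbrakk>w \<in> Obj A; x \<in> Obj A; y \<in> Obj A; z \<in> Obj A\<rbrakk>
      \<Longrightarrow> Assoc A w x (y \<star> z) \<cdot> Assoc A (w \<star> x) y z
        = (Ident A w \<bullet> Assoc A x y z) \<cdot> Assoc A w (x \<star> y) z \<cdot> (Assoc A w x y \<bullet> Ident A z)"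
    and triangle: "\<lbrakk>x \<in> Obj A; y \<in> Obj A\<rbrakk>
      \<Longrightarrow> (Ident A x \<bullet> Lun A y) \<cdot> Assoc A x (Unit A) y = Run A x \<bullet> Ident A y"

locale linear_monoidal_category = linear_category K A + monoidal_coherence A
  for K :: "'k ring" and A :: "('k, 'o, 'm, 'h, 'z) moncat_scheme" (structure) +
  assumes bilinear_TensM: "\<lbrakk>x \<in> Obj A; x' \<in> Obj A; y \<in> Obj A; y' \<in> Obj A\<rbrakk>
      \<Longrightarrow> bilinear_map K (Hom A x x') (Hom A y y') (Hom A (x \<star> y) (x' \<star> y')) (TensM A)"
    and TensM_Ident: "\<lbrakk>x \<in> Obj A; y \<in> Obj A\<rbrakk> \<Longrightarrow> Ident A x \<bullet> Ident A y = Ident A (x \<star> y)"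
    and TensM_Comp:
      "\<lbrakk>x \<in> Obj A; x' \<in> Obj A; x'' \<in> Obj A; y \<in> Obj A; y' \<in> Obj A; y'' \<in> Obj A;
        f \<in> homset A x' x''; g \<in> homset A y' y''; h \<in> homset A x x'; k \<in> homset A y y'\<rbrakk>
      \<Longrightarrow> (f \<bullet> g) \<cdot> (h \<bullet> k) = (f \<cdot> h) \<bullet> (g \<cdot> k)"

locale monoidal_supercategory = supercategory K A + monoidal_coherence A
  for K :: "'k ring" and A :: "('k, 'o, 'm, ('m, unit) superspace_ext, 'z) moncat_scheme" (structure) +
  assumes tensor_superfunctor:
      "\<exists>T. superfunctor K (product_supercat K A A) A (T :: ('o \<times> 'o, ('m \<times> 'm) list set, 'o, 'm) fun_data) \<and>
         (\<forall>x \<in> Obj A. \<forall>y \<in> Obj A. fob T (x, y) = x \<star> y) \<and>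
         (\<forall>f \<in> arrows A. \<forall>g \<in> arrows A. fmor T (pure_tensor K A A f g) = f \<bullet> g)"
    and Assoc_even: "\<lbrakk>x \<in> Obj A; y \<in> Obj A; z \<in> Obj A\<rbrakk>
      \<Longrightarrow> Assoc A x y z \<in> hpart (Hom A ((x \<star> y) \<star> z) (x \<star> (y \<star> z))) 0"
    and Lun_even: "x \<in> Obj A \<Longrightarrow> Lun A x \<in> hpart (Hom A (Unit A \<star> x) x) 0"
    and Run_even: "x \<in> Obj A \<Longrightarrow> Run A x \<in> hpart (Hom A (x \<star> Unit A) x) 0"


subsection \<open>Monoidal functors and monoidal natural transformations\<close>

record ('o, 'm, 'p, 'n) monfun = "('o, 'm, 'p, 'n) fun_data" +
  fc :: "'o \<times> 'o \<Rightarrow> 'n"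
  fi :: "'n"

text \<open>The extensionality conditions make equality of records coincide with equality of functors
  and coherence maps on the objects and morphisms of \<open>A\<close>.\<close>

locale monoidal_functor_coherence =
  fixes A :: "('k, 'o, 'm, 'h, 'y) moncat_scheme"
    and B :: "('k, 'p, 'n, 'i, 'z) moncat_scheme"
    and F :: "('o, 'm, 'p, 'n, 'w) monfun_scheme"
  assumes fob_ext: "fob F \<in> extensional (Obj A)"
    and fmor_ext: "fmor F \<in> extensional (arrows A)"
    and fc_ext: "fc F \<in> extensional (Obj A \<times> Obj A)"
    and fc_iso: "\<lbrakk>x \<in> Obj A; y \<in> Obj A\<rbrakk>
      \<Longrightarrow> isom B (fob F x \<star>\<^bsub>B\<^esub> fob F y) (fob F (x \<star>\<^bsub>A\<^esub> y)) (fc F (x, y))"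
    and fi_iso: "isom B (Unit B) (fob F (Unit A)) (fi F)"
    and fc_natural:
      "\<lbrakk>x \<in> Obj A; x' \<in> Obj A; y \<in> Obj A; y' \<in> Obj A; f \<in> homset A x x'; g \<in> homset A y y'\<rbrakk>
      \<Longrightarrow> fc F (x', y') \<cdot>\<^bsub>B\<^esub> (fmor F f \<bullet>\<^bsub>B\<^esub> fmor F g) = fmor F (f \<bullet>\<^bsub>A\<^esub> g) \<cdot>\<^bsub>B\<^esub> fc F (x, y)"
    and fc_Assoc: "\<lbrakk>x \<in> Obj A; y \<in> Obj A; z \<in> Obj A\<rbrakk>
      \<Longrightarrow> fmor F (Assoc A x y z) \<cdot>\<^bsub>B\<^esub> fc F (x \<star>\<^bsub>A\<^esub> y, z) \<cdot>\<^bsub>B\<^esub> (fc F (x, y) \<bullet>\<^bsub>B\<^esub> Ident B (fob F z))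
        = fc F (x, y \<star>\<^bsub>A\<^esub> z) \<cdot>\<^bsub>B\<^esub> (Ident B (fob F x) \<bullet>\<^bsub>B\<^esub> fc F (y, z))
            \<cdot>\<^bsub>B\<^esub> Assoc B (fob F x) (fob F y) (fob F z)"
    and fc_Lun: "x \<in> Obj A
      \<Longrightarrow> fmor F (Lun A x) \<cdot>\<^bsub>B\<^esub> fc F (Unit A, x) \<cdot>\<^bsub>B\<^esub> (fi F \<bullet>\<^bsub>B\<^esub> Ident B (fob F x)) = Lun B (fob F x)"
    and fc_Run: "x \<in> Obj A
      \<Longrightarrow> fmor F (Run A x) \<cdot>\<^bsub>B\<^esub> fc F (x, Unit A) \<cdot>\<^bsub>B\<^esub> (Ident B (fob F x) \<bullet>\<^bsub>B\<^esub> fi F) = Run B (fob F x)"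

locale linear_monoidal_functor = linear_functor K A B F + monoidal_functor_coherence A B F
  for K :: "'k ring" and A :: "('k, 'o, 'm, 'h, 'y) moncat_scheme"
    and B :: "('k, 'p, 'n, 'i, 'z) moncat_scheme" and F :: "('o, 'm, 'p, 'n, 'w) monfun_scheme"

locale monoidal_superfunctor = superfunctor K A B F + monoidal_functor_coherence A B F
  for K :: "'k ring" and A :: "('k, 'o, 'm, ('m, unit) superspace_ext, 'y) moncat_scheme"
    and B :: "('k, 'p, 'n, ('n, unit) superspace_ext, 'z) moncat_scheme"
    and F :: "('o, 'm, 'p, 'n, 'w) monfun_scheme" +
  assumes fc_even: "\<lbrakk>x \<in> Obj A; y \<in> Obj A\<rbrakk>
      \<Longrightarrow> fc F (x, y) \<in> hpart (Hom B (fob F x \<star>\<^bsub>B\<^esub> fob F y) (fob F (x \<star>\<^bsub>A\<^esub> y))) 0"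
    and fi_even: "fi F \<in> hpart (Hom B (Unit B) (fob F (Unit A))) 0"

definition id_monfun :: "('k, 'o, 'm, 'h, 'z) moncat_scheme \<Rightarrow> ('o, 'm, 'o, 'm) monfun" where
  "id_monfun A =
    \<lparr>fob = (\<lambda>x \<in> Obj A. x), fmor = (\<lambda>f \<in> arrows A. f),
     fc = (\<lambda>(x, y) \<in> Obj A \<times> Obj A. Ident A (x \<star>\<^bsub>A\<^esub> y)), fi = Ident A (Unit A)\<rparr>"

definition comp_monfun ::
    "('k, 'o, 'm, 'h, 'x) moncat_scheme \<Rightarrow> ('k, 'q, 'l, 'i, 'y) moncat_scheme
      \<Rightarrow> ('p, 'n, 'q, 'l, 'z) monfun_scheme \<Rightarrow> ('o, 'm, 'p, 'n, 'w) monfun_scheme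
      \<Rightarrow> ('o, 'm, 'q, 'l) monfun" where
  "comp_monfun A C G F =
    \<lparr>fob = (\<lambda>x \<in> Obj A. fob G (fob F x)), fmor = (\<lambda>f \<in> arrows A. fmor G (fmor F f)),
     fc = (\<lambda>(x, y) \<in> Obj A \<times> Obj A. fmor G (fc F (x, y)) \<cdot>\<^bsub>C\<^esub> fc G (fob F x, fob F y)),
     fi = fmor G (fi F) \<cdot>\<^bsub>C\<^esub> fi G\<rparr>"

locale monoidal_nat_trans =
  fixes A :: "('k, 'o, 'm, ('m, unit) superspace_ext, 'y) moncat_scheme"
    and B :: "('k, 'p, 'n, ('n, unit) superspace_ext, 'z) moncat_scheme"
    and F G :: "('o, 'm, 'p, 'n) monfun" and t :: "'o \<Rightarrow> 'n"
  assumes t_ext: "t \<in> extensional (Obj A)"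
    and t_closed: "x \<in> Obj A \<Longrightarrow> t x \<in> homset B (fob F x) (fob G x)"
    and t_even: "x \<in> Obj A \<Longrightarrow> t x \<in> hpart (Hom B (fob F x) (fob G x)) 0"
    and t_natural: "\<lbrakk>x \<in> Obj A; y \<in> Obj A; f \<in> homset A x y\<rbrakk>
      \<Longrightarrow> t y \<cdot>\<^bsub>B\<^esub> fmor F f = fmor G f \<cdot>\<^bsub>B\<^esub> t x"
    and t_tensor: "\<lbrakk>x \<in> Obj A; y \<in> Obj A\<rbrakk>
      \<Longrightarrow> t (x \<star>\<^bsub>A\<^esub> y) \<cdot>\<^bsub>B\<^esub> fc F (x, y) = fc G (x, y) \<cdot>\<^bsub>B\<^esub> (t x \<bullet>\<^bsub>B\<^esub> t y)"
    and t_unit: "t (Unit A) \<cdot>\<^bsub>B\<^esub> fi F = fi G"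


section \<open>Monoidal $\Pi$-supercategories and monoidal $\Pi$-categories\<close>

record ('k, 'o, 'm, 'h) pi_supercat = "('k, 'o, 'm, 'h) moncat" +
  pi_obj :: "'o"
  zeta :: "'m"

type_synonym ('k, 'o, 'm) pi_monsupercat = "('k, 'o, 'm, ('m, unit) superspace_ext) pi_supercat"

locale monoidal_pi_supercategory = monoidal_supercategory K A
  for K :: "'k ring" and A :: "('k, 'o, 'm) pi_monsupercat" (structure) +
  assumes pi_obj_closed: "pi_obj A \<in> Obj A"
    and zeta_iso: "isom A (pi_obj A) (Unit A) (zeta A)"
    and zeta_odd: "zeta A \<in> hpart (Hom A (pi_obj A) (Unit A)) 1"

definition forget_pi :: "('k, 'o, 'm) pi_monsupercat \<Rightarrow> ('k, 'o, 'm) monsupercat" where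
  "forget_pi A = moncat.truncate A"

record ('k, 'o, 'm, 'h) pi_cat = "('k, 'o, 'm, 'h) moncat" +
  pi_ob :: "'o"
  half_braiding :: "'o \<Rightarrow> 'm"
  xi :: "'m"

type_synonym ('k, 'o, 'm) pi_moncat = "('k, 'o, 'm, unit) pi_cat"

locale monoidal_pi_category = linear_monoidal_category K A
  for K :: "'k ring" and A :: "('k, 'o, 'm) pi_moncat" (structure) +
  fixes \<pi> \<beta> \<xi>
  defines "\<pi> \<equiv> pi_ob A" and "\<beta> \<equiv> half_braiding A" and "\<xi> \<equiv> xi A"
  assumes pi_closed: "\<pi> \<in> Obj A"
    and beta_iso: "x \<in> Obj A \<Longrightarrow> isom A (\<pi> \<star> x) (x \<star> \<pi>) (\<beta> x)"
    and beta_natural: "\<lbrakk>x \<in> Obj A; y \<in> Obj A; f \<in> homset A x y\<rbrakk>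
      \<Longrightarrow> \<beta> y \<cdot> (Ident A \<pi> \<bullet> f) = (f \<bullet> Ident A \<pi>) \<cdot> \<beta> x"
    and beta_Unit: "Lun A \<pi> \<cdot> \<beta> (Unit A) = Run A \<pi>"
    and beta_tensor: "\<lbrakk>x \<in> Obj A; y \<in> Obj A\<rbrakk>
      \<Longrightarrow> Assoc A x y \<pi> \<cdot> \<beta> (x \<star> y) \<cdot> Assoc A \<pi> x y
        = (Ident A x \<bullet> \<beta> y) \<cdot> Assoc A x \<pi> y \<cdot> (\<beta> x \<bullet> Ident A y)"
    and beta_pi: "\<beta> \<pi> = \<ominus>\<^bsub>Hom A (\<pi> \<star> \<pi>) (\<pi> \<star> \<pi>)\<^esub> Ident A (\<pi> \<star> \<pi>)"
    and xi_iso: "isom A (\<pi> \<star> \<pi>) (Unit A) \<xi>"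
    and xi_beta: "x \<in> Obj A
      \<Longrightarrow> (Ident A x \<bullet> inverse_of A \<xi>) \<cdot> inverse_of A (Run A x) \<cdot> Lun A x \<cdot> (\<xi> \<bullet> Ident A x)
        = Assoc A x \<pi> \<pi> \<cdot> (\<beta> x \<bullet> Ident A \<pi>) \<cdot> inverse_of A (Assoc A \<pi> x \<pi>)
            \<cdot> (Ident A \<pi> \<bullet> \<beta> x) \<cdot> Assoc A \<pi> \<pi> x"

record ('o, 'm, 'p, 'n) pi_monfun = "('o, 'm, 'p, 'n) monfun" +
  fj :: "'n"

locale monoidal_pi_functor = linear_monoidal_functor K A B F
  for K :: "'k ring" and A :: "('k, 'o, 'm) pi_moncat" and B :: "('k, 'p, 'n) pi_moncat"
    and F :: "('o, 'm, 'p, 'n) pi_monfun" +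
  assumes fj_iso: "isom B (pi_ob B) (fob F (pi_ob A)) (fj F)"
    and fj_beta: "x \<in> Obj A
      \<Longrightarrow> fmor F (half_braiding A x) \<cdot>\<^bsub>B\<^esub> fc F (pi_ob A, x) \<cdot>\<^bsub>B\<^esub> (fj F \<bullet>\<^bsub>B\<^esub> Ident B (fob F x))
        = fc F (x, pi_ob A) \<cdot>\<^bsub>B\<^esub> (Ident B (fob F x) \<bullet>\<^bsub>B\<^esub> fj F) \<cdot>\<^bsub>B\<^esub> half_braiding B (fob F x)"
    and fj_xi: "fi F \<cdot>\<^bsub>B\<^esub> xi B
        = fmor F (xi A) \<cdot>\<^bsub>B\<^esub> fc F (pi_ob A, pi_ob A) \<cdot>\<^bsub>B\<^esub> (fj F \<bullet>\<^bsub>B\<^esub> fj F)"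

definition id_pi_monfun :: "('k, 'o, 'm) pi_moncat \<Rightarrow> ('o, 'm, 'o, 'm) pi_monfun" where
  "id_pi_monfun A = monfun.extend (id_monfun A) (pi_monfun.fields (Ident A (pi_ob A)))"

definition comp_pi_monfun ::
    "('k, 'o, 'm) pi_moncat \<Rightarrow> ('k, 'q, 'l) pi_moncat
      \<Rightarrow> ('p, 'n, 'q, 'l) pi_monfun \<Rightarrow> ('o, 'm, 'p, 'n) pi_monfun \<Rightarrow> ('o, 'm, 'q, 'l) pi_monfun" where
  "comp_pi_monfun A C G F =
     monfun.extend (comp_monfun A C G F) (pi_monfun.fields (fmor G (fj F) \<cdot>\<^bsub>C\<^esub> fj G))"


section \<open>The categories in the statement\<close>

text \<open>The objects are all structures whose sets of objects and morphisms lie in the types \<open>'o\<close> and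
  \<open>'m\<close>, which play the role of a universe of small sets. Where the passage to underlying
  categories is to be reversed, \<open>'m\<close> has to be infinite, that is, closed under pairing: the
  morphism spaces of the supercategory attached to a $\Pi$-category are direct sums of two of the
  given morphism spaces. Arrows carry their source and target, so that morphism sets are
  disjoint.\<close>

definition SMon ::
    "'k ring \<Rightarrow> (('k, 'o, 'm) monsupercat,
      ('k, 'o, 'm) monsupercat \<times> ('o, 'm, 'o, 'm) monfun \<times> ('k, 'o, 'm) monsupercat) cat" where
  "SMon K =
    \<lparr>ob = {A. monoidal_supercategory K A},
     arr = (\<lambda>A B. {(A, F, B) | F. monoidal_superfunctor K A B F}),
     cmp = (\<lambda>(_, G, C) (A, F, _). (A, comp_monfun A C G F, C)),
     idn = (\<lambda>A. (A, id_monfun A, A))\<rparr>"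

definition Pi_SMon ::
    "'k ring \<Rightarrow> (('k, 'o, 'm) pi_monsupercat,
      ('k, 'o, 'm) pi_monsupercat \<times> ('o, 'm, 'o, 'm) monfun \<times> ('k, 'o, 'm) pi_monsupercat) cat" where
  "Pi_SMon K =
    \<lparr>ob = {A. monoidal_pi_supercategory K A},
     arr = (\<lambda>A B. {(A, F, B) | F. monoidal_superfunctor K A B F}),
     cmp = (\<lambda>(_, G, C) (A, F, _). (A, comp_monfun A C G F, C)),
     idn = (\<lambda>A. (A, id_monfun A, A))\<rparr>"

definition Pi_Mon ::
    "'k ring \<Rightarrow> (('k, 'o, 'm) pi_moncat,
      ('k, 'o, 'm) pi_moncat \<times> ('o, 'm, 'o, 'm) pi_monfun \<times> ('k, 'o, 'm) pi_moncat) cat" where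
  "Pi_Mon K =
    \<lparr>ob = {A. monoidal_pi_category K A},
     arr = (\<lambda>A B. {(A, F, B) | F. monoidal_pi_functor K A B F}),
     cmp = (\<lambda>(_, G, C) (A, F, _). (A, comp_pi_monfun A C G F, C)),
     idn = (\<lambda>A. (A, id_pi_monfun A, A))\<rparr>"

definition HomCat ::
    "'k ring \<Rightarrow> ('k, 'o, 'm) monsupercat \<Rightarrow> ('k, 'p, 'n) monsupercat
      \<Rightarrow> (('o, 'm, 'p, 'n) monfun,
          ('o, 'm, 'p, 'n) monfun \<times> ('o \<Rightarrow> 'n) \<times> ('o, 'm, 'p, 'n) monfun) cat" where
  "HomCat K A B =
    \<lparr>ob = {F. monoidal_superfunctor K A B F},
     arr = (\<lambda>F G. {(F, t, G) | t. monoidal_nat_trans A B F G t}),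
     cmp = (\<lambda>(_, s, H) (F, t, _). (F, (\<lambda>x \<in> Obj A. s x \<cdot>\<^bsub>B\<^esub> t x), H)),
     idn = (\<lambda>F. (F, (\<lambda>x \<in> Obj A. Ident B (fob F x)), F))\<rparr>"


section \<open>The functors in the statement\<close>

subsection \<open>The forgetful functor\<close>

definition nu_functor ::
    "(('k, 'o, 'm) pi_monsupercat,
      ('k, 'o, 'm) pi_monsupercat \<times> ('o, 'm, 'o, 'm) monfun \<times> ('k, 'o, 'm) pi_monsupercat,
      ('k, 'o, 'm) monsupercat,
      ('k, 'o, 'm) monsupercat \<times> ('o, 'm, 'o, 'm) monfun \<times> ('k, 'o, 'm) monsupercat) fun_data" where
  "nu_functor =
    \<lparr>fob = forget_pi, fmor = (\<lambda>(A, F, B). (forget_pi A, F, forget_pi B))\<rparr>"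


subsection \<open>The $\Pi$-envelope\<close>

text \<open>The pair \<open>(a, x)\<close> is the object \<open>\<Pi>\<^sup>a x\<close>, and the triple \<open>(a, f, b)\<close> is the morphism
  \<open>f\<^sub>a\<^sup>b\<close>.\<close>

definition shifted_space :: "bit \<Rightarrow> bit \<Rightarrow> ('k, 'm) superspace \<Rightarrow> ('k, bit \<times> 'm \<times> bit) superspace" where
  "shifted_space a b V =
    \<lparr>carrier = {a} \<times> carrier V \<times> {b},
     monoid.mult = undefined, one = undefined,
     ring.zero = (a, \<zero>\<^bsub>V\<^esub>, b),
     add = (\<lambda>(_, f, _) (_, g, _). (a, f \<oplus>\<^bsub>V\<^esub> g, b)),
     smult = (\<lambda>k (_, f, _). (a, k \<odot>\<^bsub>V\<^esub> f, b)),
     hpart = (\<lambda>p. {a} \<times> hpart V (p + a + b) \<times> {b})\<rparr>"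

definition envelope_TensM ::
    "('k, 'o, 'm) monsupercat \<Rightarrow> bit \<times> 'm \<times> bit \<Rightarrow> bit \<times> 'm \<times> bit \<Rightarrow> bit \<times> 'm \<times> bit" where
  "envelope_TensM A = (\<lambda>(a, f, b) (c, g, d).
     (a + c,
      let V = Hom A (source A f \<star>\<^bsub>A\<^esub> source A g) (target A f \<star>\<^bsub>A\<^esub> target A g)
      in finsum V
           (\<lambda>(p, q). signed V (a * q + p * d + a * d + a * c)
                      (hcomp (hom_of A f) p f \<bullet>\<^bsub>A\<^esub> hcomp (hom_of A g) q g))
           ({0, 1} \<times> {0, 1}),
      b + d))"

definition envelope :: "('k, 'o, 'm) monsupercat \<Rightarrow> ('k, bit \<times> 'o, bit \<times> 'm \<times> bit) pi_monsupercat" where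
  "envelope A =
    \<lparr>Obj = UNIV \<times> Obj A,
     Hom = (\<lambda>(a, x) (b, y). shifted_space a b (Hom A x y)),
     Comp = (\<lambda>(b, f, c) (a, g, _). (a, f \<cdot>\<^bsub>A\<^esub> g, c)),
     Ident = (\<lambda>(a, x). (a, Ident A x, a)),
     TensO = (\<lambda>(a, x) (b, y). (a + b, x \<star>\<^bsub>A\<^esub> y)),
     TensM = envelope_TensM A,
     Unit = (0, Unit A),
     Assoc = (\<lambda>(a, x) (b, y) (c, z). (a + b + c, Assoc A x y z, a + b + c)),
     Lun = (\<lambda>(a, x). (a, Lun A x, a)),
     Run = (\<lambda>(a, x). (a, Run A x, a)),
     pi_obj = (1, Unit A),
     zeta = (1, Ident A (Unit A), 0)\<rparr>"

definition envelope_monfun ::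
    "('k, 'o, 'm) monsupercat \<Rightarrow> ('o, 'm, 'p, 'n) monfun
      \<Rightarrow> (bit \<times> 'o, bit \<times> 'm \<times> bit, bit \<times> 'p, bit \<times> 'n \<times> bit) monfun" where
  "envelope_monfun A F =
    \<lparr>fob = (\<lambda>(a, x) \<in> Obj (envelope A). (a, fob F x)),
     fmor = (\<lambda>(a, f, b) \<in> arrows (envelope A). (a, fmor F f, b)),
     fc = (\<lambda>((a, x), (b, y)) \<in> Obj (envelope A) \<times> Obj (envelope A). (a + b, fc F (x, y), a + b)),
     fi = (0, fi F, 0)\<rparr>"

definition envelope_functor ::
    "(('k, 'o, 'm) monsupercat,
      ('k, 'o, 'm) monsupercat \<times> ('o, 'm, 'o, 'm) monfun \<times> ('k, 'o, 'm) monsupercat,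
      ('k, bit \<times> 'o, bit \<times> 'm \<times> bit) pi_monsupercat,
      ('k, bit \<times> 'o, bit \<times> 'm \<times> bit) pi_monsupercat
        \<times> (bit \<times> 'o, bit \<times> 'm \<times> bit, bit \<times> 'o, bit \<times> 'm \<times> bit) monfun
        \<times> ('k, bit \<times> 'o, bit \<times> 'm \<times> bit) pi_monsupercat) fun_data" where
  "envelope_functor =
    \<lparr>fob = envelope, fmor = (\<lambda>(A, F, B). (envelope A, envelope_monfun A F, envelope B))\<rparr>"


subsection \<open>Passing to the underlying monoidal $\Pi$-category\<close>

definition even_space :: "('k, 'm) superspace \<Rightarrow> ('k, 'm) module" where
  "even_space V = (module.truncate V)\<lparr>carrier := hpart V 0\<rparr>"

definition underlying :: "('k, 'o, 'm) pi_monsupercat \<Rightarrow> ('k, 'o, 'm) pi_moncat" where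
  "underlying A =
    \<lparr>Obj = Obj A,
     Hom = (\<lambda>x y. even_space (Hom A x y)),
     Comp = Comp A,
     Ident = Ident A,
     TensO = TensO A,
     TensM = TensM A,
     Unit = Unit A,
     Assoc = Assoc A,
     Lun = Lun A,
     Run = Run A,
     pi_ob = pi_obj A,
     half_braiding = (\<lambda>x.
       (Ident A x \<bullet>\<^bsub>A\<^esub> inverse_of A (zeta A)) \<cdot>\<^bsub>A\<^esub> inverse_of A (Run A x)
         \<cdot>\<^bsub>A\<^esub> Lun A x \<cdot>\<^bsub>A\<^esub> (zeta A \<bullet>\<^bsub>A\<^esub> Ident A x)),
     xi = Lun A (Unit A) \<cdot>\<^bsub>A\<^esub> (zeta A \<bullet>\<^bsub>A\<^esub> zeta A)\<rparr>"

definition underlying_monfun ::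
    "('k, 'o, 'm) pi_monsupercat \<Rightarrow> ('k, 'p, 'n) pi_monsupercat
      \<Rightarrow> ('o, 'm, 'p, 'n) monfun \<Rightarrow> ('o, 'm, 'p, 'n) pi_monfun" where
  "underlying_monfun A B F =
    \<lparr>fob = fob F,
     fmor = restrict (fmor F) (arrows (underlying A)),
     fc = fc F,
     fi = fi F,
     fj = inverse_of B (fmor F (zeta A)) \<cdot>\<^bsub>B\<^esub> fi F \<cdot>\<^bsub>B\<^esub> zeta B\<rparr>"

definition underlying_functor ::
    "(('k, 'o, 'm) pi_monsupercat,
      ('k, 'o, 'm) pi_monsupercat \<times> ('o, 'm, 'o, 'm) monfun \<times> ('k, 'o, 'm) pi_monsupercat,
      ('k, 'o, 'm) pi_moncat,
      ('k, 'o, 'm) pi_moncat \<times> ('o, 'm, 'o, 'm) pi_monfun \<times> ('k, 'o, 'm) pi_moncat) fun_data" where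
  "underlying_functor =
    \<lparr>fob = underlying,
     fmor = (\<lambda>(A, F, B). (underlying A, underlying_monfun A B F, underlying B))\<rparr>"

end

theory Submission
  imports Defs "HOL-Library.Multiset"
begin

text \<open>
  In a monoidal $\Pi$-supercategory the odd isomorphisms \<open>l \<circ> (\<zeta> \<otimes> 1) : \<pi> \<otimes> x \<rightarrow> x\<close> turn odd
  morphisms out of \<open>x\<close> into even morphisms out of \<open>\<pi> \<otimes> x\<close>.

  (1) A monoidal superfunctor \<open>F\<close> on \<open>A\<close> extends to the envelope by \<open>\<Pi>\<^sup>a x \<mapsto> \<pi>\<^sup>a \<otimes> F x\<close>,
  conjugating morphisms and coherence maps with these isomorphisms. Hence restriction along
  \<open>A \<rightarrow> A\<^sub>\<pi>\<close> is surjective on objects, and it is fully faithful because \<open>\<Pi> x\<close> is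
  isomorphic to \<open>x\<close> in the envelope.

  (2) A monoidal superfunctor is determined by its even part, since odd morphisms are even ones
  composed with these isomorphisms; conversely \<open>c\<close> and \<open>j\<close> tell a $\Pi$-functor what to do on odd
  morphisms. Given a monoidal $\Pi$-category, let the odd morphisms \<open>x \<rightarrow> y\<close> be the morphisms
  \<open>\<pi> \<otimes> x \<rightarrow> y\<close>: \<open>\<xi>\<close> composes two of them, \<open>\<beta>\<close> tensors them with objects on the left, and
  \<open>\<beta>\<^bsub>\<pi>\<^esub> = -1\<close> is both the sign of the super interchange law and, with the axiom relating
  \<open>\<xi>\<close> and \<open>\<beta>\<close>, the associativity of composition.
\<close>

section \<open>Equivalences of categories\<close>

text \<open>The definition presents the tensor product of a monoidal supercategory as a superfunctor
  on a category of formal sums modulo bilinearity. Calculations need the equivalent elementwise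
  form: a bilinear operation on morphisms that respects identities and parities and obeys the
  interchange law with its sign. Both directions are required, since the envelope and the
  supercategory attached to a \<Pi>-category must satisfy the definition itself. The signs come from
  the odd isomorphisms \<kappa>_x from \<pi> \<otimes> x to x. They commute with odd morphisms only
  up to -1, so \<kappa>_x composed with \<kappa> at \<pi> \<otimes> x is minus a map made from
  \<xi>. The inverse of this composite is the map \<open>\<omega>\<close> through which two odd
  morphisms of a \<Pi>-category have to be composed, and \<zeta> becomes the odd morphism given by
  -\<xi>. Likewise, the two ways of reducing \<kappa> on x \<otimes> y to \<kappa> on one factor
  dictate how odd morphisms are tensored with objects. The new morphisms are pairs of old ones and
  still have to inhabit the type \<open>'m\<close>; an injection from pairs into \<open>'m\<close>
  provides the room.\<close>

lemma is_equivalence_sym: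
  assumes "is_equivalence C D F"
  obtains G where "is_equivalence D C G"
  using assms unfolding is_equivalence_def by blast

text \<open>Choice selects objects \<open>G d\<close> and isomorphisms \<open>s d\<close>; the
  inverse functor lifts the conjugates of arrows along \<open>s\<close>. Its functor laws and the
  naturality of the unit are checked after applying \<open>F\<close>, where faithfulness
  suffices.\<close>

lemma is_equivalenceI:
  assumes C: "category C" and D: "category D" and F: "is_functor C D F"
    and faithful: "!!x y f g. [|x \<in> ob C; y \<in> ob C; f \<in> arr C x y; g \<in> arr C x y; fmor F f = fmor F g|]
      ==> f = g"
    and full: "!!x y h. [|x \<in> ob C; y \<in> ob C; h \<in> arr D (fob F x) (fob F y)|]
      ==> \<exists>f \<in> arr C x y. fmor F f = h"
    and surj: "!!d. d \<in> ob D ==> \<exists>x \<in> ob C. \<exists>s. cat_iso D (fob F x) d s"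
  shows "is_equivalence C D F"
proof -
  interpret C: category C by (rule C)
  interpret D: category D by (rule D)
  interpret F: is_functor C D F by (rule F)
  obtain G s where G: "!!d. d \<in> ob D ==> G d \<in> ob C \<and> cat_iso D (fob F (G d)) d (s d)"
    using surj by metis
  have Gob [simp]: "G d \<in> ob C" if "d \<in> ob D" for d using G that by blast
  have Fob [simp]: "fob F x \<in> ob D" if "x \<in> ob C" for x using F.fob_closed that .
  have "\<exists>r. d \<in> ob D \<longrightarrow> r \<in> arr D d (fob F (G d)) \<and> cmp D r (s d) = idn D (fob F (G d)) \<and> cmp D (s d) r = idn D d" for d
    using G unfolding cat_iso_def by blast
  then obtain r where r: "!!d. d \<in> ob D ==> r d \<in> arr D d (fob F (G d))"
      "!!d. d \<in> ob D ==> cmp D (r d) (s d) = idn D (fob F (G d))"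
      "!!d. d \<in> ob D ==> cmp D (s d) (r d) = idn D d"
    by metis
  have s: "s d \<in> arr D (fob F (G d)) d" if "d \<in> ob D" for d
    using G that unfolding cat_iso_def by blast
  \<comment> \<open>A functor acts on bare arrows, so one value must serve for every typing
    \<open>d\<close>, \<open>e\<close> of \<open>g\<close>; \<open>arr_disjoint\<close> makes this
    typing unique.\<close>
  have "\<exists>f. \<forall>d e. d \<in> ob D \<longrightarrow> e \<in> ob D \<longrightarrow> g \<in> arr D d e \<longrightarrow>
      f \<in> arr C (G d) (G e) \<and> fmor F f = cmp D (r e) (cmp D g (s d))" for g
  proof (cases "\<exists>d e. d \<in> ob D \<and> e \<in> ob D \<and> g \<in> arr D d e")
    case True
    then obtain d e where de: "d \<in> ob D" "e \<in> ob D" "g \<in> arr D d e" by blast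
    have "cmp D (r e) (cmp D g (s d)) \<in> arr D (fob F (G d)) (fob F (G e))"
      using de s r by (meson D.cmp_closed Fob Gob)
    then obtain f where f: "f \<in> arr C (G d) (G e)" "fmor F f = cmp D (r e) (cmp D g (s d))"
      using full[of "G d" "G e"] de by auto
    show ?thesis
    proof (intro exI[of _ f] allI impI)
      fix d' e' assume "d' \<in> ob D" "e' \<in> ob D" "g \<in> arr D d' e'"
      then have "d' = d" "e' = e" using D.arr_disjoint[of d e d' e' g] de by auto
      then show "f \<in> arr C (G d') (G e') \<and> fmor F f = cmp D (r e') (cmp D g (s d'))" using f by simp
    qed
  qed blast
  then obtain M where M: "!!g d e. [|d \<in> ob D; e \<in> ob D; g \<in> arr D d e|] ==>
      M g \<in> arr C (G d) (G e) \<and> fmor F (M g) = cmp D (r e) (cmp D g (s d))"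
    by metis
  define H where "H = \<lparr>fob = G, fmor = M\<rparr>"
  have cancel: "cmp D (s e) (cmp D (r e) h) = h" "cmp D (r e) (cmp D (s e) k) = k"
    if "d \<in> ob D" "e \<in> ob D" "h \<in> arr D d e" "k \<in> arr D d (fob F (G e))" for d e h k
  proof -
    have "cmp D (s e) (cmp D (r e) h) = cmp D (cmp D (s e) (r e)) h"
      using D.cmp_assoc[of d e "fob F (G e)" e h "r e" "s e"] that s r by simp
    then show "cmp D (s e) (cmp D (r e) h) = h" using that r D.idn_left by simp
    have "cmp D (r e) (cmp D (s e) k) = cmp D (cmp D (r e) (s e)) k"
      using D.cmp_assoc[of d "fob F (G e)" e "fob F (G e)" k "s e" "r e"] that s r by simp
    then show "cmp D (r e) (cmp D (s e) k) = k" using that r D.idn_left by simp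
  qed
  have H: "is_functor D C H"
  proof
    fix x assume x: "x \<in> ob D"
    show "fob H x \<in> ob C" using x by (simp add: H_def)
    have "M (idn D x) = idn C (G x)"
    proof (rule faithful[of "G x" "G x"])
      show "M (idn D x) \<in> arr C (G x) (G x)" using M[OF x x] D.idn_closed[OF x] by simp
      have "cmp D (idn D x) (s x) = s x" using D.idn_left[of "fob F (G x)" x] s x by simp
      then show "fmor F (M (idn D x)) = fmor F (idn C (G x))"
        using M[OF x x D.idn_closed[OF x]] r x by (simp add: F.fmor_idn)
    qed (use x C.idn_closed in auto)
    then show "fmor H (idn D x) = idn C (fob H x)" by (simp add: H_def)
  next
    fix x y f assume "x \<in> ob D" "y \<in> ob D" "f \<in> arr D x y"
    then show "fmor H f \<in> arr C (fob H x) (fob H y)" using M by (simp add: H_def)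
  next
    fix x y z f g assume a: "x \<in> ob D" "y \<in> ob D" "z \<in> ob D" "f \<in> arr D x y" "g \<in> arr D y z"
    have gf: "cmp D g f \<in> arr D x z" using a D.cmp_closed by blast
    have "M (cmp D g f) = cmp C (M g) (M f)"
    proof (rule faithful[of "G x" "G z"])
      have t: "cmp D f (s x) \<in> arr D (fob F (G x)) y" "cmp D g (s y) \<in> arr D (fob F (G y)) z"
        using a s D.cmp_closed Fob Gob by meson+
      have "fmor F (cmp C (M g) (M f)) = cmp D (cmp D (r z) (cmp D g (s y))) (cmp D (r y) (cmp D f (s x)))"
        using F.fmor_cmp[of "G x" "G y" "G z" "M f" "M g"] M a by simp
      also have "... = cmp D (r z) (cmp D (cmp D g (s y)) (cmp D (r y) (cmp D f (s x))))"
        by (rule D.cmp_assoc[where w = "fob F (G x)" and x = "fob F (G y)" and y = z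
                and z = "fob F (G z)"])
           (use a s r t D.cmp_closed[of "fob F (G x)" y "fob F (G y)"] in auto)
      also have "... = cmp D (r z) (cmp D g (cmp D (s y) (cmp D (r y) (cmp D f (s x)))))"
        by (subst D.cmp_assoc[where w = "fob F (G x)" and x = "fob F (G y)" and y = y and z = z])
           (use a s r t D.cmp_closed[of "fob F (G x)" y "fob F (G y)"] in auto)
      also have "... = cmp D (r z) (cmp D g (cmp D f (s x)))"
        using cancel(1)[of "fob F (G x)" y "cmp D f (s x)" "cmp D (r y) (cmp D f (s x))"] a t r
          D.cmp_closed[of "fob F (G x)" y "fob F (G y)"] by simp
      also have "cmp D g (cmp D f (s x)) = cmp D (cmp D g f) (s x)"
        by (rule D.cmp_assoc[symmetric, where w = "fob F (G x)" and x = x and y = y and z = z]) (use a s in auto)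
      finally show "fmor F (M (cmp D g f)) = fmor F (cmp C (M g) (M f))"
        using M[of x z "cmp D g f"] a gf by simp
    qed (use a gf M C.cmp_closed[of "G x" "G y" "G z"] in auto)
    then show "fmor H (cmp D g f) = cmp C (fmor H g) (fmor H f)" by (simp add: H_def)
  qed
  have s_nat: "nat_iso D D (comp_fun F H) id_fun s"
    unfolding nat_iso_def comp_fun_def id_fun_def H_def
  proof (simp, intro conjI ballI)
    fix x y f assume a: "x \<in> ob D" "y \<in> ob D" "f \<in> arr D x y"
    then show "cmp D (s y) (fmor F (M f)) = cmp D f (s x)"
      using M[OF a] cancel(1)[of "fob F (G x)" y "cmp D f (s x)" "cmp D (r y) (cmp D f (s x))"]
        D.cmp_closed[of "fob F (G x)" x y] D.cmp_closed[of "fob F (G x)" y "fob F (G y)"] s r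
      by simp
  qed (use G in auto)
  \<comment> \<open>The unit is a preimage of \<open>s\<close> under the full functor
    \<open>F\<close>; its inverse will be a preimage of \<open>r\<close>.\<close>
  have t_ex: "\<exists>t. x \<in> ob C \<longrightarrow> t \<in> arr C (G (fob F x)) x \<and> fmor F t = s (fob F x)" for x
    using full[of "G (fob F x)" x "s (fob F x)"] s by auto
  then obtain t where t: "!!x. x \<in> ob C ==> t x \<in> arr C (G (fob F x)) x \<and> fmor F (t x) = s (fob F x)"
    by metis
  have t_nat: "nat_iso C C (comp_fun H F) id_fun t"
    unfolding nat_iso_def comp_fun_def id_fun_def H_def
  proof (simp, intro conjI ballI)
    fix x assume x: "x \<in> ob C"
    obtain u where u: "u \<in> arr C x (G (fob F x))" "fmor F u = r (fob F x)"
      using full[of x "G (fob F x)" "r (fob F x)"] x r by auto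
    have tx: "t x \<in> arr C (G (fob F x)) x" "fmor F (t x) = s (fob F x)" using t x by auto
    have "cmp C u (t x) = idn C (G (fob F x))"
      by (rule faithful[of "G (fob F x)" "G (fob F x)"])
         (use x tx u C.cmp_closed C.idn_closed F.fmor_cmp[of "G (fob F x)" x "G (fob F x)" "t x" u]
            F.fmor_idn r in auto)
    moreover have "cmp C (t x) u = idn C x"
      by (rule faithful[of x x])
         (use x tx u C.cmp_closed[of x "G (fob F x)" x] C.idn_closed F.fmor_cmp[of x "G (fob F x)" x u "t x"]
            F.fmor_idn r in auto)
    ultimately show "cat_iso C (G (fob F x)) x (t x)"
      using tx u unfolding cat_iso_def by blast
  next
    fix x y f assume a: "x \<in> ob C" "y \<in> ob C" "f \<in> arr C x y"
    have Ff: "fmor F f \<in> arr D (fob F x) (fob F y)" using F.fmor_closed a by blast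
    have m: "M (fmor F f) \<in> arr C (G (fob F x)) (G (fob F y))"
      "fmor F (M (fmor F f)) = cmp D (r (fob F y)) (cmp D (fmor F f) (s (fob F x)))"
      using M[OF _ _ Ff] a by auto
    show "cmp C (t y) (M (fmor F f)) = cmp C f (t x)"
    proof (rule faithful[of "G (fob F x)" y])
      show "fmor F (cmp C (t y) (M (fmor F f))) = fmor F (cmp C f (t x))"
        using a t m F.fmor_cmp[of "G (fob F x)" "G (fob F y)" y "M (fmor F f)" "t y"]
          F.fmor_cmp[of "G (fob F x)" x y "t x" f]
          cancel(1)[of "fob F (G (fob F x))" "fob F y" "cmp D (fmor F f) (s (fob F x))"
            "cmp D (r (fob F y)) (cmp D (fmor F f) (s (fob F x)))"]
          D.cmp_closed[of "fob F (G (fob F x))" "fob F x" "fob F y"]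
          D.cmp_closed[of "fob F (G (fob F x))" "fob F y" "fob F (G (fob F y))"] s r Ff
        by simp
    qed (use a t m C.cmp_closed in \<open>auto intro: C.cmp_closed[of "G (fob F x)" "G (fob F y)"]
           C.cmp_closed[of "G (fob F x)" x]\<close>)
  qed
  show ?thesis unfolding is_equivalence_def using F H s_nat t_nat by blast
qed

section \<open>Linear maps and superspaces\<close>

text \<open>These two rules rewrite sums and products of parities to bit operations.\<close>

declare add_bit_eq_xor [simp del] mult_bit_eq_and [simp del]

lemma bit_add_self [simp]: "(a::bit) + a = 0" "(a::bit) + (a + b) = b"
  by (cases a; cases b; simp)+

lemma ex1_implies_uniq:
  assumes "\<exists>!(u, w). P u w" "P u w" "P u' w'"
  shows "u = u' \<and> w = w'"
  using assms by blast

lemma linear_map_closed: "linear_map K V W f ==> v \<in> carrier V ==> f v \<in> carrier W"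
  unfolding linear_map_def by blast

lemma linear_map_add:
  "[|linear_map K V W f; u \<in> carrier V; v \<in> carrier V|] ==> f (u \<oplus>\<^bsub>V\<^esub> v) = f u \<oplus>\<^bsub>W\<^esub> f v"
  unfolding linear_map_def by blast

lemma linear_map_smult:
  "[|linear_map K V W f; a \<in> carrier K; v \<in> carrier V|] ==> f (a \<odot>\<^bsub>V\<^esub> v) = a \<odot>\<^bsub>W\<^esub> f v"
  unfolding linear_map_def by blast

lemma linear_map_id: "linear_map K V V (%v. v)"
  unfolding linear_map_def by blast

lemma lin_compose:
  "linear_map K V W f ==> linear_map K U V g ==> linear_map K U W (%u. f (g u))"
  unfolding linear_map_def by (auto simp: Pi_iff)

lemma linear_map_cong:
  "[|!!v. v \<in> carrier V ==> f v = g v; module K V|] ==> linear_map K V W f \<longleftrightarrow> linear_map K V W g"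
proof -
  assume e: "!!v. v \<in> carrier V ==> f v = g v" and "module K V"
  then interpret module K V by simp
  show ?thesis unfolding linear_map_def using e by (auto simp: Pi_iff)
qed

lemma linear_map_zero:
  assumes "module K V" "module K W" "linear_map K V W f"
  shows "f \<zero>\<^bsub>V\<^esub> = \<zero>\<^bsub>W\<^esub>"
proof -
  interpret V: module K V by fact
  interpret W: module K W by fact
  have "f \<zero>\<^bsub>V\<^esub> = f (\<zero>\<^bsub>K\<^esub> \<odot>\<^bsub>V\<^esub> \<zero>\<^bsub>V\<^esub>)" by simp
  also have "... = \<zero>\<^bsub>K\<^esub> \<odot>\<^bsub>W\<^esub> f \<zero>\<^bsub>V\<^esub>" by (rule linear_map_smult[OF assms(3)]) auto
  finally show ?thesis using linear_map_closed[OF assms(3), of "\<zero>\<^bsub>V\<^esub>"] by simp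
qed

lemma linear_map_neg:
  assumes "module K V" "module K W" "linear_map K V W f" "v \<in> carrier V"
  shows "f (\<ominus>\<^bsub>V\<^esub> v) = \<ominus>\<^bsub>W\<^esub> f v"
proof -
  interpret V: module K V by fact
  interpret W: module K W by fact
  have c: "f v \<in> carrier W" "f (\<ominus>\<^bsub>V\<^esub> v) \<in> carrier W"
    using linear_map_closed[OF assms(3)] assms(4) by auto
  have "f (\<ominus>\<^bsub>V\<^esub> v) \<oplus>\<^bsub>W\<^esub> f v = f (\<ominus>\<^bsub>V\<^esub> v \<oplus>\<^bsub>V\<^esub> v)"
    using linear_map_add[OF assms(3)] assms(4) by simp
  also have "... = \<zero>\<^bsub>W\<^esub>" using linear_map_zero[OF assms(1-3)] assms(4) by (simp add: V.M.l_neg)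
  finally show ?thesis using W.M.minus_equality[OF _ c(1) c(2)] by simp
qed

lemma linear_map_signed:
  "[|module K V; module K W; linear_map K V W f; v \<in> carrier V|] ==> f (signed V e v) = signed W e (f v)"
  using linear_map_neg[of K V W f v] by (simp add: signed_def)

lemma signed_0 [simp]: "signed V 0 v = v"
  by (simp add: signed_def)

context module begin

lemma signed_closed [simp, intro]: "v \<in> carrier M ==> signed M e v \<in> carrier M"
  by (simp add: signed_def)

lemma signed_signed [simp]: "v \<in> carrier M ==> signed M a (signed M b v) = signed M (a + b) v"
  by (cases a; cases b) (simp_all add: signed_def)

lemma signed_add: "[|u \<in> carrier M; v \<in> carrier M|] ==> signed M e (u \<oplus>\<^bsub>M\<^esub> v) = signed M e u \<oplus>\<^bsub>M\<^esub> signed M e v"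
  by (simp add: signed_def M.minus_add)

lemma signed_smult: "[|a \<in> carrier R; v \<in> carrier M|] ==> signed M e (a \<odot>\<^bsub>M\<^esub> v) = a \<odot>\<^bsub>M\<^esub> signed M e v"
  by (simp add: signed_def smult_r_minus)

lemma signed_zero [simp]: "signed M e \<zero>\<^bsub>M\<^esub> = \<zero>\<^bsub>M\<^esub>"
  by (simp add: signed_def)

end

lemma linear_map_signed_const: "module K W ==> linear_map K W W (signed W e)"
  unfolding linear_map_def by (auto simp: module.signed_add module.signed_smult module.signed_closed)

lemma linear_map_zero_const:
  assumes "module K V" "module K W"
  shows "linear_map K V W (%_. \<zero>\<^bsub>W\<^esub>)"
proof -
  interpret W: module K W by fact
  show ?thesis unfolding linear_map_def by simp
qed

lemma linear_map_plus:
  assumes "module K V" "module K W" "linear_map K V W f" "linear_map K V W g"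
  shows "linear_map K V W (%v. f v \<oplus>\<^bsub>W\<^esub> g v)"
proof -
  interpret V: module K V by fact
  interpret W: module K W by fact
  show ?thesis
    using assms(3,4) unfolding linear_map_def
    by (auto simp: Pi_iff W.M.a_ac W.smult_r_distr)
qed

lemma linear_map_signed_compose:
  "[|module K W; linear_map K V W f|] ==> linear_map K V W (%v. signed W e (f v))"
  by (rule lin_compose[OF linear_map_signed_const])

lemma bilinear_map_left: "[|bilinear_map K U V W b; v \<in> carrier V|] ==> linear_map K U W (%u. b u v)"
  unfolding bilinear_map_def by blast

lemma bilinear_map_right: "[|bilinear_map K U V W b; u \<in> carrier U|] ==> linear_map K V W (b u)"
  unfolding bilinear_map_def by blast

context superspace begin

lemma hpart_carrier: "u \<in> hpart V p ==> u \<in> carrier V"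
  using submoduleE(1)[OF submodule_hpart] by blast

lemma hpart_zero [simp, intro]: "\<zero>\<^bsub>V\<^esub> \<in> hpart V p"
  using subgroup.one_closed[OF submodule.axioms(1)[OF submodule_hpart]] by simp

lemma hpart_neg [intro]: "u \<in> hpart V p ==> \<ominus>\<^bsub>V\<^esub> u \<in> hpart V p"
  using submoduleE(3)[OF submodule_hpart] .

lemma hpart_signed [intro]: "u \<in> hpart V p ==> signed V e u \<in> hpart V p"
  by (auto simp: signed_def)

lemma hpart_add [intro]: "[|u \<in> hpart V p; v \<in> hpart V p|] ==> u \<oplus>\<^bsub>V\<^esub> v \<in> hpart V p"
  using submoduleE(5)[OF submodule_hpart] .

lemma hpart_smult [intro]: "[|a \<in> carrier K; u \<in> hpart V p|] ==> a \<odot>\<^bsub>V\<^esub> u \<in> hpart V p"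
  using submoduleE(4)[OF submodule_hpart] .

text \<open>The axiom decomposes a vector as even plus odd, in this order; for \<open>p = 1\<close>
  the summands are exchanged first.\<close>

lemma decomposition_unique:
  assumes "u \<in> hpart V p" "w \<in> hpart V (p + 1)" "u' \<in> hpart V p" "w' \<in> hpart V (p + 1)"
    and "u \<oplus>\<^bsub>V\<^esub> w = u' \<oplus>\<^bsub>V\<^esub> w'"
  shows "u = u' \<and> w = w'"
proof (cases "p = 0")
  case [simp]: True
  have "u \<oplus>\<^bsub>V\<^esub> w \<in> carrier V" using assms hpart_carrier by simp
  from direct_sum[OF this] show ?thesis
    by (rule ex1_implies_uniq) (use assms in simp_all)
next
  case False
  then have [simp]: "p = 1" by simp
  have c: "u \<oplus>\<^bsub>V\<^esub> w \<in> carrier V" "w \<oplus>\<^bsub>V\<^esub> u = u \<oplus>\<^bsub>V\<^esub> w" "w' \<oplus>\<^bsub>V\<^esub> u' = u' \<oplus>\<^bsub>V\<^esub> w'"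
    using assms hpart_carrier by (auto simp: M.a_comm)
  from direct_sum[OF c(1)] have "w = w' \<and> u = u'"
    by (rule ex1_implies_uniq) (use assms c in simp_all)
  then show ?thesis by simp
qed

lemma decomposition_ex:
  assumes "v \<in> carrier V"
  shows "\<exists>u \<in> hpart V p. \<exists>w \<in> hpart V (p + 1). v = u \<oplus>\<^bsub>V\<^esub> w"
proof -
  obtain u w where uw: "u \<in> hpart V 0" "w \<in> hpart V 1" "v = u \<oplus>\<^bsub>V\<^esub> w"
    using direct_sum[OF assms] by blast
  then have vw: "v = w \<oplus>\<^bsub>V\<^esub> u" using hpart_carrier M.a_comm by metis
  have "p = 1 ==> ?thesis" using uw(1,2) vw by force
  moreover have "p = 0 ==> ?thesis" using uw by force
  ultimately show ?thesis by (cases p) blast+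
qed

lemma hcomp_eqI:
  assumes "u \<in> hpart V p" "w \<in> hpart V (p + 1)" "v = u \<oplus>\<^bsub>V\<^esub> w"
  shows "hcomp V p v = u"
  unfolding hcomp_def
proof (rule the_equality)
  show "u \<in> hpart V p \<and> (\<exists>w\<in>hpart V (p + 1). v = u \<oplus>\<^bsub>V\<^esub> w)" using assms by blast
next
  fix u' assume "u' \<in> hpart V p \<and> (\<exists>w\<in>hpart V (p + 1). v = u' \<oplus>\<^bsub>V\<^esub> w)"
  then obtain w' where "u' \<in> hpart V p" "w' \<in> hpart V (p + 1)" "v = u' \<oplus>\<^bsub>V\<^esub> w'" by blast
  then show "u' = u" using decomposition_unique[of u p w u' w'] assms by simp
qed

lemma hcomp_hpart [simp, intro]: "v \<in> carrier V ==> hcomp V p v \<in> hpart V p"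
  using decomposition_ex[of v p] hcomp_eqI by metis

lemma hcomp_carrier [simp, intro]: "v \<in> carrier V ==> hcomp V p v \<in> carrier V"
  using hcomp_hpart hpart_carrier by blast

lemma hcomp_sum:
  assumes "v \<in> carrier V"
  shows "v = hcomp V 0 v \<oplus>\<^bsub>V\<^esub> hcomp V 1 v"
proof -
  obtain u w where uw: "u \<in> hpart V 0" "w \<in> hpart V (0 + 1)" "v = u \<oplus>\<^bsub>V\<^esub> w"
    using decomposition_ex[OF assms, of 0] by auto
  have "v = w \<oplus>\<^bsub>V\<^esub> u" using uw hpart_carrier M.a_comm by metis
  then have "hcomp V 1 v = w" by (intro hcomp_eqI[of w 1 u]) (use uw in auto)
  then show ?thesis using hcomp_eqI[OF uw] uw by simp
qed

lemma hcomp_same [simp]: "v \<in> hpart V p ==> hcomp V p v = v"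
  by (rule hcomp_eqI[of v p "\<zero>\<^bsub>V\<^esub>"]) (auto simp: hpart_carrier)

lemma hcomp_other: "v \<in> hpart V p ==> q \<noteq> p ==> hcomp V q v = \<zero>\<^bsub>V\<^esub>"
  by (rule hcomp_eqI[of "\<zero>\<^bsub>V\<^esub>" q v]) (cases p; cases q; auto simp: hpart_carrier)+

lemma linear_map_hcomp: "linear_map K V V (hcomp V p)"
proof -
  have "hcomp V p (u \<oplus>\<^bsub>V\<^esub> v) = hcomp V p u \<oplus>\<^bsub>V\<^esub> hcomp V p v"
    if uv: "u \<in> carrier V" "v \<in> carrier V" for u v
  proof -
    obtain a b where ab: "a \<in> hpart V p" "b \<in> hpart V (p + 1)" "u = a \<oplus>\<^bsub>V\<^esub> b"
      using decomposition_ex[OF uv(1)] by blast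
    obtain c d where cd: "c \<in> hpart V p" "d \<in> hpart V (p + 1)" "v = c \<oplus>\<^bsub>V\<^esub> d"
      using decomposition_ex[OF uv(2)] by blast
    have "hcomp V p (u \<oplus>\<^bsub>V\<^esub> v) = a \<oplus>\<^bsub>V\<^esub> c"
    proof (rule hcomp_eqI)
      show "u \<oplus>\<^bsub>V\<^esub> v = a \<oplus>\<^bsub>V\<^esub> c \<oplus>\<^bsub>V\<^esub> (b \<oplus>\<^bsub>V\<^esub> d)" using ab cd hpart_carrier by (simp add: M.a_ac)
    qed (use ab cd in auto)
    then show ?thesis using hcomp_eqI ab cd by metis
  qed
  moreover have "hcomp V p (k \<odot>\<^bsub>V\<^esub> v) = k \<odot>\<^bsub>V\<^esub> hcomp V p v"
    if uv: "k \<in> carrier K" "v \<in> carrier V" for k v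
  proof -
    obtain c d where cd: "c \<in> hpart V p" "d \<in> hpart V (p + 1)" "v = c \<oplus>\<^bsub>V\<^esub> d"
      using decomposition_ex[OF uv(2)] by blast
    have "hcomp V p (k \<odot>\<^bsub>V\<^esub> v) = k \<odot>\<^bsub>V\<^esub> c"
      by (rule hcomp_eqI[where w = "k \<odot>\<^bsub>V\<^esub> d"]) (use uv cd hpart_carrier in \<open>auto simp: smult_r_distr\<close>)
    then show ?thesis using hcomp_eqI cd by metis
  qed
  ultimately show ?thesis unfolding linear_map_def by auto
qed

text \<open>A vector is the sum of its homogeneous components, so a linear map is known from its
  values on homogeneous vectors. All formulas stated with signs are extended to arbitrary morphisms
  in this way.\<close>

lemma linear_map_eqI:
  assumes "linear_map K V W f" "linear_map K V W g"
    and "!!p v. v \<in> hpart V p ==> f v = g v" and "v \<in> carrier V"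
  shows "f v = g v"
proof -
  have "f v = f (hcomp V 0 v \<oplus>\<^bsub>V\<^esub> hcomp V 1 v)" using hcomp_sum[OF assms(4)] by simp
  also have "... = f (hcomp V 0 v) \<oplus>\<^bsub>W\<^esub> f (hcomp V 1 v)"
    by (rule linear_map_add[OF assms(1)]) (use assms(4) in auto)
  also have "... = g (hcomp V 0 v) \<oplus>\<^bsub>W\<^esub> g (hcomp V 1 v)"
    using assms(3)[of "hcomp V 0 v" 0] assms(3)[of "hcomp V 1 v" 1] assms(4) by simp
  also have "... = g (hcomp V 0 v \<oplus>\<^bsub>V\<^esub> hcomp V 1 v)"
    by (rule linear_map_add[OF assms(2), symmetric]) (use assms(4) in auto)
  finally show ?thesis using hcomp_sum[OF assms(4)] by simp
qed

end

notation Comp (infixr "$\<index>" 60) and TensM (infixl "**\<index>" 70) and TensO (infixl "*.\<index>" 70)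

section \<open>Composition and identities\<close>

lemma cat_of_simps [simp]:
  "ob (cat_of A) = Obj A" "arr (cat_of A) = (%x y. homset A x y)" "cmp (cat_of A) = Comp A"
  "idn (cat_of A) = Ident A"
  by (simp_all add: cat_of_def)

text \<open>The endpoints are read off from the arrow instead of being parameters, as also in
  \<open>sgn_arr\<close>. Typing conditions then become equations between sources and targets, which
  rewriting can discharge.\<close>

definition invertible :: "('k, 'o, 'm, 'h, 'z) lincat_scheme \<Rightarrow> 'm \<Rightarrow> bool" where
  "invertible A f \<longleftrightarrow> f \<in> arrows A \<and> isom A (source A f) (target A f) f"

definition sgn_arr :: "('k, 'o, 'm, 'h, 'z) lincat_scheme \<Rightarrow> bit \<Rightarrow> 'm \<Rightarrow> 'm" where
  "sgn_arr A e f = signed (hom_of A f) e f"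

context linear_category begin

abbreviation "src \<equiv> source A"
abbreviation "tgt \<equiv> target A"
abbreviation "Arr \<equiv> arrows A"
abbreviation "ivs \<equiv> inverse_of A"
abbreviation "I \<equiv> Ident A"
abbreviation cmpA (infixr "$$" 60) where "g $$ f \<equiv> g $\<^bsub>A\<^esub> f"
abbreviation "Ob x \<equiv> x \<in> Obj A"
abbreviation "ar f \<equiv> f \<in> arrows A"
abbreviation "hs \<equiv> homset A"
abbreviation "Hm \<equiv> Hom A"

lemma homD:
  assumes "f \<in> hs x y" "Ob x" "Ob y"
  shows "ar f" "src f = x" "tgt f = y"
proof -
  show "ar f" using assms unfolding arrows_def by blast
  have d: "x' = x \<and> y' = y" if "Ob x'" "Ob y'" "f \<in> hs x' y'" for x' y'
    using arr_disjoint[of x' y' x y f] that assms by simp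
  show "src f = x" unfolding source_def
    by (rule the_equality) (use assms d in blast)+
  show "tgt f = y" unfolding target_def
    by (rule the_equality) (use assms d in blast)+
qed

lemma arrows_hom:
  assumes "ar f"
  shows "src f \<in> Obj A" "tgt f \<in> Obj A" "f \<in> hs (src f) (tgt f)"
proof -
  obtain x y where "Ob x" "Ob y" "f \<in> hs x y" using assms unfolding arrows_def by blast
  then show "src f \<in> Obj A" "tgt f \<in> Obj A" "f \<in> hs (src f) (tgt f)"
    by (simp_all add: homD(2)[of f x y] homD(3)[of f x y])
qed

lemma homI: "[|ar f; src f = x; tgt f = y|] ==> f \<in> hs x y"
  using arrows_hom(3) by blast

lemma hom_iff:
  "[|Ob x; Ob y|] ==> f \<in> hs x y \<longleftrightarrow> f \<in> Arr \<and> src f = x \<and> tgt f = y"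
  using homI homD by blast

lemma source_Obj [simp]: "ar f ==> src f \<in> Obj A"
  and target_Obj [simp]: "ar f ==> tgt f \<in> Obj A"
  using arrows_hom by auto

lemma comp_arrow:
  assumes "ar f" "ar g" "tgt f = src g"
  shows "g $$ f \<in> Arr" "src (g $$ f) = src f" "tgt (g $$ f) = tgt g"
proof -
  have "g $$ f \<in> hs (src f) (tgt g)"
    using cmp_closed[of "src f" "tgt f" "tgt g" f g] arrows_hom[OF assms(1)]
      arrows_hom[OF assms(2)] assms(3) by simp
  then show "g $$ f \<in> Arr" "src (g $$ f) = src f" "tgt (g $$ f) = tgt g"
    using homD assms by auto
qed

declare comp_arrow [simp]

lemma Ident_arrow [simp]:
  assumes "Ob x"
  shows "I x \<in> Arr" "src (I x) = x" "tgt (I x) = x"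
  using homD[of "I x" x x] idn_closed[of x] assms by auto

lemma comp_assoc [simp]:
  assumes "ar f" "ar g" "ar h" "tgt f = src g" "tgt g = src h"
  shows "(h $$ g) $$ f = h $$ (g $$ f)"
  using cmp_assoc[of "src f" "tgt f" "tgt g" "tgt h" f g h] assms
    arrows_hom[OF assms(1)] arrows_hom[OF assms(2)] arrows_hom[OF assms(3)] by simp

lemma Ident_comp [simp]: "[|ar f; tgt f = y|] ==> I y $$ f = f"
  using idn_left[of "src f" y f] arrows_hom[of f] by simp

lemma comp_Ident [simp]: "[|ar f; src f = x|] ==> f $$ I x = f"
  using idn_right[of x "tgt f" f] arrows_hom[of f] by simp

lemma isomD:
  assumes "isom A x y f" "Ob x" "Ob y"
  shows "invertible A f" "ar f" "src f = x" "tgt f = y"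
proof -
  have "f \<in> hs x y" using assms(1) unfolding cat_iso_def by simp
  then show "invertible A f" "ar f" "src f = x" "tgt f = y"
    unfolding invertible_def using homD assms by auto
qed

lemma invertible_arrow [simp]: "invertible A f ==> ar f"
  unfolding invertible_def by blast

lemma invertible_isom: "[|invertible A f; src f = x; tgt f = y|] ==> isom A x y f"
  unfolding invertible_def by blast

lemma inverse_of_eqI:
  assumes "ar f" "ar g" "src g = tgt f" "tgt g = src f"
    and "g $$ f = I (src f)" "f $$ g = I (tgt f)"
  shows "ivs f = g" "invertible A f"
proof -
  have g: "g \<in> hs (tgt f) (src f)" using assms arrows_hom[OF assms(2)] by simp
  show "ivs f = g" unfolding inverse_of_def
  proof (rule the_equality)
    fix g' assume a: "g' \<in> hs (tgt f) (src f) \<and>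
         g' $$ f = I (src f) \<and> f $$ g' = I (tgt f)"
    then have g': "ar g'" "src g' = tgt f" "tgt g' = src f"
      using homD assms(1) by auto
    have "g' = (g' $$ f) $$ g" using assms g' a by (subst comp_assoc) simp_all
    also have "... = g" using a assms by simp
    finally show "g' = g" .
  qed (use assms g in auto)
  show "invertible A f"
    unfolding invertible_def cat_iso_def using assms g arrows_hom[OF assms(1)] by auto
qed

lemma invertibleE:
  assumes "invertible A f"
  obtains g where "ar g" "src g = tgt f" "tgt g = src f"
    "g $$ f = I (src f)" "f $$ g = I (tgt f)" "ivs f = g"
proof -
  have f: "ar f" using assms by simp
  obtain g where g: "g \<in> hs (tgt f) (src f)"
    "g $$ f = I (src f)" "f $$ g = I (tgt f)"
    using assms unfolding invertible_def cat_iso_def by auto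
  have ga: "ar g" "src g = tgt f" "tgt g = src f"
    using homD[OF g(1)] f by auto
  show ?thesis using that[OF ga g(2,3)] inverse_of_eqI(1)[OF f ga g(2,3)] by simp
qed

lemma inverse_of_arrow [simp]:
  assumes "invertible A f"
  shows "ivs f \<in> Arr" "src (ivs f) = tgt f"
    "tgt (ivs f) = src f"
  using invertibleE[OF assms] by metis+

lemma inverse_comp [simp]:
  assumes "invertible A f"
  shows "ivs f $$ f = I (src f)" "f $$ ivs f = I (tgt f)"
  using invertibleE[OF assms] by metis+

text \<open>\<open>comp_assoc\<close> keeps composites nested to the right, so an inverse pair
  usually stands in front of further factors; these are the cancellation rules for that
  position.\<close>

lemma inverse_comp_cancel [simp]:
  assumes "invertible A f" "ar g"
  shows "tgt g = src f ==> ivs f $$ (f $$ g) = g"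
    and "tgt g = tgt f ==> f $$ (ivs f $$ g) = g"
  using assms by (simp_all flip: comp_assoc)

lemma invertible_inverse [simp]:
  assumes "invertible A f"
  shows "invertible A (ivs f)" "ivs (ivs f) = f"
  by (rule inverse_of_eqI(2)[of "ivs f" f]; use assms in simp)
     (rule inverse_of_eqI(1)[of "ivs f" f]; use assms in simp)

lemma invertible_Ident [simp]:
  assumes "Ob x"
  shows "invertible A (I x)" "ivs (I x) = I x"
  by (rule inverse_of_eqI(2)[of "I x" "I x"]; use assms in simp)
     (rule inverse_of_eqI(1)[of "I x" "I x"]; use assms in simp)

lemma invertible_comp [simp]:
  assumes "invertible A f" "invertible A g" "tgt f = src g"
  shows "invertible A (g $$ f)" "ivs (g $$ f) = ivs f $$ ivs g"
  by (rule inverse_of_eqI(2)[of "g $$ f" "ivs f $$ ivs g"]; use assms in simp)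
     (rule inverse_of_eqI(1)[of "g $$ f" "ivs f $$ ivs g"]; use assms in simp)

lemma comp_cancel_left:
  assumes "invertible A f" "ar g" "ar h" "tgt g = src f"
    "tgt h = src f" "f $$ g = f $$ h"
  shows "g = h"
  by (metis assms inverse_comp_cancel(1))

lemma comp_cancel_right:
  assumes "invertible A f" "ar g" "ar h" "src g = tgt f"
    "src h = tgt f" "g $$ f = h $$ f"
  shows "g = h"
proof -
  have "(g $$ f) $$ ivs f = (h $$ f) $$ ivs f" using assms by simp
  then show ?thesis using assms(1-5) by simp
qed

lemma inverse_switch:
  assumes "invertible A f" "ar g" "ar h" "tgt g = src f" "f $$ g = h"
  shows "g = ivs f $$ h"
  using assms by auto

lemma module_hom_of: "ar f ==> module K (hom_of A f)"
  unfolding hom_of_def using module_Hom by simp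

lemma hom_of_eq: "[|f \<in> hs x y; Ob x; Ob y|] ==> hom_of A f = Hm x y"
  unfolding hom_of_def using homD by simp

lemma arrow_hom_of: "ar f ==> f \<in> carrier (hom_of A f)"
  unfolding hom_of_def using arrows_hom by simp

lemma linear_comp_right:
  "[|ar g; src g = y; tgt g = z; Ob x|] ==> linear_map K (Hm x y) (Hm x z) (Comp A g)"
  using bilinear_map_right[OF bilinear_Comp[of x y z]] arrows_hom[of g] by auto

lemma linear_comp_left:
  "[|ar g; src g = x; tgt g = y; Ob z|]
    ==> linear_map K (Hm y z) (Hm x z) (%f. f $$ g)"
  using bilinear_map_left[OF bilinear_Comp[of x y z]] arrows_hom[of g] by auto

lemma sgn_arr_hom: "[|f \<in> hs x y; Ob x; Ob y|] ==> sgn_arr A e f = signed (Hm x y) e f"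
  unfolding sgn_arr_def by (simp add: hom_of_eq)

lemma sgn_arr_arrow [simp]:
  assumes "ar f"
  shows "sgn_arr A e f \<in> Arr" "src (sgn_arr A e f) = src f"
    "tgt (sgn_arr A e f) = tgt f"
proof -
  interpret module K "Hm (src f) (tgt f)" using assms by (intro module_Hom) auto
  have "sgn_arr A e f \<in> hs (src f) (tgt f)"
    unfolding sgn_arr_def hom_of_def using arrows_hom(3)[OF assms] by simp
  from homD[OF this] assms show "sgn_arr A e f \<in> Arr" "src (sgn_arr A e f) = src f"
    "tgt (sgn_arr A e f) = tgt f" by auto
qed

lemma sgn_arr_0 [simp]: "sgn_arr A 0 f = f"
  unfolding sgn_arr_def by simp

lemma hom_of_sgn_arr [simp]: "ar f ==> hom_of A (sgn_arr A e f) = hom_of A f"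
  unfolding hom_of_def by simp

lemma sgn_arr_sgn_arr [simp]: "ar f ==> sgn_arr A a (sgn_arr A b f) = sgn_arr A (a + b) f"
  using module.signed_signed[OF module_hom_of arrow_hom_of] by (simp add: sgn_arr_def[of A a] sgn_arr_def[of A "a+b"])
    (simp add: sgn_arr_def)

lemma sgn_arr_eq_iff:
  assumes "ar f" "ar g"
  shows "sgn_arr A e f = g \<longleftrightarrow> f = sgn_arr A e g"
  using assms by auto

text \<open>Signs are moved to the front of a composite, where \<open>sgn_arr_sgn_arr\<close> adds
  their exponents. Comparing signs thus becomes an identity between polynomials in parities over
  Z/2.\<close>

lemma comp_sgn_arr [simp]:
  assumes "ar f" "ar g" "tgt f = src g"
  shows "sgn_arr A e g $$ f = sgn_arr A e (g $$ f)" "g $$ sgn_arr A e f = sgn_arr A e (g $$ f)"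
proof -
  have m: "module K (Hm (src f) (src g))" "module K (Hm (src g) (tgt g))"
     "module K (Hm (src f) (tgt g))"
    using assms by (auto intro: module_Hom)
  show "sgn_arr A e g $$ f = sgn_arr A e (g $$ f)"
    using linear_map_signed[OF m(2,3) linear_comp_left[of f "src f" "src g" "tgt g"]] assms arrows_hom[OF assms(2)]
    by (simp add: sgn_arr_def hom_of_def)
  show "g $$ sgn_arr A e f = sgn_arr A e (g $$ f)"
    using linear_map_signed[OF m(1,3) linear_comp_right[of g "src g" "tgt g" "src f"]] assms arrows_hom[OF assms(1)]
    by (simp add: sgn_arr_def hom_of_def)
qed

lemma sgn_arr_invertible [simp]:
  assumes "invertible A f"
  shows "invertible A (sgn_arr A e f)" "ivs (sgn_arr A e f) = sgn_arr A e (ivs f)"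
  by (rule inverse_of_eqI(2)[of "sgn_arr A e f" "sgn_arr A e (ivs f)"]; use assms in simp)
     (rule inverse_of_eqI(1)[of "sgn_arr A e f" "sgn_arr A e (ivs f)"]; use assms in simp)

end

section \<open>Tensor products\<close>

lemma tensor_class_eqI: "tensor_eq K U V xs ys ==> tensor_class K U V xs = tensor_class K U V ys"
  unfolding tensor_class_def using tensor_eq.trans tensor_eq.sym by blast

lemma tensor_class_self: "xs \<in> lists (carrier U \<times> carrier V) ==> xs \<in> tensor_class K U V xs"
  unfolding tensor_class_def by (simp add: tensor_eq.refl)

lemma in_tensor_classD: "ys \<in> tensor_class K U V xs ==> tensor_eq K U V xs ys"
  unfolding tensor_class_def by simp

locale two_modules = U: module K U + V: module K V
  for K :: "'k ring" and U :: "('k, 'm, 'y) module_scheme" and V :: "('k, 'n, 'z) module_scheme"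
begin

lemma tensor_eq_lists:
  "tensor_eq K U V xs ys ==> xs \<in> lists (carrier U \<times> carrier V) \<and> ys \<in> lists (carrier U \<times> carrier V)"
  by (induction rule: tensor_eq.induct) auto

lemma tensor_eq_append_cong:
  "[|tensor_eq K U V xs xs'; ys \<in> lists (carrier U \<times> carrier V)|] ==> tensor_eq K U V (xs @ ys) (xs' @ ys)"
  "[|tensor_eq K U V xs xs'; ys \<in> lists (carrier U \<times> carrier V)|] ==> tensor_eq K U V (ys @ xs) (ys @ xs')"
  using tensor_eq.append tensor_eq.refl by metis+

text \<open>The congruence only exchanges two blocks, but this generates all permutations: the head
  of \<open>xs\<close> is located in \<open>ys\<close> and moved to the front. It allows a double
  sum to be reordered.\<close>

lemma tensor_eq_perm:
  "[|mset xs = mset ys; xs \<in> lists (carrier U \<times> carrier V)|] ==> tensor_eq K U V xs ys"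
proof (induction xs arbitrary: ys)
  case Nil
  then show ?case by (simp add: tensor_eq.refl)
next
  case (Cons x xs)
  have "x \<in> set ys" using Cons.prems(1) by (metis list.set_intros(1) set_mset_mset)
  then obtain as bs where ys: "ys = as @ x # bs" by (meson split_list)
  have e: "tensor_eq K U V xs (as @ bs)" using Cons ys by (intro Cons.IH) auto
  have l: "as \<in> lists (carrier U \<times> carrier V)" "bs \<in> lists (carrier U \<times> carrier V)"
    "[x] \<in> lists (carrier U \<times> carrier V)"
    using tensor_eq_lists[OF e] Cons.prems(2) by auto
  have 1: "tensor_eq K U V ([x] @ xs) ([x] @ as @ bs)" using tensor_eq_append_cong(2)[OF e l(3)] .
  have 2: "tensor_eq K U V (([x] @ as) @ bs) ((as @ [x]) @ bs)"
    by (rule tensor_eq_append_cong(1)[OF tensor_eq.commute[OF l(3,1)] l(2)])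
  show ?case unfolding ys using tensor_eq.trans[of K U V "x # xs" "x # as @ bs" "as @ x # bs"] 1 2 by simp
qed

text \<open>Only the zero in the left factor is among the generators; the scalar 0 is taken out of
  the right factor and moved across to the left one.\<close>

lemma tensor_eq_zero_right: "u \<in> carrier U ==> tensor_eq K U V [(u, \<zero>\<^bsub>V\<^esub>)] []"
  by (rule tensor_eq.trans[OF tensor_eq.sym tensor_eq.zero[of "\<zero>\<^bsub>V\<^esub>"]])
     (use tensor_eq.scalar[of "\<zero>\<^bsub>K\<^esub>" K u U "\<zero>\<^bsub>V\<^esub>" V] in simp_all)

text \<open>Functoriality of the tensor product: a pair of linear maps carries each generating
  relation to a relation of the same kind.\<close>

lemma tensor_eq_map:
  assumes "linear_map K U U' \<alpha>" "linear_map K V V' \<beta>" "module K U'" "tensor_eq K U V xs ys"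
  shows "tensor_eq K U' V' (map (%(u, v). (\<alpha> u, \<beta> v)) xs) (map (%(u, v). (\<alpha> u, \<beta> v)) ys)"
  using assms(4)
proof (induction rule: tensor_eq.induct)
  note c = linear_map_closed[OF assms(1)] linear_map_closed[OF assms(2)]
  {
    case (refl xs)
    then show ?case by (intro tensor_eq.refl) (auto intro!: c)
  next
    case sym
    then show ?case by (simp add: tensor_eq.sym)
  next
    case trans
    then show ?case by (meson tensor_eq.trans)
  next
    case append
    then show ?case by (simp add: tensor_eq.append)
  next
    case (commute xs ys)
    then have "map (%(u, v). (\<alpha> u, \<beta> v)) xs \<in> lists (carrier U' \<times> carrier V')"
      "map (%(u, v). (\<alpha> u, \<beta> v)) ys \<in> lists (carrier U' \<times> carrier V')"
      by (auto intro!: c)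
    then show ?case by (simp add: tensor_eq.commute)
  next
    case (add_left u u' v)
    then show ?case by (simp add: c linear_map_add[OF assms(1)] tensor_eq.add_left)
  next
    case (add_right u v v')
    then show ?case by (simp add: c linear_map_add[OF assms(2)] tensor_eq.add_right)
  next
    case (scalar a u v)
    then show ?case
      by (simp add: c linear_map_smult[OF assms(1)] linear_map_smult[OF assms(2)] tensor_eq.scalar)
  next
    case (zero v)
    then show ?case
      by (simp add: c linear_map_zero[OF U.module_axioms assms(3,1)] tensor_eq.zero)
  }
qed

lemma tensor_space_add:
  assumes "xs \<in> lists (carrier U \<times> carrier V)" "ys \<in> lists (carrier U \<times> carrier V)"
  shows "(\<Union>xs' \<in> tensor_class K U V xs. \<Union>ys' \<in> tensor_class K U V ys. tensor_class K U V (xs' @ ys'))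
    = tensor_class K U V (xs @ ys)"
proof -
  have "tensor_class K U V (xs' @ ys') = tensor_class K U V (xs @ ys)"
    if "xs' \<in> tensor_class K U V xs" "ys' \<in> tensor_class K U V ys" for xs' ys'
    by (rule tensor_class_eqI[OF tensor_eq.sym[OF tensor_eq.append]])
       (rule in_tensor_classD, rule that)+
  then show ?thesis using tensor_class_self[OF assms(1)] tensor_class_self[OF assms(2)] by fast
qed

lemma tensor_space_smult:
  assumes "xs \<in> lists (carrier U \<times> carrier V)" "a \<in> carrier K"
  shows "(\<Union>xs' \<in> tensor_class K U V xs. tensor_class K U V (map (%(u, v). (a \<odot>\<^bsub>U\<^esub> u, v)) xs'))
    = tensor_class K U V (map (%(u, v). (a \<odot>\<^bsub>U\<^esub> u, v)) xs)"
proof -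
  have l: "linear_map K U U (%u. a \<odot>\<^bsub>U\<^esub> u)"
    unfolding linear_map_def using assms(2)
    by (auto simp: U.smult_r_distr simp flip: U.smult_assoc1) (metis U.R.m_comm)
  have "tensor_class K U V (map (%(u, v). (a \<odot>\<^bsub>U\<^esub> u, v)) xs')
      = tensor_class K U V (map (%(u, v). (a \<odot>\<^bsub>U\<^esub> u, v)) xs)"
    if "xs' \<in> tensor_class K U V xs" for xs'
    by (rule tensor_class_eqI[OF tensor_eq.sym[OF tensor_eq_map[OF l linear_map_id U.module_axioms]]])
       (rule in_tensor_classD, rule that)
  then show ?thesis using tensor_class_self[OF assms(1)] by fast
qed

end

text \<open>The linear map on the tensor product induced by a bilinear map \<open>b\<close>,
  evaluated on a representing formal sum.\<close>

definition tensor_sum ::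
    "('k, 'l, 'z) module_scheme \<Rightarrow> ('m \<Rightarrow> 'n \<Rightarrow> 'l) \<Rightarrow> ('m \<times> 'n) list \<Rightarrow> 'l" where
  "tensor_sum W b xs = foldr (%(u, v) s. b u v \<oplus>\<^bsub>W\<^esub> s) xs \<zero>\<^bsub>W\<^esub>"

lemma tensor_sum_simps [simp]:
  "tensor_sum W b [] = \<zero>\<^bsub>W\<^esub>" "tensor_sum W b ((u, v) # xs) = b u v \<oplus>\<^bsub>W\<^esub> tensor_sum W b xs"
  by (simp_all add: tensor_sum_def)

locale bilinear = two_modules K U V + W: module K W
  for K :: "'k ring" and U :: "('k, 'm, 'x) module_scheme" and V :: "('k, 'n, 'y) module_scheme"
    and W :: "('k, 'l, 'z) module_scheme" +
  fixes b
  assumes bilinear: "bilinear_map K U V W b"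
begin

lemma b_closed [simp]: "[|u \<in> carrier U; v \<in> carrier V|] ==> b u v \<in> carrier W"
  using linear_map_closed[OF bilinear_map_right[OF bilinear]] by blast

lemma tensor_sum_closed [simp]:
  "xs \<in> lists (carrier U \<times> carrier V) ==> tensor_sum W b xs \<in> carrier W"
  by (induction xs) auto

lemma tensor_sum_append:
  "[|xs \<in> lists (carrier U \<times> carrier V); ys \<in> lists (carrier U \<times> carrier V)|]
    ==> tensor_sum W b (xs @ ys) = tensor_sum W b xs \<oplus>\<^bsub>W\<^esub> tensor_sum W b ys"
proof (induction xs)
  case (Cons x xs)
  then obtain u v where x: "x = (u, v)" "u \<in> carrier U" "v \<in> carrier V" "xs \<in> lists (carrier U \<times> carrier V)"
    by auto
  then show ?case
    using Cons.IH[OF x(4) Cons.prems(2)] W.M.a_assoc[OF b_closed tensor_sum_closed tensor_sum_closed] Cons.prems(2)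
    by simp
qed (simp add: tensor_sum_closed)

text \<open>One half of the universal property: bilinearity of \<open>b\<close> is exactly what the
  generating relations ask for, so the value depends on the class alone.\<close>

lemma tensor_sum_cong: "tensor_eq K U V xs ys ==> tensor_sum W b xs = tensor_sum W b ys"
proof (induction rule: tensor_eq.induct)
  case (append xs xs' ys ys')
  then show ?case using tensor_eq_lists by (simp add: tensor_sum_append)
next
  case (commute xs ys)
  then show ?case by (simp add: tensor_sum_append W.M.a_comm)
next
  case (add_left u u' v)
  then show ?case using linear_map_add[OF bilinear_map_left[OF bilinear]] by (simp add: W.M.a_assoc)
next
  case (add_right u v v')
  then show ?case using linear_map_add[OF bilinear_map_right[OF bilinear]] by (simp add: W.M.a_assoc)
next
  case (scalar a u v)
  then show ?case
    using linear_map_smult[OF bilinear_map_left[OF bilinear]] linear_map_smult[OF bilinear_map_right[OF bilinear]]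
    by simp
next
  case (zero v)
  then show ?case
    using linear_map_zero[OF U.module_axioms W.module_axioms bilinear_map_left[OF bilinear]] by simp
qed auto

end

text \<open>Interchange of two finite summations, for formal sums regarded up to order.\<close>

lemma mset_concat_swap:
  "mset (concat (map (%i. map (%d. E d i) ds) is)) = mset (concat (map (%d. map (E d) is) ds))"
proof (induction ds)
  case Nil
  show ?case by (induction "is") auto
next
  case (Cons d ds)
  have "mset (concat (map (%i. map (%d. E d i) (d # ds)) is))
      = mset (map (E d) is) + mset (concat (map (%i. map (%d. E d i) ds) is))"
    by (induction "is") auto
  then show ?case using Cons by simp
qed

section \<open>Well-definedness of composition in the product supercategory\<close>

context supercategory begin

abbreviation "teq x x' y y' \<equiv> tensor_eq K (Hm x x') (Hm y y')"
abbreviation "Ls x x' y y' \<equiv> lists (hs x x' \<times> hs y y')"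

lemma two_modules_Hom:
  "[|Ob x; Ob x'; Ob y; Ob y'|] ==> two_modules K (Hm x x') (Hm y y')"
  by (intro two_modules.intro module_Hom)

text \<open>One summand in the composite of two pure tensors: \<open>p\<close> is the parity
  selected from \<open>g\<close> and \<open>q\<close> the parity selected from \<open>h\<close>, the
  two morphisms that pass each other. The sign is carried by the second factor.\<close>

definition prod_entry :: "'m \<times> 'm \<Rightarrow> 'm \<times> 'm \<Rightarrow> bit \<times> bit \<Rightarrow> 'm \<times> 'm" where
  "prod_entry = (%(f, g) (h, k) (p, q). (f $$ hcomp (hom_of A h) q h,
     (let g' = hcomp (hom_of A g) p g $$ k in signed (hom_of A g') (p * q) g')))"

abbreviation parity_pairs :: "(bit \<times> bit) list" where
  "parity_pairs \<equiv> [(0, 0), (0, 1), (1, 0), (1, 1)]"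

lemma comp_sums_entries:
  "comp_sums A A ds cs = concat (map (%d. concat (map (%c. map (prod_entry d c) parity_pairs) cs)) ds)"
  unfolding comp_sums_def prod_entry_def
  by (intro arg_cong[of _ _ concat] map_cong refl)
     (auto intro!: arg_cong[of _ _ concat] map_cong)

text \<open>Moves the summation over \<open>ds\<close> innermost. With the right-hand pair and both
  parities fixed, what is left depends linearly on each component of the left-hand pair.\<close>

lemma comp_sums_mset_left:
  "mset (comp_sums A A ds cs) = mset (concat (map (%(c, r). map (%d. prod_entry d c r) ds)
     (List.product cs parity_pairs)))"
proof -
  have "comp_sums A A ds cs
      = concat (map (%d. map (%(c, r). prod_entry d c r) (List.product cs parity_pairs)) ds)"
    unfolding comp_sums_entries by (simp add: product_concat_map map_concat comp_def)
  then show ?thesis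
    using mset_concat_swap[of "%d (c, r). prod_entry d c r" ds "List.product cs parity_pairs"]
    by (simp add: case_prod_beta')
qed

lemma comp_sums_mset_right:
  "mset (comp_sums A A ds cs) = mset (concat (map (%(d, r). map (%c. prod_entry d c r) cs)
     (List.product ds parity_pairs)))"
proof (induction ds)
  case Nil
  then show ?case unfolding comp_sums_entries by simp
next
  case (Cons d ds)
  have "mset (concat (map (%c. map (prod_entry d c) parity_pairs) cs))
    = mset (concat (map (%r. map (%c. prod_entry d c r) cs) parity_pairs))"
    by (rule mset_concat_swap[symmetric])
  then show ?case using Cons unfolding comp_sums_entries by (simp add: ac_simps)
qed

context
  fixes x x' x'' y y' y''
  assumes obj: "Ob x" "Ob x'" "Ob x''" "Ob y" "Ob y'" "Ob y''"
begin

lemma prod_entry_eq: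
  assumes "f \<in> hs x' x''" "g \<in> hs y' y''" "h \<in> hs x x'" "k \<in> hs y y'"
  shows "prod_entry (f, g) (h, k) (p, q) = (f $$ hcomp (Hm x x') q h,
    signed (Hm y y'') (p * q) (hcomp (Hm y' y'') p g $$ k))"
proof -
  have "hcomp (Hm y' y'') p g \<in> hs y' y''"
    using superspace.hcomp_carrier[OF superspace_Hom] obj assms by simp
  then have "hcomp (Hm y' y'') p g $$ k \<in> hs y y''"
    using cmp_closed[of y y' y'' k] obj assms by simp
  then show ?thesis unfolding prod_entry_def using assms obj by (simp add: hom_of_eq)
qed

lemma linear_prod_entry_left:
  assumes "h \<in> hs x x'" "k \<in> hs y y'"
  shows "linear_map K (Hm x' x'') (Hm x x'') (%f. f $$ hcomp (Hm x x') q h)"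
    "linear_map K (Hm y' y'') (Hm y y'') (%g. signed (Hm y y'') e (hcomp (Hm y' y'') p g $$ k))"
proof -
  have "hcomp (Hm x x') q h \<in> hs x x'"
    using superspace.hcomp_carrier[OF superspace_Hom] obj assms by simp
  then show "linear_map K (Hm x' x'') (Hm x x'') (%f. f $$ hcomp (Hm x x') q h)"
    using bilinear_map_left[OF bilinear_Comp] obj by simp
  have "linear_map K (Hm y' y'') (Hm y y'') (%g. g $$ k)"
    using bilinear_map_left[OF bilinear_Comp] obj assms by simp
  from lin_compose[OF this superspace.linear_map_hcomp[OF superspace_Hom]]
  show "linear_map K (Hm y' y'') (Hm y y'') (%g. signed (Hm y y'') e (hcomp (Hm y' y'') p g $$ k))"
    using obj module_Hom by (intro linear_map_signed_compose) auto
qed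

lemma linear_prod_entry_right:
  assumes "f \<in> hs x' x''" "g \<in> hs y' y''"
  shows "linear_map K (Hm x x') (Hm x x'') (%h. f $$ hcomp (Hm x x') q h)"
    "linear_map K (Hm y y') (Hm y y'') (%k. signed (Hm y y'') e (hcomp (Hm y' y'') p g $$ k))"
proof -
  have "linear_map K (Hm x x') (Hm x x'') (%h. f $$ h)"
    using bilinear_map_right[OF bilinear_Comp] obj assms by simp
  from lin_compose[OF this superspace.linear_map_hcomp[OF superspace_Hom]]
  show "linear_map K (Hm x x') (Hm x x'') (%h. f $$ hcomp (Hm x x') q h)"
    using obj by simp
  have "hcomp (Hm y' y'') p g \<in> hs y' y''"
    using superspace.hcomp_carrier[OF superspace_Hom] obj assms by simp
  then have "linear_map K (Hm y y') (Hm y y'') (%k. hcomp (Hm y' y'') p g $$ k)"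
    using bilinear_map_right[OF bilinear_Comp] obj by simp
  then show "linear_map K (Hm y y') (Hm y y'') (%k. signed (Hm y y'') e (hcomp (Hm y' y'') p g $$ k))"
    using obj module_Hom by (intro linear_map_signed_compose) auto
qed

lemma comp_sums_lists:
  assumes "ds \<in> Ls x' x'' y' y''" "cs \<in> Ls x x' y y'"
  shows "comp_sums A A ds cs \<in> Ls x x'' y y''"
proof -
  have "prod_entry d c r \<in> hs x x'' \<times> hs y y''"
    if "d \<in> hs x' x'' \<times> hs y' y''" "c \<in> hs x x' \<times> hs y y'" for d c r
  proof -
    obtain f g h k p q where e: "d = (f, g)" "c = (h, k)" "r = (p, q)" by (metis surj_pair)
    then show ?thesis
      using that linear_map_closed[OF linear_prod_entry_left(1)[of h k q], of f]
        linear_map_closed[OF linear_prod_entry_left(2)[of h k "p * q" p], of g]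
      by (simp add: prod_entry_eq)
  qed
  then show ?thesis using assms unfolding comp_sums_entries by (auto simp: in_lists_conv_set)
qed

lemma tensor_eq_concat_map:
  assumes "two_modules K U V" "!!i. i \<in> set is ==> tensor_eq K U V (E i) (F i)"
  shows "tensor_eq K U V (concat (map E is)) (concat (map F is))"
  using assms(2) by (induction "is") (auto intro: tensor_eq.append tensor_eq.refl)

text \<open>After regrouping, each block is the image of \<open>ds\<close> under a pair of linear
  maps, so \<open>tensor_eq_map\<close> applies block by block.\<close>

lemma comp_sums_cong_left:
  assumes "teq x' x'' y' y'' ds ds'" "cs \<in> Ls x x' y y'"
  shows "teq x x'' y y'' (comp_sums A A ds cs) (comp_sums A A ds' cs)"
proof -
  interpret D: two_modules K "Hm x' x''" "Hm y' y''" using two_modules_Hom obj by simp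
  interpret E: two_modules K "Hm x x''" "Hm y y''" using two_modules_Hom obj by simp
  have dl: "ds \<in> Ls x' x'' y' y''" "ds' \<in> Ls x' x'' y' y''"
    using D.tensor_eq_lists[OF assms(1)] by auto
  let ?L = "%ds. concat (map (%(c, r). map (%d. prod_entry d c r) ds) (List.product cs parity_pairs))"
  have p: "teq x x'' y y'' (comp_sums A A ds cs) (?L ds)"
    if "ds \<in> Ls x' x'' y' y''" for ds
    using E.tensor_eq_perm[OF comp_sums_mset_left comp_sums_lists[OF that assms(2)]] .
  have "teq x x'' y y'' (?L ds) (?L ds')"
  proof (rule tensor_eq_concat_map[OF E.two_modules_axioms])
    fix i assume i: "i \<in> set (List.product cs parity_pairs)"
    obtain h k p q where [simp]: "i = ((h, k), (p, q))" by (metis surj_pair)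
    have hk: "h \<in> hs x x'" "k \<in> hs y y'" using i assms(2) by (auto simp: in_lists_conv_set)
    let ?\<phi> = "%(f, g). (f $$ hcomp (Hm x x') q h, signed (Hm y y'') (p * q) (hcomp (Hm y' y'') p g $$ k))"
    have m: "map (%d. prod_entry d (h, k) (p, q)) ds = map ?\<phi> ds"
      if "ds \<in> Ls x' x'' y' y''" for ds
      by (rule map_cong) (use that hk in \<open>auto simp: prod_entry_eq in_lists_conv_set\<close>)
    show "teq x x'' y y'' ((%(c, r). map (%d. prod_entry d c r) ds) i)
       ((%(c, r). map (%d. prod_entry d c r) ds') i)"
      using D.tensor_eq_map[OF linear_prod_entry_left(1)[OF hk, of q] linear_prod_entry_left(2)[OF hk, of "p * q" p] E.U.module_axioms assms(1)]
      by (simp add: m[OF dl(1)] m[OF dl(2)] del: map_eq_conv)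
  qed
  then show ?thesis using p[OF dl(1)] p[OF dl(2)] by (meson tensor_eq.trans tensor_eq.sym)
qed

lemma comp_sums_cong_right:
  assumes "teq x x' y y' cs cs'" "ds \<in> Ls x' x'' y' y''"
  shows "teq x x'' y y'' (comp_sums A A ds cs) (comp_sums A A ds cs')"
proof -
  interpret D: two_modules K "Hm x x'" "Hm y y'" using two_modules_Hom obj by simp
  interpret E: two_modules K "Hm x x''" "Hm y y''" using two_modules_Hom obj by simp
  have dl: "cs \<in> Ls x x' y y'" "cs' \<in> Ls x x' y y'"
    using D.tensor_eq_lists[OF assms(1)] by auto
  let ?L = "%cs. concat (map (%(d, r). map (%c. prod_entry d c r) cs) (List.product ds parity_pairs))"
  have p: "teq x x'' y y'' (comp_sums A A ds cs) (?L cs)"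
    if "cs \<in> Ls x x' y y'" for cs
    using E.tensor_eq_perm[OF comp_sums_mset_right comp_sums_lists[OF assms(2) that]] .
  have "teq x x'' y y'' (?L cs) (?L cs')"
  proof (rule tensor_eq_concat_map[OF E.two_modules_axioms])
    fix i assume i: "i \<in> set (List.product ds parity_pairs)"
    obtain f g p q where [simp]: "i = ((f, g), (p, q))" by (metis surj_pair)
    have hk: "f \<in> hs x' x''" "g \<in> hs y' y''" using i assms(2) by (auto simp: in_lists_conv_set)
    let ?\<phi> = "%(h, k). (f $$ hcomp (Hm x x') q h, signed (Hm y y'') (p * q) (hcomp (Hm y' y'') p g $$ k))"
    have m: "map (%c. prod_entry (f, g) c (p, q)) cs = map ?\<phi> cs"
      if "cs \<in> Ls x x' y y'" for cs
      by (rule map_cong) (use that hk in \<open>auto simp: prod_entry_eq in_lists_conv_set\<close>)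
    show "teq x x'' y y'' ((%(d, r). map (%c. prod_entry d c r) cs) i)
       ((%(d, r). map (%c. prod_entry d c r) cs') i)"
      using D.tensor_eq_map[OF linear_prod_entry_right(1)[OF hk, of q] linear_prod_entry_right(2)[OF hk, of "p * q" p] E.U.module_axioms assms(1)]
      by (simp add: m[OF dl(1)] m[OF dl(2)] del: map_eq_conv)
  qed
  then show ?thesis using p[OF dl(1)] p[OF dl(2)] by (meson tensor_eq.trans tensor_eq.sym)
qed

end

abbreviation prod_class :: "'o \<Rightarrow> 'o \<Rightarrow> 'o \<Rightarrow> 'o \<Rightarrow> ('m \<times> 'm) list \<Rightarrow> ('m \<times> 'm) list set" where
  "prod_class x x' y y' \<equiv> tensor_class K (Hm x x') (Hm y y')"

text \<open>A class is a bare set of lists, yet it remembers the four objects, because hom-spaces of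
  different pairs of objects are disjoint. This is what makes the composition in the product
  supercategory single-valued.\<close>

lemma prod_class_objects:
  assumes "Ob x" "Ob x'" "Ob y" "Ob y'" "Ob u" "Ob u'" "Ob v" "Ob v'"
    and "C \<in> prod_class x x' y y' ` Ls x x' y y'"
    and "C \<in> prod_class u u' v v' ` Ls u u' v v'"
  shows "u = x \<and> u' = x' \<and> v = y \<and> v' = y'"
proof -
  interpret D: two_modules K "Hm x x'" "Hm y y'" using two_modules_Hom assms by simp
  interpret E: two_modules K "Hm u u'" "Hm v v'" using two_modules_Hom assms by simp
  \<comment> \<open>The representative may be the empty list, which carries no information on
    objects. Adding a pair of zeros does not change the class and exhibits elements of both
    hom-spaces.\<close>
  let ?z = "(\<zero>\<^bsub>Hm x x'\<^esub>, \<zero>\<^bsub>Hm y y'\<^esub>)"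
  obtain cs where cs: "cs \<in> Ls x x' y y'" "C = prod_class x x' y y' cs"
    using assms(9) by blast
  have "teq x x' y y' ([?z] @ cs) ([] @ cs)"
    by (rule D.tensor_eq_append_cong(1)[OF D.tensor_eq_zero_right]) (use cs in auto)
  then have z: "?z # cs \<in> C" unfolding cs(2) tensor_class_def using tensor_eq.sym by fastforce
  obtain cs' where cs': "C = prod_class u u' v v' cs'" using assms(10) by blast
  have "?z # cs \<in> Ls u u' v v'"
    using E.tensor_eq_lists[OF in_tensor_classD] z cs' by blast
  then have "\<zero>\<^bsub>Hm x x'\<^esub> \<in> hs u u'" "\<zero>\<^bsub>Hm y y'\<^esub> \<in> hs v v'" by auto
  then show ?thesis
    using homD[of "\<zero>\<^bsub>Hm x x'\<^esub>" u u'] homD[of "\<zero>\<^bsub>Hm y y'\<^esub>" v v']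
      D.U.M.zero_closed D.V.M.zero_closed homD[of "\<zero>\<^bsub>Hm x x'\<^esub>" x x'] homD[of "\<zero>\<^bsub>Hm y y'\<^esub>" y y'] assms by simp
qed

text \<open>The definition takes a union over all typings and representatives. The typing is forced
  by \<open>prod_class_objects\<close> and the class is independent of the representatives, so the
  union runs over a single set.\<close>

lemma product_Comp:
  assumes obj: "Ob x" "Ob x'" "Ob x''" "Ob y" "Ob y'" "Ob y''"
    and ds: "ds \<in> Ls x' x'' y' y''" and cs: "cs \<in> Ls x x' y y'"
  shows "Comp (product_supercat K A A) (prod_class x' x'' y' y'' ds) (prod_class x x' y y' cs)
    = prod_class x x'' y y'' (comp_sums A A ds cs)"
proof -
  have carr: "carrier (tensor_space K (Hm u u') (Hm v v'))
    = prod_class u u' v v' ` Ls u u' v v'" for u u' v v'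
    by (simp add: tensor_space_def)
  let ?S = "{tensor_class K (Hm u u'') (Hm v v'') (comp_sums A A ds' cs') |
        u u' u'' v v' v'' cs' ds'.
          u \<in> Obj A \<and> Ob u' \<and> Ob u'' \<and> Ob v \<and> Ob v' \<and> Ob v'' \<and>
          prod_class x x' y y' cs \<in> carrier (tensor_space K (Hm u u') (Hm v v')) \<and>
          prod_class x' x'' y' y'' ds \<in> carrier (tensor_space K (Hm u' u'') (Hm v' v'')) \<and>
          cs' \<in> prod_class x x' y y' cs \<and> ds' \<in> prod_class x' x'' y' y'' ds}"
  have "?S = {prod_class x x'' y y'' (comp_sums A A ds cs)}"
  proof (intro equalityI subsetI)
    fix X assume "X \<in> ?S"
    then obtain u u' u'' v v' v'' cs' ds' where X: "X = prod_class u u'' v v'' (comp_sums A A ds' cs')"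
      "Ob u" "Ob u'" "Ob u''" "Ob v" "Ob v'" "Ob v''"
      "prod_class x x' y y' cs \<in> carrier (tensor_space K (Hm u u') (Hm v v'))"
      "prod_class x' x'' y' y'' ds \<in> carrier (tensor_space K (Hm u' u'') (Hm v' v''))"
      "cs' \<in> prod_class x x' y y' cs" "ds' \<in> prod_class x' x'' y' y'' ds" by blast
    have "u = x \<and> u' = x' \<and> v = y \<and> v' = y'"
      by (rule prod_class_objects[where C = "prod_class x x' y y' cs"]) (use X obj cs in \<open>auto simp: carr\<close>)
    moreover have "u' = x' \<and> u'' = x'' \<and> v' = y' \<and> v'' = y''"
      by (rule prod_class_objects[where C = "prod_class x' x'' y' y'' ds"]) (use X obj ds in \<open>auto simp: carr\<close>)
    moreover have e: "teq x x' y y' cs cs'"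
      "teq x' x'' y' y'' ds ds'" using X in_tensor_classD by blast+
    moreover have "ds' \<in> Ls x' x'' y' y''"
      using two_modules.tensor_eq_lists[OF two_modules_Hom e(2)] obj by blast
    ultimately show "X \<in> {prod_class x x'' y y'' (comp_sums A A ds cs)}"
      using comp_sums_cong_left[OF obj e(2) cs] comp_sums_cong_right[OF obj e(1)] X(1)
      by (auto intro!: tensor_class_eqI[OF tensor_eq.sym] intro: tensor_eq.trans)
  next
    fix X assume "X \<in> {prod_class x x'' y y'' (comp_sums A A ds cs)}"
    then have X: "X = prod_class x x'' y y'' (comp_sums A A ds cs)" by simp
    have m: "cs \<in> prod_class x x' y y' cs" "ds \<in> prod_class x' x'' y' y'' ds"
      using ds cs by (auto intro: tensor_class_self)
    show "X \<in> ?S" unfolding carr X using obj ds cs m by blast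
  qed
  then show ?thesis unfolding product_supercat_def by simp
qed

end

section \<open>The tensor product of morphisms\<close>

text \<open>The content of a tensor superfunctor in terms of morphisms. In the interchange law only
  \<open>g\<close> and \<open>h\<close> are taken homogeneous, because the sign depends on these two
  alone.\<close>

locale tensor_supercategory = supercategory K A + monoidal_coherence A
  for K :: "'k ring" and A :: "('k, 'o, 'm, ('m, unit) superspace_ext, 'z) moncat_scheme" (structure) +
  assumes bilinear_TensM: "[|x \<in> Obj A; x' \<in> Obj A; y \<in> Obj A; y' \<in> Obj A|]
      ==> bilinear_map K (Hom A x x') (Hom A y y') (Hom A (x *. y) (x' *. y')) (TensM A)"
    and TensM_Ident: "[|x \<in> Obj A; y \<in> Obj A|] ==> Ident A x ** Ident A y = Ident A (x *. y)"
    and TensM_hpart: "[|x \<in> Obj A; x' \<in> Obj A; y \<in> Obj A; y' \<in> Obj A;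
        f \<in> hpart (Hom A x x') p; g \<in> hpart (Hom A y y') q|]
      ==> f ** g \<in> hpart (Hom A (x *. y) (x' *. y')) (p + q)"
    and TensM_Comp:
      "[|x \<in> Obj A; x' \<in> Obj A; x'' \<in> Obj A; y \<in> Obj A; y' \<in> Obj A; y'' \<in> Obj A;
        f \<in> homset A x' x''; g \<in> hpart (Hom A y' y'') p; h \<in> hpart (Hom A x x') q; k \<in> homset A y y'|]
      ==> (f ** g) $ (h ** k) = signed (Hom A (x *. y) (x'' *. y'')) (p * q) ((f $ h) ** (g $ k))"
begin

lemma bilinear_Hom:
  "[|Ob x; Ob x'; Ob y; Ob y'|]
    ==> bilinear K (Hm x x') (Hm y y') (Hm (x *. y) (x' *. y')) (TensM A)"
  by (intro bilinear.intro two_modules_Hom module_Hom TensO_closed bilinear_axioms.intro bilinear_TensM)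

end

lemma (in supercategory) hpart_homset: "[|f \<in> hpart (Hm x y) p; Ob x; Ob y|] ==> f \<in> hs x y"
  using superspace.hpart_carrier[OF superspace_Hom] by blast

text \<open>On pure tensors the superfunctor \<open>T\<close> is the operation \<open>TensM\<close>,
  so each law is obtained by applying \<open>T\<close> to a relation between classes of formal
  sums.\<close>

lemma tensor_if_monoidal:
  fixes K :: "'k ring" and A :: "('k, 'o, 'm, ('m, unit) superspace_ext, 'z) moncat_scheme" (structure)
  assumes "monoidal_supercategory K A"
  shows "tensor_supercategory K A"
proof -
  interpret A: monoidal_supercategory K A by fact
  obtain T :: "('o \<times> 'o, ('m \<times> 'm) list set, 'o, 'm) fun_data" where
    T: "superfunctor K (product_supercat K A A) A T"
      "!!x y. x \<in> Obj A ==> A.Ob y ==> fob T (x, y) = x *. y"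
      "!!f g. f \<in> A.Arr ==> A.ar g ==> fmor T (pure_tensor K A A f g) = f ** g"
    using A.tensor_superfunctor by blast
  interpret T: superfunctor K "product_supercat K A A" A T by (rule T(1))
  let ?cl = A.prod_class
  let ?P = "product_supercat K A A"
  have pO: "Obj ?P = Obj A \<times> Obj A" by (simp add: product_supercat_def)
  have pH: "Hom ?P (x, y) (x', y') = tensor_space K (A.Hm x x') (A.Hm y y')" for x y x' y'
    by (simp add: product_supercat_def)
  have pC: "carrier (tensor_space K (A.Hm x x') (A.Hm y y')) = ?cl x x' y y' ` A.Ls x x' y y'"
    for x x' y y' by (simp add: tensor_space_def)
  have Tp: "fmor T (?cl x x' y y' [(f, g)]) = f ** g"
    if "A.Ob x" "A.Ob x'" "A.Ob y" "A.Ob y'" "f \<in> A.hs x x'" "g \<in> A.hs y y'"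
    for x x' y y' f g
    using T(3)[of f g] that A.homD[of f x x'] A.homD[of g y y'] by (simp add: pure_tensor_def hom_of_def)
  have Tlin: "linear_map K (tensor_space K (A.Hm x x') (A.Hm y y')) (A.Hm (x *. y) (x' *. y')) (fmor T)"
    if "A.Ob x" "A.Ob x'" "A.Ob y" "A.Ob y'" for x x' y y'
    using T.linear_fmor[of "(x, y)" "(x', y')"] that by (simp add: pO pH T(2))
  \<comment> \<open>Additivity of \<open>T\<close> determines it on a class from its values on the
    pure tensors of any representative.\<close>
  have Tcl: "fmor T (?cl x x' y y' xs) = tensor_sum (A.Hm (x *. y) (x' *. y')) (TensM A) xs"
    if o: "A.Ob x" "A.Ob x'" "A.Ob y" "A.Ob y'" and "xs \<in> A.Ls x x' y y'"
    for x x' y y' xs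
    using that(5)
  proof (induction xs)
    interpret D: two_modules K "A.Hm x x'" "A.Hm y y'" using A.two_modules_Hom o by simp
    interpret W: module K "A.Hm (x *. y) (x' *. y')"
      using A.module_Hom A.TensO_closed o by simp
    note l = Tlin[OF o]
    {
      case Nil
      have c: "?cl x x' y y' [] \<in> carrier (tensor_space K (A.Hm x x') (A.Hm y y'))" by (simp add: pC)
      have "fmor T (?cl x x' y y' []) \<in> A.hs (x *. y) (x' *. y')"
        using linear_map_closed[OF l c] .
      \<comment> \<open>The empty list represents its own double, and only the zero of a group has
        this property.\<close>
      moreover have "fmor T (?cl x x' y y' []) = fmor T (?cl x x' y y' []) \<oplus>\<^bsub>A.Hm (x *. y) (x' *. y')\<^esub> fmor T (?cl x x' y y' [])"
        using linear_map_add[OF l c c] D.tensor_space_add[of "[]" "[]"] by (simp add: tensor_space_def)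
      ultimately show ?case by (metis W.M.add.l_cancel_one' tensor_sum_simps(1))
    next
      case (Cons a xs)
      obtain f g where a: "a = (f, g)" "f \<in> A.hs x x'" "g \<in> A.hs y y'" using Cons by auto
      have c: "?cl x x' y y' [a] \<in> carrier (tensor_space K (A.Hm x x') (A.Hm y y'))"
         "?cl x x' y y' xs \<in> carrier (tensor_space K (A.Hm x x') (A.Hm y y'))" using Cons a by (auto simp: pC)
      have "fmor T (?cl x x' y y' (a # xs)) = fmor T (?cl x x' y y' [a]) \<oplus>\<^bsub>A.Hm (x *. y) (x' *. y')\<^esub> fmor T (?cl x x' y y' xs)"
        using linear_map_add[OF l c] D.tensor_space_add[of "[a]" xs] Cons a by (simp add: tensor_space_def)
      then show ?case using Cons a Tp[OF o a(2,3)] by simp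
    }
  qed
  have bil: "bilinear_map K (A.Hm x x') (A.Hm y y') (A.Hm (x *. y) (x' *. y')) (TensM A)"
    if o: "A.Ob x" "A.Ob x'" "A.Ob y" "A.Ob y'" for x x' y y'
  proof -
    interpret D: two_modules K "A.Hm x x'" "A.Hm y y'" using A.two_modules_Hom o by simp
    interpret W: module K "A.Hm (x *. y) (x' *. y')"
      using A.module_Hom A.TensO_closed o by simp
    have cl: "f ** g \<in> A.hs (x *. y) (x' *. y')" if "f \<in> A.hs x x'" "g \<in> A.hs y y'" for f g
      using linear_map_closed[OF Tlin[OF o], of "?cl x x' y y' [(f, g)]"] that Tp[OF o that] by (auto simp: pC)
    have al: "(f \<oplus>\<^bsub>A.Hm x x'\<^esub> f') ** g = f ** g \<oplus>\<^bsub>A.Hm (x *. y) (x' *. y')\<^esub> f' ** g"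
      if "f \<in> A.hs x x'" "f' \<in> A.hs x x'" "g \<in> A.hs y y'" for f f' g
      using tensor_class_eqI[OF tensor_eq.add_left[of f "A.Hm x x'" f' g "A.Hm y y'" K]] that
        Tp[OF o, of "f \<oplus>\<^bsub>A.Hm x x'\<^esub> f'" g] Tcl[OF o, of "[(f, g), (f', g)]"] cl by simp
    have ar: "f ** (g \<oplus>\<^bsub>A.Hm y y'\<^esub> g') = f ** g \<oplus>\<^bsub>A.Hm (x *. y) (x' *. y')\<^esub> f ** g'"
      if "f \<in> A.hs x x'" "g \<in> A.hs y y'" "g' \<in> A.hs y y'" for f g g'
      using tensor_class_eqI[OF tensor_eq.add_right[of f "A.Hm x x'" g "A.Hm y y'" g' K]] that
        Tp[OF o, of f "g \<oplus>\<^bsub>A.Hm y y'\<^esub> g'"] Tcl[OF o, of "[(f, g), (f, g')]"] cl by simp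
    have sl: "(k \<odot>\<^bsub>A.Hm x x'\<^esub> f) ** g = k \<odot>\<^bsub>A.Hm (x *. y) (x' *. y')\<^esub> (f ** g)"
      if "k \<in> carrier K" "f \<in> A.hs x x'" "g \<in> A.hs y y'" for k f g
    proof -
      have "?cl x x' y y' [(k \<odot>\<^bsub>A.Hm x x'\<^esub> f, g)] = k \<odot>\<^bsub>tensor_space K (A.Hm x x') (A.Hm y y')\<^esub> ?cl x x' y y' [(f, g)]"
        using D.tensor_space_smult[of "[(f, g)]" k] that by (simp add: tensor_space_def)
      then show ?thesis
        using linear_map_smult[OF Tlin[OF o] that(1), of "?cl x x' y y' [(f, g)]"] that
          Tp[OF o that(2,3)] Tp[OF o, of "k \<odot>\<^bsub>A.Hm x x'\<^esub> f" g] by (auto simp: pC)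
    qed
    have sr: "f ** (k \<odot>\<^bsub>A.Hm y y'\<^esub> g) = k \<odot>\<^bsub>A.Hm (x *. y) (x' *. y')\<^esub> (f ** g)"
      if "k \<in> carrier K" "f \<in> A.hs x x'" "g \<in> A.hs y y'" for k f g
      using tensor_class_eqI[OF tensor_eq.scalar[of k K f "A.Hm x x'" g "A.Hm y y'"]] that
        Tp[OF o, of "k \<odot>\<^bsub>A.Hm x x'\<^esub> f" g] Tp[OF o, of f "k \<odot>\<^bsub>A.Hm y y'\<^esub> g"] sl by simp
    show ?thesis
      unfolding bilinear_map_def linear_map_def using cl al ar sl sr by auto
  qed
  show ?thesis
  proof (standard; (rule bil; assumption)?)
    fix x x' y y' f g p q assume o: "A.Ob x" "A.Ob x'" "A.Ob y" "A.Ob y'"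
      and h: "f \<in> hpart (A.Hm x x') p" "g \<in> hpart (A.Hm y y') q"
    \<comment> \<open>The grading of a tensor space pairs parity \<open>r\<close> with the total
      parity plus \<open>r\<close>; taking \<open>r = p\<close> must leave \<open>q\<close> for the
      second factor.\<close>
    have "p + q + p = q" by (cases p; cases q; simp)
    then have "(f, g) \<in> (\<Union>r. hpart (A.Hm x x') r \<times> hpart (A.Hm y y') (p + q + r))"
      using h by (intro UN_I[of p]) auto
    then have "?cl x x' y y' [(f, g)] \<in> hpart (tensor_space K (A.Hm x x') (A.Hm y y')) (p + q)"
      unfolding tensor_space_def by (simp del: UN_iff)
    from T.parity_fmor[of "(x, y)" "(x', y')", unfolded pH, OF _ _ this]
    show "f ** g \<in> hpart (A.Hm (x *. y) (x' *. y')) (p + q)"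
      using o h Tp[OF o, of f g] A.hpart_homset by (simp add: pO T(2))
  next
    fix x y assume o: "A.Ob x" "A.Ob y"
    have "fmor T (Ident ?P (x, y)) = A.I (x *. y)"
      using T.fmor_idn[of "(x, y)"] o by (simp add: pO T(2))
    then show "A.I x ** A.I y = A.I (x *. y)"
      using Tp[of x x y y "A.I x" "A.I y"] o A.idn_closed by (simp add: product_supercat_def)
  next
    fix x x' x'' y y' y'' f g h k p q
    assume o: "A.Ob x" "A.Ob x'" "A.Ob x''" "A.Ob y" "A.Ob y'" "A.Ob y''"
      and a: "f \<in> A.hs x' x''" "g \<in> hpart (A.Hm y' y'') p" "h \<in> hpart (A.Hm x x') q" "k \<in> A.hs y y'"
    interpret D: two_modules K "A.Hm x x''" "A.Hm y y''" using A.two_modules_Hom o by simp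
    interpret X: superspace K "A.Hm x x'" using A.superspace_Hom o by simp
    interpret Y: superspace K "A.Hm y' y''" using A.superspace_Hom o by simp
    have gh: "g \<in> A.hs y' y''" "h \<in> A.hs x x'" using a o A.hpart_homset by auto
    have fc: "f $ h \<in> A.hs x x''" "g $ k \<in> A.hs y y''"
      using A.cmp_closed[of x x' x'' h f] A.cmp_closed[of y y' y'' k g] a gh o by auto
    have l1: "linear_map K (A.Hm x x') (A.Hm x x'') (%h. f $ h)"
      using bilinear_map_right[OF A.bilinear_Comp] a o by simp
    have l2: "linear_map K (A.Hm y' y'') (A.Hm y y'') (%g. g $ k)"
      using bilinear_map_left[OF A.bilinear_Comp] a o by simp
    have z: "f $ \<zero>\<^bsub>A.Hm x x'\<^esub> = \<zero>\<^bsub>A.Hm x x''\<^esub>" "\<zero>\<^bsub>A.Hm y' y''\<^esub> $ k = \<zero>\<^bsub>A.Hm y y''\<^esub>"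
      using linear_map_zero[OF _ _ l1] linear_map_zero[OF _ _ l2] o A.module_Hom by auto
    \<comment> \<open>Of the four summands in the composite of two pure tensors only the one with
      the actual parities \<open>p\<close> and \<open>q\<close> survives; in the others some
      homogeneous component is zero.\<close>
    define e where "e r s = A.prod_entry (f, g) (h, k) (r, s)" for r s
    have e: "e r s = (f $ hcomp (A.Hm x x') s h,
       signed (A.Hm y y'') (r * s) (hcomp (A.Hm y' y'') r g $ k))" for r s
      unfolding e_def by (rule A.prod_entry_eq) (use a o gh in auto)
    have epq: "e p q = (f $ h, signed (A.Hm y y'') (p * q) (g $ k))"
      unfolding e using a by simp
    have z1: "A.teq x x'' y y'' [e r s] []" if "r \<noteq> p \<or> s \<noteq> q" for r s
    proof (cases "s = q")
      case True
      then have "hcomp (A.Hm y' y'') r g = \<zero>\<^bsub>A.Hm y' y''\<^esub>" using Y.hcomp_other[OF a(2), of r] that by auto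
      then show ?thesis unfolding e using True a fc z
        by (simp add: D.tensor_eq_zero_right)
    next
      case False
      then have "hcomp (A.Hm x x') s h = \<zero>\<^bsub>A.Hm x x'\<^esub>" using X.hcomp_other[OF a(3), of s] by auto
      moreover have "signed (A.Hm y y'') (r * s) (hcomp (A.Hm y' y'') r g $ k) \<in> A.hs y y''"
        using linear_map_closed[OF l2] gh by auto
      ultimately show ?thesis unfolding e using z by (simp add: tensor_eq.zero)
    qed
    have cs: "comp_sums A A [(f, g)] [(h, k)] = [e 0 0] @ [e 0 1] @ [e 1 0] @ [e 1 1]"
      unfolding A.comp_sums_entries e_def by simp
    have r: "A.teq x x'' y y'' [e p q] [e p q]"
      unfolding epq by (rule tensor_eq.refl) (use fc in auto)
    have c4: "A.teq x x'' y y'' ([e 0 0] @ [e 0 1] @ [e 1 0] @ [e 1 1])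
       ((if (0,0) = (p,q) then [e 0 0] else []) @ (if (0,1) = (p,q) then [e 0 1] else [])
         @ (if (1,0) = (p,q) then [e 1 0] else []) @ (if (1,1) = (p,q) then [e 1 1] else []))"
      by (intro tensor_eq.append) (use z1 r in auto)
    have c4': "((if (0,0) = (p,q) then [e 0 0] else []) @ (if (0,1) = (p,q) then [e 0 1] else [])
         @ (if (1,0) = (p,q) then [e 1 0] else []) @ (if (1,1) = (p,q) then [e 1 1] else [])) = [e p q]"
      by (cases p; cases q) auto
    have C: "A.teq x x'' y y'' (comp_sums A A [(f, g)] [(h, k)]) [e p q]"
      unfolding cs using c4 unfolding c4' .
    have "(f ** g) $ (h ** k) = fmor T (?cl x' x'' y' y'' [(f, g)]) $ fmor T (?cl x x' y y' [(h, k)])"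
      using Tp[of x' x'' y' y'' f g] Tp[of x x' y y' h k] o a gh by simp
    also have "... = fmor T (Comp ?P (?cl x' x'' y' y'' [(f, g)]) (?cl x x' y y' [(h, k)]))"
      using T.fmor_cmp[of "(x, y)" "(x', y')" "(x'', y'')" "?cl x x' y y' [(h, k)]" "?cl x' x'' y' y'' [(f, g)]"]
        o a gh by (simp add: pO pH pC)
    also have "Comp ?P (?cl x' x'' y' y'' [(f, g)]) (?cl x x' y y' [(h, k)])
      = ?cl x x'' y y'' (comp_sums A A [(f, g)] [(h, k)])"
      by (rule A.product_Comp) (use o a gh in auto)
    also have "... = ?cl x x'' y y'' [e p q]" by (rule tensor_class_eqI[OF C])
    also have "fmor T ... = (f $ h) ** signed (A.Hm y y'') (p * q) (g $ k)"
      unfolding epq by (rule Tp) (use o fc in auto)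
    also have "... = signed (A.Hm (x *. y) (x'' *. y'')) (p * q) ((f $ h) ** (g $ k))"
      by (rule linear_map_signed[OF _ _ bilinear_map_right[OF bil] fc(2)])
         (use o fc A.module_Hom A.TensO_closed in auto)
    finally show "(f ** g) $ (h ** k)
      = signed (A.Hm (x *. y) (x'' *. y'')) (p * q) ((f $ h) ** (g $ k))" .
  qed
qed

text \<open>Conversely, the superfunctor is the linear map induced by the bilinear
  \<open>TensM\<close>. It respects composition because, after splitting into homogeneous parts,
  every summand is an instance of the interchange law.\<close>

lemma (in tensor_supercategory) monoidal_if_tensor:
  assumes even: "!!x y z. [|Ob x; Ob y; Ob z|]
      ==> Assoc A x y z \<in> hpart (Hm ((x *. y) *. z) (x *. (y *. z))) 0"
    "!!x. x \<in> Obj A ==> Lun A x \<in> hpart (Hm (Unit A *. x) x) 0"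
    "!!x. x \<in> Obj A ==> Run A x \<in> hpart (Hm (x *. Unit A) x) 0"
  shows "monoidal_supercategory K A"
proof (intro monoidal_supercategory.intro monoidal_supercategory_axioms.intro even)
  let ?S = "%x x' y y'. tensor_sum (Hm (x *. y) (x' *. y')) (TensM A)"
  let ?L = "%x x' y y'. Ls x x' y y'"
  \<comment> \<open>The value at a class is specified through an arbitrary typing and
    representative; \<open>prod_class_objects\<close> and \<open>tensor_sum_cong\<close> show that
    all of them give the same morphism.\<close>
  define R where "R C m \<longleftrightarrow> (\<exists>x x' y y' cs. x \<in> Obj A \<and> Ob x' \<and> Ob y \<and> Ob y' \<and>
     cs \<in> ?L x x' y y' \<and> C = prod_class x x' y y' cs \<and> m = ?S x x' y y' cs)" for C m
  define T where "T = \<lparr>fob = (%(x, y). x *. y), fmor = (%C. THE m. R C m)\<rparr>"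
  let ?P = "product_supercat K A A"
  have pO: "Obj ?P = Obj A \<times> Obj A" by (simp add: product_supercat_def)
  have pH: "Hom ?P (x, y) (x', y') = tensor_space K (Hm x x') (Hm y y')" for x y x' y'
    by (simp add: product_supercat_def)
  have pC: "carrier (tensor_space K (Hm x x') (Hm y y')) = prod_class x x' y y' ` ?L x x' y y'"
    for x x' y y' by (simp add: tensor_space_def)
  have Tob [simp]: "fob T (x, y) = x *. y" for x y by (simp add: T_def)
  have T: "fmor T (prod_class x x' y y' cs) = ?S x x' y y' cs"
    if o: "Ob x" "Ob x'" "Ob y" "Ob y'" and cs: "cs \<in> ?L x x' y y'" for x x' y y' cs
  proof -
    have "(THE m. R (prod_class x x' y y' cs) m) = ?S x x' y y' cs"
    proof (rule the_equality)
      show "R (prod_class x x' y y' cs) (?S x x' y y' cs)" unfolding R_def using o cs by blast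
    next
      fix m assume "R (prod_class x x' y y' cs) m"
      then obtain u u' v v' cs' where u: "Ob u" "Ob u'" "Ob v" "Ob v'"
        "cs' \<in> ?L u u' v v'" "prod_class x x' y y' cs = prod_class u u' v v' cs'" "m = ?S u u' v v' cs'"
        unfolding R_def by blast
      have "u = x \<and> u' = x' \<and> v = y \<and> v' = y'"
        by (rule prod_class_objects[where C = "prod_class x x' y y' cs"]) (use o u cs in auto)
      then have m: "m = ?S x x' y y' cs'" and e: "prod_class x x' y y' cs = prod_class x x' y y' cs'"
        and l: "cs' \<in> ?L x x' y y'" using u by auto
      have "teq x x' y y' cs cs'"
        by (rule in_tensor_classD) (use tensor_class_self[OF l, of K] e in simp)
      from bilinear.tensor_sum_cong[OF bilinear_Hom this] show "m = ?S x x' y y' cs" using m o by simp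
    qed
    then show ?thesis by (simp add: T_def)
  qed
  have tsum1: "?S x x' y y' [(f, g)] = f ** g"
    if o: "Ob x" "Ob x'" "Ob y" "Ob y'" and "f \<in> hs x x'" "g \<in> hs y y'"
    for x x' y y' f g
  proof -
    interpret b: bilinear K "Hm x x'" "Hm y y'" "Hm (x *. y) (x' *. y')" "TensM A"
      using bilinear_Hom o by simp
    show ?thesis using that by simp
  qed
  have "superfunctor K ?P A T"
  proof (unfold_locales; (unfold cat_of_simps pO)?)
    fix x assume "x \<in> Obj A \<times> Obj A"
    then show "fob T x \<in> Obj A" using TensO_closed by auto
  next
    fix X Y C assume a: "X \<in> Obj A \<times> Obj A" "Y \<in> Obj A \<times> Obj A" "C \<in> homset ?P X Y"
    then obtain x y x' y' where o: "X = (x, y)" "Y = (x', y')" "Ob x" "Ob x'" "Ob y" "Ob y'" by blast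
    interpret b: bilinear K "Hm x x'" "Hm y y'" "Hm (x *. y) (x' *. y')" "TensM A"
      using bilinear_Hom o by simp
    obtain cs where cs: "C = prod_class x x' y y' cs" "cs \<in> ?L x x' y y'" using a by (auto simp: o pH pC)
    show "fmor T C \<in> hs (fob T X) (fob T Y)"
      using T[OF o(3-6) cs(2)] b.tensor_sum_closed[OF cs(2)] by (simp add: o cs(1))
  next
    fix X Y Z C D assume a: "X \<in> Obj A \<times> Obj A" "Y \<in> Obj A \<times> Obj A" "Z \<in> Obj A \<times> Obj A"
      "C \<in> homset ?P X Y" "D \<in> homset ?P Y Z"
    then obtain x y x' y' x'' y'' where o: "X = (x, y)" "Y = (x', y')" "Z = (x'', y'')"
      "Ob x" "Ob x'" "Ob x''" "Ob y" "Ob y'" "Ob y''" by blast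
    obtain cs ds where c: "C = prod_class x x' y y' cs" "D = prod_class x' x'' y' y'' ds"
      and cs: "cs \<in> ?L x x' y y'" and ds: "ds \<in> ?L x' x'' y' y''"
      using a by (auto simp: o pH pC)
    interpret b1: bilinear K "Hm x x'" "Hm y y'" "Hm (x *. y) (x' *. y')" "TensM A"
      using bilinear_Hom o by simp
    interpret b2: bilinear K "Hm x' x''" "Hm y' y''" "Hm (x' *. y') (x'' *. y'')" "TensM A"
      using bilinear_Hom o by simp
    interpret b: bilinear K "Hm x x''" "Hm y y''" "Hm (x *. y) (x'' *. y'')" "TensM A"
      using bilinear_Hom o by simp
    interpret X: superspace K "Hm x x'" using superspace_Hom o by simp
    interpret Y: superspace K "Hm y' y''" using superspace_Hom o by simp
    have bc: "bilinear_map K (Hm (x' *. y') (x'' *. y'')) (Hm (x *. y) (x' *. y')) (Hm (x *. y) (x'' *. y'')) (Comp A)"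
      using bilinear_Comp o TensO_closed by simp
    note lc = bilinear_map_left[OF bc] and rc = bilinear_map_right[OF bc]
    let ?W = "Hm (x *. y) (x'' *. y'')"
    \<comment> \<open>Both \<open>g\<close> and \<open>h\<close> are expanded into even and odd
      parts. The four composites so obtained are the four entries, whose signs are those of the
      interchange law.\<close>
    have entry: "?S x x'' y y'' (map (prod_entry d c) parity_pairs)
       = (case d of (f, g) \<Rightarrow> case c of (h, k) \<Rightarrow> (f ** g) $ (h ** k))"
      if d: "d \<in> hs x' x'' \<times> hs y' y''" and c: "c \<in> hs x x' \<times> hs y y'" for c d
    proof -
      obtain f g h k where e: "d = (f, g)" "c = (h, k)" "f \<in> hs x' x''" "g \<in> hs y' y''"
         "h \<in> hs x x'" "k \<in> hs y y'" using d c by auto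
      have gk: "hcomp (Hm y' y'') p g $ k \<in> hs y y''" for p
        using cmp_closed[of y y' y'' k "hcomp (Hm y' y'') p g"] o e by simp
      have fh: "f $ hcomp (Hm x x') q h \<in> hs x x''" for q
        using cmp_closed[of x x' x'' "hcomp (Hm x x') q h" f] o e by simp
      have t: "(f $ hcomp (Hm x x') q h) ** signed (Hm y y'') (p * q) (hcomp (Hm y' y'') p g $ k)
        = (f ** hcomp (Hm y' y'') p g) $ (hcomp (Hm x x') q h ** k)" for p q
      proof -
        have "(f ** hcomp (Hm y' y'') p g) $ (hcomp (Hm x x') q h ** k)
          = signed ?W (p * q) ((f $ hcomp (Hm x x') q h) ** (hcomp (Hm y' y'') p g $ k))"
          by (rule TensM_Comp) (use o e in auto)
        also have "... = (f $ hcomp (Hm x x') q h) ** signed (Hm y y'') (p * q) (hcomp (Hm y' y'') p g $ k)"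
          by (rule linear_map_signed[symmetric, OF b.V.module_axioms b.W.module_axioms
                bilinear_map_right[OF b.bilinear fh] gk])
        finally show ?thesis ..
      qed
      define H where "H q = hcomp (Hm x x') q h" for q
      define G where "G p = hcomp (Hm y' y'') p g" for p
      have HG: "H q \<in> hs x x'" "G q \<in> hs y' y''" for q using e by (auto simp: H_def G_def)
      have hg: "h = H 0 \<oplus>\<^bsub>Hm x x'\<^esub> H 1" "g = G 0 \<oplus>\<^bsub>Hm y' y''\<^esub> G 1"
        using X.hcomp_sum[OF e(5)] Y.hcomp_sum[OF e(4)] by (simp_all add: H_def G_def)
      have fG: "f ** g = f ** G 0 \<oplus>\<^bsub>Hm (x' *. y') (x'' *. y'')\<^esub> f ** G 1"
        using linear_map_add[OF bilinear_map_right[OF b2.bilinear e(3)] HG(2) HG(2), of 0 1] hg(2) by simp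
      have Hk: "h ** k = H 0 ** k \<oplus>\<^bsub>Hm (x *. y) (x' *. y')\<^esub> H 1 ** k"
        using linear_map_add[OF bilinear_map_left[OF b1.bilinear e(6)] HG(1) HG(1), of 0 1] hg(1) by simp
      have cc: "(f ** G p) $ (H q ** k) \<in> carrier ?W" for p q
        by (rule linear_map_closed[OF rc]) (use HG e in auto)
      have E1: "(f ** g) $ (h ** k) = ((f ** G 0) $ (h ** k)) \<oplus>\<^bsub>?W\<^esub> ((f ** G 1) $ (h ** k))"
        unfolding fG by (rule linear_map_add[OF lc]) (use HG e in auto)
      have E2: "(f ** G p) $ (h ** k) = ((f ** G p) $ (H 0 ** k)) \<oplus>\<^bsub>?W\<^esub> ((f ** G p) $ (H 1 ** k))" for p
        unfolding Hk by (rule linear_map_add[OF rc]) (use HG e in auto)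
      have E: "(f ** g) $ (h ** k) = ((f ** G 0) $ (H 0 ** k)) \<oplus>\<^bsub>?W\<^esub> (((f ** G 0) $ (H 1 ** k))
        \<oplus>\<^bsub>?W\<^esub> (((f ** G 1) $ (H 0 ** k)) \<oplus>\<^bsub>?W\<^esub> (((f ** G 1) $ (H 1 ** k)) \<oplus>\<^bsub>?W\<^esub> \<zero>\<^bsub>?W\<^esub>)))"
        unfolding E1 E2 using cc by (simp add: b.W.M.a_assoc)
      have "?S x x'' y y'' (map (prod_entry d c) parity_pairs) = ?S x x'' y y''
          (map (%(p, q). (f $ hcomp (Hm x x') q h, signed (Hm y y'') (p * q) (hcomp (Hm y' y'') p g $ k))) parity_pairs)"
        unfolding e(1,2) using prod_entry_eq[OF o(4-9) e(3-6)] by (auto intro!: arg_cong[of _ _ "?S x x'' y y''"])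
      also have "... = (f ** g) $ (h ** k)"
        unfolding E using t[of 0 0] t[of 0 1] t[of 1 0] t[of 1 1] by (simp add: H_def G_def)
      finally show ?thesis by (simp add: e)
    qed
    have el: "map (prod_entry d c) parity_pairs \<in> ?L x x'' y y''"
      if "d \<in> hs x' x'' \<times> hs y' y''" "c \<in> hs x x' \<times> hs y y'" for c d
      using comp_sums_lists[OF o(4-9), of "[d]" "[c]"] that by (simp add: comp_sums_entries)
    have row: "?S x x'' y y'' (comp_sums A A [(f, g)] cs) = (f ** g) $ ?S x x' y y' cs"
      if d: "f \<in> hs x' x''" "g \<in> hs y' y''" for f g
      using cs
    proof (induction cs)
      case Nil
      have "(f ** g) $ \<zero>\<^bsub>Hm (x *. y) (x' *. y')\<^esub> = \<zero>\<^bsub>?W\<^esub>"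
        by (rule linear_map_zero[OF b1.W.module_axioms b.W.module_axioms rc]) (use d in simp)
      then show ?case by (simp add: comp_sums_entries)
    next
      case (Cons c cs)
      obtain h k where c: "c = (h, k)" "h \<in> hs x x'" "k \<in> hs y y'" using Cons by auto
      have l: "cs \<in> ?L x x' y y'" using Cons by simp
      have "?S x x'' y y'' (comp_sums A A [(f, g)] (c # cs))
        = ?S x x'' y y'' (map (prod_entry (f, g) c) parity_pairs @ comp_sums A A [(f, g)] cs)"
        by (simp add: comp_sums_entries)
      also have "... = ?S x x'' y y'' (map (prod_entry (f, g) c) parity_pairs) \<oplus>\<^bsub>?W\<^esub> ?S x x'' y y'' (comp_sums A A [(f, g)] cs)"
        by (rule b.tensor_sum_append[OF el comp_sums_lists[OF o(4-9)]]) (use d c l in auto)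
      also have "... = ((f ** g) $ (h ** k)) \<oplus>\<^bsub>?W\<^esub> ((f ** g) $ ?S x x' y y' cs)"
        using entry[of "(f, g)" c] c d Cons.IH by simp
      also have "... = (f ** g) $ ?S x x' y y' (c # cs)"
        using linear_map_add[OF rc, of "f ** g" "h ** k" "?S x x' y y' cs"] c d l by simp
      finally show ?case .
    qed
    have all: "?S x x'' y y'' (comp_sums A A ds cs) = ?S x' x'' y' y'' ds $ ?S x x' y y' cs"
      using ds
    proof (induction ds)
      case Nil
      have "\<zero>\<^bsub>Hm (x' *. y') (x'' *. y'')\<^esub> $ ?S x x' y y' cs = \<zero>\<^bsub>?W\<^esub>"
        by (rule linear_map_zero[OF b2.W.module_axioms b.W.module_axioms lc]) (use cs in simp)
      then show ?case by (simp add: comp_sums_entries)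
    next
      case (Cons d ds)
      obtain f g where d: "d = (f, g)" "f \<in> hs x' x''" "g \<in> hs y' y''" using Cons by auto
      have l: "ds \<in> ?L x' x'' y' y''" using Cons by simp
      have "?S x x'' y y'' (comp_sums A A (d # ds) cs)
        = ?S x x'' y y'' (comp_sums A A [d] cs @ comp_sums A A ds cs)"
        by (simp add: comp_sums_entries)
      also have "... = ?S x x'' y y'' (comp_sums A A [d] cs) \<oplus>\<^bsub>?W\<^esub> ?S x x'' y y'' (comp_sums A A ds cs)"
        by (rule b.tensor_sum_append[OF comp_sums_lists[OF o(4-9)] comp_sums_lists[OF o(4-9)]]) (use d cs l in auto)
      also have "... = ?S x' x'' y' y'' (d # ds) $ ?S x x' y y' cs"
        using linear_map_add[OF lc, of "?S x x' y y' cs" "f ** g" "?S x' x'' y' y'' ds"] d l cs row[of f g] Cons.IH by simp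
      finally show ?case .
    qed
    have "Comp ?P D C = prod_class x x'' y y'' (comp_sums A A ds cs)"
      unfolding c by (rule product_Comp) (use o cs ds in auto)
    then have "fmor T (Comp ?P D C) = ?S x x'' y y'' (comp_sums A A ds cs)"
      using T comp_sums_lists[OF o(4-9) ds cs] o by simp
    then show "fmor T (Comp ?P D C) = fmor T D $ fmor T C"
      using all T o cs ds c by simp
  next
    fix X assume "X \<in> Obj A \<times> Obj A"
    then obtain x y where o: "X = (x, y)" "Ob x" "Ob y" by blast
    have i: "I x \<in> hs x x" "I y \<in> hs y y" using idn_closed o by auto
    then show "fmor T (Ident ?P X) = I (fob T X)"
      using T[of x x y y "[(I x, I y)]"] tsum1[of x x y y] TensM_Ident o
      by (simp add: product_supercat_def del: tensor_sum_simps)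
  next
    fix X Y assume a: "X \<in> Obj A \<times> Obj A" "Y \<in> Obj A \<times> Obj A"
    then obtain x y x' y' where o: "X = (x, y)" "Y = (x', y')" "Ob x" "Ob x'" "Ob y" "Ob y'" by blast
    interpret b: bilinear K "Hm x x'" "Hm y y'" "Hm (x *. y) (x' *. y')" "TensM A"
      using bilinear_Hom o by simp
    have sm: "?S x x' y y' (map (%(u, v). (k \<odot>\<^bsub>Hm x x'\<^esub> u, v)) cs) = k \<odot>\<^bsub>Hm (x *. y) (x' *. y')\<^esub> ?S x x' y y' cs"
      if "k \<in> carrier K" "cs \<in> ?L x x' y y'" for k cs
      using that(2)
    proof (induction cs)
      case (Cons c cs)
      obtain f g where c: "c = (f, g)" "f \<in> hs x x'" "g \<in> hs y y'" using Cons by auto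
      then show ?case using Cons that linear_map_smult[OF bilinear_map_left[OF b.bilinear]]
        by (simp add: b.W.smult_r_distr)
    qed (use that in simp)
    have "linear_map K (tensor_space K (Hm x x') (Hm y y')) (Hm (x *. y) (x' *. y')) (fmor T)"
      unfolding linear_map_def pC
    proof (intro conjI ballI)
      show "fmor T \<in> prod_class x x' y y' ` ?L x x' y y' \<rightarrow> hs (x *. y) (x' *. y')"
      proof (rule funcsetI, erule imageE)
        fix C cs assume "C = prod_class x x' y y' cs" "cs \<in> ?L x x' y y'"
        then show "fmor T C \<in> hs (x *. y) (x' *. y')"
          using T[OF o(3-6)] b.tensor_sum_closed by metis
      qed
    next
      fix C D assume "C \<in> prod_class x x' y y' ` ?L x x' y y'" "D \<in> prod_class x x' y y' ` ?L x x' y y'"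
      then obtain cs ds where c: "C = prod_class x x' y y' cs" "D = prod_class x x' y y' ds"
        "cs \<in> ?L x x' y y'" "ds \<in> ?L x x' y y'" by blast
      then have "C \<oplus>\<^bsub>tensor_space K (Hm x x') (Hm y y')\<^esub> D = prod_class x x' y y' (cs @ ds)"
        using b.tensor_space_add[of cs ds] by (simp add: tensor_space_def)
      then show "fmor T (C \<oplus>\<^bsub>tensor_space K (Hm x x') (Hm y y')\<^esub> D) = fmor T C \<oplus>\<^bsub>Hm (x *. y) (x' *. y')\<^esub> fmor T D"
        using c o T[of x x' y y' "cs @ ds"] T b.tensor_sum_append[of cs ds] by simp
    next
      fix k C assume k: "k \<in> carrier K" and "C \<in> prod_class x x' y y' ` ?L x x' y y'"
      then obtain cs where c: "C = prod_class x x' y y' cs" "cs \<in> ?L x x' y y'" by blast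
      have l: "map (%(u, v). (k \<odot>\<^bsub>Hm x x'\<^esub> u, v)) cs \<in> ?L x x' y y'" using c(2) k
        by (auto simp: in_lists_conv_set)
      have "k \<odot>\<^bsub>tensor_space K (Hm x x') (Hm y y')\<^esub> C = prod_class x x' y y' (map (%(u, v). (k \<odot>\<^bsub>Hm x x'\<^esub> u, v)) cs)"
        using b.tensor_space_smult[of cs k] c k by (simp add: tensor_space_def)
      then show "fmor T (k \<odot>\<^bsub>tensor_space K (Hm x x') (Hm y y')\<^esub> C) = k \<odot>\<^bsub>Hm (x *. y) (x' *. y')\<^esub> fmor T C"
        using T[OF o(3-6) l] T[OF o(3-6) c(2)] sm[OF k c(2)] c by simp
    qed
    then show "linear_map K (Hom ?P X Y) (Hm (fob T X) (fob T Y)) (fmor T)" by (simp add: o pH)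
  next
    fix X Y C p assume a: "X \<in> Obj A \<times> Obj A" "Y \<in> Obj A \<times> Obj A" "C \<in> hpart (Hom ?P X Y) p"
    then obtain x y x' y' where o: "X = (x, y)" "Y = (x', y')" "Ob x" "Ob x'" "Ob y" "Ob y'" by blast
    interpret W: superspace K "Hm (x *. y) (x' *. y')" using superspace_Hom o TensO_closed by simp
    obtain cs where C: "C = prod_class x x' y y' cs"
      and cs: "cs \<in> lists (\<Union>q. hpart (Hm x x') q \<times> hpart (Hm y y') (p + q))"
      using a(3) by (auto simp: o pH tensor_space_def)
    have sub: "(\<Union>q. hpart (Hm x x') q \<times> hpart (Hm y y') (p + q)) \<subseteq> hs x x' \<times> hs y y'"
      using hpart_homset o by blast
    have "?S x x' y y' cs \<in> hpart (Hm (x *. y) (x' *. y')) p" using cs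
    proof (induction cs)
      case (Cons c cs)
      then obtain f g q where c: "c = (f, g)" "f \<in> hpart (Hm x x') q" "g \<in> hpart (Hm y y') (p + q)" by auto
      have "q + (p + q) = p" by (cases p; cases q; simp)
      then have "f ** g \<in> hpart (Hm (x *. y) (x' *. y')) p" using TensM_hpart[OF o(3-6) c(2,3)] by simp
      then show ?case using Cons c by auto
    qed auto
    moreover have "cs \<in> ?L x x' y y'" using lists_mono[OF sub] cs by blast
    ultimately show "fmor T C \<in> hpart (Hm (fob T X) (fob T Y)) p" using T o C by simp
  qed
  moreover have "fmor T (pure_tensor K A A f g) = f ** g" if "ar f" "ar g" for f g
    using T[of "src f" "tgt f" "src g" "tgt g" "[(f, g)]"]
      tsum1[of "src f" "tgt f" "src g" "tgt g" f g] arrows_hom[OF that(1)] arrows_hom[OF that(2)]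
    by (simp add: pure_tensor_def hom_of_def)
  ultimately show "\<exists>T. superfunctor K ?P A (T :: ('o \<times> 'o, ('m \<times> 'm) list set, 'o, 'm) fun_data) \<and>
     (\<forall>x \<in> Obj A. \<forall>y \<in> Obj A. fob T (x, y) = x *. y) \<and>
     (\<forall>f \<in> arrows A. \<forall>g \<in> arrows A. fmor T (pure_tensor K A A f g) = f ** g)"
    by (intro exI[of _ T]) auto
qed (rule supercategory_axioms monoidal_coherence_axioms)+

section \<open>Coherence in linear monoidal categories\<close>

context monoidal_coherence
begin

lemma TensO_Obj [simp]: "[|x \<in> Obj A; y \<in> Obj A|] ==> x *. y \<in> Obj A"
  and Unit_Obj [simp]: "Unit A \<in> Obj A"
  using TensO_closed Unit_closed by auto

end

locale linear_coherence = linear_category K A + monoidal_coherence A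
  for K :: "'k ring" and A :: "('k, 'o, 'm, 'h, 'z) moncat_scheme" (structure)
begin

lemma Assoc_arrow [simp]:
  assumes "Ob x" "Ob y" "Ob z"
  shows "invertible A (Assoc A x y z)" "src (Assoc A x y z) = (x *. y) *. z"
    "tgt (Assoc A x y z) = x *. (y *. z)"
  using isomD[OF Assoc_iso[OF assms]] assms by simp_all

lemma Lun_arrow [simp]:
  assumes "Ob x"
  shows "invertible A (Lun A x)" "src (Lun A x) = Unit A *. x" "tgt (Lun A x) = x"
  using isomD[OF Lun_iso[OF assms]] assms by simp_all

lemma Run_arrow [simp]:
  assumes "Ob x"
  shows "invertible A (Run A x)" "src (Run A x) = x *. Unit A" "tgt (Run A x) = x"
  using isomD[OF Run_iso[OF assms]] assms by simp_all

lemma Assoc_nat: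
  "[|ar f; ar g; ar h; src f = x; src g = y; src h = z;
    tgt f = x'; tgt g = y'; tgt h = z'|]
    ==> Assoc A x' y' z' $ ((f ** g) ** h) = (f ** (g ** h)) $ Assoc A x y z"
  using Assoc_natural[of x y z x' y' z' f g h] arrows_hom[of f] arrows_hom[of g] arrows_hom[of h] by simp

lemma Lun_nat:
  "[|ar f; src f = x; tgt f = y|] ==> Lun A y $ (I (Unit A) ** f) = f $ Lun A x"
  using Lun_natural[of x y f] arrows_hom[of f] by simp

lemma Run_nat:
  "[|ar f; src f = x; tgt f = y|] ==> Run A y $ (f ** I (Unit A)) = f $ Run A x"
  using Run_natural[of x y f] arrows_hom[of f] by simp

end

sublocale linear_monoidal_category \<subseteq> linear_coherence ..

sublocale tensor_supercategory \<subseteq> linear_coherence ..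

context linear_monoidal_category
begin

lemma TensM_arrow [simp]:
  assumes "ar f" "ar g"
  shows "f ** g \<in> Arr" "src (f ** g) = src f *. src g"
    "tgt (f ** g) = tgt f *. tgt g"
proof -
  have "f ** g \<in> hs (src f *. src g) (tgt f *. tgt g)"
    using linear_map_closed[OF bilinear_map_right[OF bilinear_TensM]]
      arrows_hom[OF assms(1)] arrows_hom[OF assms(2)] by simp
  from homD[OF this] show "f ** g \<in> Arr" "src (f ** g) = src f *. src g"
    "tgt (f ** g) = tgt f *. tgt g" using assms by simp_all
qed

declare TensM_Ident [simp]

lemma TensM_comp [simp]:
  assumes "ar f" "ar g" "ar h" "ar k"
    "tgt h = src f" "tgt k = src g"
  shows "(f ** g) $ (h ** k) = (f $ h) ** (g $ k)"
  using TensM_Comp[of "src h" "src f" "tgt f" "src k" "src g" "tgt g" f g h k]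
    arrows_hom[OF assms(1)] arrows_hom[OF assms(2)] arrows_hom[OF assms(3)] arrows_hom[OF assms(4)] assms
  by simp

lemma TensM_comp_assoc [simp]:
  assumes "ar f" "ar g" "ar h" "ar k" "ar m"
    "tgt h = src f" "tgt k = src g" "tgt m = src h *. src k"
  shows "(f ** g) $ (h ** k) $ m = ((f $ h) ** (g $ k)) $ m"
  using assms by (simp flip: comp_assoc)

lemma TensM_invertible [simp]:
  assumes "invertible A f" "invertible A g"
  shows "invertible A (f ** g)" "ivs (f ** g) = ivs f ** ivs g"
  by (rule inverse_of_eqI(2)[of _ "ivs f ** ivs g"]; use assms in simp)
     (rule inverse_of_eqI(1); use assms in simp)

lemma TensM_sgn [simp]:
  assumes "ar f" "ar g"
  shows "sgn_arr A e f ** g = sgn_arr A e (f ** g)" "f ** sgn_arr A e g = sgn_arr A e (f ** g)"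
proof -
  note h = arrows_hom[OF assms(1)] arrows_hom[OF assms(2)]
  have b: "bilinear_map K (hom_of A f) (hom_of A g) (hom_of A (f ** g)) (TensM A)"
    using bilinear_TensM assms unfolding hom_of_def by simp
  show "sgn_arr A e f ** g = sgn_arr A e (f ** g)" "f ** sgn_arr A e g = sgn_arr A e (f ** g)"
    unfolding sgn_arr_def using assms
    by (auto intro!: linear_map_signed[OF _ _ bilinear_map_left[OF b]] linear_map_signed[OF _ _ bilinear_map_right[OF b]]
      module_hom_of arrow_hom_of)
qed

text \<open>The left unitor is a natural isomorphism from tensoring with the unit to the identity
  functor, so tensoring with the unit loses nothing.\<close>

lemma Unit_TensM_faithful:
  assumes "ar f" "ar g" "src f = src g" "tgt f = tgt g"
    and "I (Unit A) ** f = I (Unit A) ** g"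
  shows "f = g"
proof (rule comp_cancel_right[of "Lun A (src f)"])
  show "f $ Lun A (src f) = g $ Lun A (src f)"
    using Lun_nat[of f "src f" "tgt f"] Lun_nat[of g "src f" "tgt f"] assms by simp
qed (use assms in simp_all)

lemma TensM_Unit_faithful:
  assumes "ar f" "ar g" "src f = src g" "tgt f = tgt g"
    and "f ** I (Unit A) = g ** I (Unit A)"
  shows "f = g"
proof (rule comp_cancel_right[of "Run A (src f)"])
  show "f $ Run A (src f) = g $ Run A (src f)"
    using Run_nat[of f "src f" "tgt f"] Run_nat[of g "src f" "tgt f"] assms by simp
qed (use assms in simp_all)

text \<open>The next three lemmas are due to Kelly.\<close>

lemma Lun_TensO:
  assumes [simp]: "Ob x" "Ob y"
  shows "Lun A (x *. y) $ Assoc A (Unit A) x y = Lun A x ** I y"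
proof (rule Unit_TensM_faithful)
  let ?I = "Unit A" let ?i = "I (Unit A)"
  \<comment> \<open>Composing with this invertible map brings in the pentagon for two units,
    \<open>x\<close> and \<open>y\<close>; two triangles and naturality of the associator then join
    both sides.\<close>
  let ?t = "Assoc A ?I (?I *. x) y $ (Assoc A ?I ?I x ** I y)"
  have "(?i ** (Lun A (x *. y) $ Assoc A ?I x y)) $ ?t
      = (?i ** Lun A (x *. y)) $ ((?i ** Assoc A ?I x y) $ ?t)" by simp
  also have "... = (?i ** Lun A (x *. y)) $ (Assoc A ?I ?I (x *. y) $ Assoc A (?I *. ?I) x y)"
    using pentagon[of ?I ?I x y] by simp
  also have "... = (Run A ?I ** I (x *. y)) $ Assoc A (?I *. ?I) x y"
    using triangle[of ?I "x *. y"] by (simp flip: comp_assoc)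
  also have "... = Assoc A ?I x y $ ((Run A ?I ** I x) ** I y)"
    using Assoc_nat[of "Run A ?I" "I x" "I y"] by simp
  also have "... = Assoc A ?I x y $ (((?i ** Lun A x) $ Assoc A ?I ?I x) ** I y)"
    using triangle[of ?I x] by simp
  also have "... = (Assoc A ?I x y $ ((?i ** Lun A x) ** I y)) $ (Assoc A ?I ?I x ** I y)"
    by simp
  also have "... = (?i ** (Lun A x ** I y)) $ ?t"
    by (subst Assoc_nat[of _ _ _ ?I "?I *. x" y]) simp_all
  finally show "?i ** (Lun A (x *. y) $ Assoc A ?I x y) = ?i ** (Lun A x ** I y)"
    by (intro comp_cancel_right[of ?t "?i ** (Lun A (x *. y) $ Assoc A ?I x y)" "?i ** (Lun A x ** I y)"]) simp_all
qed simp_all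

lemma Run_TensO:
  assumes [simp]: "Ob x" "Ob y"
  shows "(I x ** Run A y) $ Assoc A x y (Unit A) = Run A (x *. y)"
proof (rule TensM_Unit_faithful)
  let ?I = "Unit A" let ?i = "I (Unit A)"
  have "Assoc A x y ?I $ (((I x ** Run A y) $ Assoc A x y ?I) ** ?i)
      = (Assoc A x y ?I $ ((I x ** Run A y) ** ?i)) $ (Assoc A x y ?I ** ?i)" by simp
  also have "... = (I x ** (Run A y ** ?i)) $ Assoc A x (y *. ?I) ?I $ (Assoc A x y ?I ** ?i)"
    by (subst Assoc_nat[of _ _ _ x "y *. ?I" ?I]) simp_all
  also have "... = (I x ** ((I y ** Lun A ?I) $ Assoc A y ?I ?I)) $ Assoc A x (y *. ?I) ?I $ (Assoc A x y ?I ** ?i)"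
    using triangle[of y ?I] by simp
  also have "... = (I x ** (I y ** Lun A ?I)) $ ((I x ** Assoc A y ?I ?I) $ Assoc A x (y *. ?I) ?I $ (Assoc A x y ?I ** ?i))"
    by simp
  also have "... = (I x ** (I y ** Lun A ?I)) $ (Assoc A x y (?I *. ?I) $ Assoc A (x *. y) ?I ?I)"
    using pentagon[of x y ?I ?I] by simp
  also have "... = (Assoc A x y ?I $ ((I x ** I y) ** Lun A ?I)) $ Assoc A (x *. y) ?I ?I"
    by (subst Assoc_nat[of _ _ _ x y "?I *. ?I"]) simp_all
  also have "... = Assoc A x y ?I $ (Run A (x *. y) ** ?i)"
    using triangle[of "x *. y" ?I] by simp
  finally show "((I x ** Run A y) $ Assoc A x y ?I) ** ?i = Run A (x *. y) ** ?i"
    by (intro comp_cancel_left[of "Assoc A x y ?I"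
        "((I x ** Run A y) $ Assoc A x y ?I) ** ?i" "Run A (x *. y) ** ?i"]) simp_all
qed simp_all

lemma Lun_Unit: "Lun A (Unit A) = Run A (Unit A)"
proof (rule TensM_Unit_faithful)
  let ?I = "Unit A" let ?i = "I (Unit A)"
  \<comment> \<open>Naturality of the left unitor at the unitor of the unit object, followed by
    cancellation of that unitor.\<close>
  have "Lun A (?I *. ?I) = ?i ** Lun A ?I"
    by (rule comp_cancel_left[of "Lun A ?I"]) (simp_all add: Lun_nat[of "Lun A ?I" "?I *. ?I"])
  then show "Lun A ?I ** ?i = Run A ?I ** ?i"
    using Lun_TensO[of ?I ?I] triangle[of ?I ?I] by simp
qed simp_all

end

section \<open>Homogeneous morphisms\<close>

definition hmg :: "('k, 'o, 'm, ('m, unit) superspace_ext, 'z) lincat_scheme \<Rightarrow> bit \<Rightarrow> 'm \<Rightarrow> bool" where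
  "hmg A p f \<longleftrightarrow> f \<in> arrows A \<and> f \<in> hpart (hom_of A f) p"

context supercategory
begin

lemma hmgI: "[|f \<in> hpart (Hm x y) p; Ob x; Ob y|] ==> hmg A p f"
  unfolding hmg_def using homD[of f x y] hpart_homset[of f x y p] by (simp add: hom_of_def)

lemma hmg_arrow: "hmg A p f ==> ar f"
  unfolding hmg_def by blast

lemma hmg_hpart: "[|hmg A p f; src f = x; tgt f = y|] ==> f \<in> hpart (Hm x y) p"
  unfolding hmg_def hom_of_def by auto

lemma hpart_iff_hmg:
  "[|Ob x; Ob y|] ==> f \<in> hpart (Hm x y) p \<longleftrightarrow> hmg A p f \<and> src f = x \<and> tgt f = y"
  using hmgI hmg_hpart hpart_homset[of f x y p] homD[of f x y] by blast

lemma hmg_comp_gen: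
  assumes "hmg A p f" "hmg A q g" "tgt f = src g"
  shows "hmg A (q + p) (g $$ f)"
  by (rule hmgI[of _ "src f" "tgt g"],
      rule parity_Comp[of "src f" "tgt f" "tgt g"])
     (use assms hmg_hpart hmg_arrow in auto)

text \<open>The four instances of \<open>hmg_comp_gen\<close> with the sum of parities evaluated, so
  that they match goals with a literal parity.\<close>

lemma hmg_comp [simp]:
  assumes "tgt f = src g"
  shows "[|hmg A 0 f; hmg A 0 g|] ==> hmg A 0 (g $$ f)"
    and "[|hmg A 1 f; hmg A 0 g|] ==> hmg A 1 (g $$ f)"
    and "[|hmg A 0 f; hmg A 1 g|] ==> hmg A 1 (g $$ f)"
    and "[|hmg A 1 f; hmg A 1 g|] ==> hmg A 0 (g $$ f)"
  using hmg_comp_gen[of 0 f 0 g] hmg_comp_gen[of 1 f 0 g] hmg_comp_gen[of 0 f 1 g] hmg_comp_gen[of 1 f 1 g] assms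
  by simp_all

lemma hmg_sgn [simp]: "hmg A p f ==> hmg A p (sgn_arr A e f)"
  using superspace.hpart_signed[OF superspace_Hom, of "src f" "tgt f" f p e]
  unfolding hmg_def by (simp add: hom_of_def sgn_arr_def)
    (metis (no_types, lifting) hom_of_def sgn_arr_def sgn_arr_arrow)

lemma split_arrow:
  assumes "ar f"
  obtains u w where "hmg A p u" "hmg A (p + 1) w" "f = u \<oplus>\<^bsub>hom_of A f\<^esub> w"
    "src u = src f" "tgt u = tgt f" "src w = src f" "tgt w = tgt f"
proof -
  interpret superspace K "hom_of A f" unfolding hom_of_def using assms by (intro superspace_Hom) auto
  obtain u w where "u \<in> hpart (hom_of A f) p" "w \<in> hpart (hom_of A f) (p + 1)" "f = u \<oplus>\<^bsub>hom_of A f\<^esub> w"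
    using decomposition_ex[OF arrow_hom_of[OF assms]] by blast
  then show ?thesis using that assms unfolding hom_of_def by (auto simp: hpart_iff_hmg)
qed

text \<open>Write the identity as \<open>u\<close> even plus \<open>w\<close> odd. Comparing
  parities in \<open>u = u 1\<close> gives \<open>u w = 0\<close>, and in \<open>w = w 1\<close> it
  gives \<open>w w = 0\<close>; hence \<open>w = 1 w = 0\<close>.\<close>

lemma hmg_Ident [simp]:
  assumes "Ob x"
  shows "hmg A 0 (I x)"
proof -
  interpret superspace K "Hm x x" using assms by (rule superspace_Hom) fact
  obtain u w where uw: "u \<in> hpart (Hm x x) 0" "w \<in> hpart (Hm x x) (0 + 1)" "I x = u \<oplus>\<^bsub>Hm x x\<^esub> w"
    using decomposition_ex[of "I x" 0] idn_closed assms by auto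
  have c: "u \<in> hs x x" "w \<in> hs x x" using uw hpart_carrier by auto
  have h: "a $$ b \<in> hpart (Hm x x) (p + q)" if "a \<in> hpart (Hm x x) p" "b \<in> hpart (Hm x x) q" for a b p q
    using parity_Comp that assms by blast
  have add: "a $$ (u \<oplus>\<^bsub>Hm x x\<^esub> w) = (a $$ u) \<oplus>\<^bsub>Hm x x\<^esub> (a $$ w)"
    if "a \<in> hs x x" for a
    using linear_map_add[OF bilinear_map_right[OF bilinear_Comp that] c] assms by simp
  have id: "a $$ (u \<oplus>\<^bsub>Hm x x\<^esub> w) = a" "(u \<oplus>\<^bsub>Hm x x\<^esub> w) $$ a = a" if "a \<in> hs x x" for a
    using idn_right[of x x a] idn_left[of x x a] that assms uw(3) by simp_all
  have "w = \<zero>\<^bsub>Hm x x\<^esub>"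
  proof -
    have "(u $$ u) \<oplus>\<^bsub>Hm x x\<^esub> (u $$ w) = u \<oplus>\<^bsub>Hm x x\<^esub> \<zero>\<^bsub>Hm x x\<^esub>"
      using add[OF c(1)] id(1)[OF c(1)] c by simp
    then have uw0: "u $$ w = \<zero>\<^bsub>Hm x x\<^esub>"
      using decomposition_unique[of "u $$ u" 0 "u $$ w" u "\<zero>\<^bsub>Hm x x\<^esub>"] h[of u 0 u 0] h[of u 0 w 1] uw by simp
    have "(w $$ w) \<oplus>\<^bsub>Hm x x\<^esub> (w $$ u) = \<zero>\<^bsub>Hm x x\<^esub> \<oplus>\<^bsub>Hm x x\<^esub> w"
      using add[OF c(2)] id(1)[OF c(2)] c h[of w 1 u 0] h[of w 1 w 1] uw hpart_carrier by (simp add: M.a_comm)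
    then have ww: "w $$ w = \<zero>\<^bsub>Hm x x\<^esub>"
      using decomposition_unique[of "w $$ w" 0 "w $$ u" "\<zero>\<^bsub>Hm x x\<^esub>" w] h[of w 1 w 1] h[of w 1 u 0] uw by simp
    have "w = (u $$ w) \<oplus>\<^bsub>Hm x x\<^esub> (w $$ w)"
      using linear_map_add[OF bilinear_map_left[OF bilinear_Comp c(2)] c] id(2)[OF c(2)] assms by simp
    then show ?thesis using uw0 ww by simp
  qed
  then show ?thesis using uw c assms by (intro hmgI[of _ x x]) auto
qed

text \<open>Let \<open>u\<close> be the component of parity \<open>p\<close> of the inverse of
  \<open>f\<close>. The even part of the product of \<open>f\<close> with its inverse is
  \<open>f u\<close>, so \<open>f u\<close> is the identity, and uniqueness of inverses identifies
  \<open>u\<close>.\<close>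

lemma hmg_inverse [simp]:
  assumes "hmg A p f" "invertible A f"
  shows "hmg A p (ivs f)"
proof -
  let ?x = "src f" and ?y = "tgt f"
  have f: "ar f" using assms by simp
  let ?g = "ivs f"
  obtain u w where uw: "hmg A p u" "hmg A (p + 1) w" "?g = u \<oplus>\<^bsub>Hm ?y ?x\<^esub> w"
    "src u = ?y" "tgt u = ?x" "src w = ?y" "tgt w = ?x"
  proof (rule split_arrow[of ?g p])
    fix u w assume a: "hmg A p u" "hmg A (p + 1) w" "?g = u \<oplus>\<^bsub>hom_of A ?g\<^esub> w" "src u = src ?g"
      "tgt u = tgt ?g" "src w = src ?g" "tgt w = tgt ?g"
    have g: "src ?g = ?y" "tgt ?g = ?x" using assms by simp_all
    show thesis by (rule that[OF a(1,2)]) (use a(3-7) in \<open>unfold hom_of_def g\<close>)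
  qed (use assms in simp)
  interpret X: superspace K "Hm ?y ?y" using f by (intro superspace_Hom) auto
  have h: "f $$ u \<in> hpart (Hm ?y ?y) 0" "f $$ w \<in> hpart (Hm ?y ?y) (0 + 1)"
    using hmg_comp_gen[OF uw(1) assms(1)] hmg_comp_gen[OF uw(2) assms(1)] uw f
    by (auto simp: hpart_iff_hmg hmg_arrow)
  have "(f $$ u) \<oplus>\<^bsub>Hm ?y ?y\<^esub> (f $$ w) = f $$ ?g"
    unfolding uw(3) by (rule linear_map_add[OF linear_comp_right, symmetric])
      (use f uw hmg_arrow[OF uw(1)] hmg_arrow[OF uw(2)] in \<open>auto simp: hom_iff\<close>)
  also have "... = I ?y \<oplus>\<^bsub>Hm ?y ?y\<^esub> \<zero>\<^bsub>Hm ?y ?y\<^esub>"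
    using assms f arrows_hom[of "I ?y"] by simp
  finally have fu: "f $$ u = I ?y"
    using X.decomposition_unique[OF h, of "I ?y" "\<zero>\<^bsub>Hm ?y ?y\<^esub>"] hmg_Ident[of ?y] f
    by (simp add: hpart_iff_hmg)
  have "u = ?g" using inverse_switch[OF assms(2), of u "I ?y"] fu uw(4,5) hmg_arrow[OF uw(1)] assms(2) by simp
  then show ?thesis using uw(1) by simp
qed

lemma homogeneous_eqI:
  assumes "linear_map K (Hm x y) W \<phi>" "linear_map K (Hm x y) W \<psi>" "Ob x" "Ob y"
    and "!!p f. [|hmg A p f; src f = x; tgt f = y|] ==> \<phi> f = \<psi> f"
    and "ar f" "src f = x" "tgt f = y"
  shows "\<phi> f = \<psi> f"
  by (rule superspace.linear_map_eqI[OF superspace_Hom assms(1,2)])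
     (use assms homI[of f] in \<open>auto simp: hpart_iff_hmg\<close>)

end

context tensor_supercategory
begin

lemma TensM_arrow [simp]:
  assumes "ar f" "ar g"
  shows "f ** g \<in> Arr" "src (f ** g) = src f *. src g"
    "tgt (f ** g) = tgt f *. tgt g"
proof -
  have "f ** g \<in> hs (src f *. src g) (tgt f *. tgt g)"
    using linear_map_closed[OF bilinear_map_right[OF bilinear_TensM]]
      arrows_hom[OF assms(1)] arrows_hom[OF assms(2)] by simp
  from homD[OF this] show "f ** g \<in> Arr" "src (f ** g) = src f *. src g"
    "tgt (f ** g) = tgt f *. tgt g" using assms by simp_all
qed

lemma linear_TensM_right:
  "[|ar f; src f = u; tgt f = v; Ob x; Ob y|]
    ==> linear_map K (Hm x y) (Hm (u *. x) (v *. y)) (TensM A f)"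
  using bilinear_map_right[OF bilinear_TensM[of u v x y]] arrows_hom[of f] by auto

lemma linear_TensM_left:
  "[|ar f; src f = u; tgt f = v; Ob x; Ob y|]
    ==> linear_map K (Hm x y) (Hm (x *. u) (y *. v)) (%g. g ** f)"
  using bilinear_map_left[OF bilinear_TensM[of x y u v]] arrows_hom[of f] by auto

declare TensM_Ident [simp]

lemma TensM_sgn [simp]:
  assumes "ar f" "ar g"
  shows "sgn_arr A e f ** g = sgn_arr A e (f ** g)" "f ** sgn_arr A e g = sgn_arr A e (f ** g)"
proof -
  have b: "bilinear_map K (hom_of A f) (hom_of A g) (hom_of A (f ** g)) (TensM A)"
    using bilinear_TensM assms unfolding hom_of_def by simp
  show "sgn_arr A e f ** g = sgn_arr A e (f ** g)" "f ** sgn_arr A e g = sgn_arr A e (f ** g)"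
    unfolding sgn_arr_def using assms
    by (auto intro!: linear_map_signed[OF _ _ bilinear_map_left[OF b]] linear_map_signed[OF _ _ bilinear_map_right[OF b]]
      module_hom_of arrow_hom_of)
qed

lemma hmg_TensM_gen:
  assumes "hmg A p f" "hmg A q g"
  shows "hmg A (p + q) (f ** g)"
  by (rule hmgI[of _ "src f *. src g" "tgt f *. tgt g"], rule TensM_hpart)
     (use assms hmg_arrow[OF assms(1)] hmg_arrow[OF assms(2)] in \<open>auto intro: hmg_hpart\<close>)

lemma hmg_TensM [simp]:
  shows "[|hmg A 0 f; hmg A 0 g|] ==> hmg A 0 (f ** g)"
    and "[|hmg A 1 f; hmg A 0 g|] ==> hmg A 1 (f ** g)"
    and "[|hmg A 0 f; hmg A 1 g|] ==> hmg A 1 (f ** g)"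
    and "[|hmg A 1 f; hmg A 1 g|] ==> hmg A 0 (f ** g)"
  using hmg_TensM_gen[of 0 f 0 g] hmg_TensM_gen[of 1 f 0 g] hmg_TensM_gen[of 0 f 1 g] hmg_TensM_gen[of 1 f 1 g]
  by simp_all

lemma TensM_comp_gen:
  assumes "ar f" "hmg A p g" "hmg A q h" "ar k" "tgt h = src f" "tgt k = src g"
  shows "(f ** g) $ (h ** k) = sgn_arr A (p * q) ((f $ h) ** (g $ k))"
proof -
  note a = hmg_arrow[OF assms(2)] hmg_arrow[OF assms(3)]
  have "(f $ h) ** (g $ k) \<in> Arr" using a assms by simp
  then have "sgn_arr A (p * q) ((f $ h) ** (g $ k))
    = signed (Hm (src h *. src k) (tgt f *. tgt g)) (p * q) ((f $ h) ** (g $ k))"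
    unfolding sgn_arr_def hom_of_def using assms a by simp
  then show ?thesis
    using TensM_Comp[of "src h" "src f" "tgt f" "src k" "src g" "tgt g" f g p h q k]
      assms a arrows_hom[OF assms(1)] arrows_hom[OF assms(4)] hmg_hpart[OF assms(2)] hmg_hpart[OF assms(3)] by simp
qed

text \<open>If \<open>g\<close> is even the sign is trivial whatever the parity of \<open>h\<close>,
  so linearity in \<open>h\<close> removes the homogeneity condition.\<close>

lemma TensM_comp_even_left [simp]:
  assumes "ar f" "hmg A 0 g" "ar h" "ar k" "tgt h = src f" "tgt k = src g"
  shows "(f ** g) $ (h ** k) = (f $ h) ** (g $ k)"
proof (rule homogeneous_eqI[where f = h])
  note g = hmg_arrow[OF assms(2)]
  show "linear_map K (Hm (src h) (tgt h)) (Hm (src h *. src k) (tgt f *. tgt g))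
     (%h. (f ** g) $ (h ** k))"
    by (rule lin_compose[OF linear_comp_right linear_TensM_left]) (use assms g in auto)
  show "linear_map K (Hm (src h) (tgt h)) (Hm (src h *. src k) (tgt f *. tgt g))
     (%h. (f $ h) ** (g $ k))"
    by (rule lin_compose[OF linear_TensM_left linear_comp_right]) (use assms g in auto)
qed (use assms TensM_comp_gen[of f 0 g] in auto)

lemma TensM_comp_even_right [simp]:
  assumes "ar f" "ar g" "hmg A 0 h" "ar k" "tgt h = src f" "tgt k = src g"
  shows "(f ** g) $ (h ** k) = (f $ h) ** (g $ k)"
proof (rule homogeneous_eqI[where f = g])
  note h = hmg_arrow[OF assms(3)]
  show "linear_map K (Hm (src g) (tgt g)) (Hm (src h *. src k) (tgt f *. tgt g))
     (%g. (f ** g) $ (h ** k))"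
    by (rule lin_compose[OF linear_comp_left linear_TensM_right]) (use assms h in auto)
  show "linear_map K (Hm (src g) (tgt g)) (Hm (src h *. src k) (tgt f *. tgt g))
     (%g. (f $ h) ** (g $ k))"
    by (rule lin_compose[OF linear_TensM_right linear_comp_left]) (use assms h in auto)
qed (use assms TensM_comp_gen[of f _ _ 0 h] in auto)

lemma TensM_comp_odd:
  assumes "ar f" "hmg A 1 g" "hmg A 1 h" "ar k" "tgt h = src f" "tgt k = src g"
  shows "(f ** g) $ (h ** k) = sgn_arr A 1 ((f $ h) ** (g $ k))"
  using TensM_comp_gen[OF assms] by simp

lemma TensM_comp_assoc_even_left [simp]:
  assumes "ar f" "hmg A 0 g" "ar h" "ar k" "tgt h = src f" "tgt k = src g"
    "ar m" "tgt m = src h *. src k"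
  shows "(f ** g) $ (h ** k) $ m = ((f $ h) ** (g $ k)) $ m"
  using assms hmg_arrow[OF assms(2)] by (simp flip: comp_assoc)

lemma TensM_comp_assoc_even_right [simp]:
  assumes "ar f" "ar g" "hmg A 0 h" "ar k" "tgt h = src f" "tgt k = src g"
    "ar m" "tgt m = src h *. src k"
  shows "(f ** g) $ (h ** k) $ m = ((f $ h) ** (g $ k)) $ m"
  using assms hmg_arrow[OF assms(3)] by (simp flip: comp_assoc)

end

section \<open>Monoidal functors\<close>

text \<open>The common part of linear monoidal categories and monoidal supercategories: interchange
  with an identity carries no sign in either. This is enough to compose monoidal functors once for
  both kinds.\<close>

locale whiskering = linear_coherence K A
  for K :: "'k ring" and A :: "('k, 'o, 'm, 'h, 'z) moncat_scheme" (structure) +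
  assumes tensor_arrow: "[|f \<in> arrows A; g \<in> arrows A|] ==> f ** g \<in> arrows A"
      "[|f \<in> arrows A; g \<in> arrows A|] ==> source A (f ** g) = source A f *. source A g"
      "[|f \<in> arrows A; g \<in> arrows A|] ==> target A (f ** g) = target A f *. target A g"
    and tensor_Ident: "[|x \<in> Obj A; y \<in> Obj A|] ==> Ident A x ** Ident A y = Ident A (x *. y)"
    and whisker_comp: "[|f \<in> arrows A; g \<in> arrows A; target A f = source A g; x \<in> Obj A|]
        ==> (g $ f) ** Ident A x = (g ** Ident A x) $ (f ** Ident A x)"
      "[|f \<in> arrows A; g \<in> arrows A; target A f = source A g; x \<in> Obj A|]
        ==> Ident A x ** (g $ f) = (Ident A x ** g) $ (Ident A x ** f)"

sublocale linear_monoidal_category \<subseteq> whiskering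
  by unfold_locales simp_all

sublocale tensor_supercategory \<subseteq> whiskering
  by unfold_locales simp_all

locale linear_functor_between = A: linear_category K A + B: linear_category K B + linear_functor K A B F
  for K :: "'k ring" and A :: "('k, 'o, 'm, 'h, 'y) lincat_scheme"
    and B :: "('k, 'p, 'n, 'i, 'z) lincat_scheme" and F :: "('o, 'm, 'p, 'n, 'w) fun_data_scheme"
begin

lemma fob_Obj [simp]: "A.Ob x ==> fob F x \<in> Obj B"
  using fob_closed by simp

lemma fmor_arrow [simp]:
  assumes "A.ar f"
  shows "fmor F f \<in> arrows B" "source B (fmor F f) = fob F (source A f)" "target B (fmor F f) = fob F (target A f)"
  using B.homD[of "fmor F f" "fob F (source A f)" "fob F (target A f)"] A.arrows_hom[OF assms]
    fmor_closed[of "source A f" "target A f" f] by simp_all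

lemma fmor_comp: "[|A.ar f; A.ar g; target A f = source A g|]
    ==> fmor F (g $\<^bsub>A\<^esub> f) = fmor F g $\<^bsub>B\<^esub> fmor F f"
  using fmor_cmp[of "source A f" "target A f" "target A g" f g] A.arrows_hom[of f] A.arrows_hom[of g] by simp

lemma fmor_Ident [simp]: "A.Ob x ==> fmor F (Ident A x) = Ident B (fob F x)"
  using fmor_idn by simp

lemma fmor_invertible [simp]:
  assumes "invertible A f"
  shows "invertible B (fmor F f)" "inverse_of B (fmor F f) = fmor F (inverse_of A f)"
proof -
  have a: "fmor F (inverse_of A f) $\<^bsub>B\<^esub> fmor F f = Ident B (fob F (source A f))"
    "fmor F f $\<^bsub>B\<^esub> fmor F (inverse_of A f) = Ident B (fob F (target A f))"
    using assms by (simp_all flip: fmor_comp)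
  show "invertible B (fmor F f)" by (rule B.inverse_of_eqI(2)[of _ "fmor F (inverse_of A f)"])
      (use assms a in simp_all)
  show "inverse_of B (fmor F f) = fmor F (inverse_of A f)"
    by (rule B.inverse_of_eqI(1)) (use assms a in simp_all)
qed

lemma fmor_sgn [simp]: "A.ar f ==> fmor F (sgn_arr A e f) = sgn_arr B e (fmor F f)"
  unfolding sgn_arr_def
  using linear_map_signed[OF _ _ linear_fmor[of "source A f" "target A f"], of f e] A.arrows_hom[of f]
     A.module_Hom[of "source A f" "target A f"] B.module_Hom[of "fob F (source A f)" "fob F (target A f)"]
  by (simp add: hom_of_def)

end

locale monoidal_functor_between = A: whiskering K A + B: whiskering K B +
    linear_functor_between K A B F + monoidal_functor_coherence A B F
  for K :: "'k ring" and A :: "('k, 'o, 'm, 'h, 'y) moncat_scheme"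
    and B :: "('k, 'p, 'n, 'i, 'z) moncat_scheme" (structure) and F :: "('o, 'm, 'p, 'n, 'w) monfun_scheme"
begin

lemma fc_arrow [simp]:
  assumes "A.Ob x" "A.Ob y"
  shows "invertible B (fc F (x, y))" "source B (fc F (x, y)) = fob F x *. fob F y"
    "target B (fc F (x, y)) = fob F (x *.\<^bsub>A\<^esub> y)"
  using B.isomD[OF fc_iso[OF assms]] assms by simp_all

lemma fi_arrow [simp]:
  "invertible B (fi F)" "source B (fi F) = Unit B" "target B (fi F) = fob F (Unit A)"
  using B.isomD[OF fi_iso] by simp_all

lemma fc_nat:
  "[|A.ar f; A.ar g; source A f = x; source A g = y; target A f = x'; target A g = y'|]
    ==> fc F (x', y') $ (fmor F f ** fmor F g) = fmor F (f **\<^bsub>A\<^esub> g) $ fc F (x, y)"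
  using fc_natural[of x x' y y' f g] A.arrows_hom[of f] A.arrows_hom[of g] by simp

lemmas fc_nat_refl = fc_nat[OF _ _ HOL.refl HOL.refl HOL.refl HOL.refl]

end

locale composable = F: monoidal_functor_between K A B F + G: monoidal_functor_between K B C G
  for K :: "'k ring" and A :: "('k, 'o, 'm, 'h, 'x) moncat_scheme"
    and B :: "('k, 'p, 'n, 'i, 'y) moncat_scheme" and C :: "('k, 'q, 'l, 'j, 'z) moncat_scheme" (structure)
    and F :: "('o, 'm, 'p, 'n, 'v) monfun_scheme" and G :: "('p, 'n, 'q, 'l, 'w) monfun_scheme"
begin

abbreviation "GF \<equiv> comp_monfun A C G F"

lemma comp_monfun_simps [simp]:
  "x \<in> Obj A ==> fob GF x = fob G (fob F x)"
  "f \<in> arrows A ==> fmor GF f = fmor G (fmor F f)"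
  "[|x \<in> Obj A; y \<in> Obj A|] ==> fc GF (x, y) = fmor G (fc F (x, y)) $ fc G (fob F x, fob F y)"
  "fi GF = fmor G (fi F) $ fi G"
  by (simp_all add: comp_monfun_def)

declare F.B.tensor_arrow [simp] G.B.tensor_arrow [simp] F.A.tensor_arrow [simp]

lemma linear_functor_comp: "linear_functor K A C GF"
proof (unfold_locales; (unfold cat_of_simps)?)
  fix x y assume o: "x \<in> Obj A" "y \<in> Obj A"
  have l: "linear_map K (Hom A x y) (Hom C (fob G (fob F x)) (fob G (fob F y))) (%f. fmor G (fmor F f))"
    by (rule lin_compose[OF G.linear_fmor F.linear_fmor]) (use o in auto)
  have e: "fmor G (fmor F f) = fmor GF f" if "f \<in> homset A x y" for f
    using that o F.A.homD[of f x y] by simp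
  from linear_map_cong[OF e F.A.module_Hom[OF o], THEN iffD1, OF _ l]
  show "linear_map K (Hom A x y) (Hom C (fob GF x) (fob GF y)) (fmor GF)" using o by simp
qed (auto simp: F.A.hom_iff G.B.hom_iff F.fmor_comp G.fmor_comp)

text \<open>Each axiom is the image under \<open>G\<close> of the axiom for \<open>F\<close>,
  followed by the axiom for \<open>G\<close>; naturality of \<open>fc G\<close> at the coherence
  maps of \<open>F\<close> joins the two.\<close>

lemma coherence_comp: "monoidal_functor_coherence A C GF"
proof
  show "fob GF \<in> extensional (Obj A)" "fmor GF \<in> extensional (arrows A)" "fc GF \<in> extensional (Obj A \<times> Obj A)"
    by (auto simp: comp_monfun_def extensional_def)
next
  fix x y assume "x \<in> Obj A" "y \<in> Obj A"
  then show "isom C (fob GF x *. fob GF y) (fob GF (x *.\<^bsub>A\<^esub> y)) (fc GF (x, y))"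
    by (intro G.B.invertible_isom) simp_all
next
  show "isom C (Unit C) (fob GF (Unit A)) (fi GF)" by (intro G.B.invertible_isom) simp_all
next
  fix x x' y y' f g
  assume a: "x \<in> Obj A" "x' \<in> Obj A" "y \<in> Obj A" "y' \<in> Obj A" "f \<in> homset A x x'" "g \<in> homset A y y'"
  then have [simp]: "f \<in> arrows A" "source A f = x" "target A f = x'" "g \<in> arrows A" "source A g = y" "target A g = y'"
    using F.A.homD by auto
  have "fc GF (x', y') $ (fmor GF f ** fmor GF g)
    = fmor G (fc F (x', y')) $ (fc G (fob F x', fob F y') $ (fmor G (fmor F f) ** fmor G (fmor F g)))"
    using a by simp
  also have "... = fmor G (fc F (x', y') $\<^bsub>B\<^esub> (fmor F f **\<^bsub>B\<^esub> fmor F g)) $ fc G (fob F x, fob F y)"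
    using a G.fc_nat[of "fmor F f" "fmor F g" "fob F x" "fob F y" "fob F x'" "fob F y'"] by (simp add: G.fmor_comp)
  also have "... = fmor GF (f **\<^bsub>A\<^esub> g) $ fc GF (x, y)"
    using a F.fc_nat[of f g x y x' y'] by (simp add: G.fmor_comp)
  finally show "fc GF (x', y') $ (fmor GF f ** fmor GF g) = fmor GF (f **\<^bsub>A\<^esub> g) $ fc GF (x, y)" .
next
  fix x y z assume o: "x \<in> Obj A" "y \<in> Obj A" "z \<in> Obj A"
  have 1: "fc G (fob F (x *.\<^bsub>A\<^esub> y), fob F z) $ (fmor G (fc F (x, y)) ** Ident C (fob G (fob F z)))
    = fmor G (fc F (x, y) **\<^bsub>B\<^esub> Ident B (fob F z)) $ fc G (fob F x *.\<^bsub>B\<^esub> fob F y, fob F z)"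
    using G.fc_nat_refl[of "fc F (x, y)" "Ident B (fob F z)"] o by simp
  have 2: "fc G (fob F x, fob F (y *.\<^bsub>A\<^esub> z)) $ (Ident C (fob G (fob F x)) ** fmor G (fc F (y, z)))
    = fmor G (Ident B (fob F x) **\<^bsub>B\<^esub> fc F (y, z)) $ fc G (fob F x, fob F y *.\<^bsub>B\<^esub> fob F z)"
    using G.fc_nat_refl[of "Ident B (fob F x)" "fc F (y, z)"] o by simp
  have "fmor GF (Assoc A x y z) $ fc GF (x *.\<^bsub>A\<^esub> y, z) $ (fc GF (x, y) ** Ident C (fob GF z))
    = fmor G (fmor F (Assoc A x y z)) $ fmor G (fc F (x *.\<^bsub>A\<^esub> y, z))
       $ (fc G (fob F (x *.\<^bsub>A\<^esub> y), fob F z) $ (fmor G (fc F (x, y)) ** Ident C (fob G (fob F z))))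
       $ (fc G (fob F x, fob F y) ** Ident C (fob G (fob F z)))"
    using o by (simp add: G.B.whisker_comp)
  also have "... = fmor G (fmor F (Assoc A x y z) $\<^bsub>B\<^esub> fc F (x *.\<^bsub>A\<^esub> y, z) $\<^bsub>B\<^esub> (fc F (x, y) **\<^bsub>B\<^esub> Ident B (fob F z)))
       $ fc G (fob F x *.\<^bsub>B\<^esub> fob F y, fob F z) $ (fc G (fob F x, fob F y) ** Ident C (fob G (fob F z)))"
    unfolding 1 using o by (simp add: G.fmor_comp)
  also have "... = fmor G (fc F (x, y *.\<^bsub>A\<^esub> z) $\<^bsub>B\<^esub> (Ident B (fob F x) **\<^bsub>B\<^esub> fc F (y, z)))
       $ fmor G (Assoc B (fob F x) (fob F y) (fob F z))
       $ fc G (fob F x *.\<^bsub>B\<^esub> fob F y, fob F z) $ (fc G (fob F x, fob F y) ** Ident C (fob G (fob F z)))"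
    using F.fc_Assoc[OF o] o by (simp add: G.fmor_comp)
  also have "... = fmor G (fc F (x, y *.\<^bsub>A\<^esub> z) $\<^bsub>B\<^esub> (Ident B (fob F x) **\<^bsub>B\<^esub> fc F (y, z)))
       $ fc G (fob F x, fob F y *.\<^bsub>B\<^esub> fob F z) $ (Ident C (fob G (fob F x)) ** fc G (fob F y, fob F z))
       $ Assoc C (fob G (fob F x)) (fob G (fob F y)) (fob G (fob F z))"
    using G.fc_Assoc[of "fob F x" "fob F y" "fob F z"] o by simp
  also have "... = fmor G (fc F (x, y *.\<^bsub>A\<^esub> z))
       $ (fmor G (Ident B (fob F x) **\<^bsub>B\<^esub> fc F (y, z)) $ fc G (fob F x, fob F y *.\<^bsub>B\<^esub> fob F z))
       $ (Ident C (fob G (fob F x)) ** fc G (fob F y, fob F z))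
       $ Assoc C (fob G (fob F x)) (fob G (fob F y)) (fob G (fob F z))"
    using o by (simp add: G.fmor_comp)
  also have "... = fc GF (x, y *.\<^bsub>A\<^esub> z) $ (Ident C (fob GF x) ** fc GF (y, z))
            $ Assoc C (fob GF x) (fob GF y) (fob GF z)"
    unfolding 2[symmetric] using o by (simp add: G.B.whisker_comp)
  finally show "fmor GF (Assoc A x y z) $ fc GF (x *.\<^bsub>A\<^esub> y, z) $ (fc GF (x, y) ** Ident C (fob GF z))
    = fc GF (x, y *.\<^bsub>A\<^esub> z) $ (Ident C (fob GF x) ** fc GF (y, z)) $ Assoc C (fob GF x) (fob GF y) (fob GF z)" .
next
  fix x assume o: "x \<in> Obj A"
  have 1: "fc G (fob F (Unit A), fob F x) $ (fmor G (fi F) ** Ident C (fob G (fob F x)))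
    = fmor G (fi F **\<^bsub>B\<^esub> Ident B (fob F x)) $ fc G (Unit B, fob F x)"
    using G.fc_nat_refl[of "fi F" "Ident B (fob F x)"] o by simp
  have "fmor GF (Lun A x) $ fc GF (Unit A, x) $ (fi GF ** Ident C (fob GF x))
    = fmor G (fmor F (Lun A x)) $ fmor G (fc F (Unit A, x)) $
      (fc G (fob F (Unit A), fob F x) $ (fmor G (fi F) ** Ident C (fob G (fob F x))))
      $ (fi G ** Ident C (fob G (fob F x)))"
    using o by (simp add: G.B.whisker_comp)
  also have "... = fmor G (fmor F (Lun A x) $\<^bsub>B\<^esub> fc F (Unit A, x) $\<^bsub>B\<^esub> (fi F **\<^bsub>B\<^esub> Ident B (fob F x)))
     $ fc G (Unit B, fob F x) $ (fi G ** Ident C (fob G (fob F x)))"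
    unfolding 1 using o by (simp add: G.fmor_comp)
  also have "... = Lun C (fob GF x)" using F.fc_Lun[OF o] G.fc_Lun[of "fob F x"] o by simp
  finally show "fmor GF (Lun A x) $ fc GF (Unit A, x) $ (fi GF ** Ident C (fob GF x)) = Lun C (fob GF x)" .
  have 2: "fc G (fob F x, fob F (Unit A)) $ (Ident C (fob G (fob F x)) ** fmor G (fi F))
    = fmor G (Ident B (fob F x) **\<^bsub>B\<^esub> fi F) $ fc G (fob F x, Unit B)"
    using G.fc_nat_refl[of "Ident B (fob F x)" "fi F"] o by simp
  have "fmor GF (Run A x) $ fc GF (x, Unit A) $ (Ident C (fob GF x) ** fi GF)
    = fmor G (fmor F (Run A x)) $ fmor G (fc F (x, Unit A)) $
      (fc G (fob F x, fob F (Unit A)) $ (Ident C (fob G (fob F x)) ** fmor G (fi F)))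
      $ (Ident C (fob G (fob F x)) ** fi G)"
    using o by (simp add: G.B.whisker_comp)
  also have "... = fmor G (fmor F (Run A x) $\<^bsub>B\<^esub> fc F (x, Unit A) $\<^bsub>B\<^esub> (Ident B (fob F x) **\<^bsub>B\<^esub> fi F))
     $ fc G (fob F x, Unit B) $ (Ident C (fob G (fob F x)) ** fi G)"
    unfolding 2 using o by (simp add: G.fmor_comp)
  also have "... = Run C (fob GF x)" using F.fc_Run[OF o] G.fc_Run[of "fob F x"] o by simp
  finally show "fmor GF (Run A x) $ fc GF (x, Unit A) $ (Ident C (fob GF x) ** fi GF) = Run C (fob GF x)" .
qed

end

context whiskering
begin

declare tensor_arrow [simp] tensor_Ident [simp]

lemma id_monfun_simps [simp]:
  "Ob x ==> fob (id_monfun A) x = x"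
  "ar f ==> fmor (id_monfun A) f = f"
  "[|Ob x; Ob y|] ==> fc (id_monfun A) (x, y) = I (x *. y)"
  "fi (id_monfun A) = I (Unit A)"
  by (simp_all add: id_monfun_def)

lemma linear_functor_id: "linear_functor K A A (id_monfun A)"
proof (unfold_locales; (unfold cat_of_simps)?)
  fix x y assume o: "Ob x" "Ob y"
  then have "f = fmor (id_monfun A) f" if "f \<in> homset A x y" for f
    using that homD[of f x y] by simp
  then show "linear_map K (Hom A x y) (Hom A (fob (id_monfun A) x) (fob (id_monfun A) y)) (fmor (id_monfun A))"
    using linear_map_cong[of "Hom A x y" "%f. f" "fmor (id_monfun A)" K] linear_map_id module_Hom o by fastforce
qed (auto simp: hom_iff)

lemma coherence_id: "monoidal_functor_coherence A A (id_monfun A)"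
proof
  show "fob (id_monfun A) \<in> extensional (Obj A)" "fmor (id_monfun A) \<in> extensional (Arr)"
    "fc (id_monfun A) \<in> extensional (Obj A \<times> Obj A)"
    by (auto simp: id_monfun_def extensional_def)
qed (simp_all add: invertible_isom hom_iff)

end

text \<open>Extensionality of the fields gives equality on the nose. It is stated field by field
  because \<open>F\<close> may be a record with further fields.\<close>

lemma (in monoidal_functor_between) comp_id_monfun:
  "fob (comp_monfun A B F (id_monfun A)) = fob F" "fmor (comp_monfun A B F (id_monfun A)) = fmor F"
  "fc (comp_monfun A B F (id_monfun A)) = fc F" "fi (comp_monfun A B F (id_monfun A)) = fi F"
  using fob_ext fmor_ext fc_ext
  by (auto simp: fun_eq_iff comp_monfun_def extensional_def)

lemma (in monoidal_functor_between) id_comp_monfun: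
  "fob (comp_monfun A B (id_monfun B) F) = fob F" "fmor (comp_monfun A B (id_monfun B) F) = fmor F"
  "fc (comp_monfun A B (id_monfun B) F) = fc F" "fi (comp_monfun A B (id_monfun B) F) = fi F"
  using fob_ext fmor_ext fc_ext
  by (auto simp: fun_eq_iff comp_monfun_def extensional_def)

lemma comp_monfun_assoc:
  assumes "composable K A B C F G" "composable K B C D G H"
  shows "comp_monfun A D (comp_monfun B D H G) F = comp_monfun A D H (comp_monfun A C G F)"
proof -
  interpret FG: composable K A B C F G by fact
  interpret GH: composable K B C D G H by fact
  show ?thesis
    unfolding comp_monfun_def
    by (auto simp: restrict_def fun_eq_iff GH.G.fmor_comp simp del: FG.comp_monfun_simps GH.comp_monfun_simps)
qed

lemmas (in linear_coherence) Assoc_nat_refl = Assoc_nat[OF _ _ _ HOL.refl HOL.refl HOL.refl HOL.refl HOL.refl HOL.refl]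
lemmas (in linear_coherence) Lun_nat_refl = Lun_nat[OF _ HOL.refl HOL.refl]
lemmas (in linear_coherence) Run_nat_refl = Run_nat[OF _ HOL.refl HOL.refl]

lemma (in supercategory) sgn_arr_signed:
  "[|ar f; src f = x; tgt f = y|] ==> signed (Hm x y) e f = sgn_arr A e f"
  unfolding sgn_arr_def hom_of_def by simp

section \<open>Sums of morphisms\<close>

definition add_arr :: "('k, 'o, 'm, 'h, 'z) lincat_scheme \<Rightarrow> 'm \<Rightarrow> 'm \<Rightarrow> 'm" where
  "add_arr A f g = f \<oplus>\<^bsub>hom_of A f\<^esub> g"

definition zero_arr :: "('k, 'o, 'm, 'h, 'z) lincat_scheme \<Rightarrow> 'o \<Rightarrow> 'o \<Rightarrow> 'm" where
  "zero_arr A x y = \<zero>\<^bsub>Hom A x y\<^esub>"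

context linear_category
begin

abbreviation "par f g \<equiv> f \<in> Arr \<and> g \<in> Arr \<and> src f = src g \<and> tgt f = tgt g"

lemma add_arr_arrow [simp]:
  assumes "ar f" "ar g" "src g = src f" "tgt g = tgt f"
  shows "add_arr A f g \<in> Arr" "src (add_arr A f g) = src f" "tgt (add_arr A f g) = tgt f"
proof -
  interpret module K "Hm (src f) (tgt f)" using assms by (intro module_Hom) auto
  have "add_arr A f g \<in> hs (src f) (tgt f)"
    unfolding add_arr_def hom_of_def using arrows_hom(3)[OF assms(1)] arrows_hom(3)[OF assms(2)] assms by simp
  from homD[OF this] assms show "add_arr A f g \<in> Arr" "src (add_arr A f g) = src f"
    "tgt (add_arr A f g) = tgt f" by auto
qed

lemma zero_arr_arrow [simp]:
  assumes "Ob x" "Ob y"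
  shows "zero_arr A x y \<in> Arr" "src (zero_arr A x y) = x" "tgt (zero_arr A x y) = y"
proof -
  interpret module K "Hm x y" using assms by (rule module_Hom)
  have "zero_arr A x y \<in> hs x y" unfolding zero_arr_def by simp
  from homD[OF this assms] show "zero_arr A x y \<in> Arr" "src (zero_arr A x y) = x" "tgt (zero_arr A x y) = y" .
qed

lemma add_arr_eq: "[|ar f; src f = x; tgt f = y|] ==> f \<oplus>\<^bsub>Hm x y\<^esub> g = add_arr A f g"
  unfolding add_arr_def hom_of_def by simp

lemma add_arr_map:
  assumes "linear_map K (Hm x y) (Hm u v) \<phi>" "!!h. [|ar h; src h = x; tgt h = y|]
      ==> \<phi> h \<in> Arr \<and> src (\<phi> h) = u \<and> tgt (\<phi> h) = v"
    and "par f g" "src f = x" "tgt f = y"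
  shows "\<phi> (add_arr A f g) = add_arr A (\<phi> f) (\<phi> g)"
  using linear_map_add[OF assms(1), of f g] assms arrows_hom[of f] arrows_hom[of g]
  unfolding add_arr_def hom_of_def by auto

lemma comp_add_arr [simp]:
  assumes "ar f" "ar g" "ar h" "src g = src f" "tgt g = tgt f"
  shows "tgt f = src h ==> h $$ add_arr A f g = add_arr A (h $$ f) (h $$ g)"
    and "tgt h = src f ==> add_arr A f g $$ h = add_arr A (f $$ h) (g $$ h)"
  by (rule add_arr_map[OF linear_comp_right]; use assms in simp)
     (rule add_arr_map[OF linear_comp_left]; use assms in simp)

lemma zero_arr_map:
  assumes "linear_map K (Hm x y) (Hm u v) \<phi>" "Ob x" "Ob y" "Ob u" "Ob v"
  shows "\<phi> (zero_arr A x y) = zero_arr A u v"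
  unfolding zero_arr_def by (rule linear_map_zero[OF module_Hom module_Hom]) (use assms in auto)

lemma comp_zero_arr [simp]:
  "[|ar h; Ob x; src h = y|] ==> h $$ zero_arr A x y = zero_arr A x (tgt h)"
  "[|ar h; Ob y; tgt h = x|] ==> zero_arr A x y $$ h = zero_arr A (src h) y"
  by (rule zero_arr_map[OF linear_comp_right]; auto) (rule zero_arr_map[OF linear_comp_left]; auto)

lemma add_arr_ac:
  assumes "ar f" "ar g" "src g = src f" "tgt g = tgt f"
  shows "add_arr A f g = add_arr A g f"
    and "[|ar h; src h = src f; tgt h = tgt f|]
      ==> add_arr A (add_arr A f g) h = add_arr A f (add_arr A g h)"
    and "[|ar h; src h = src f; tgt h = tgt f|]
      ==> add_arr A f (add_arr A g h) = add_arr A g (add_arr A f h)"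
proof -
  interpret module K "Hm (src f) (tgt f)" using assms by (intro module_Hom) auto
  note c = arrows_hom[OF assms(1)] arrows_hom[OF assms(2)]
  show "add_arr A f g = add_arr A g f"
    unfolding add_arr_def hom_of_def using assms c by (simp add: M.a_comm)
  assume h: "ar h" "src h = src f" "tgt h = tgt f"
  show "add_arr A (add_arr A f g) h = add_arr A f (add_arr A g h)" "add_arr A f (add_arr A g h) = add_arr A g (add_arr A f h)"
    using assms c h arrows_hom[OF h(1)] add_arr_arrow[OF assms] by (simp_all add: add_arr_def hom_of_def M.a_ac)
qed

lemma add_zero_arr [simp]:
  "[|ar f; src f = x; tgt f = y|] ==> add_arr A f (zero_arr A x y) = f"
  "[|ar f; src f = x; tgt f = y|] ==> add_arr A (zero_arr A x y) f = f"
proof -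
  assume f: "ar f" "src f = x" "tgt f = y"
  interpret module K "Hm x y" using f by (intro module_Hom) auto
  show "add_arr A f (zero_arr A x y) = f" "add_arr A (zero_arr A x y) f = f"
    using arrows_hom[OF f(1)] f zero_arr_arrow[of x y] by (auto simp: add_arr_def hom_of_def zero_arr_def)
qed

end

lemma (in linear_category) sgn_add_arr [simp]:
  assumes "ar f" "ar g" "src g = src f" "tgt g = tgt f"
  shows "sgn_arr A e (add_arr A f g) = add_arr A (sgn_arr A e f) (sgn_arr A e g)"
proof -
  have h: "hom_of A (add_arr A f g) = hom_of A f" "hom_of A g = hom_of A f" unfolding hom_of_def using assms by simp_all
  have "sgn_arr A e (add_arr A f g) = signed (hom_of A f) e (f \<oplus>\<^bsub>hom_of A f\<^esub> g)"
    by (simp only: sgn_arr_def h) (simp only: add_arr_def)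
  also have "... = sgn_arr A e f \<oplus>\<^bsub>hom_of A f\<^esub> sgn_arr A e g"
    using module.signed_add[OF module_hom_of[OF assms(1)], of f g e] arrow_hom_of[OF assms(1)] arrow_hom_of[OF assms(2)]
    by (simp only: sgn_arr_def h)
  finally show ?thesis by (simp only: add_arr_def hom_of_sgn_arr[OF assms(1)])
qed

lemma (in supercategory) split_add:
  assumes "ar f"
  obtains u w where "hmg A 0 u" "hmg A 1 w" "f = add_arr A u w" "ar u" "ar w"
    "src u = src f" "tgt u = tgt f" "src w = src f" "tgt w = tgt f"
proof (rule split_arrow[OF assms, of 0])
  fix u w assume "hmg A 0 u" "hmg A (0 + 1) w" "f = u \<oplus>\<^bsub>hom_of A f\<^esub> w"
    "src u = src f" "tgt u = tgt f" "src w = src f" "tgt w = tgt f"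
  then show thesis by (intro that[of u w]) (auto dest: hmg_arrow simp: add_arr_def hom_of_def)
qed

text \<open>A list of requirements for constructing monoidal supercategories: interchange and
  naturality are demanded for homogeneous morphisms only. It serves both the envelope and the
  supercategory built from a \<Pi>-category.\<close>

locale graded_tensor = supercategory K A
  for K :: "'k ring" and A :: "('k, 'o, 'm, ('m, unit) superspace_ext, 'z) moncat_scheme" (structure) +
  assumes Obj_TensO [simp]: "[|x \<in> Obj A; y \<in> Obj A|] ==> x *. y \<in> Obj A"
    and Obj_Unit [simp]: "Unit A \<in> Obj A"
    and Assoc_arr: "[|x \<in> Obj A; y \<in> Obj A; z \<in> Obj A|] ==> invertible A (Assoc A x y z) \<and>
      hmg A 0 (Assoc A x y z) \<and> source A (Assoc A x y z) = (x *. y) *. z \<and> target A (Assoc A x y z) = x *. (y *. z)"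
    and Lun_arr: "x \<in> Obj A ==> invertible A (Lun A x) \<and>
      hmg A 0 (Lun A x) \<and> source A (Lun A x) = Unit A *. x \<and> target A (Lun A x) = x"
    and Run_arr: "x \<in> Obj A ==> invertible A (Run A x) \<and>
      hmg A 0 (Run A x) \<and> source A (Run A x) = x *. Unit A \<and> target A (Run A x) = x"
    and bilin_TensM: "[|x \<in> Obj A; x' \<in> Obj A; y \<in> Obj A; y' \<in> Obj A|]
      ==> bilinear_map K (Hom A x x') (Hom A y y') (Hom A (x *. y) (x' *. y')) (TensM A)"
    and Ident_TensM: "[|x \<in> Obj A; y \<in> Obj A|] ==> Ident A x ** Ident A y = Ident A (x *. y)"
    and parity_TensM: "[|hmg A p f; hmg A q g|] ==> hmg A (p + q) (f ** g)"
    and interchange: "[|hmg A r f; hmg A p g; hmg A q h; hmg A s k; target A h = source A f; target A k = source A g|]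
      ==> (f ** g) $ (h ** k) = sgn_arr A (p * q) ((f $ h) ** (g $ k))"
    and Assoc_hnat: "[|hmg A p f; hmg A q g; hmg A r h|] ==>
      Assoc A (target A f) (target A g) (target A h) $ ((f ** g) ** h)
      = (f ** (g ** h)) $ Assoc A (source A f) (source A g) (source A h)"
    and Lun_hnat: "hmg A p f ==> Lun A (target A f) $ (Ident A (Unit A) ** f) = f $ Lun A (source A f)"
    and Run_hnat: "hmg A p f ==> Run A (target A f) $ (f ** Ident A (Unit A)) = f $ Run A (source A f)"
    and pentagon_eq: "[|w \<in> Obj A; x \<in> Obj A; y \<in> Obj A; z \<in> Obj A|]
      ==> Assoc A w x (y *. z) $ Assoc A (w *. x) y z
        = (Ident A w ** Assoc A x y z) $ Assoc A w (x *. y) z $ (Assoc A w x y ** Ident A z)"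
    and triangle_eq: "[|x \<in> Obj A; y \<in> Obj A|]
      ==> (Ident A x ** Lun A y) $ Assoc A x (Unit A) y = Run A x ** Ident A y"
begin

lemma arr_TensM [simp]:
  assumes "ar f" "ar g"
  shows "f ** g \<in> Arr" "src (f ** g) = src f *. src g"
    "tgt (f ** g) = tgt f *. tgt g"
proof -
  have "f ** g \<in> hs (src f *. src g) (tgt f *. tgt g)"
    using linear_map_closed[OF bilinear_map_right[OF bilin_TensM]]
      arrows_hom[OF assms(1)] arrows_hom[OF assms(2)] by simp
  from homD[OF this] show "f ** g \<in> Arr" "src (f ** g) = src f *. src g"
    "tgt (f ** g) = tgt f *. tgt g" using assms by simp_all
qed

lemma lin_right:
  "[|ar f; src f = u; tgt f = v; Ob x; Ob y|]
    ==> linear_map K (Hm x y) (Hm (u *. x) (v *. y)) (TensM A f)"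
  using bilinear_map_right[OF bilin_TensM[of u v x y]] arrows_hom[of f] by auto

lemma lin_left:
  "[|ar f; src f = u; tgt f = v; Ob x; Ob y|]
    ==> linear_map K (Hm x y) (Hm (x *. u) (y *. v)) (%g. g ** f)"
  using bilinear_map_left[OF bilin_TensM[of x y u v]] arrows_hom[of f] by auto

lemma TensM_add [simp]:
  assumes "ar f" "ar g" "ar h" "src g = src f" "tgt g = tgt f"
  shows "h ** add_arr A f g = add_arr A (h ** f) (h ** g)" "add_arr A f g ** h = add_arr A (f ** h) (g ** h)"
  by (rule add_arr_map[OF lin_right]; use assms in simp) (rule add_arr_map[OF lin_left]; use assms in simp)

text \<open>The sign depends on \<open>g\<close> and \<open>h\<close> only, so \<open>f\<close> and
  \<open>k\<close> can be split into homogeneous parts and both sides expanded.\<close>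

lemma interchange_all:
  assumes "ar f" "hmg A p g" "hmg A q h" "ar k" "tgt h = src f" "tgt k = src g"
  shows "(f ** g) $ (h ** k) = sgn_arr A (p * q) ((f $ h) ** (g $ k))"
proof -
  note [simp] = hmg_arrow[OF assms(2)] hmg_arrow[OF assms(3)] assms(5,6)
  obtain f0 f1 where f: "hmg A 0 f0" "hmg A 1 f1" "f = add_arr A f0 f1" "ar f0" "ar f1"
    "src f0 = src f" "tgt f0 = tgt f" "src f1 = src f" "tgt f1 = tgt f" using split_add[OF assms(1)] .
  obtain k0 k1 where k: "hmg A 0 k0" "hmg A 1 k1" "k = add_arr A k0 k1" "ar k0" "ar k1"
    "src k0 = src k" "tgt k0 = tgt k" "src k1 = src k" "tgt k1 = tgt k" using split_add[OF assms(4)] .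
  note i = interchange[OF f(1) assms(2,3) k(1)] interchange[OF f(1) assms(2,3) k(2)]
    interchange[OF f(2) assms(2,3) k(1)] interchange[OF f(2) assms(2,3) k(2)]
  have "(add_arr A f0 f1 ** g) $ (h ** add_arr A k0 k1) = sgn_arr A (p * q) ((add_arr A f0 f1 $ h) ** (g $ add_arr A k0 k1))"
    using i by (simp add: f(4-) k(4-))
  then show ?thesis by (simp only: f(3)[symmetric] k(3)[symmetric])
qed

lemma Assoc_simps [simp]:
  assumes "Ob x" "Ob y" "Ob z"
  shows "invertible A (Assoc A x y z)" "hmg A 0 (Assoc A x y z)"
    "src (Assoc A x y z) = (x *. y) *. z" "tgt (Assoc A x y z) = x *. (y *. z)"
  using Assoc_arr[OF assms] by auto

lemma Lun_simps [simp]: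
  assumes "Ob x"
  shows "invertible A (Lun A x)" "hmg A 0 (Lun A x)" "src (Lun A x) = Unit A *. x" "tgt (Lun A x) = x"
  using Lun_arr[OF assms] by auto

lemma Run_simps [simp]:
  assumes "Ob x"
  shows "invertible A (Run A x)" "hmg A 0 (Run A x)" "src (Run A x) = x *. Unit A" "tgt (Run A x) = x"
  using Run_arr[OF assms] by auto

lemma Assoc_all:
  assumes "ar f" "ar g" "ar h"
  shows "Assoc A (tgt f) (tgt g) (tgt h) $ ((f ** g) ** h) = (f ** (g ** h)) $ Assoc A (src f) (src g) (src h)"
proof -
  obtain f0 f1 where f: "hmg A 0 f0" "hmg A 1 f1" "f = add_arr A f0 f1" "ar f0" "ar f1"
    "src f0 = src f" "tgt f0 = tgt f" "src f1 = src f" "tgt f1 = tgt f" using split_add[OF assms(1)] .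
  obtain g0 g1 where g: "hmg A 0 g0" "hmg A 1 g1" "g = add_arr A g0 g1" "ar g0" "ar g1"
    "src g0 = src g" "tgt g0 = tgt g" "src g1 = src g" "tgt g1 = tgt g" using split_add[OF assms(2)] .
  obtain h0 h1 where h: "hmg A 0 h0" "hmg A 1 h1" "h = add_arr A h0 h1" "ar h0" "ar h1"
    "src h0 = src h" "tgt h0 = tgt h" "src h1 = src h" "tgt h1 = tgt h" using split_add[OF assms(3)] .
  note a = Assoc_hnat[OF f(1)] Assoc_hnat[OF f(2)]
  note b = a[OF g(1)] a[OF g(2)]
  note c = b[OF h(1)] b[OF h(2)]
  have "Assoc A (tgt f) (tgt g) (tgt h) $ ((add_arr A f0 f1 ** add_arr A g0 g1) ** add_arr A h0 h1)
    = (add_arr A f0 f1 ** (add_arr A g0 g1 ** add_arr A h0 h1)) $ Assoc A (src f) (src g) (src h)"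
    using c assms by (simp add: f(4-) g(4-) h(4-))
  then show ?thesis by (simp only: f(3)[symmetric] g(3)[symmetric] h(3)[symmetric])
qed

lemma unit_all:
  assumes [simp]: "ar f"
  shows "Lun A (tgt f) $ (I (Unit A) ** f) = f $ Lun A (src f)" "Run A (tgt f) $ (f ** I (Unit A)) = f $ Run A (src f)"
proof -
  obtain u w where f: "hmg A 0 u" "hmg A 1 w" "f = add_arr A u w" "ar u" "ar w"
    "src u = src f" "tgt u = tgt f" "src w = src f" "tgt w = tgt f" using split_add[OF assms] .
  show "Lun A (tgt f) $ (I (Unit A) ** f) = f $ Lun A (src f)" "Run A (tgt f) $ (f ** I (Unit A)) = f $ Run A (src f)"
    using Lun_hnat[OF f(1)] Lun_hnat[OF f(2)] Run_hnat[OF f(1)] Run_hnat[OF f(2)] f(4-)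
    by (subst (2 3) f(3), simp)+
qed

lemma tensor_supercategory: "tensor_supercategory K A"
proof
  fix x y z x' y' z' f g h
  assume "Ob x" "Ob y" "Ob z" "Ob x'" "Ob y'" "Ob z'"
    "f \<in> hs x x'" "g \<in> hs y y'" "h \<in> hs z z'"
  then show "Assoc A x' y' z' $ ((f ** g) ** h) = (f ** (g ** h)) $ Assoc A x y z"
    using Assoc_all[of f g h] by (simp add: hom_iff)
next
  fix x y f assume "Ob x" "Ob y" "f \<in> hs x y"
  then show "Lun A y $ (I (Unit A) ** f) = f $ Lun A x"
    "Run A y $ (f ** I (Unit A)) = f $ Run A x"
    using unit_all[of f] by (simp_all add: hom_iff)
next
  fix x x' y y' f p g q
  assume "Ob x" "Ob x'" "Ob y" "Ob y'" "f \<in> hpart (Hm x x') p" "g \<in> hpart (Hm y y') q"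
  then show "f ** g \<in> hpart (Hm (x *. y) (x' *. y')) (p + q)"
    using parity_TensM[of p f q g] hmg_arrow[of p f] hmg_arrow[of q g] by (auto simp: hpart_iff_hmg)
next
  fix x x' x'' y y' y'' f g h k p q
  assume o: "Ob x" "Ob x'" "Ob x''" "Ob y" "Ob y'" "Ob y''"
   and "f \<in> hs x' x''" "g \<in> hpart (Hm y' y'') p" "h \<in> hpart (Hm x x') q" "k \<in> hs y y'"
  then have a: "ar f" "hmg A p g" "hmg A q h" "ar k" "src f = x'" "tgt f = x''"
    "src g = y'" "tgt g = y''" "src h = x" "tgt h = x'" "src k = y" "tgt k = y'"
    by (auto simp: hom_iff hpart_iff_hmg)
  then show "(f ** g) $ (h ** k) = signed (Hm (x *. y) (x'' *. y'')) (p * q) ((f $ h) ** (g $ k))"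
    using interchange_all[OF a(1-4)] hmg_arrow[OF a(2)] hmg_arrow[OF a(3)] by (simp add: sgn_arr_signed)
qed (simp_all add: invertible_isom bilin_TensM Ident_TensM pentagon_eq triangle_eq)

lemma monoidal_supercategory: "monoidal_supercategory K A"
proof -
  interpret T: tensor_supercategory K A by (rule tensor_supercategory)
  show ?thesis by (rule T.monoidal_if_tensor) (simp_all add: hmg_hpart)
qed

end

section \<open>The categories of monoidal supercategories and of monoidal $\Pi$-categories\<close>

lemma monoidal_functor_between_super:
  assumes "monoidal_supercategory K A" "monoidal_supercategory K B" "monoidal_superfunctor K A B F"
  shows "monoidal_functor_between K A B F"
proof -
  interpret A: tensor_supercategory K A by (rule tensor_if_monoidal) fact
  interpret B: tensor_supercategory K B by (rule tensor_if_monoidal) fact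
  interpret F: monoidal_superfunctor K A B F by fact
  show ?thesis ..
qed

lemma monoidal_functor_between_linear:
  assumes "linear_monoidal_category K A" "linear_monoidal_category K B" "linear_monoidal_functor K A B F"
  shows "monoidal_functor_between K A B F"
proof -
  interpret A: linear_monoidal_category K A by fact
  interpret B: linear_monoidal_category K B by fact
  interpret F: linear_monoidal_functor K A B F by fact
  show ?thesis ..
qed

lemma monoidal_superfunctor_comp:
  assumes A: "monoidal_supercategory K A" and B: "monoidal_supercategory K B" and C: "monoidal_supercategory K C"
    and F: "monoidal_superfunctor K A B F" and G: "monoidal_superfunctor K B C G"
  shows "monoidal_superfunctor K A C (comp_monfun A C G F)"
proof -
  interpret A: tensor_supercategory K A by (rule tensor_if_monoidal) fact
  interpret B: tensor_supercategory K B by (rule tensor_if_monoidal) fact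
  interpret C: tensor_supercategory K C by (rule tensor_if_monoidal) fact
  interpret F: monoidal_superfunctor K A B F by fact
  interpret G: monoidal_superfunctor K B C G by fact
  interpret FG: composable K A B C F G
    using monoidal_functor_between_super[OF A B F] monoidal_functor_between_super[OF B C G]
    by (rule composable.intro)
  have h: "hmg C p (fmor G f)" if "hmg B p f" for f p
    using G.parity_fmor[of "source B f" "target B f" f p] that B.hmg_hpart[OF that] B.hmg_arrow[OF that]
    by (simp add: C.hpart_iff_hmg)
  have hF: "hmg B p (fmor F f)" if "hmg A p f" for f p
    using F.parity_fmor[of "source A f" "target A f" f p] that A.hmg_hpart[OF that] A.hmg_arrow[OF that]
    by (simp add: B.hpart_iff_hmg)
  show ?thesis
  proof (intro monoidal_superfunctor.intro superfunctor.intro superfunctor_axioms.intro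
      monoidal_superfunctor_axioms.intro FG.linear_functor_comp FG.coherence_comp)
    fix x y f p assume "x \<in> Obj A" "y \<in> Obj A" "f \<in> hpart (Hom A x y) p"
    then show "fmor FG.GF f \<in> hpart (Hom C (fob FG.GF x) (fob FG.GF y)) p"
      using h[of p "fmor F f"] hF[of p f] A.hmg_arrow[of p f] by (auto simp: A.hpart_iff_hmg C.hpart_iff_hmg)
  next
    fix x y assume "x \<in> Obj A" "y \<in> Obj A"
    then show "fc FG.GF (x, y) \<in> hpart (Hom C (fob FG.GF x *.\<^bsub>C\<^esub> fob FG.GF y) (fob FG.GF (x *.\<^bsub>A\<^esub> y))) 0"
      using h[of 0 "fc F (x, y)"] F.fc_even[of x y] G.fc_even[of "fob F x" "fob F y"]
      by (simp add: B.hpart_iff_hmg C.hpart_iff_hmg)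
  next
    show "fi FG.GF \<in> hpart (Hom C (Unit C) (fob FG.GF (Unit A))) 0"
      using h[of 0 "fi F"] F.fi_even G.fi_even by (simp add: B.hpart_iff_hmg C.hpart_iff_hmg)
  qed
qed

lemma monoidal_superfunctor_id:
  assumes A: "monoidal_supercategory K A"
  shows "monoidal_superfunctor K A A (id_monfun A)"
proof -
  interpret A: tensor_supercategory K A by (rule tensor_if_monoidal) fact
  show ?thesis
  proof (intro monoidal_superfunctor.intro superfunctor.intro superfunctor_axioms.intro
      monoidal_superfunctor_axioms.intro A.linear_functor_id A.coherence_id)
  qed (simp_all add: A.hpart_iff_hmg A.hmg_arrow)
qed

text \<open>Arrows are triples that carry their source and target, which makes hom-sets disjoint;
  what remains are equations between functor records. Used for both kinds of monoidal
  \<Pi>-structure.\<close>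

lemma category_monoidal:
  assumes "!!A B F. [|A \<in> obj; B \<in> obj; func A B F|] ==> func A B (comp_f A B F (id_f A)) \<and>
      comp_f A B F (id_f A) = F \<and> comp_f A B (id_f B) F = F"
    and "!!A. A \<in> obj ==> func A A (id_f A)"
    and "!!A B C F G. [|A \<in> obj; B \<in> obj; C \<in> obj; func A B F; func B C G|] ==> func A C (comp_f A C G F)"
    and "!!A B C D F G H. [|A \<in> obj; B \<in> obj; C \<in> obj; D \<in> obj; func A B F; func B C G; func C D H|]
      ==> comp_f A D (comp_f B D H G) F = comp_f A D H (comp_f A C G F)"
  shows "category \<lparr>ob = obj, arr = (%A B. {(A, F, B) | F. func A B F}),
     cmp = (%(_, G, C) (A, F, _). (A, comp_f A C G F, C)), idn = (%A. (A, id_f A, A))\<rparr>"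
  by unfold_locales (use assms in auto)

lemma monfun_eqI:
  fixes F G :: "('o, 'm, 'p, 'n) monfun"
  shows "[|fob F = fob G; fmor F = fmor G; fc F = fc G; fi F = fi G|] ==> F = G"
  by simp

lemma pi_monfun_eqI:
  fixes F G :: "('o, 'm, 'p, 'n) pi_monfun"
  shows "[|fob F = fob G; fmor F = fmor G; fc F = fc G; fi F = fi G; fj F = fj G|] ==> F = G"
  by simp

lemma monoidal_supercategory_if_pi: "monoidal_pi_supercategory K A ==> monoidal_supercategory K A"
  unfolding monoidal_pi_supercategory_def by blast

lemma category_Pi_SMon: "category (Pi_SMon K :: (('k, 'o, 'm) pi_monsupercat, _) cat)"
  unfolding Pi_SMon_def
proof (rule category_monoidal; (unfold mem_Collect_eq)?)
  fix A B :: "('k, 'o, 'm) pi_monsupercat" and F :: "('o, 'm, 'o, 'm) monfun"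
  assume a: "monoidal_pi_supercategory K A" "monoidal_pi_supercategory K B" "monoidal_superfunctor K A B F"
  note m = monoidal_supercategory_if_pi[OF a(1)] monoidal_supercategory_if_pi[OF a(2)]
  interpret F: monoidal_functor_between K A B F by (rule monoidal_functor_between_super[OF m a(3)])
  have "comp_monfun A B F (id_monfun A) = F" "comp_monfun A B (id_monfun B) F = F"
    by (rule monfun_eqI; simp add: F.comp_id_monfun F.id_comp_monfun)+
  then show "monoidal_superfunctor K A B (comp_monfun A B F (id_monfun A)) \<and>
      comp_monfun A B F (id_monfun A) = F \<and> comp_monfun A B (id_monfun B) F = F" using a by simp
next
  fix A B C D :: "('k, 'o, 'm) pi_monsupercat" and F G H :: "('o, 'm, 'o, 'm) monfun"
  assume a: "monoidal_pi_supercategory K A" "monoidal_pi_supercategory K B"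
    "monoidal_pi_supercategory K C" "monoidal_pi_supercategory K D"
    "monoidal_superfunctor K A B F" "monoidal_superfunctor K B C G" "monoidal_superfunctor K C D H"
  note m = a(1-4)[THEN monoidal_supercategory_if_pi]
  show "comp_monfun A D (comp_monfun B D H G) F = comp_monfun A D H (comp_monfun A C G F)"
    by (rule comp_monfun_assoc; rule composable.intro; rule monoidal_functor_between_super)
       (use m a in auto)
qed (auto intro: monoidal_superfunctor_comp monoidal_superfunctor_id monoidal_supercategory_if_pi)

lemma monoidal_pi_functor_linear: "monoidal_pi_functor K A B F ==> linear_monoidal_functor K A B F"
  unfolding monoidal_pi_functor_def by blast

lemma monoidal_pi_category_linear: "monoidal_pi_category K A ==> linear_monoidal_category K A"
  unfolding monoidal_pi_category_def by blast

lemma pi_monfun_comp_simps [simp]: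
  "fob (comp_pi_monfun A C G F) = fob (comp_monfun A C G F)"
  "fmor (comp_pi_monfun A C G F) = fmor (comp_monfun A C G F)"
  "fc (comp_pi_monfun A C G F) = fc (comp_monfun A C G F)"
  "fi (comp_pi_monfun A C G F) = fi (comp_monfun A C G F)"
  "fj (comp_pi_monfun A C G F) = fmor G (fj F) $\<^bsub>C\<^esub> fj G"
  by (simp_all add: comp_pi_monfun_def monfun.defs pi_monfun.defs comp_monfun_def)

lemma pi_monfun_id_simps [simp]:
  "fob (id_pi_monfun A) = fob (id_monfun A)"
  "fmor (id_pi_monfun A) = fmor (id_monfun A)"
  "fc (id_pi_monfun A) = fc (id_monfun A)"
  "fi (id_pi_monfun A) = fi (id_monfun A)"
  "fj (id_pi_monfun A) = Ident A (pi_ob A)"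
  by (simp_all add: id_pi_monfun_def monfun.defs pi_monfun.defs id_monfun_def)

text \<open>These axioms read only the fields that a \<Pi>-functor shares with a monoidal functor,
  so the results on composites and identities carry over to the extended records.\<close>

lemma linear_functor_fields:
  "[|fob F = fob G; fmor F = fmor G|] ==> linear_functor K A B F \<longleftrightarrow> linear_functor K A B G"
  unfolding linear_functor_def linear_functor_axioms_def is_functor_def by simp

lemma coherence_fields:
  "[|fob F = fob G; fmor F = fmor G; fc F = fc G; fi F = fi G|]
    ==> monoidal_functor_coherence A B F \<longleftrightarrow> monoidal_functor_coherence A B G"
  unfolding monoidal_functor_coherence_def by simp

text \<open>As for the tensor coherence, the axioms on \<open>fj F\<close> are transported by
  \<open>G\<close> and joined to those on \<open>fj G\<close> by naturality of
  \<open>fc G\<close>.\<close>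

lemma monoidal_pi_functor_comp:
  fixes A :: "('k, 'o, 'm) pi_moncat" and B :: "('k, 'p, 'n) pi_moncat" and C :: "('k, 'q, 'l) pi_moncat" (structure)
  assumes A: "monoidal_pi_category K A" and B: "monoidal_pi_category K B" and C: "monoidal_pi_category K C"
    and F: "monoidal_pi_functor K A B F" and G: "monoidal_pi_functor K B C G"
  shows "monoidal_pi_functor K A C (comp_pi_monfun A C G F)"
proof -
  interpret A: monoidal_pi_category K A "pi_ob A" "half_braiding A" "xi A"
    using A unfolding monoidal_pi_category_def by simp
  interpret B: monoidal_pi_category K B "pi_ob B" "half_braiding B" "xi B" using B by simp
  interpret C: monoidal_pi_category K C "pi_ob C" "half_braiding C" "xi C" using C by simp
  interpret F: monoidal_pi_functor K A B F by fact
  interpret G: monoidal_pi_functor K B C G by fact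
  interpret FG: composable K A B C F G
    using monoidal_functor_between_linear[OF _ _ monoidal_pi_functor_linear[OF F]]
      monoidal_functor_between_linear[OF _ _ monoidal_pi_functor_linear[OF G]]
      A B C by (auto intro: composable.intro dest: monoidal_pi_category_linear)
  note [simp] = A.pi_closed B.pi_closed C.pi_closed
  have j [simp]: "invertible B (fj F)" "source B (fj F) = pi_ob B" "target B (fj F) = fob F (pi_ob A)"
    "invertible C (fj G)" "source C (fj G) = pi_ob C" "target C (fj G) = fob G (pi_ob B)"
    using B.isomD[OF F.fj_iso] C.isomD[OF G.fj_iso] by simp_all
  have bA [simp]: "invertible A (half_braiding A x)" "source A (half_braiding A x) = pi_ob A *.\<^bsub>A\<^esub> x"
    "target A (half_braiding A x) = x *.\<^bsub>A\<^esub> pi_ob A" if "x \<in> Obj A" for x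
    using A.isomD[OF A.beta_iso[OF that]] that by simp_all
  have bB [simp]: "invertible B (half_braiding B x)" "source B (half_braiding B x) = pi_ob B *.\<^bsub>B\<^esub> x"
    "target B (half_braiding B x) = x *.\<^bsub>B\<^esub> pi_ob B" if "x \<in> Obj B" for x
    using B.isomD[OF B.beta_iso[OF that]] that by simp_all
  have bC [simp]: "invertible C (half_braiding C x)" "source C (half_braiding C x) = pi_ob C *. x"
    "target C (half_braiding C x) = x *. pi_ob C" if "x \<in> Obj C" for x
    using C.isomD[OF C.beta_iso[OF that]] that by simp_all
  have xs [simp]: "invertible A (xi A)" "source A (xi A) = pi_ob A *.\<^bsub>A\<^esub> pi_ob A" "target A (xi A) = Unit A"
    "invertible B (xi B)" "source B (xi B) = pi_ob B *.\<^bsub>B\<^esub> pi_ob B" "target B (xi B) = Unit B"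
    "invertible C (xi C)" "source C (xi C) = pi_ob C *. pi_ob C" "target C (xi C) = Unit C"
    using A.isomD[OF A.xi_iso] B.isomD[OF B.xi_iso] C.isomD[OF C.xi_iso] by simp_all
  show ?thesis
  proof (intro monoidal_pi_functor.intro linear_monoidal_functor.intro monoidal_pi_functor_axioms.intro)
    show "linear_functor K A C (comp_pi_monfun A C G F)"
      using FG.linear_functor_comp by (subst linear_functor_fields[of _ FG.GF]) simp_all
    show "monoidal_functor_coherence A C (comp_pi_monfun A C G F)"
      using FG.coherence_comp by (subst coherence_fields[of _ FG.GF]) simp_all
    show "isom C (pi_ob C) (fob (comp_pi_monfun A C G F) (pi_ob A)) (fj (comp_pi_monfun A C G F))"
      by (intro C.invertible_isom) simp_all
  next
    fix x assume o [simp]: "x \<in> Obj A"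
    let ?Fx = "fob F x" and ?GFx = "fob G (fob F x)" and ?p = "pi_ob A" and ?q = "pi_ob B"
    have 1: "fc G (fob F ?p, ?Fx) $ (fmor G (fj F) ** Ident C ?GFx)
      = fmor G (fj F **\<^bsub>B\<^esub> Ident B ?Fx) $ fc G (?q, ?Fx)"
      using FG.G.fc_nat_refl[of "fj F" "Ident B ?Fx"] by simp
    have 2: "fc G (?Fx, fob F ?p) $ (Ident C ?GFx ** fmor G (fj F))
      = fmor G (Ident B ?Fx **\<^bsub>B\<^esub> fj F) $ fc G (?Fx, ?q)"
      using FG.G.fc_nat_refl[of "Ident B ?Fx" "fj F"] by simp
    have "fmor FG.GF (half_braiding A x) $ fc FG.GF (?p, x) $ ((fmor G (fj F) $ fj G) ** Ident C ?GFx)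
      = fmor G (fmor F (half_braiding A x)) $ fmor G (fc F (?p, x))
        $ (fc G (fob F ?p, ?Fx) $ (fmor G (fj F) ** Ident C ?GFx)) $ (fj G ** Ident C ?GFx)"
      by simp
    also have "... = fmor G (fmor F (half_braiding A x) $\<^bsub>B\<^esub> fc F (?p, x) $\<^bsub>B\<^esub> (fj F **\<^bsub>B\<^esub> Ident B ?Fx))
        $ fc G (?q, ?Fx) $ (fj G ** Ident C ?GFx)"
      unfolding 1 by (simp add: FG.G.fmor_comp)
    also have "... = fmor G (fc F (x, ?p) $\<^bsub>B\<^esub> (Ident B ?Fx **\<^bsub>B\<^esub> fj F)) $
        (fmor G (half_braiding B ?Fx) $ fc G (?q, ?Fx) $ (fj G ** Ident C ?GFx))"
      using F.fj_beta[OF o] by (simp add: FG.G.fmor_comp)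
    also have "... = fmor G (fc F (x, ?p)) $ (fmor G (Ident B ?Fx **\<^bsub>B\<^esub> fj F) $ fc G (?Fx, ?q))
        $ (Ident C ?GFx ** fj G) $ half_braiding C ?GFx"
      using G.fj_beta[of ?Fx] by (simp add: FG.G.fmor_comp)
    also have "... = fc FG.GF (x, ?p) $ (Ident C ?GFx ** (fmor G (fj F) $ fj G)) $ half_braiding C ?GFx"
      unfolding 2[symmetric] by simp
    finally show "fmor (comp_pi_monfun A C G F) (half_braiding A x) $ fc (comp_pi_monfun A C G F) (?p, x)
        $ (fj (comp_pi_monfun A C G F) ** Ident C (fob (comp_pi_monfun A C G F) x))
      = fc (comp_pi_monfun A C G F) (x, ?p) $ (Ident C (fob (comp_pi_monfun A C G F) x) ** fj (comp_pi_monfun A C G F))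
        $ half_braiding C (fob (comp_pi_monfun A C G F) x)"
      by simp
  next
    let ?p = "pi_ob A" and ?q = "pi_ob B"
    have "(fmor G (fi F) $ fi G) $ xi C
      = fmor G (fi F) $ fmor G (xi B) $ fc G (?q, ?q) $ (fj G ** fj G)"
      using G.fj_xi by simp
    also have "... = fmor G (fi F $\<^bsub>B\<^esub> xi B) $ fc G (?q, ?q) $ (fj G ** fj G)"
      by (simp add: FG.G.fmor_comp)
    also have "... = fmor G (fmor F (xi A)) $ fmor G (fc F (?p, ?p)) $ (fmor G (fj F **\<^bsub>B\<^esub> fj F) $ fc G (?q, ?q))
       $ (fj G ** fj G)"
      using F.fj_xi by (simp add: FG.G.fmor_comp)
    also have "fmor G (fj F **\<^bsub>B\<^esub> fj F) $ fc G (?q, ?q)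
      = fc G (fob F ?p, fob F ?p) $ (fmor G (fj F) ** fmor G (fj F))"
      using FG.G.fc_nat_refl[of "fj F" "fj F"] by simp
    finally show "fi (comp_pi_monfun A C G F) $ xi C = fmor (comp_pi_monfun A C G F) (xi A)
        $ fc (comp_pi_monfun A C G F) (?p, ?p) $ (fj (comp_pi_monfun A C G F) ** fj (comp_pi_monfun A C G F))"
      by simp
  qed
qed

lemma monoidal_pi_functor_id:
  fixes A :: "('k, 'o, 'm) pi_moncat"
  assumes A: "monoidal_pi_category K A"
  shows "monoidal_pi_functor K A A (id_pi_monfun A)"
proof -
  interpret A: monoidal_pi_category K A "pi_ob A" "half_braiding A" "xi A" using A by simp
  note [simp] = A.pi_closed
  have bA [simp]: "invertible A (half_braiding A x)" "source A (half_braiding A x) = pi_ob A *.\<^bsub>A\<^esub> x"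
    "target A (half_braiding A x) = x *.\<^bsub>A\<^esub> pi_ob A" if "x \<in> Obj A" for x
    using A.isomD[OF A.beta_iso[OF that]] that by simp_all
  have xs [simp]: "invertible A (xi A)" "source A (xi A) = pi_ob A *.\<^bsub>A\<^esub> pi_ob A" "target A (xi A) = Unit A"
    using A.isomD[OF A.xi_iso] by simp_all
  show ?thesis
  proof (intro monoidal_pi_functor.intro linear_monoidal_functor.intro monoidal_pi_functor_axioms.intro)
    show "linear_functor K A A (id_pi_monfun A)"
      using A.linear_functor_id by (subst linear_functor_fields[of _ "id_monfun A"]) simp_all
    show "monoidal_functor_coherence A A (id_pi_monfun A)"
      using A.coherence_id by (subst coherence_fields[of _ "id_monfun A"]) simp_all
  qed (simp_all add: A.invertible_isom)
qed

lemma category_Pi_Mon: "category (Pi_Mon K :: (('k, 'o, 'm) pi_moncat, _) cat)"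
  unfolding Pi_Mon_def
proof (rule category_monoidal; (unfold mem_Collect_eq)?)
  fix A B :: "('k, 'o, 'm) pi_moncat" and F :: "('o, 'm, 'o, 'm) pi_monfun"
  assume a: "monoidal_pi_category K A" "monoidal_pi_category K B" "monoidal_pi_functor K A B F"
  interpret F: monoidal_functor_between K A B F
    using monoidal_functor_between_linear[OF _ _ monoidal_pi_functor_linear[OF a(3)]] a
    by (auto dest: monoidal_pi_category_linear)
  interpret A: monoidal_pi_category K A "pi_ob A" "half_braiding A" "xi A" using a by simp
  interpret B: monoidal_pi_category K B "pi_ob B" "half_braiding B" "xi B" using a by simp
  interpret P: monoidal_pi_functor K A B F by fact
  note [simp] = A.pi_closed B.pi_closed
  have j: "fj F \<in> arrows B" "source B (fj F) = pi_ob B" "target B (fj F) = fob F (pi_ob A)"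
    using F.B.isomD[OF P.fj_iso] by simp_all
  have "comp_pi_monfun A B F (id_pi_monfun A) = F"
    by (rule pi_monfun_eqI) (use j F.comp_id_monfun in \<open>simp_all add: comp_monfun_def\<close>)
  moreover have "comp_pi_monfun A B (id_pi_monfun B) F = F"
    by (rule pi_monfun_eqI) (use j F.id_comp_monfun in \<open>simp_all add: comp_monfun_def\<close>)
  ultimately show "monoidal_pi_functor K A B (comp_pi_monfun A B F (id_pi_monfun A)) \<and>
      comp_pi_monfun A B F (id_pi_monfun A) = F \<and> comp_pi_monfun A B (id_pi_monfun B) F = F" using a by simp
next
  fix A B C D :: "('k, 'o, 'm) pi_moncat" and F G H :: "('o, 'm, 'o, 'm) pi_monfun"
  assume a: "monoidal_pi_category K A" "monoidal_pi_category K B"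
    "monoidal_pi_category K C" "monoidal_pi_category K D"
    "monoidal_pi_functor K A B F" "monoidal_pi_functor K B C G" "monoidal_pi_functor K C D H"
  interpret A: monoidal_pi_category K A "pi_ob A" "half_braiding A" "xi A" using a by simp
  interpret B: monoidal_pi_category K B "pi_ob B" "half_braiding B" "xi B" using a by simp
  interpret C: monoidal_pi_category K C "pi_ob C" "half_braiding C" "xi C" using a by simp
  interpret D: monoidal_pi_category K D "pi_ob D" "half_braiding D" "xi D" using a by simp
  note l = monoidal_functor_between_linear[OF _ _ monoidal_pi_functor_linear]
  interpret FG: composable K A B C F G
    using l[OF _ _ a(5)] l[OF _ _ a(6)] a
    by (auto intro: composable.intro dest: monoidal_pi_category_linear)
  interpret GH: composable K B C D G H
    using l[OF _ _ a(6)] l[OF _ _ a(7)] a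
    by (auto intro: composable.intro dest: monoidal_pi_category_linear)
  interpret F: monoidal_pi_functor K A B F by fact
  interpret G: monoidal_pi_functor K B C G by fact
  interpret H: monoidal_pi_functor K C D H by fact
  note [simp] = A.pi_closed B.pi_closed C.pi_closed D.pi_closed
  have j: "fj F \<in> arrows B" "source B (fj F) = pi_ob B" "target B (fj F) = fob F (pi_ob A)"
    "fj G \<in> arrows C" "source C (fj G) = pi_ob C" "target C (fj G) = fob G (pi_ob B)"
    "fj H \<in> arrows D" "source D (fj H) = pi_ob D" "target D (fj H) = fob H (pi_ob C)"
    using B.isomD[OF F.fj_iso] C.isomD[OF G.fj_iso] D.isomD[OF H.fj_iso] by simp_all
  have e: "comp_monfun A D (comp_monfun B D H G) F = comp_monfun A D H (comp_monfun A C G F)"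
    by (rule comp_monfun_assoc) unfold_locales
  have f: "comp_monfun A D (comp_pi_monfun B D H G) F = comp_monfun A D (comp_monfun B D H G) F"
    "comp_monfun A D H (comp_pi_monfun A C G F) = comp_monfun A D H (comp_monfun A C G F)"
    by (simp_all add: comp_monfun_def[of A D])
  show "comp_pi_monfun A D (comp_pi_monfun B D H G) F = comp_pi_monfun A D H (comp_pi_monfun A C G F)"
    by (rule pi_monfun_eqI) (use j e f in \<open>simp_all add: GH.G.fmor_comp\<close>)
qed (auto intro: monoidal_pi_functor_comp monoidal_pi_functor_id)

section \<open>The forgetful functor\<close>

context
  fixes A :: "('k, 'o, 'm) pi_monsupercat"
begin

lemma forget_pi_simps [simp]:
  "Obj (forget_pi A) = Obj A" "Hom (forget_pi A) = Hom A" "Comp (forget_pi A) = Comp A"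
  "Ident (forget_pi A) = Ident A" "TensO (forget_pi A) = TensO A" "TensM (forget_pi A) = TensM A"
  "Unit (forget_pi A) = Unit A" "Assoc (forget_pi A) = Assoc A" "Lun (forget_pi A) = Lun A"
  "Run (forget_pi A) = Run A"
  by (simp_all add: forget_pi_def moncat.defs)

lemma forget_pi_derived [simp]:
  "cat_of (forget_pi A) = cat_of A" "arrows (forget_pi A) = arrows A" "source (forget_pi A) = source A"
  "target (forget_pi A) = target A" "hom_of (forget_pi A) = hom_of A" "inverse_of (forget_pi A) = inverse_of A"
  by (simp_all add: cat_of_def arrows_def source_def target_def hom_of_def inverse_of_def fun_eq_iff)

lemma forget_pi_product [simp]: "product_supercat K (forget_pi A) (forget_pi A) = product_supercat K A A"
  by (simp add: product_supercat_def comp_sums_def)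

lemma forget_pi_pure_tensor [simp]: "pure_tensor K (forget_pi A) (forget_pi A) = pure_tensor K A A"
  by (simp add: pure_tensor_def fun_eq_iff)

lemma monoidal_supercategory_forget_pi:
  "monoidal_supercategory K (forget_pi A) \<longleftrightarrow> monoidal_supercategory K A"
  unfolding monoidal_supercategory_def monoidal_supercategory_axioms_def supercategory_def
    supercategory_axioms_def linear_category_def linear_category_axioms_def monoidal_coherence_def
    superfunctor_def superfunctor_axioms_def linear_functor_def linear_functor_axioms_def
  by simp

end

lemma monoidal_superfunctor_forget_pi:
  "monoidal_superfunctor K (forget_pi A) (forget_pi B) F \<longleftrightarrow> monoidal_superfunctor K A B F"
  unfolding monoidal_superfunctor_def monoidal_superfunctor_axioms_def monoidal_functor_coherence_def
    superfunctor_def superfunctor_axioms_def linear_functor_def linear_functor_axioms_def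
  by simp

lemma nu_functor_is_functor:
  "is_functor (Pi_SMon K :: (('k, 'o, 'm) pi_monsupercat, _) cat) (SMon K) nu_functor"
  by unfold_locales
    (auto simp: Pi_SMon_def SMon_def nu_functor_def monoidal_supercategory_forget_pi
      monoidal_superfunctor_forget_pi comp_monfun_def id_monfun_def dest: monoidal_supercategory_if_pi)

section \<open>The $\Pi$-envelope\<close>

lemma shifted_space_simps [simp]:
  "carrier (shifted_space a b V) = {a} \<times> carrier V \<times> {b}"
  "\<zero>\<^bsub>shifted_space a b V\<^esub> = (a, \<zero>\<^bsub>V\<^esub>, b)"
  "(a', f, b') \<oplus>\<^bsub>shifted_space a b V\<^esub> (a'', g, b'') = (a, f \<oplus>\<^bsub>V\<^esub> g, b)"
  "k \<odot>\<^bsub>shifted_space a b V\<^esub> (a', f, b') = (a, k \<odot>\<^bsub>V\<^esub> f, b)"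
  "hpart (shifted_space a b V) p = {a} \<times> hpart V (p + a + b) \<times> {b}"
  by (simp_all add: shifted_space_def)

lemma module_shifted_space:
  assumes "module K V"
  shows "module K (shifted_space a b V)"
proof -
  interpret module K V by fact
  show ?thesis
  proof (rule moduleI)
    show "abelian_group (shifted_space a b V)"
    proof (rule abelian_groupI)
      fix x assume "x \<in> carrier (shifted_space a b V)"
      then obtain v where "x = (a, v, b)" "v \<in> carrier V" by auto
      then show "\<exists>y\<in>carrier (shifted_space a b V). y \<oplus>\<^bsub>shifted_space a b V\<^esub> x = \<zero>\<^bsub>shifted_space a b V\<^esub>"
        by (intro bexI[of _ "(a, \<ominus>\<^bsub>V\<^esub> v, b)"]) (auto simp: M.l_neg)
    qed (auto simp: M.a_ac)
  qed (auto simp: smult_l_distr smult_r_distr smult_assoc1 R.is_cring)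
qed

lemma signed_shifted_space:
  assumes "module K V" "v \<in> carrier V"
  shows "signed (shifted_space a b V) e (a, v, b) = (a, signed V e v, b)"
proof -
  interpret V: module K V by fact
  interpret S: module K "shifted_space a b V" by (rule module_shifted_space) fact
  have "\<ominus>\<^bsub>shifted_space a b V\<^esub> (a, v, b) = (a, \<ominus>\<^bsub>V\<^esub> v, b)"
    by (rule S.M.minus_equality) (use assms(2) in \<open>auto simp: V.M.l_neg\<close>)
  then show ?thesis by (simp add: signed_def)
qed

text \<open>The even part of the shifted space is the part of parity \<open>a + b\<close>, which may
  be the odd part of \<open>V\<close>; this is why decompositions starting at an arbitrary parity
  are available.\<close>

lemma superspace_shifted_space:
  fixes V :: "('k, 'm) superspace"
  assumes "superspace K V"
  shows "superspace K (shifted_space a b V)"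
proof -
  interpret V: superspace K V by fact
  interpret S: module K "shifted_space a b V" by (rule module_shifted_space) unfold_locales
  show ?thesis
  proof (intro superspace.intro superspace_axioms.intro S.module_axioms)
    fix p
    show "submodule (hpart (shifted_space a b V) p) K (shifted_space a b V)"
    proof (rule S.submoduleI)
      fix x assume "x \<in> hpart (shifted_space a b V) p"
      then obtain v where "x = (a, v, b)" "v \<in> hpart V (p + a + b)" by auto
      then show "\<ominus>\<^bsub>shifted_space a b V\<^esub> x \<in> hpart (shifted_space a b V) p"
        using signed_shifted_space[OF V.module_axioms V.hpart_carrier, of v _ a b 1] by (auto simp: signed_def)
    qed (auto simp: V.hpart_carrier)
  next
    fix x assume "x \<in> carrier (shifted_space a b V)"
    then obtain v where v: "x = (a, v, b)" "v \<in> carrier V" by auto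
    obtain u w where uw: "u \<in> hpart V (0 + a + b)" "w \<in> hpart V ((0 + a + b) + 1)" "v = u \<oplus>\<^bsub>V\<^esub> w"
      using V.decomposition_ex[OF v(2), of "0 + a + b"] by blast
    have e: "0 + a + b + 1 = 1 + a + b" by (simp add: ac_simps)
    show "\<exists>!(u, w). u \<in> hpart (shifted_space a b V) 0 \<and> w \<in> hpart (shifted_space a b V) 1 \<and> x = u \<oplus>\<^bsub>shifted_space a b V\<^esub> w"
    proof (rule ex1I[of _ "((a, u, b), (a, w, b))"])
      show "case ((a, u, b), a, w, b) of (u, w) \<Rightarrow> u \<in> hpart (shifted_space a b V) 0 \<and>
        w \<in> hpart (shifted_space a b V) 1 \<and> x = u \<oplus>\<^bsub>shifted_space a b V\<^esub> w"
        using uw v unfolding e by simp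
    next
      fix z :: "(bit \<times> 'm \<times> bit) \<times> (bit \<times> 'm \<times> bit)"
      obtain c1 u' c2 c3 w' c4 where z: "z = ((c1, u', c2), (c3, w', c4))" by (metis surj_pair)
      assume "case z of (u, w) \<Rightarrow> u \<in> hpart (shifted_space a b V) 0 \<and>
        w \<in> hpart (shifted_space a b V) 1 \<and> x = u \<oplus>\<^bsub>shifted_space a b V\<^esub> w"
      then show "z = ((a, u, b), (a, w, b))"
        unfolding z using V.decomposition_unique[OF uw(1,2), of u' w'] v uw unfolding e by simp
    qed
  qed
qed

lemma linear_map_shifted_space:
  assumes "linear_map K V W f" "!!v. v \<in> carrier V ==> \<phi> (a, v, b) = (c, f v, d)" "module K V"
  shows "linear_map K (shifted_space a b V) (shifted_space c d W) \<phi>"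
proof -
  interpret module K V by fact
  show ?thesis using assms(1,2) unfolding linear_map_def by (auto simp: Pi_iff)
qed

lemma (in module) finsum_parities:
  assumes "!!r. t r \<in> carrier M"
  shows "finsum M t ({0 :: bit, 1} \<times> {0 :: bit, 1}) = t (0, 0) \<oplus>\<^bsub>M\<^esub> (t (0, 1) \<oplus>\<^bsub>M\<^esub> (t (1, 0) \<oplus>\<^bsub>M\<^esub> t (1, 1)))"
proof -
  have "{0 :: bit, 1} \<times> {0 :: bit, 1} = {(0, 0), (0, 1), (1, 0), (1, 1)}" by auto
  then show ?thesis using assms by (simp add: Pi_iff M.finsum_insert)
qed

section \<open>Homogeneous components of the envelope tensor product\<close>

context tensor_supercategory
begin

lemma hcomp_arrow:
  assumes "ar f"
  shows "hmg A p (hcomp (hom_of A f) p f)" "src (hcomp (hom_of A f) p f) = src f"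
    "tgt (hcomp (hom_of A f) p f) = tgt f"
  using superspace.hcomp_hpart[OF superspace_Hom, of "src f" "tgt f" f p] arrows_hom[OF assms]
  by (auto simp: hom_of_def hpart_iff_hmg)

text \<open>The summands in the middle component of \<open>envelope_TensM\<close>, with the sign
  attached to arrows. The exponent depends on both source shifts and on the target shift of the
  second factor.\<close>

definition env_term :: "bit \<Rightarrow> bit \<Rightarrow> bit \<Rightarrow> 'm \<Rightarrow> 'm \<Rightarrow> bit \<times> bit \<Rightarrow> 'm" where
  "env_term a c d f g = (%(p, q). sgn_arr A (a * q + p * d + a * d + a * c)
     (hcomp (hom_of A f) p f ** hcomp (hom_of A g) q g))"

definition env_tensor :: "bit \<Rightarrow> bit \<Rightarrow> bit \<Rightarrow> 'm \<Rightarrow> 'm \<Rightarrow> 'm" where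
  "env_tensor a c d f g = finsum (Hm (src f *. src g) (tgt f *. tgt g))
     (env_term a c d f g) ({0, 1} \<times> {0, 1})"

lemma env_term_arrow:
  assumes "ar f" "ar g"
  shows "env_term a c d f g r \<in> Arr" "src (env_term a c d f g r) = src f *. src g"
    "tgt (env_term a c d f g r) = tgt f *. tgt g"
  using hcomp_arrow[OF assms(1)] hcomp_arrow[OF assms(2)]
  by (simp_all add: env_term_def case_prod_beta hmg_arrow[of "fst r"] hmg_arrow[of "snd r"])

lemma env_tensor_sum:
  assumes "ar f" "ar g" "W = Hm (src f *. src g) (tgt f *. tgt g)"
  shows "env_tensor a c d f g = env_term a c d f g (0, 0) \<oplus>\<^bsub>W\<^esub>
    (env_term a c d f g (0, 1) \<oplus>\<^bsub>W\<^esub> (env_term a c d f g (1, 0) \<oplus>\<^bsub>W\<^esub> env_term a c d f g (1, 1)))"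
proof -
  interpret W: module K W unfolding assms(3) using assms by (intro module_Hom) auto
  show ?thesis unfolding env_tensor_def assms(3)[symmetric]
    by (rule W.finsum_parities) (simp add: assms(3) homI env_term_arrow[OF assms(1,2)])
qed

lemma bilinear_env_tensor:
  assumes o: "Ob x" "Ob x'" "Ob y" "Ob y'"
  shows "bilinear_map K (Hm x x') (Hm y y') (Hm (x *. y) (x' *. y')) (env_tensor a c d)"
proof -
  let ?U = "Hm x x'" and ?V = "Hm y y'" and ?W = "Hm (x *. y) (x' *. y')"
  interpret U: superspace K ?U using o by (intro superspace_Hom)
  interpret V: superspace K ?V using o by (intro superspace_Hom)
  interpret W: superspace K ?W using o by (intro superspace_Hom) auto
  let ?t = "%f g (p, q). signed ?W (a * q + p * d + a * d + a * c) (hcomp ?U p f ** hcomp ?V q g)"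
  have t: "env_term a c d f g r = ?t f g r" if "f \<in> carrier ?U" "g \<in> carrier ?V" for f g r
  proof -
    note h = homD[OF that(1) o(1,2)] homD[OF that(2) o(3,4)]
    have u: "hom_of A f = ?U" "hom_of A g = ?V" by (simp_all add: hom_of_def h)
    show ?thesis
      using hcomp_arrow[OF h(1), of "fst r", unfolded u] hcomp_arrow[OF h(4), of "snd r", unfolded u] h
        hmg_arrow[of "fst r" "hcomp ?U (fst r) f"] hmg_arrow[of "snd r" "hcomp ?V (snd r) g"]
      unfolding env_term_def u by (simp add: case_prod_beta sgn_arr_signed)
  qed
  have lr: "linear_map K ?V ?W (%g. ?t f g r)" if "f \<in> carrier ?U" for f r
    unfolding case_prod_beta
    by (rule linear_map_signed_compose[OF W.module_axioms lin_compose[OF bilinear_map_right[OF bilinear_TensM[OF o]]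
          V.linear_map_hcomp]]) (use that in auto)
  have ll: "linear_map K ?U ?W (%f. ?t f g r)" if "g \<in> carrier ?V" for g r
    unfolding case_prod_beta
    by (rule linear_map_signed_compose[OF W.module_axioms lin_compose[OF bilinear_map_left[OF bilinear_TensM[OF o]]
          U.linear_map_hcomp]]) (use that in auto)
  have e: "env_tensor a c d f g = ?t f g (0, 0) \<oplus>\<^bsub>?W\<^esub> (?t f g (0, 1) \<oplus>\<^bsub>?W\<^esub> (?t f g (1, 0) \<oplus>\<^bsub>?W\<^esub> ?t f g (1, 1)))"
    if "f \<in> carrier ?U" "g \<in> carrier ?V" for f g
    using env_tensor_sum[of f g ?W a c d] homD[OF that(1) o(1,2)] homD[OF that(2) o(3,4)] t[OF that] by simp
  note p = linear_map_plus[OF _ W.module_axioms]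
  have "linear_map K ?V ?W (env_tensor a c d f)" if f: "f \<in> carrier ?U" for f
    by (rule linear_map_cong[OF e[OF f] V.module_axioms, THEN iffD2, OF _ p[OF V.module_axioms lr[OF f]
          p[OF V.module_axioms lr[OF f] p[OF V.module_axioms lr[OF f] lr[OF f]]]]])
  moreover have "linear_map K ?U ?W (%f. env_tensor a c d f g)" if g: "g \<in> carrier ?V" for g
    by (rule linear_map_cong[OF e[OF _ g] U.module_axioms, THEN iffD2, OF _ p[OF U.module_axioms ll[OF g]
          p[OF U.module_axioms ll[OF g] p[OF U.module_axioms ll[OF g] ll[OF g]]]]])
  ultimately show ?thesis unfolding bilinear_map_def by blast
qed

text \<open>For homogeneous arguments three of the four summands contain a vanishing component,
  which leaves the formula that defines the tensor product of the envelope.\<close>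

lemma env_tensor_homogeneous:
  assumes "hmg A p f" "hmg A q g"
  shows "env_tensor a c d f g = sgn_arr A (a * q + p * d + a * d + a * c) (f ** g)"
proof -
  note f = hmg_arrow[OF assms(1)] and g = hmg_arrow[OF assms(2)]
  let ?W = "Hm (src f *. src g) (tgt f *. tgt g)"
  interpret W: module K ?W using f g by (intro module_Hom) auto
  interpret U: superspace K "hom_of A f" unfolding hom_of_def using f by (intro superspace_Hom) auto
  interpret V: superspace K "hom_of A g" unfolding hom_of_def using g by (intro superspace_Hom) auto
  have b: "bilinear_map K (hom_of A f) (hom_of A g) ?W (TensM A)"
    unfolding hom_of_def using f g by (intro bilinear_TensM) auto
  have h: "f \<in> hpart (hom_of A f) p" "g \<in> hpart (hom_of A g) q" using assms unfolding hmg_def by auto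
  have z: "env_term a c d f g (r, s) = \<zero>\<^bsub>?W\<^esub>" if "r \<noteq> p \<or> s \<noteq> q" for r s
  proof -
    have fg: "u ** v = \<zero>\<^bsub>?W\<^esub>" if "u \<in> carrier (hom_of A f)" "v \<in> carrier (hom_of A g)"
      "u = \<zero>\<^bsub>hom_of A f\<^esub> \<or> v = \<zero>\<^bsub>hom_of A g\<^esub>" for u v
      using linear_map_zero[OF V.module_axioms W.module_axioms bilinear_map_right[OF b that(1)]]
        linear_map_zero[OF U.module_axioms W.module_axioms bilinear_map_left[OF b that(2)]] that(3) by auto
    have "hcomp (hom_of A f) r f ** hcomp (hom_of A g) s g = \<zero>\<^bsub>?W\<^esub>"
      by (rule fg) (use that U.hcomp_other[OF h(1), of r] V.hcomp_other[OF h(2), of s] arrow_hom_of f g in auto)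
    moreover have "sgn_arr A e \<zero>\<^bsub>?W\<^esub> = \<zero>\<^bsub>?W\<^esub>" for e
      using sgn_arr_hom[OF W.M.zero_closed, of e] f g by simp
    ultimately show ?thesis by (simp add: env_term_def)
  qed
  have pq: "env_term a c d f g (p, q) = sgn_arr A (a * q + p * d + a * d + a * c) (f ** g)"
    using h by (simp add: env_term_def)
  have c: "env_term a c d f g (p, q) \<in> carrier ?W" using env_term_arrow[OF f g, of a c d "(p, q)"] by (intro homI) auto
  have "env_tensor a c d f g = env_term a c d f g (p, q)"
    unfolding env_tensor_sum[OF f g HOL.refl]
  proof (cases p; cases q)
  qed (use z c in auto)
  then show ?thesis using pq by simp
qed

end

locale even_monoidal = monoidal_supercategory K A + tensor_supercategory K A
  for K :: "'k ring" and A :: "('k, 'o, 'm, ('m, unit) superspace_ext, 'z) moncat_scheme" (structure)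
begin

lemma coherence_even [simp]:
  "[|Ob x; Ob y; Ob z|] ==> hmg A 0 (Assoc A x y z)"
  "Ob x ==> hmg A 0 (Lun A x)" "Ob x ==> hmg A 0 (Run A x)"
  using Assoc_even[of x y z] Lun_even[of x] Run_even[of x] by (simp_all add: hpart_iff_hmg)

end

lemma even_monoidal: "monoidal_supercategory K A ==> even_monoidal K A"
  by (intro even_monoidal.intro tensor_if_monoidal)

locale pi_envelope = even_monoidal K A
  for K :: "'k ring" and A :: "('k, 'o, 'm) monsupercat" (structure)
begin

abbreviation "E \<equiv> envelope A"

lemma envelope_simps [simp]:
  "Obj E = UNIV \<times> Obj A" "Hom E (a, x) (b, y) = shifted_space a b (Hm x y)"
  "Comp E (b, f, c) (a, g, b') = (a, f $ g, c)" "Ident E (a, x) = (a, I x, a)"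
  "TensO E (a, x) (b, y) = (a + b, x *. y)" "Unit E = (0, Unit A)"
  "Assoc E (a, x) (b, y) (c, z) = (a + b + c, Assoc A x y z, a + b + c)"
  "Lun E (a, x) = (a, Lun A x, a)" "Run E (a, x) = (a, Run A x, a)"
  "pi_obj E = (1, Unit A)" "zeta E = (1, I (Unit A), 0)"
  by (simp_all add: envelope_def)

lemma category_envelope: "category (cat_of E)"
proof (unfold_locales; (unfold cat_of_simps)?)
  fix X Y Z f g assume "X \<in> Obj E" "Y \<in> Obj E" "Z \<in> Obj E" "f \<in> homset E X Y" "g \<in> homset E Y Z"
  then show "Comp E g f \<in> homset E X Z" by (auto simp: hom_iff)
next
  fix W X Y Z f g h
  assume "W \<in> Obj E" "X \<in> Obj E" "Y \<in> Obj E" "Z \<in> Obj E" "f \<in> homset E W X" "g \<in> homset E X Y" "h \<in> homset E Y Z"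
  then show "Comp E (Comp E h g) f = Comp E h (Comp E g f)" by (auto simp: hom_iff)
next
  fix X Y X' Y' f assume "X \<in> Obj E" "Y \<in> Obj E" "X' \<in> Obj E" "Y' \<in> Obj E" "f \<in> homset E X Y" "f \<in> homset E X' Y'"
  then show "X = X' \<and> Y = Y'" by (auto simp: hom_iff)
qed (auto simp: hom_iff)

lemma supercategory_envelope: "supercategory K E"
proof (intro supercategory.intro linear_category.intro category_envelope linear_category_axioms.intro supercategory_axioms.intro)
  fix X Y assume "X \<in> Obj E" "Y \<in> Obj E"
  then show "module K (Hom E X Y)" "superspace K (Hom E X Y)"
    by (auto intro!: module_shifted_space superspace_shifted_space module_Hom superspace_Hom)
next
  fix X Y Z assume "X \<in> Obj E" "Y \<in> Obj E" "Z \<in> Obj E"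
  then obtain a x b y c z where o: "X = (a, x)" "Y = (b, y)" "Z = (c, z)" "Ob x" "Ob y" "Ob z" by auto
  show "bilinear_map K (Hom E Y Z) (Hom E X Y) (Hom E X Z) (Comp E)"
    unfolding bilinear_map_def
  proof (intro conjI ballI)
    fix g assume "g \<in> homset E Y Z"
    then obtain g' where g: "g = (b, g', c)" "g' \<in> hs y z" by (auto simp: o)
    show "linear_map K (Hom E X Y) (Hom E X Z) (Comp E g)"
      unfolding o envelope_simps
      by (rule linear_map_shifted_space[OF bilinear_map_right[OF bilinear_Comp[of x y z] g(2)]])
         (use o g module_Hom in auto)
  next
    fix g assume "g \<in> homset E X Y"
    then obtain g' where g: "g = (a, g', b)" "g' \<in> hs x y" by (auto simp: o)
    show "linear_map K (Hom E Y Z) (Hom E X Z) (%f. Comp E f g)"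
      unfolding o envelope_simps
      by (rule linear_map_shifted_space[OF bilinear_map_left[OF bilinear_Comp[of x y z] g(2)]])
         (use o g module_Hom in auto)
  qed
next
  fix X Y Z f g p q assume "X \<in> Obj E" "Y \<in> Obj E" "Z \<in> Obj E" "g \<in> hpart (Hom E Y Z) p" "f \<in> hpart (Hom E X Y) q"
  then obtain a x b y c z f' g' where o: "X = (a, x)" "Y = (b, y)" "Z = (c, z)" "Ob x" "Ob y" "Ob z"
    "g = (b, g', c)" "g' \<in> hpart (Hm y z) (p + b + c)" "f = (a, f', b)" "f' \<in> hpart (Hm x y) (q + a + b)" by auto
  have e: "p + b + c + (q + a + b) = p + q + a + c" by (simp add: ac_simps)
  show "Comp E g f \<in> hpart (Hom E X Z) (p + q)" using parity_Comp[OF o(4-6,8,10), unfolded e] o by simp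
qed

sublocale E: supercategory K E by (rule supercategory_envelope)

lemma envelope_arrows [simp]: "(a, f, b) \<in> arrows E \<longleftrightarrow> f \<in> Arr"
  unfolding arrows_def by auto

lemma envelope_source [simp]:
  assumes "ar f"
  shows "source E (a, f, b) = (a, src f)" "target E (a, f, b) = (b, tgt f)"
  using E.homD[of "(a, f, b)" "(a, src f)" "(b, tgt f)"] arrows_hom[OF assms] by auto

lemma envelope_arrowE:
  assumes "F \<in> arrows E"
  obtains a f b where "F = (a, f, b)" "ar f"
  using assms by (metis envelope_arrows surj_pair)

lemma envelope_hmg [simp]: "hmg E p (a, f, b) \<longleftrightarrow> hmg A (p + a + b) f"
proof
  assume h: "hmg E p (a, f, b)"
  then have f: "ar f" using E.hmg_arrow by fastforce
  then show "hmg A (p + a + b) f" using h unfolding hmg_def by (simp add: hom_of_def)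
next
  assume h: "hmg A (p + a + b) f"
  then have f: "ar f" using hmg_arrow by fastforce
  then show "hmg E p (a, f, b)" using h unfolding hmg_def by (simp add: hom_of_def)
qed

lemma envelope_sgn [simp]: "ar f ==> sgn_arr E e (a, f, b) = (a, sgn_arr A e f, b)"
  unfolding sgn_arr_def hom_of_def
  by (simp add: signed_shifted_space[OF module_Hom] arrows_hom)

lemma envelope_invertible:
  assumes "invertible A f"
  shows "invertible E (a, f, b)" "inverse_of E (a, f, b) = (b, ivs f, a)"
  by (rule E.inverse_of_eqI(2)[of _ "(b, ivs f, a)"]; use assms in simp)
     (rule E.inverse_of_eqI(1); use assms in simp)

lemma envelope_TensM_eq:
  assumes "ar f" "ar g"
  shows "TensM E (a, f, b) (c, g, d) = (a + c, env_tensor a c d f g, b + d)"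
proof -
  let ?W = "Hm (src f *. src g) (tgt f *. tgt g)"
  interpret W: module K ?W using assms by (intro module_Hom) auto
  have "signed ?W (a * q + p * d + a * d + a * c) (hcomp (hom_of A f) p f ** hcomp (hom_of A g) q g)
     = env_term a c d f g (p, q)" for p q
    using hcomp_arrow[OF assms(1), of p] hcomp_arrow[OF assms(2), of q]
      hmg_arrow[of p "hcomp (hom_of A f) p f"] hmg_arrow[of q "hcomp (hom_of A g) q g"]
    by (simp add: env_term_def sgn_arr_signed)
  then show ?thesis
    by (simp add: envelope_def envelope_TensM_def env_tensor_def Let_def case_prod_unfold)
qed

lemma envelope_TensM [simp]:
  assumes "hmg A p f" "hmg A q g"
  shows "TensM E (a, f, b) (c, g, d) = (a + c, sgn_arr A (a * q + p * d + a * d + a * c) (f ** g), b + d)"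
  using envelope_TensM_eq[OF hmg_arrow[OF assms(1)] hmg_arrow[OF assms(2)]] env_tensor_homogeneous[OF assms] by simp

text \<open>A morphism of the envelope is a morphism of \<open>A\<close> with two shifts, so every
  axiom reduces to the one in \<open>A\<close> together with an identity between sign
  exponents.\<close>

lemma graded_tensor_envelope: "graded_tensor K E"
proof
  fix X Y assume "X \<in> Obj E" "Y \<in> Obj E"
  then show "TensO E X Y \<in> Obj E" by auto
next
  fix X Y Z assume "X \<in> Obj E" "Y \<in> Obj E" "Z \<in> Obj E"
  then obtain a x b y c z where o: "X = (a, x)" "Y = (b, y)" "Z = (c, z)" "Ob x" "Ob y" "Ob z" by auto
  then show "invertible E (Assoc E X Y Z) \<and> hmg E 0 (Assoc E X Y Z) \<and>
    source E (Assoc E X Y Z) = TensO E (TensO E X Y) Z \<and> target E (Assoc E X Y Z) = TensO E X (TensO E Y Z)"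
    by (simp add: envelope_invertible ac_simps)
next
  fix X assume "X \<in> Obj E"
  then show "invertible E (Lun E X) \<and> hmg E 0 (Lun E X) \<and> source E (Lun E X) = TensO E (Unit E) X \<and> target E (Lun E X) = X"
    "invertible E (Run E X) \<and> hmg E 0 (Run E X) \<and> source E (Run E X) = TensO E X (Unit E) \<and> target E (Run E X) = X"
    by (auto simp: envelope_invertible)
next
  fix X X' Y Y' assume "X \<in> Obj E" "X' \<in> Obj E" "Y \<in> Obj E" "Y' \<in> Obj E"
  then obtain a x b x' c y d y' where o: "X = (a, x)" "X' = (b, x')" "Y = (c, y)" "Y' = (d, y')"
    "Ob x" "Ob x'" "Ob y" "Ob y'" by auto
  note bl = bilinear_env_tensor[OF o(5-8), of a c d]
  show "bilinear_map K (Hom E X X') (Hom E Y Y') (Hom E (TensO E X Y) (TensO E X' Y')) (TensM E)"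
    unfolding bilinear_map_def
  proof (intro conjI ballI)
    fix F assume "F \<in> homset E X X'"
    then obtain f where f: "F = (a, f, b)" "f \<in> hs x x'" by (auto simp: o)
    show "linear_map K (Hom E Y Y') (Hom E (TensO E X Y) (TensO E X' Y')) (TensM E F)"
      unfolding o envelope_simps
      by (rule linear_map_shifted_space[OF bilinear_map_right[OF bl f(2)]])
         (use o f module_Hom envelope_TensM_eq in \<open>auto simp: hom_iff\<close>)
  next
    fix F assume "F \<in> homset E Y Y'"
    then obtain f where f: "F = (c, f, d)" "f \<in> hs y y'" by (auto simp: o)
    show "linear_map K (Hom E X X') (Hom E (TensO E X Y) (TensO E X' Y')) (%G. TensM E G F)"
      unfolding o envelope_simps
      by (rule linear_map_shifted_space[OF bilinear_map_left[OF bl f(2)]])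
         (use o f module_Hom envelope_TensM_eq in \<open>auto simp: hom_iff\<close>)
  qed
next
  fix X Y assume "X \<in> Obj E" "Y \<in> Obj E"
  then show "TensM E (Ident E X) (Ident E Y) = Ident E (TensO E X Y)"
    by (auto simp: envelope_TensM[of 0 _ 0])
next
  fix p q F G assume h: "hmg E p F" "hmg E q G"
  obtain a f b where F: "F = (a, f, b)" by (cases F)
  obtain c g d where G: "G = (c, g, d)" by (cases G)
  have fg: "hmg A (p + a + b) f" "hmg A (q + c + d) g" using h by (simp_all add: F G)
  have e: "p + a + b + (q + c + d) = p + q + (a + c) + (b + d)" by (simp add: ac_simps)
  show "hmg E (p + q) (TensM E F G)"
    using hmg_sgn[OF hmg_TensM_gen[OF fg, unfolded e]] unfolding F G envelope_TensM[OF fg] by simp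
next
  fix r p q s F G H J assume h: "hmg E r F" "hmg E p G" "hmg E q H" "hmg E s J"
    and t: "target E H = source E F" "target E J = source E G"
  obtain b f b' where F: "F = (b, f, b')" by (cases F)
  obtain d g d' where G: "G = (d, g, d')" by (cases G)
  obtain a h' b1 where H: "H = (a, h', b1)" by (cases H)
  obtain c k d1 where J: "J = (c, k, d1)" by (cases J)
  \<comment> \<open>These are the parities in \<open>A\<close>. The parities in the envelope differ
    from them by the shifts, and the exponents are compared as polynomials in the parities of
    \<open>A\<close> and the shifts.\<close>
  define fr where "fr = r + b + b'"
  define gp where "gp = p + d + d'"
  have p: "p = gp + d + d'" by (simp add: gp_def ac_simps)
  define hq where "hq = q + a + b1"
  have q: "q = hq + a + b1" by (simp add: hq_def ac_simps)
  define ks where "ks = s + c + d1"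
  have A: "hmg A fr f" "hmg A gp g" "hmg A hq h'" "hmg A ks k"
    using h by (simp_all add: F G H J fr_def gp_def hq_def ks_def)
  note [simp] = A[THEN hmg_arrow]
  have [simp]: "b1 = b" "d1 = d" and t' [simp]: "tgt h' = src f" "tgt k = src g"
    using t by (simp_all add: F G H J)
  have fh: "hmg A (fr + hq) (f $ h')" "hmg A (gp + ks) (g $ k)"
    using hmg_comp_gen[OF A(3,1)] hmg_comp_gen[OF A(4,2)] by simp_all
  have "Comp E (TensM E F G) (TensM E H J)
    = (a + c, sgn_arr A (b * gp + fr * d' + b * d' + b * d + (a * ks + hq * d + a * d + a * c) + gp * hq)
        ((f $ h') ** (g $ k)), b' + d')"
    unfolding F G H J envelope_TensM[OF A(1,2)] envelope_TensM[OF A(3,4)]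
    using TensM_comp_gen[OF _ A(2,3), of f k] by (simp add: ac_simps)
  moreover have "TensM E (Comp E F H) (Comp E G J) = (a + c, sgn_arr A (a * (gp + ks) + (fr + hq) * d' + a * d' + a * c)
      ((f $ h') ** (g $ k)), b' + d')"
    unfolding F G H J envelope_simps by (simp add: envelope_TensM[OF fh])
  \<comment> \<open>The sign in the tensor product of the envelope is made for this identity over
    Z/2: the product \<open>p * q\<close> of shifted parities supplies precisely the cross terms by
    which the two sides differ.\<close>
  moreover have "b * gp + fr * d' + b * d' + b * d + (a * ks + hq * d + a * d + a * c) + gp * hq
    = p * q + (a * (gp + ks) + (fr + hq) * d' + a * d' + a * c)"
    unfolding p q by (simp add: algebra_simps)
  ultimately show "Comp E (TensM E F G) (TensM E H J) = sgn_arr E (p * q) (TensM E (Comp E F H) (Comp E G J))"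
    by simp
next
  fix p q r F G H assume h: "hmg E p F" "hmg E q G" "hmg E r H"
  obtain a f b where F: "F = (a, f, b)" by (cases F)
  obtain c g d where G: "G = (c, g, d)" by (cases G)
  obtain e k e' where H: "H = (e, k, e')" by (cases H)
  have A: "hmg A (p + a + b) f" "hmg A (q + c + d) g" "hmg A (r + e + e') k"
    using h by (simp_all add: F G H)
  note [simp] = A[THEN hmg_arrow]
  note s = hmg_sgn[OF hmg_TensM_gen[OF A(1,2)]] hmg_sgn[OF hmg_TensM_gen[OF A(2,3)]]
  show "Comp E (Assoc E (target E F) (target E G) (target E H)) (TensM E (TensM E F G) H)
    = Comp E (TensM E F (TensM E G H)) (Assoc E (source E F) (source E G) (source E H))"
    unfolding F G H envelope_TensM[OF A(1,2)] envelope_TensM[OF A(2,3)] envelope_TensM[OF s(1) A(3)] envelope_TensM[OF A(1) s(2)]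
    using Assoc_nat_refl[of f g k] by (simp add: algebra_simps)
next
  fix p F assume h: "hmg E p F"
  obtain a f b where F: "F = (a, f, b)" by (cases F)
  have A: "hmg A (p + a + b) f" using h by (simp_all add: F)
  note [simp] = A[THEN hmg_arrow]
  have i: "hmg A 0 (I (Unit A))" by simp
  show "Comp E (Lun E (target E F)) (TensM E (Ident E (Unit E)) F) = Comp E F (Lun E (source E F))"
    "Comp E (Run E (target E F)) (TensM E F (Ident E (Unit E))) = Comp E F (Run E (source E F))"
    unfolding F using Lun_nat_refl[of f] Run_nat_refl[of f] by (simp_all add: envelope_TensM[OF i A] envelope_TensM[OF A i])
next
  fix W X Y Z assume "W \<in> Obj E" "X \<in> Obj E" "Y \<in> Obj E" "Z \<in> Obj E"
  then obtain d w a x b y c z where o: "W = (d, w)" "X = (a, x)" "Y = (b, y)" "Z = (c, z)"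
    "Ob w" "Ob x" "Ob y" "Ob z" by auto
  then show "Comp E (Assoc E W X (TensO E Y Z)) (Assoc E (TensO E W X) Y Z)
    = Comp E (TensM E (Ident E W) (Assoc E X Y Z)) (Comp E (Assoc E W (TensO E X Y) Z) (TensM E (Assoc E W X Y) (Ident E Z)))"
    using pentagon[of w x y z]
    by (simp add: envelope_TensM[of 0 _ 0] algebra_simps del: TensM_comp_assoc_even_left TensM_comp_assoc_even_right)
next
  fix X Y assume "X \<in> Obj E" "Y \<in> Obj E"
  then obtain a x b y where o: "X = (a, x)" "Y = (b, y)" "Ob x" "Ob y" by auto
  then show "Comp E (TensM E (Ident E X) (Lun E Y)) (Assoc E X (Unit E) Y) = TensM E (Run E X) (Ident E Y)"
    using triangle[of x y] by (simp add: envelope_TensM[of 0 _ 0])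
qed auto

lemma monoidal_supercategory_envelope: "monoidal_supercategory K E"
  by (rule graded_tensor.monoidal_supercategory[OF graded_tensor_envelope])

lemma monoidal_pi_supercategory_envelope: "monoidal_pi_supercategory K E"
proof (intro monoidal_pi_supercategory.intro monoidal_supercategory_envelope monoidal_pi_supercategory_axioms.intro)
  show "isom E (pi_obj E) (Unit E) (zeta E)" by (intro E.invertible_isom) (simp_all add: envelope_invertible)
  show "zeta E \<in> hpart (Hom E (pi_obj E) (Unit E)) 1"
    using hmg_hpart[OF hmg_Ident[of "Unit A"]] by simp
qed simp

end

section \<open>Criteria for monoidal superfunctors, and functoriality of the envelope\<close>

locale superfun_between = A: even_monoidal K A + B: even_monoidal K B + monoidal_functor_between K A B F +
    monoidal_superfunctor K A B F
  for K :: "'k ring" and A :: "('k, 'o, 'm, ('m, unit) superspace_ext, 'y) moncat_scheme"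
    and B :: "('k, 'p, 'n, ('n, unit) superspace_ext, 'z) moncat_scheme" (structure)
    and F :: "('o, 'm, 'p, 'n, 'w) monfun_scheme"
begin

lemma fmor_hmg [simp]: "hmg A p f ==> hmg B p (fmor F f)"
  using parity_fmor[of "source A f" "target A f" f p] A.hmg_hpart[of p f] A.hmg_arrow[of p f]
  by (simp add: B.hpart_iff_hmg)

lemma fc_hmg [simp]: "[|x \<in> Obj A; y \<in> Obj A|] ==> hmg B 0 (fc F (x, y))"
  using fc_even[of x y] by (simp add: B.hpart_iff_hmg)

lemma fi_hmg [simp]: "hmg B 0 (fi F)"
  using fi_even by (simp add: B.hpart_iff_hmg)

end

lemma superfun_between:
  "[|monoidal_supercategory K A; monoidal_supercategory K B; monoidal_superfunctor K A B F|]
    ==> superfun_between K A B F"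
  by (intro superfun_between.intro even_monoidal monoidal_functor_between_super)

text \<open>Both sides of the composition law are linear in each argument, so homogeneous morphisms
  suffice. The extension is made in one argument at a time.\<close>

lemma superfunctorI:
  fixes B (structure)
  assumes "supercategory K A" "supercategory K B"
    and ob: "!!x. x \<in> Obj A ==> fob F x \<in> Obj B"
    and lin: "!!x y. [|x \<in> Obj A; y \<in> Obj A|] ==> linear_map K (Hom A x y) (Hom B (fob F x) (fob F y)) (fmor F)"
    and hmg: "!!p f. hmg A p f ==> hmg B p (fmor F f)"
    and cmp: "!!p q f g. [|hmg A p f; hmg A q g; target A f = source A g|] ==> fmor F (g $\<^bsub>A\<^esub> f) = fmor F g $ fmor F f"
    and idn: "!!x. x \<in> Obj A ==> fmor F (Ident A x) = Ident B (fob F x)"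
  shows "superfunctor K A B F"
proof -
  interpret A: supercategory K A by fact
  interpret B: supercategory K B by fact
  have cl: "fmor F f \<in> arrows B" "source B (fmor F f) = fob F (source A f)" "target B (fmor F f) = fob F (target A f)"
    if "f \<in> arrows A" for f
    using B.homD[of "fmor F f" "fob F (source A f)" "fob F (target A f)"] A.arrows_hom[OF that] ob
      linear_map_closed[OF lin[of "source A f" "target A f"], of f] by simp_all
  have 1: "fmor F (g $\<^bsub>A\<^esub> f) = fmor F g $ fmor F f"
    if "f \<in> arrows A" "hmg A q g" "target A f = source A g" for f g q
  proof (rule A.homogeneous_eqI[where f = f and \<phi> = "%f. fmor F (g $\<^bsub>A\<^esub> f)" and \<psi> = "%f. fmor F g $ fmor F f"])
    note [simp] = that A.hmg_arrow[OF that(2)] cl ob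
    let ?W = "Hom B (fob F (source A f)) (fob F (target A g))"
    show "linear_map K (Hom A (source A f) (target A f)) ?W (%f. fmor F (g $\<^bsub>A\<^esub> f))"
      by (rule lin_compose[OF lin A.linear_comp_right]) simp_all
    show "linear_map K (Hom A (source A f) (target A f)) ?W (%f. fmor F g $ fmor F f)"
      by (rule lin_compose[OF B.linear_comp_right lin]) simp_all
  qed (use that cmp[OF _ that(2)] A.hmg_arrow[OF that(2)] in auto)
  have 2: "fmor F (g $\<^bsub>A\<^esub> f) = fmor F g $ fmor F f"
    if "f \<in> arrows A" "g \<in> arrows A" "target A f = source A g" for f g
  proof (rule A.homogeneous_eqI[where f = g and \<phi> = "%g. fmor F (g $\<^bsub>A\<^esub> f)" and \<psi> = "%g. fmor F g $ fmor F f"])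
    note [simp] = that cl ob
    let ?W = "Hom B (fob F (source A f)) (fob F (target A g))"
    show "linear_map K (Hom A (source A g) (target A g)) ?W (%g. fmor F (g $\<^bsub>A\<^esub> f))"
      by (rule lin_compose[OF lin A.linear_comp_left]) simp_all
    show "linear_map K (Hom A (source A g) (target A g)) ?W (%g. fmor F g $ fmor F f)"
      by (rule lin_compose[OF B.linear_comp_left lin]) simp_all
  qed (use that 1[OF that(1)] in auto)
  show ?thesis
  proof (intro superfunctor.intro linear_functor.intro is_functor.intro linear_functor_axioms.intro
      superfunctor_axioms.intro; (unfold cat_of_simps)?)
    fix x y f p assume "x \<in> Obj A" "y \<in> Obj A" "f \<in> hpart (Hom A x y) p"
    then show "fmor F f \<in> hpart (Hom B (fob F x) (fob F y)) p"
      using hmg[of p f] cl[of f] A.hmg_arrow[of p f] ob by (auto simp: A.hpart_iff_hmg B.hpart_iff_hmg)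
  qed (use ob lin idn 2 cl in \<open>auto simp: A.hom_iff B.hom_iff\<close>)
qed

text \<open>Naturality of the coherence map is likewise bilinear and needs to be verified on
  homogeneous morphisms only.\<close>

lemma monoidal_superfunctorI:
  fixes B (structure)
  assumes A: "monoidal_supercategory K A" and B: "monoidal_supercategory K B" and F: "superfunctor K A B F"
    and ext: "fob F \<in> extensional (Obj A)" "fmor F \<in> extensional (arrows A)" "fc F \<in> extensional (Obj A \<times> Obj A)"
    and fc: "!!x y. [|x \<in> Obj A; y \<in> Obj A|] ==> invertible B (fc F (x, y)) \<and> hmg B 0 (fc F (x, y)) \<and>
        source B (fc F (x, y)) = fob F x *. fob F y \<and> target B (fc F (x, y)) = fob F (x *.\<^bsub>A\<^esub> y)"
    and fi: "invertible B (fi F) \<and> hmg B 0 (fi F) \<and> source B (fi F) = Unit B \<and> target B (fi F) = fob F (Unit A)"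
    and nat: "!!p q f g. [|hmg A p f; hmg A q g|] ==>
        fc F (target A f, target A g) $ (fmor F f ** fmor F g) = fmor F (f **\<^bsub>A\<^esub> g) $ fc F (source A f, source A g)"
    and assoc: "!!x y z. [|x \<in> Obj A; y \<in> Obj A; z \<in> Obj A|]
      ==> fmor F (Assoc A x y z) $ fc F (x *.\<^bsub>A\<^esub> y, z) $ (fc F (x, y) ** Ident B (fob F z))
        = fc F (x, y *.\<^bsub>A\<^esub> z) $ (Ident B (fob F x) ** fc F (y, z))
            $ Assoc B (fob F x) (fob F y) (fob F z)"
    and lun: "!!x. x \<in> Obj A
      ==> fmor F (Lun A x) $ fc F (Unit A, x) $ (fi F ** Ident B (fob F x)) = Lun B (fob F x)"
    and run: "!!x. x \<in> Obj A
      ==> fmor F (Run A x) $ fc F (x, Unit A) $ (Ident B (fob F x) ** fi F) = Run B (fob F x)"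
  shows "monoidal_superfunctor K A B F"
proof -
  interpret A: even_monoidal K A by (rule even_monoidal) fact
  interpret B: even_monoidal K B by (rule even_monoidal) fact
  interpret F: superfunctor K A B F by fact
  interpret F: linear_functor_between K A B F ..
  have fc' [simp]: "invertible B (fc F (x, y))" "hmg B 0 (fc F (x, y))"
    "source B (fc F (x, y)) = fob F x *. fob F y" "target B (fc F (x, y)) = fob F (x *.\<^bsub>A\<^esub> y)"
    if "x \<in> Obj A" "y \<in> Obj A" for x y
    using fc[OF that] by auto
  let ?N = "%f g. fc F (target A f, target A g) $ (fmor F f ** fmor F g) = fmor F (f **\<^bsub>A\<^esub> g) $ fc F (source A f, source A g)"
  have 1: "?N f g" if "f \<in> arrows A" "hmg A q g" for f g q
  proof (rule A.homogeneous_eqI[where f = f and \<phi> = "%h. fc F (target A f, target A g) $ (fmor F h ** fmor F g)"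
      and \<psi> = "%h. fmor F (h **\<^bsub>A\<^esub> g) $ fc F (source A f, source A g)"])
    note [simp] = that A.hmg_arrow[OF that(2)]
    let ?W = "Hom B (fob F (source A f) *. fob F (source A g)) (fob F (target A f *.\<^bsub>A\<^esub> target A g))"
    show "linear_map K (Hom A (source A f) (target A f)) ?W (%h. fc F (target A f, target A g) $ (fmor F h ** fmor F g))"
      by (rule lin_compose[OF B.linear_comp_right lin_compose[OF B.linear_TensM_left F.linear_fmor]]) simp_all
    show "linear_map K (Hom A (source A f) (target A f)) ?W (%h. fmor F (h **\<^bsub>A\<^esub> g) $ fc F (source A f, source A g))"
      by (rule lin_compose[OF B.linear_comp_left lin_compose[OF F.linear_fmor A.linear_TensM_left]]) simp_all
    show "fc F (target A f, target A g) $ (fmor F h ** fmor F g) = fmor F (h **\<^bsub>A\<^esub> g) $ fc F (source A f, source A g)"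
      if "hmg A p h" "source A h = source A f" "target A h = target A f" for h p
      using nat[OF that(1) \<open>hmg A q g\<close>] that by simp
  qed (use that in simp_all)
  have 2: "?N f g" if "f \<in> arrows A" "g \<in> arrows A" for f g
  proof (rule A.homogeneous_eqI[where f = g and \<phi> = "%h. fc F (target A f, target A g) $ (fmor F f ** fmor F h)"
      and \<psi> = "%h. fmor F (f **\<^bsub>A\<^esub> h) $ fc F (source A f, source A g)"])
    note [simp] = that
    let ?W = "Hom B (fob F (source A f) *. fob F (source A g)) (fob F (target A f *.\<^bsub>A\<^esub> target A g))"
    show "linear_map K (Hom A (source A g) (target A g)) ?W (%h. fc F (target A f, target A g) $ (fmor F f ** fmor F h))"
      by (rule lin_compose[OF B.linear_comp_right lin_compose[OF B.linear_TensM_right F.linear_fmor]]) simp_all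
    show "linear_map K (Hom A (source A g) (target A g)) ?W (%h. fmor F (f **\<^bsub>A\<^esub> h) $ fc F (source A f, source A g))"
      by (rule lin_compose[OF B.linear_comp_left lin_compose[OF F.linear_fmor A.linear_TensM_right]]) simp_all
    show "fc F (target A f, target A g) $ (fmor F f ** fmor F h) = fmor F (f **\<^bsub>A\<^esub> h) $ fc F (source A f, source A g)"
      if "hmg A p h" "source A h = source A g" "target A h = target A g" for h p
      using 1[OF \<open>f \<in> arrows A\<close> that(1)] that by simp
  qed (use that in simp_all)
  show ?thesis
  proof (intro monoidal_superfunctor.intro F monoidal_superfunctor_axioms.intro monoidal_functor_coherence.intro ext assoc lun run)
    fix x x' y y' f g
    assume "x \<in> Obj A" "x' \<in> Obj A" "y \<in> Obj A" "y' \<in> Obj A" "f \<in> homset A x x'" "g \<in> homset A y y'"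
    then show "fc F (x', y') $ (fmor F f ** fmor F g) = fmor F (f **\<^bsub>A\<^esub> g) $ fc F (x, y)"
      using 2[of f g] by (simp add: A.hom_iff)
  qed (use fi in \<open>simp_all add: B.invertible_isom B.hmg_hpart\<close>)
qed

text \<open>\<open>F\<close> preserves parities and has even coherence maps, so the tensor products
  in both envelopes carry the same sign and each axiom is that of \<open>F\<close>.\<close>

lemma monoidal_superfunctor_envelope:
  fixes A :: "('k, 'o, 'm) monsupercat" and B :: "('k, 'p, 'n) monsupercat" and F :: "('o, 'm, 'p, 'n) monfun"
  assumes A: "monoidal_supercategory K A" and B: "monoidal_supercategory K B" and F: "monoidal_superfunctor K A B F"
  shows "monoidal_superfunctor K (envelope A) (envelope B) (envelope_monfun A F)"
proof -
  interpret A: pi_envelope K A by (intro pi_envelope.intro even_monoidal A)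
  interpret B: pi_envelope K B by (intro pi_envelope.intro even_monoidal B)
  interpret F: superfun_between K A B F using superfun_between[OF A B F] .
  have [simp]: "x \<in> Obj A ==> fob (envelope_monfun A F) (a, x) = (a, fob F x)"
    "f \<in> arrows A ==> fmor (envelope_monfun A F) (a, f, b) = (a, fmor F f, b)"
    "[|x \<in> Obj A; y \<in> Obj A|] ==> fc (envelope_monfun A F) ((a, x), (b, y)) = (a + b, fc F (x, y), a + b)"
    "fi (envelope_monfun A F) = (0, fi F, 0)" for a b x y f
    by (simp_all add: envelope_monfun_def)
  show ?thesis
  proof (rule monoidal_superfunctorI[OF A.monoidal_supercategory_envelope B.monoidal_supercategory_envelope])
    show "superfunctor K A.E B.E (envelope_monfun A F)"
    proof (rule superfunctorI[OF A.supercategory_envelope B.supercategory_envelope])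
      fix X Y assume "X \<in> Obj A.E" "Y \<in> Obj A.E"
      then obtain a x b y where o: "X = (a, x)" "Y = (b, y)" "x \<in> Obj A" "y \<in> Obj A" by auto
      have "linear_map K (shifted_space a b (Hom A x y)) (shifted_space a b (Hom B (fob F x) (fob F y)))
        (fmor (envelope_monfun A F))"
        by (rule linear_map_shifted_space[OF F.linear_fmor[OF o(3,4)]])
          (use o A.module_Hom in \<open>auto simp: A.hom_iff\<close>)
      then show "linear_map K (Hom A.E X Y) (Hom B.E (fob (envelope_monfun A F) X) (fob (envelope_monfun A F) Y)) (fmor (envelope_monfun A F))"
        by (simp add: o)
    next
      fix p f assume h: "hmg A.E p f"
      obtain a f' b where f: "f = (a, f', b)" by (cases f)
      show "hmg B.E p (fmor (envelope_monfun A F) f)"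
        using h A.hmg_arrow[of _ f'] by (auto simp: f)
    next
      fix p q f g assume h: "hmg A.E p f" "hmg A.E q g" "target A.E f = source A.E g"
      obtain a f' b where f: "f = (a, f', b)" by (cases f)
      obtain c g' d where g: "g = (c, g', d)" by (cases g)
      have [simp]: "f' \<in> arrows A" "g' \<in> arrows A" using h A.hmg_arrow by (auto simp: f g)
      show "fmor (envelope_monfun A F) (Comp A.E g f) = Comp B.E (fmor (envelope_monfun A F) g) (fmor (envelope_monfun A F) f)"
        using h by (simp add: f g F.fmor_comp)
    qed auto
  next
    fix p q f g assume h: "hmg A.E p f" "hmg A.E q g"
    obtain a f' b where f: "f = (a, f', b)" by (cases f)
    obtain c g' d where g: "g = (c, g', d)" by (cases g)
    have A: "hmg A (p + a + b) f'" "hmg A (q + c + d) g'" using h by (simp_all add: f g)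
    note [simp] = A[THEN A.hmg_arrow]
    note A' = A[THEN F.fmor_hmg]
    show "Comp B.E (fc (envelope_monfun A F) (target A.E f, target A.E g)) (TensM B.E (fmor (envelope_monfun A F) f) (fmor (envelope_monfun A F) g))
     = Comp B.E (fmor (envelope_monfun A F) (TensM A.E f g)) (fc (envelope_monfun A F) (source A.E f, source A.E g))"
      using F.fc_nat_refl[of f' g'] by (simp add: f g A.envelope_TensM[OF A] B.envelope_TensM[OF A'])
  next
    fix X Y Z assume "X \<in> Obj A.E" "Y \<in> Obj A.E" "Z \<in> Obj A.E"
    then obtain a x b y c z where o: "X = (a, x)" "Y = (b, y)" "Z = (c, z)" "x \<in> Obj A" "y \<in> Obj A" "z \<in> Obj A" by auto
    show "Comp B.E (fmor (envelope_monfun A F) (Assoc A.E X Y Z)) (Comp B.E (fc (envelope_monfun A F) (TensO A.E X Y, Z))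
        (TensM B.E (fc (envelope_monfun A F) (X, Y)) (Ident B.E (fob (envelope_monfun A F) Z))))
      = Comp B.E (fc (envelope_monfun A F) (X, TensO A.E Y Z)) (Comp B.E (TensM B.E (Ident B.E (fob (envelope_monfun A F) X)) (fc (envelope_monfun A F) (Y, Z)))
            (Assoc B.E (fob (envelope_monfun A F) X) (fob (envelope_monfun A F) Y) (fob (envelope_monfun A F) Z)))"
      using F.fc_Assoc[of x y z] o by (simp add: B.envelope_TensM[of 0 _ 0] algebra_simps)
  next
    fix X assume "X \<in> Obj A.E"
    then obtain a x where o: "X = (a, x)" "x \<in> Obj A" by auto
    show "Comp B.E (fmor (envelope_monfun A F) (Lun A.E X)) (Comp B.E (fc (envelope_monfun A F) (Unit A.E, X))
        (TensM B.E (fi (envelope_monfun A F)) (Ident B.E (fob (envelope_monfun A F) X)))) = Lun B.E (fob (envelope_monfun A F) X)"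
      "Comp B.E (fmor (envelope_monfun A F) (Run A.E X)) (Comp B.E (fc (envelope_monfun A F) (X, Unit A.E))
        (TensM B.E (Ident B.E (fob (envelope_monfun A F) X)) (fi (envelope_monfun A F)))) = Run B.E (fob (envelope_monfun A F) X)"
      using F.fc_Lun[of x] F.fc_Run[of x] o by (simp_all add: B.envelope_TensM[of 0 _ 0])
  next
    show "fob (envelope_monfun A F) \<in> extensional (Obj A.E)" "fmor (envelope_monfun A F) \<in> extensional (arrows A.E)"
      "fc (envelope_monfun A F) \<in> extensional (Obj A.E \<times> Obj A.E)"
      by (auto simp: envelope_monfun_def extensional_def)
  qed (auto simp: B.envelope_invertible)
qed

lemma envelope_monfun_id:
  assumes "monoidal_supercategory K A"
  shows "envelope_monfun A (id_monfun A) = id_monfun (envelope A)"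
proof -
  interpret A: pi_envelope K A by (intro pi_envelope.intro even_monoidal assms)
  show ?thesis
    by (rule monfun_eqI) (auto simp: envelope_monfun_def id_monfun_def fun_eq_iff)
qed

lemma envelope_monfun_comp:
  assumes A: "monoidal_supercategory K A" and B: "monoidal_supercategory K B" and C: "monoidal_supercategory K C"
    and F: "monoidal_superfunctor K A B F" and G: "monoidal_superfunctor K B C G"
  shows "envelope_monfun A (comp_monfun A C G F)
    = comp_monfun (envelope A) (envelope C) (envelope_monfun B G) (envelope_monfun A F)"
proof -
  interpret A: pi_envelope K A by (intro pi_envelope.intro even_monoidal A)
  interpret B: pi_envelope K B by (intro pi_envelope.intro even_monoidal B)
  interpret C: pi_envelope K C by (intro pi_envelope.intro even_monoidal C)
  interpret F: superfun_between K A B F using superfun_between[OF A B F] .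
  interpret G: superfun_between K B C G using superfun_between[OF B C G] .
  show ?thesis
    by (rule monfun_eqI) (auto simp: envelope_monfun_def comp_monfun_def fun_eq_iff)
qed

lemma envelope_functor_is_functor:
  "is_functor (SMon K :: (('k, 'o, 'm) monsupercat, _) cat) (Pi_SMon K) envelope_functor"
proof (unfold_locales, unfold SMon_def Pi_SMon_def envelope_functor_def)
qed (auto simp: monoidal_superfunctor_envelope envelope_monfun_id envelope_monfun_comp
    intro!: pi_envelope.monoidal_pi_supercategory_envelope pi_envelope.intro even_monoidal)

section \<open>Extending monoidal superfunctors to the $\Pi$-envelope\<close>

lemma linear_map_from_shifted_space:
  assumes "linear_map K V W f" "!!v. v \<in> carrier V ==> \<phi> (a, v, b) = f v" "module K V"
  shows "linear_map K (shifted_space a b V) W \<phi>"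
proof -
  interpret module K V by fact
  show ?thesis using assms(1,2) unfolding linear_map_def by (auto simp: Pi_iff)
qed

text \<open>The target is a plain monoidal supercategory with a chosen odd isomorphism onto its
  unit: all that is visible of a monoidal \<Pi>-supercategory after its structure has been
  forgotten.\<close>

locale envelope_extension = A: pi_envelope K A + F: superfun_between K A B F
  for K :: "'k ring" and A :: "('k, 'o, 'm) monsupercat" and B :: "('k, 'p, 'n) monsupercat" (structure)
    and F :: "('o, 'm, 'p, 'n) monfun" +
  fixes \<pi> \<zeta>
  assumes pi_Obj [simp]: "\<pi> \<in> Obj B"
    and zeta: "invertible B \<zeta>" "hmg B 1 \<zeta>" "source B \<zeta> = \<pi>" "target B \<zeta> = Unit B"
begin

abbreviation "ivB \<equiv> inverse_of B"
abbreviation "IB \<equiv> Ident B"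

text \<open>An isomorphism of parity \<open>a\<close> from the value at \<open>\<Pi>^a x\<close> to
  \<open>F x\<close>. For shift 0 it is an identity and not a unitor, so that the extension
  restricts to \<open>F\<close> exactly.\<close>

definition th :: "bit \<Rightarrow> 'o \<Rightarrow> 'n" where
  "th a x = (if a = 0 then IB (fob F x) else Lun B (fob F x) $ (\<zeta> ** IB (fob F x)))"

definition ext_ob :: "bit \<Rightarrow> 'o \<Rightarrow> 'p" where
  "ext_ob a x = (if a = 0 then fob F x else \<pi> *. fob F x)"

lemma zeta_whisker:
  assumes "x \<in> Obj B"
  shows "invertible B (\<zeta> ** IB x)"
proof (rule F.B.inverse_of_eqI(2)[of _ "ivB \<zeta> ** IB x"])
qed (use zeta assms in simp_all)

lemma theta [simp]:
  assumes "A.Ob x"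
  shows "invertible B (th a x)" "hmg B a (th a x)" "source B (th a x) = ext_ob a x" "target B (th a x) = fob F x"
    "ext_ob a x \<in> Obj B"
  using assms zeta zeta_whisker[of "fob F x"] by (cases a; simp add: th_def ext_ob_def)+

lemma theta_0 [simp]: "th 0 x = IB (fob F x)" "ext_ob 0 x = fob F x"
  by (simp_all add: th_def ext_ob_def)

text \<open>The sign in \<open>fc\<close> is forced: in the envelope the tensor product of the
  shifts \<open>\<Pi>^a x\<close> to \<open>x\<close> and \<open>\<Pi>^b y\<close> to
  \<open>y\<close> is the shift of the tensor product times \<open>(-1)^(a b)\<close>, and
  \<open>th\<close> plays the role of the image of a shift.\<close>

definition ext :: "(bit \<times> 'o, bit \<times> 'm \<times> bit, 'p, 'n) monfun" where
  "ext = \<lparr>fob = (\<lambda>(a, x) \<in> Obj A.E. ext_ob a x),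
     fmor = (\<lambda>(a, f, b) \<in> arrows A.E. ivB (th b (target A f)) $ fmor F f $ th a (source A f)),
     fc = (\<lambda>((a, x), (b, y)) \<in> Obj A.E \<times> Obj A.E.
       sgn_arr B (a * b) (ivB (th (a + b) (x *.\<^bsub>A\<^esub> y)) $ fc F (x, y) $ (th a x ** th b y))),
     fi = fi F\<rparr>"

lemma ext_simps [simp]:
  "A.Ob x ==> fob ext (a, x) = ext_ob a x"
  "A.ar f ==> fmor ext (a, f, b) = ivB (th b (target A f)) $ fmor F f $ th a (source A f)"
  "[|A.Ob x; A.Ob y|] ==> fc ext ((a, x), (b, y)) =
     sgn_arr B (a * b) (ivB (th (a + b) (x *.\<^bsub>A\<^esub> y)) $ fc F (x, y) $ (th a x ** th b y))"
  "fi ext = fi F"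
  by (simp_all add: ext_def)

text \<open>By the interchange law the tensor product of the inverses is an inverse up to the sign
  \<open>a * b\<close>, so the sign is put into the candidate.\<close>

lemma theta_TensM_invertible [simp]:
  assumes "A.Ob x" "A.Ob y"
  shows "invertible B (th a x ** th b y)"
proof (rule F.B.inverse_of_eqI(2)[of _ "sgn_arr B (a * b) (ivB (th a x) ** ivB (th b y))"])
  have h: "hmg B a (ivB (th a x))" "hmg B b (ivB (th b y))" "hmg B a (th a x)" "hmg B b (th b y)"
    using assms by simp_all
  note [simp] = h[THEN F.B.hmg_arrow]
  show "sgn_arr B (a * b) (ivB (th a x) ** ivB (th b y)) $ (th a x ** th b y)
    = IB (source B (th a x ** th b y))"
    using F.B.TensM_comp_gen[OF _ h(2,3), of "ivB (th a x)" "th b y"] assms by (simp add: mult.commute)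
  show "(th a x ** th b y) $ sgn_arr B (a * b) (ivB (th a x) ** ivB (th b y))
    = IB (target B (th a x ** th b y))"
    using F.B.TensM_comp_gen[OF _ h(4,1), of "th a x" "ivB (th b y)"] assms by (simp add: mult.commute)
qed (use assms in simp_all)

lemma ext_fc_hmg:
  assumes "A.Ob x" "A.Ob y"
  shows "hmg B 0 (fc ext ((a, x), (b, y)))"
proof -
  have "hmg B (0 + (a + b)) (fc F (x, y) $ (th a x ** th b y))"
    by (rule F.B.hmg_comp_gen) (use assms F.B.hmg_TensM_gen in simp_all)
  from F.B.hmg_comp_gen[OF this, of "a + b" "ivB (th (a + b) (x *.\<^bsub>A\<^esub> y))"]
  show ?thesis using assms by simp
qed

lemma superfunctor_ext: "superfunctor K A.E B ext"
proof (rule superfunctorI[OF A.supercategory_envelope F.B.supercategory_axioms])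
  fix X Y assume "X \<in> Obj A.E" "Y \<in> Obj A.E"
  then obtain a x b y where o: "X = (a, x)" "Y = (b, y)" "A.Ob x" "A.Ob y" by auto
  have "linear_map K (Hom A x y) (Hom B (ext_ob a x) (ext_ob b y))
      (%f. ivB (th b y) $ (fmor F f $ th a x))"
    by (rule lin_compose[OF F.B.linear_comp_right lin_compose[OF F.B.linear_comp_left F.linear_fmor]])
       (use o in simp_all)
  from linear_map_from_shifted_space[OF this, of "fmor ext" a b]
  show "linear_map K (Hom A.E X Y) (Hom B (fob ext X) (fob ext Y)) (fmor ext)"
    using o A.module_Hom by (auto simp: A.hom_iff)
next
  fix p f assume h: "hmg A.E p f"
  obtain a f' b where f: "f = (a, f', b)" by (cases f)
  have A: "hmg A (p + a + b) f'" using h by (simp add: f)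
  note [simp] = A[THEN A.hmg_arrow]
  have "hmg B (b + (p + a + b + a)) (ivB (th b (target A f')) $ fmor F f' $ th a (source A f'))"
    by (intro F.B.hmg_comp_gen) (use A in simp_all)
  moreover have "b + (p + a + b + a) = p" by (simp add: ac_simps)
  ultimately show "hmg B p (fmor ext f)" by (simp add: f)
next
  fix p q f g assume h: "hmg A.E p f" "hmg A.E q g" "target A.E f = source A.E g"
  obtain a f' b where f: "f = (a, f', b)" by (cases f)
  obtain c g' d where g: "g = (c, g', d)" by (cases g)
  have [simp]: "A.ar f'" "A.ar g'" using h A.hmg_arrow by (auto simp: f g)
  show "fmor ext (Comp A.E g f) = fmor ext g $ fmor ext f"
    using h by (simp add: f g F.fmor_comp)
qed auto

lemma monoidal_superfunctor_ext: "monoidal_superfunctor K A.E B ext"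
proof (rule monoidal_superfunctorI[OF A.monoidal_supercategory_envelope F.B.monoidal_supercategory_axioms superfunctor_ext])
  show "fob ext \<in> extensional (Obj A.E)" "fmor ext \<in> extensional (arrows A.E)" "fc ext \<in> extensional (Obj A.E \<times> Obj A.E)"
    by (auto simp: ext_def extensional_def)
next
  fix X Y assume "X \<in> Obj A.E" "Y \<in> Obj A.E"
  then obtain a x b y where o: "X = (a, x)" "Y = (b, y)" "A.Ob x" "A.Ob y" by auto
  show "invertible B (fc ext (X, Y)) \<and> hmg B 0 (fc ext (X, Y)) \<and>
    source B (fc ext (X, Y)) = fob ext X *. fob ext Y \<and> target B (fc ext (X, Y)) = fob ext (TensO A.E X Y)"
    using o ext_fc_hmg by (simp del: ext_simps(3)) simp
next
  fix p q f g assume h: "hmg A.E p f" "hmg A.E q g"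
  obtain a f' a' where f: "f = (a, f', a')" by (cases f)
  obtain b g' b' where g: "g = (b, g', b')" by (cases g)
  define P where "P = p + a + a'"
  define Q where "Q = q + b + b'"
  have A: "hmg A P f'" "hmg A Q g'" using h by (simp_all add: f g P_def Q_def)
  note [simp] = A[THEN A.hmg_arrow]
  let ?x = "source A f'" and ?x' = "target A f'" and ?y = "source A g'" and ?y' = "target A g'"
  let ?Ff = "fmor F f'" and ?Fg = "fmor F g'"
  let ?i = "ivB (th (a' + b') (?x' *.\<^bsub>A\<^esub> ?y'))"
  have k: "hmg B (a' + (P + a)) (ivB (th a' ?x') $ ?Ff $ th a ?x)"
    by (intro F.B.hmg_comp_gen) (use A in simp_all)
  \<comment> \<open>The map \<open>th b' ?y'\<close>, of parity \<open>b'\<close>, passes the image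
    of the first morphism; the next equation records the passage of the second morphism by
    \<open>th a ?x\<close>.\<close>
  have 1: "(th a' ?x' ** th b' ?y') $ ((ivB (th a' ?x') $ ?Ff $ th a ?x) **
      (ivB (th b' ?y') $ ?Fg $ th b ?y))
    = sgn_arr B (b' * (a' + (P + a))) ((?Ff $ th a ?x) ** (?Fg $ th b ?y))"
    by (subst F.B.TensM_comp_gen[OF _ _ k]) simp_all
  have 2: "(?Ff $ th a ?x) ** (?Fg $ th b ?y) = sgn_arr B (Q * a) ((?Ff ** ?Fg) $ (th a ?x ** th b ?y))"
    using A by (subst F.B.TensM_comp_gen[of _ Q _ a]) simp_all
  have "fc ext (target A.E f, target A.E g) $ (fmor ext f ** fmor ext g)
    = sgn_arr B (a' * b') (?i $ fc F (?x', ?y') $ ((th a' ?x' ** th b' ?y') $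
      ((ivB (th a' ?x') $ ?Ff $ th a ?x) ** (ivB (th b' ?y') $ ?Fg $ th b ?y))))"
    by (simp add: f g)
  \<comment> \<open>The two terms \<open>a' * b'\<close> cancel. What remains is
    \<open>a * Q + P * b' + a * b'\<close>, the exponent in the envelope up to \<open>a * b\<close>,
    and this last term is the sign of \<open>fc ext\<close> at the source.\<close>
  also have "... = sgn_arr B (a' * b' + (b' * (a' + (P + a)) + Q * a))
      (?i $ (fc F (?x', ?y') $ (?Ff ** ?Fg)) $ (th a ?x ** th b ?y))"
    unfolding 1 2 by simp
  also have "fc F (?x', ?y') $ (?Ff ** ?Fg) = fmor F (f' **\<^bsub>A\<^esub> g') $ fc F (?x, ?y)"
    by (rule F.fc_nat_refl) simp_all
  also have "sgn_arr B (a' * b' + (b' * (a' + (P + a)) + Q * a))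
      (?i $ (fmor F (f' **\<^bsub>A\<^esub> g') $ fc F (?x, ?y)) $ (th a ?x ** th b ?y))
    = fmor ext (TensM A.E f g) $ fc ext (source A.E f, source A.E g)"
    unfolding f g A.envelope_TensM[OF A] by (simp add: algebra_simps)
  finally show "fc ext (target A.E f, target A.E g) $ (fmor ext f ** fmor ext g)
    = fmor ext (TensM A.E f g) $ fc ext (source A.E f, source A.E g)" .
next
  fix X Y Z assume "X \<in> Obj A.E" "Y \<in> Obj A.E" "Z \<in> Obj A.E"
  then obtain a x b y c z where o: "X = (a, x)" "Y = (b, y)" "Z = (c, z)"
    and [simp]: "A.Ob x" "A.Ob y" "A.Ob z" by auto
  let ?Fx = "fob F x" and ?Fy = "fob F y" and ?Fz = "fob F z"
  let ?i = "ivB (th (a + b + c) (x *.\<^bsub>A\<^esub> (y *.\<^bsub>A\<^esub> z)))"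
  have k: "hmg B 0 (fc F (x, y))" "hmg B 0 (fc F (y, z))" by simp_all
  have h1: "hmg B 0 (ivB (th (a + b) (x *.\<^bsub>A\<^esub> y)) $ fc F (x, y) $ (th a x ** th b y))"
    using F.B.hmg_sgn[OF ext_fc_hmg[of x y a b], of "a * b"] by simp
  have h2: "hmg B 0 (ivB (th (b + c) (y *.\<^bsub>A\<^esub> z)) $ fc F (y, z) $ (th b y ** th c z))"
    using F.B.hmg_sgn[OF ext_fc_hmg[of y z b c], of "b * c"] by simp
  \<comment> \<open>The coherence map of \<open>ext\<close> is even, so it can be pulled through the
    tensor product without a sign, and its leading inverse cancels.\<close>
  have 1: "(th (a + b) (x *.\<^bsub>A\<^esub> y) ** th c z) $ ((ivB (th (a + b) (x *.\<^bsub>A\<^esub> y)) $ fc F (x, y) $ (th a x ** th b y))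
      ** IB (ext_ob c z)) = (fc F (x, y) ** IB ?Fz) $ ((th a x ** th b y) ** th c z)"
    by (subst F.B.TensM_comp_even_right[OF _ _ h1]) simp_all
  have 2: "(th a x ** th (b + c) (y *.\<^bsub>A\<^esub> z)) $ (IB (ext_ob a x) ** (ivB (th (b + c) (y *.\<^bsub>A\<^esub> z)) $ fc F (y, z) $ (th b y ** th c z)))
     = (IB ?Fx ** fc F (y, z)) $ (th a x ** (th b y ** th c z))"
    by simp
  have "fmor ext (Assoc A.E X Y Z) $ fc ext (TensO A.E X Y, Z) $ (fc ext (X, Y) ** IB (fob ext Z))
     = sgn_arr B (a * b + (a + b) * c) (?i $ fmor F (Assoc A x y z) $ fc F (x *.\<^bsub>A\<^esub> y, z) $
       ((th (a + b) (x *.\<^bsub>A\<^esub> y) ** th c z) $ ((ivB (th (a + b) (x *.\<^bsub>A\<^esub> y)) $ fc F (x, y) $ (th a x ** th b y))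
      ** IB (ext_ob c z))))"
    using o by (simp del: F.B.TensM_comp_even_left F.B.TensM_comp_even_right)
  also have "... = sgn_arr B (a * b + (a + b) * c) (?i $ (fmor F (Assoc A x y z) $ fc F (x *.\<^bsub>A\<^esub> y, z) $
       (fc F (x, y) ** IB ?Fz)) $ ((th a x ** th b y) ** th c z))"
    unfolding 1 by (simp del: F.B.TensM_comp_even_left F.B.TensM_comp_even_right)
  also have "... = sgn_arr B (a * b + (a + b) * c) (?i $ fc F (x, y *.\<^bsub>A\<^esub> z) $ (IB ?Fx ** fc F (y, z)) $
       (Assoc B ?Fx ?Fy ?Fz $ ((th a x ** th b y) ** th c z)))"
    using F.fc_Assoc[of x y z] by simp
  also have "Assoc B ?Fx ?Fy ?Fz $ ((th a x ** th b y) ** th c z)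
      = (th a x ** (th b y ** th c z)) $ Assoc B (ext_ob a x) (ext_ob b y) (ext_ob c z)"
    using F.B.Assoc_nat_refl[of "th a x" "th b y" "th c z"] by simp
  \<comment> \<open>Both bracketings give the exponent \<open>a * b + a * c + b * c\<close>: the
    bilinear sign of \<open>fc ext\<close> satisfies the cocycle identity.\<close>
  also have "sgn_arr B (a * b + (a + b) * c) (?i $ fc F (x, y *.\<^bsub>A\<^esub> z) $ (IB ?Fx ** fc F (y, z)) $
       ((th a x ** (th b y ** th c z)) $ Assoc B (ext_ob a x) (ext_ob b y) (ext_ob c z)))
     = sgn_arr B (b * c + a * (b + c)) (?i $ fc F (x, y *.\<^bsub>A\<^esub> z) $
      (((IB ?Fx ** fc F (y, z)) $ (th a x ** (th b y ** th c z))) $ Assoc B (ext_ob a x) (ext_ob b y) (ext_ob c z)))"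
    by (simp add: algebra_simps)
  also have "... = fc ext (X, TensO A.E Y Z) $ (IB (fob ext X) ** fc ext (Y, Z))
      $ Assoc B (fob ext X) (fob ext Y) (fob ext Z)"
    unfolding 2[symmetric] using o
    by (simp add: add.assoc del: F.B.TensM_comp_even_left F.B.TensM_comp_even_right)
  finally show "fmor ext (Assoc A.E X Y Z) $ fc ext (TensO A.E X Y, Z) $ (fc ext (X, Y) ** IB (fob ext Z))
    = fc ext (X, TensO A.E Y Z) $ (IB (fob ext X) ** fc ext (Y, Z))
      $ Assoc B (fob ext X) (fob ext Y) (fob ext Z)" .
next
  fix X assume "X \<in> Obj A.E"
  then obtain a x where o: "X = (a, x)" and [simp]: "A.Ob x" by auto
  let ?Fx = "fob F x"
  have "fmor ext (Lun A.E X) $ fc ext (Unit A.E, X) $ (fi ext ** IB (fob ext X))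
    = ivB (th a x) $ fmor F (Lun A x) $ fc F (Unit A, x) $ (fi F ** th a x)"
    using o by simp
  also have "fi F ** th a x = (fi F ** IB ?Fx) $ (IB (Unit B) ** th a x)" by simp
  also have "ivB (th a x) $ fmor F (Lun A x) $ fc F (Unit A, x) $ ...
    = ivB (th a x) $ (fmor F (Lun A x) $ fc F (Unit A, x) $ (fi F ** IB ?Fx)) $ (IB (Unit B) ** th a x)"
    by simp
  also have "... = ivB (th a x) $ (Lun B ?Fx $ (IB (Unit B) ** th a x))"
    using F.fc_Lun[of x] by simp
  also have "... = Lun B (fob ext X)" using F.B.Lun_nat_refl[of "th a x"] o by simp
  finally show "fmor ext (Lun A.E X) $ fc ext (Unit A.E, X) $ (fi ext ** IB (fob ext X)) = Lun B (fob ext X)" .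
  have "fmor ext (Run A.E X) $ fc ext (X, Unit A.E) $ (IB (fob ext X) ** fi ext)
    = ivB (th a x) $ fmor F (Run A x) $ fc F (x, Unit A) $ (th a x ** fi F)"
    using o by simp
  also have "th a x ** fi F = (IB ?Fx ** fi F) $ (th a x ** IB (Unit B))" by simp
  also have "ivB (th a x) $ fmor F (Run A x) $ fc F (x, Unit A) $ ...
    = ivB (th a x) $ (fmor F (Run A x) $ fc F (x, Unit A) $ (IB ?Fx ** fi F)) $ (th a x ** IB (Unit B))"
    by simp
  also have "... = ivB (th a x) $ (Run B ?Fx $ (th a x ** IB (Unit B)))"
    using F.fc_Run[of x] by simp
  also have "... = Run B (fob ext X)" using F.B.Run_nat_refl[of "th a x"] o by simp
  finally show "fmor ext (Run A.E X) $ fc ext (X, Unit A.E) $ (IB (fob ext X) ** fi ext) = Run B (fob ext X)" .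
qed simp_all

end

section \<open>The universal property of the $\Pi$-envelope\<close>

lemma linear_map_to_shifted_space:
  assumes "linear_map K V W f" "!!v. v \<in> carrier V ==> \<phi> v = (c, f v, d)" "module K V"
  shows "linear_map K V (shifted_space c d W) \<phi>"
proof -
  interpret module K V by fact
  show ?thesis using assms(1,2) unfolding linear_map_def by (auto simp: Pi_iff)
qed

lemma HomCat_simps:
  "ob (HomCat K A B) = {F. monoidal_superfunctor K A B F}"
  "arr (HomCat K A B) F G = {(F, t, G) | t. monoidal_nat_trans A B F G t}"
  "cmp (HomCat K A B) (G', s, H) (F, t, G) = (F, (\<lambda>x \<in> Obj A. s x $\<^bsub>B\<^esub> t x), H)"
  "idn (HomCat K A B) F = (F, (\<lambda>x \<in> Obj A. Ident B (fob F x)), F)"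
  by (simp_all add: HomCat_def)

lemma monoidal_nat_transI:
  fixes B (structure)
  assumes B: "supercategory K B" and t: "t \<in> extensional (Obj A)"
    "!!x. x \<in> Obj A ==> hmg B 0 (t x) \<and> source B (t x) = fob F x \<and> target B (t x) = fob G x"
    and nat: "!!f. f \<in> arrows A ==> t (target A f) $ fmor F f = fmor G f $ t (source A f)"
    and ten: "!!x y. [|x \<in> Obj A; y \<in> Obj A|] ==> t (x *.\<^bsub>A\<^esub> y) $ fc F (x, y) = fc G (x, y) $ (t x ** t y)"
    and un: "t (Unit A) $ fi F = fi G" and A: "linear_category K A"
  shows "monoidal_nat_trans A B F G t"
proof -
  interpret A: linear_category K A by fact
  interpret B: supercategory K B by fact
  show ?thesis
  proof (intro monoidal_nat_trans.intro t(1) ten un)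
    fix x assume "x \<in> Obj A"
    then show "t x \<in> homset B (fob F x) (fob G x)" "t x \<in> hpart (Hom B (fob F x) (fob G x)) 0"
      using t(2)[of x] B.homI[OF B.hmg_arrow[of 0 "t x"]] B.hmg_hpart[of 0 "t x"] by auto
  next
    fix x y f assume "x \<in> Obj A" "y \<in> Obj A" "f \<in> homset A x y"
    then show "t y $ fmor F f = fmor G f $ t x" using nat[of f] by (auto simp: A.hom_iff)
  qed
qed

lemma monoidal_nat_transD:
  fixes B (structure)
  assumes F: "superfun_between K A B F" and G: "superfun_between K A B G" and t: "monoidal_nat_trans A B F G t"
  shows "x \<in> Obj A ==> hmg B 0 (t x)" "x \<in> Obj A ==> source B (t x) = fob F x" "x \<in> Obj A ==> target B (t x) = fob G x"
    "f \<in> arrows A ==> t (target A f) $ fmor F f = fmor G f $ t (source A f)"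
proof -
  interpret F: superfun_between K A B F by fact
  interpret G: superfun_between K A B G by fact
  interpret t: monoidal_nat_trans A B F G t by fact
  show "x \<in> Obj A ==> hmg B 0 (t x)" "x \<in> Obj A ==> source B (t x) = fob F x" "x \<in> Obj A ==> target B (t x) = fob G x"
    using t.t_even[of x] by (simp_all add: F.B.hpart_iff_hmg)
  show "f \<in> arrows A ==> t (target A f) $ fmor F f = fmor G f $ t (source A f)"
    using t.t_natural[of "source A f" "target A f" f] F.A.arrows_hom[of f] by simp
qed

lemma category_HomCat:
  fixes A :: "('k, 'o, 'm) monsupercat" and B :: "('k, 'p, 'n) monsupercat" (structure)
  assumes A: "monoidal_supercategory K A" and B: "monoidal_supercategory K B"
  shows "category (HomCat K A B)"
proof -
  note sf = superfun_between[OF A B]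
  interpret A: even_monoidal K A by (rule even_monoidal) fact
  interpret B: even_monoidal K B by (rule even_monoidal) fact
  have comp: "monoidal_nat_trans A B F H (\<lambda>x \<in> Obj A. s x $ t x)"
    if f: "monoidal_superfunctor K A B F" "monoidal_superfunctor K A B G" "monoidal_superfunctor K A B H"
      and t: "monoidal_nat_trans A B F G t" and s: "monoidal_nat_trans A B G H s" for F G H s t
  proof -
    interpret F: superfun_between K A B F by (rule sf) fact
    interpret G: superfun_between K A B G by (rule sf) fact
    interpret H: superfun_between K A B H by (rule sf) fact
    note T = monoidal_nat_transD[OF sf[OF f(1)] sf[OF f(2)] t]
    note S = monoidal_nat_transD[OF sf[OF f(2)] sf[OF f(3)] s]
    note [simp] = T(1-3) S(1-3) T(1)[THEN B.hmg_arrow] S(1)[THEN B.hmg_arrow]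
    show ?thesis
    proof (rule monoidal_nat_transI[OF B.supercategory_axioms _ _ _ _ _ A.linear_category_axioms])
    fix h assume h: "h \<in> arrows A"
    have "(s (target A h) $ t (target A h)) $ fmor F h = s (target A h) $ fmor G h $ t (source A h)"
      using h T(4)[OF h] by simp
    also have "... = (s (target A h) $ fmor G h) $ t (source A h)" using h by simp
    also have "... = fmor H h $ s (source A h) $ t (source A h)" using h S(4)[OF h] by simp
    finally show "(\<lambda>x\<in>Obj A. s x $ t x) (target A h) $ fmor F h = fmor H h $ (\<lambda>x\<in>Obj A. s x $ t x) (source A h)"
      using h by simp
  next
    fix x y assume o [simp]: "x \<in> Obj A" "y \<in> Obj A"
    have "(s (x *.\<^bsub>A\<^esub> y) $ t (x *.\<^bsub>A\<^esub> y)) $ fc F (x, y) = s (x *.\<^bsub>A\<^esub> y) $ fc G (x, y) $ (t x ** t y)"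
      using monoidal_nat_trans.t_tensor[OF t o] by simp
    also have "... = (s (x *.\<^bsub>A\<^esub> y) $ fc G (x, y)) $ (t x ** t y)" by simp
    also have "... = fc H (x, y) $ ((s x $ t x) ** (s y $ t y))"
      using monoidal_nat_trans.t_tensor[OF s o] by simp
    finally show "(\<lambda>x\<in>Obj A. s x $ t x) (x *.\<^bsub>A\<^esub> y) $ fc F (x, y)
      = fc H (x, y) $ ((\<lambda>x\<in>Obj A. s x $ t x) x ** (\<lambda>x\<in>Obj A. s x $ t x) y)"
      by simp
  next
    show "(\<lambda>x\<in>Obj A. s x $ t x) (Unit A) $ fi F = fi H"
      using monoidal_nat_trans.t_unit[OF s] monoidal_nat_trans.t_unit[OF t] by simp
    fix x assume "x \<in> Obj A"
    then show "hmg B 0 ((\<lambda>x\<in>Obj A. s x $ t x) x) \<and> source B ((\<lambda>x\<in>Obj A. s x $ t x) x) = fob F x \<and>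
      target B ((\<lambda>x\<in>Obj A. s x $ t x) x) = fob H x" by simp
    qed simp
  qed
  have idn: "monoidal_nat_trans A B F F (\<lambda>x \<in> Obj A. Ident B (fob F x))" if "monoidal_superfunctor K A B F" for F
  proof -
    interpret F: superfun_between K A B F by (rule sf) fact
    show ?thesis
      by (rule monoidal_nat_transI[OF B.supercategory_axioms _ _ _ _ _ A.linear_category_axioms]) simp_all
  qed
  have ext: "t = (\<lambda>x \<in> Obj A. u x)" if "monoidal_nat_trans A B F G t" "!!x. x \<in> Obj A ==> t x = u x" for F G t u
    using monoidal_nat_trans.t_ext[OF that(1)] that(2) by (auto simp: extensional_def fun_eq_iff)
  show ?thesis
  proof (unfold_locales; (unfold HomCat_simps mem_Collect_eq)?)
    fix F G H and f g :: "('o, 'm, 'p, 'n) monfun \<times> ('o \<Rightarrow> 'n) \<times> ('o, 'm, 'p, 'n) monfun"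
    assume a: "monoidal_superfunctor K A B F" "monoidal_superfunctor K A B G" "monoidal_superfunctor K A B H"
      "\<exists>t. f = (F, t, G) \<and> monoidal_nat_trans A B F G t" "\<exists>t. g = (G, t, H) \<and> monoidal_nat_trans A B G H t"
    then show "\<exists>t. cmp (HomCat K A B) g f = (F, t, H) \<and> monoidal_nat_trans A B F H t"
      using comp[OF a(1-3)] by (auto simp: HomCat_simps)
  next
    fix F G H L and f g h :: "('o, 'm, 'p, 'n) monfun \<times> ('o \<Rightarrow> 'n) \<times> ('o, 'm, 'p, 'n) monfun"
    assume a: "monoidal_superfunctor K A B F" "monoidal_superfunctor K A B G" "monoidal_superfunctor K A B H"
      "monoidal_superfunctor K A B L"
      "\<exists>t. f = (F, t, G) \<and> monoidal_nat_trans A B F G t" "\<exists>t. g = (G, t, H) \<and> monoidal_nat_trans A B G H t"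
      "\<exists>t. h = (H, t, L) \<and> monoidal_nat_trans A B H L t"
    then obtain t s r where t: "f = (F, t, G)" "monoidal_nat_trans A B F G t" and s: "g = (G, s, H)" "monoidal_nat_trans A B G H s"
      and r: "h = (H, r, L)" "monoidal_nat_trans A B H L r" by blast
    note T = monoidal_nat_transD[OF sf[OF a(1)] sf[OF a(2)] t(2)] monoidal_nat_transD[OF sf[OF a(2)] sf[OF a(3)] s(2)]
      monoidal_nat_transD[OF sf[OF a(3)] sf[OF a(4)] r(2)]
    show "cmp (HomCat K A B) (cmp (HomCat K A B) h g) f = cmp (HomCat K A B) h (cmp (HomCat K A B) g f)"
      using T(1-3,5-7,9-11) T(1)[THEN B.hmg_arrow] T(5)[THEN B.hmg_arrow] T(9)[THEN B.hmg_arrow]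
      by (simp add: t s r HomCat_simps fun_eq_iff restrict_def)
  next
    fix F G and f :: "('o, 'm, 'p, 'n) monfun \<times> ('o \<Rightarrow> 'n) \<times> ('o, 'm, 'p, 'n) monfun"
    assume a: "monoidal_superfunctor K A B F" "monoidal_superfunctor K A B G"
      "\<exists>t. f = (F, t, G) \<and> monoidal_nat_trans A B F G t"
    then obtain t where t: "f = (F, t, G)" "monoidal_nat_trans A B F G t" by blast
    note T = monoidal_nat_transD[OF sf[OF a(1)] sf[OF a(2)] t(2)]
    note T' = T(1)[THEN B.hmg_arrow]
    show "cmp (HomCat K A B) (G, \<lambda>x\<in>Obj A. Ident B (fob G x), G) f = f"
      "cmp (HomCat K A B) f (F, \<lambda>x\<in>Obj A. Ident B (fob F x), F) = f"
      using T T' by (auto simp: t(1) HomCat_simps intro!: ext[OF t(2), symmetric])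
  qed (use idn in auto)
qed

section \<open>Restriction along the inclusion into the envelope\<close>

context pi_envelope
begin

text \<open>The unit of the adjunction. All its coherence maps are identities, so restriction along
  it keeps the coherence maps at shift 0.\<close>

definition env_incl :: "('o, 'm, bit \<times> 'o, bit \<times> 'm \<times> bit) monfun" where
  "env_incl = \<lparr>fob = (\<lambda>x \<in> Obj A. (0, x)), fmor = (\<lambda>f \<in> Arr. (0, f, 0)),
     fc = (\<lambda>(x, y) \<in> Obj A \<times> Obj A. (0, I (x *. y), 0)), fi = (0, I (Unit A), 0)\<rparr>"

lemma env_incl_simps [simp]:
  "Ob x ==> fob env_incl x = (0, x)" "ar f ==> fmor env_incl f = (0, f, 0)"
  "[|Ob x; Ob y|] ==> fc env_incl (x, y) = (0, I (x *. y), 0)"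
  "fi env_incl = (0, I (Unit A), 0)"
  by (simp_all add: env_incl_def)

lemma monoidal_superfunctor_env_incl: "monoidal_superfunctor K A E env_incl"
proof (rule monoidal_superfunctorI[OF monoidal_supercategory_axioms monoidal_supercategory_envelope])
  show "superfunctor K A E env_incl"
  proof (rule superfunctorI[OF supercategory_axioms supercategory_envelope])
    fix x y assume "Ob x" "Ob y"
    then show "linear_map K (Hm x y) (Hom E (fob env_incl x) (fob env_incl y)) (fmor env_incl)"
      using linear_map_to_shifted_space[OF linear_map_id _ module_Hom[of x y], of "fmor env_incl" 0 0]
      by (simp add: hom_iff)
  qed (auto simp: hmg_arrow)
qed (auto simp: envelope_invertible env_incl_def extensional_def envelope_TensM[of 0 _ 0] hmg_arrow)

end

lemma monoidal_superfunctor_forget_left: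
  "monoidal_superfunctor K (forget_pi A) B F \<longleftrightarrow> monoidal_superfunctor K A B F"
  unfolding monoidal_superfunctor_def monoidal_superfunctor_axioms_def monoidal_functor_coherence_def
    superfunctor_def superfunctor_axioms_def linear_functor_def linear_functor_axioms_def
  by simp

lemma monoidal_nat_trans_forget_left:
  "monoidal_nat_trans (forget_pi A) B F G t \<longleftrightarrow> monoidal_nat_trans A B F G t"
  unfolding monoidal_nat_trans_def by simp

locale envelope_functor_to = A: pi_envelope K A + G: superfun_between K "envelope A" B G
  for K :: "'k ring" and A :: "('k, 'o, 'm) monsupercat" and B :: "('k, 'p, 'n) monsupercat" (structure)
    and G :: "(bit \<times> 'o, bit \<times> 'm \<times> bit, 'p, 'n) monfun"
begin

abbreviation "rG \<equiv> comp_monfun A B G A.env_incl"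

sublocale composable K A "envelope A" B A.env_incl G
  by (intro composable.intro monoidal_functor_between_super
      A.monoidal_supercategory_axioms A.monoidal_supercategory_envelope A.monoidal_superfunctor_env_incl)
    unfold_locales

lemma restr_simps [simp]:
  "A.Ob x ==> fmor G (a, Ident A x, a) = Ident B (fob G (a, x))"
  "[|A.Ob x; A.Ob y|] ==> fc rG (x, y) = fc G ((0, x), (0, y))"
  "fi rG = fi G"
proof -
  show 1: "A.Ob x ==> fmor G (a, Ident A x, a) = Ident B (fob G (a, x))" for a x
    using G.fmor_Ident[of "(a, x)"] by simp
  show "fc rG (x, y) = fc G ((0, x), (0, y))" if o: "A.Ob x" "A.Ob y"
    using 1[of "x *.\<^bsub>A\<^esub> y" 0] G.fc_arrow[of "(0, x)" "(0, y)"] o by simp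
  show "fi rG = fi G" using 1[of "Unit A" 0] G.fi_arrow by simp
qed

text \<open>A functor on the envelope sends the shifts of identities to isomorphisms between its
  values at \<open>\<Pi>^a x\<close> and \<open>\<Pi>^b x\<close>; through them everything is
  expressed by the values at shift 0.\<close>

lemma shift_arrow [simp]:
  assumes "A.Ob x"
  shows "invertible B (fmor G (a, Ident A x, b))" "source B (fmor G (a, Ident A x, b)) = fob G (a, x)"
    "target B (fmor G (a, Ident A x, b)) = fob G (b, x)" "hmg B (a + b) (fmor G (a, Ident A x, b))"
  using G.fmor_invertible(1)[of "(a, Ident A x, b)"] A.envelope_invertible[of "Ident A x" a b]
    G.fmor_arrow[of "(a, Ident A x, b)"] G.fmor_hmg[of "a + b" "(a, Ident A x, b)"] assms
  by (simp_all add: ac_simps)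

lemma shift_comp [simp]:
  "A.ar f ==> x = target A f ==> fmor G (b, Ident A x, c) $ fmor G (a, f, b) = fmor G (a, f, c)"
  "A.ar f ==> x = source A f ==> fmor G (b, f, c) $ fmor G (a, Ident A x, b) = fmor G (a, f, c)"
  using G.fmor_comp[of "(a, f, b)" "(b, Ident A (target A f), c)"] G.fmor_comp[of "(a, Ident A (source A f), b)" "(b, f, c)"]
  by simp_all

lemma fc_shift_target:
  assumes "A.Ob x" "A.Ob y"
  shows "fc G ((a, x), (b, y)) $ (fmor G (0, Ident A x, a) ** fmor G (0, Ident A y, b))
    = fmor G (0, Ident A (x *.\<^bsub>A\<^esub> y), a + b) $ fc G ((0, x), (0, y))"
  using G.fc_nat_refl[of "(0, Ident A x, a)" "(0, Ident A y, b)"] assms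
  by (simp add: A.envelope_TensM[of 0 _ 0])

text \<open>Shifts down to 0 tensor to a shift only up to the sign \<open>a * b\<close>, whereas
  shifts up from 0, in the preceding lemma, tensor without a sign. This is the term
  \<open>a c\<close> in the tensor product of the envelope.\<close>

lemma fc_shift_source:
  assumes "A.Ob x" "A.Ob y"
  shows "fc G ((0, x), (0, y)) $ (fmor G (a, Ident A x, 0) ** fmor G (b, Ident A y, 0))
    = sgn_arr B (a * b) (fmor G (a + b, Ident A (x *.\<^bsub>A\<^esub> y), 0) $ fc G ((a, x), (b, y)))"
proof -
  have "fmor G (a + b, sgn_arr A (a * b) (Ident A (x *.\<^bsub>A\<^esub> y)), 0) = sgn_arr B (a * b) (fmor G (a + b, Ident A (x *.\<^bsub>A\<^esub> y), 0))"
    using G.fmor_sgn[of "(a + b, Ident A (x *.\<^bsub>A\<^esub> y), 0)" "a * b"] assms by simp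
  then show ?thesis
    using G.fc_nat_refl[of "(a, Ident A x, 0)" "(b, Ident A y, 0)"] assms
    by (simp add: A.envelope_TensM[of 0 _ 0])
qed

end

text \<open>Restriction goes from functors on the envelope to functors on \<open>A\<close>; the
  functor in the stated direction is its quasi-inverse.\<close>

lemma envelope_equivalence:
  fixes A :: "('k, 'o, 'm) monsupercat" and B :: "('k, 'p, 'n) monsupercat" (structure)
  assumes A: "monoidal_supercategory K A" and B: "monoidal_supercategory K B"
    and p: "p \<in> Obj B" and iso: "isom B p (Unit B) z" and odd: "z \<in> hpart (Hom B p (Unit B)) 1"
  shows "\<exists>\<Phi>. is_equivalence (HomCat K A B) (HomCat K (forget_pi (envelope A)) B) \<Phi>"
proof -
  interpret A: pi_envelope K A by (intro pi_envelope.intro even_monoidal A)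
  interpret B: even_monoidal K B by (rule even_monoidal) fact
  let ?E = "forget_pi (envelope A)"
  have E: "monoidal_supercategory K ?E"
    by (simp add: monoidal_supercategory_forget_pi A.monoidal_supercategory_envelope)
  have env: "envelope_functor_to K A B G" if "monoidal_superfunctor K A.E B G" for G
    by (intro envelope_functor_to.intro superfun_between A.monoidal_supercategory_envelope B that) unfold_locales
  define R where "R G = comp_monfun A B G A.env_incl" for G :: "(bit \<times> 'o, bit \<times> 'm \<times> bit, 'p, 'n) monfun"
  have R: "monoidal_superfunctor K A B (R G)" if "monoidal_superfunctor K A.E B G" for G
    unfolding R_def
    by (rule monoidal_superfunctor_comp[OF A A.monoidal_supercategory_envelope B A.monoidal_superfunctor_env_incl that])
  define \<Psi> where "\<Psi> = \<lparr>fob = R, fmor = (%(G, t, G'). (R G, (\<lambda>x \<in> Obj A. t (0 :: bit, x) :: 'n), R G'))\<rparr>"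
  note sE = superfun_between[OF A.monoidal_supercategory_envelope B]
  note TD = monoidal_nat_transD[OF sE sE]
  have arr: "arr (HomCat K ?E B) G G' = {(G, t, G') | t. monoidal_nat_trans A.E B G G' t}" for G G'
    by (simp add: HomCat_simps monoidal_nat_trans_forget_left)
  have ob: "ob (HomCat K ?E B) = {G. monoidal_superfunctor K A.E B G}"
    by (simp add: HomCat_simps monoidal_superfunctor_forget_left)
  \<comment> \<open>Naturality at the shift from \<open>\<Pi>^a x\<close> to \<open>x\<close>
    computes every component from those at shift 0. This yields faithfulness and, read as a
    definition, fullness.\<close>
  have shift: "t (a, x) = fmor G' (0, Ident A x, a) $ t (0, x) $ fmor G (a, Ident A x, 0)"
    if "monoidal_superfunctor K A.E B G" "monoidal_superfunctor K A.E B G'" "monoidal_nat_trans A.E B G G' t" "x \<in> Obj A"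
    for G G' :: "(bit \<times> 'o, bit \<times> 'm \<times> bit, 'p, 'n) monfun" and t a x
  proof -
    interpret G: envelope_functor_to K A B G by (rule env) fact
    interpret G': envelope_functor_to K A B G' by (rule env) fact
    note T = TD[OF that(1-3)]
    note [simp] = T(1-3) T(1)[THEN B.hmg_arrow] that(4)
    have "fmor G' (0, Ident A x, a) $ t (0, x) $ fmor G (a, Ident A x, 0)
      = fmor G' (0, Ident A x, a) $ fmor G' (a, Ident A x, 0) $ t (a, x)"
      using T(4)[of "(a, Ident A x, 0)"] by simp
    also have "... = (fmor G' (0, Ident A x, a) $ fmor G' (a, Ident A x, 0)) $ t (a, x)"
      by (subst B.comp_assoc) simp_all
    also have "... = t (a, x)" by (subst G'.shift_comp) simp_all
    finally show ?thesis by simp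
  qed
  have "is_equivalence (HomCat K ?E B) (HomCat K A B) \<Psi>"
  proof (rule is_equivalenceI[OF category_HomCat[OF E B] category_HomCat[OF A B]])
    show "is_functor (HomCat K ?E B) (HomCat K A B) \<Psi>"
    proof (unfold_locales; (unfold ob arr mem_Collect_eq)?)
      fix G :: "(bit \<times> 'o, bit \<times> 'm \<times> bit, 'p, 'n) monfun" assume "monoidal_superfunctor K A.E B G"
      then show "fob \<Psi> G \<in> ob (HomCat K A B)" by (simp add: \<Psi>_def R HomCat_simps)
    next
      fix G G' :: "(bit \<times> 'o, bit \<times> 'm \<times> bit, 'p, 'n) monfun" and f assume a: "monoidal_superfunctor K A.E B G" "monoidal_superfunctor K A.E B G'"
        "\<exists>t. f = (G, t, G') \<and> monoidal_nat_trans A.E B G G' t"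
      then obtain t where t: "f = (G, t, G')" "monoidal_nat_trans A.E B G G' t" by blast
      interpret G: envelope_functor_to K A B G by (rule env) fact
      interpret G': envelope_functor_to K A B G' by (rule env) fact
      note T = TD[OF a(1,2) t(2)]
      note [simp] = T(1-3) T(1)[THEN B.hmg_arrow]
      have "monoidal_nat_trans A B (R G) (R G') (\<lambda>x\<in>Obj A. t (0, x))"
        unfolding R_def
      proof (rule monoidal_nat_transI[OF B.supercategory_axioms _ _ _ _ _ A.linear_category_axioms])
        fix f assume "f \<in> arrows A"
        then show "(\<lambda>x\<in>Obj A. t (0, x)) (target A f) $ fmor G.rG f = fmor G'.rG f $ (\<lambda>x\<in>Obj A. t (0, x)) (source A f)"
          using T(4)[of "(0, f, 0)"] by simp
      next
        fix x y assume "x \<in> Obj A" "y \<in> Obj A"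
        then show "(\<lambda>x\<in>Obj A. t (0, x)) (x *.\<^bsub>A\<^esub> y) $ fc G.rG (x, y)
          = fc G'.rG (x, y) $ ((\<lambda>x\<in>Obj A. t (0, x)) x ** (\<lambda>x\<in>Obj A. t (0, x)) y)"
          using monoidal_nat_trans.t_tensor[OF t(2), of "(0, x)" "(0, y)"] by simp
      next
        show "(\<lambda>x\<in>Obj A. t (0, x)) (Unit A) $ fi G.rG = fi G'.rG"
          using monoidal_nat_trans.t_unit[OF t(2)] by simp
      qed simp_all
      then show "fmor \<Psi> f \<in> arr (HomCat K A B) (fob \<Psi> G) (fob \<Psi> G')"
        by (simp add: \<Psi>_def t(1) HomCat_simps)
    next
      fix G G' G'' :: "(bit \<times> 'o, bit \<times> 'm \<times> bit, 'p, 'n) monfun" and f g assume "monoidal_superfunctor K A.E B G" "monoidal_superfunctor K A.E B G'" "monoidal_superfunctor K A.E B G''"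
        "\<exists>t. f = (G, t, G') \<and> monoidal_nat_trans A.E B G G' t" "\<exists>t. g = (G', t, G'') \<and> monoidal_nat_trans A.E B G' G'' t"
      then show "fmor \<Psi> (cmp (HomCat K ?E B) g f) = cmp (HomCat K A B) (fmor \<Psi> g) (fmor \<Psi> f)"
        by (auto simp: \<Psi>_def HomCat_simps fun_eq_iff restrict_def)
    next
      fix G :: "(bit \<times> 'o, bit \<times> 'm \<times> bit, 'p, 'n) monfun" assume "monoidal_superfunctor K A.E B G"
      then show "fmor \<Psi> (idn (HomCat K ?E B) G) = idn (HomCat K A B) (fob \<Psi> G)"
        by (auto simp: \<Psi>_def HomCat_simps fun_eq_iff restrict_def R_def comp_monfun_def)
    qed
  next
    fix G G' f g assume "G \<in> ob (HomCat K ?E B)" "G' \<in> ob (HomCat K ?E B)" "f \<in> arr (HomCat K ?E B) G G'"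
      "g \<in> arr (HomCat K ?E B) G G'" and e: "fmor \<Psi> f = fmor \<Psi> g"
    then obtain t s where a: "monoidal_superfunctor K A.E B G" "monoidal_superfunctor K A.E B G'"
      and t: "f = (G, t, G')" "monoidal_nat_trans A.E B G G' t" and s: "g = (G, s, G')" "monoidal_nat_trans A.E B G G' s"
      by (auto simp: ob arr)
    have "t (0, x) = s (0, x)" if "x \<in> Obj A" for x
      using e that by (auto simp: \<Psi>_def t s fun_eq_iff restrict_def split: if_splits)
    then have ax: "t (a, x) = s (a, x)" if "x \<in> Obj A" for a x
      using shift[OF a t(2) that, of a] shift[OF a s(2) that, of a] that by simp
    have "t = s"
      by (rule extensionalityI[OF monoidal_nat_trans.t_ext[OF t(2)] monoidal_nat_trans.t_ext[OF s(2)]]) (use ax in auto)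
    then show "f = g" by (simp add: t s)
  next
    fix G G' h assume o: "G \<in> ob (HomCat K ?E B)" "G' \<in> ob (HomCat K ?E B)" and h: "h \<in> arr (HomCat K A B) (fob \<Psi> G) (fob \<Psi> G')"
    have a: "monoidal_superfunctor K A.E B G" "monoidal_superfunctor K A.E B G'" using o by (simp_all add: ob)
    obtain u where u: "h = (R G, u, R G')" "monoidal_nat_trans A B (R G) (R G') u"
      using h by (auto simp: HomCat_simps \<Psi>_def)
    interpret G: envelope_functor_to K A B G by (rule env) fact
    interpret G': envelope_functor_to K A B G' by (rule env) fact
    note U = monoidal_nat_transD[OF superfun_between[OF A B R[OF a(1)]] superfun_between[OF A B R[OF a(2)]] u(2)]
    have u' [simp]: "hmg B 0 (u x)" "u x \<in> arrows B" "source B (u x) = fob G (0, x)" "target B (u x) = fob G' (0, x)" if "x \<in> Obj A" for x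
      using U(1-3)[OF that] that B.hmg_arrow by (auto simp: R_def)
    have un: "u (target A f) $ fmor G (0, f, 0) = fmor G' (0, f, 0) $ u (source A f)" if "f \<in> arrows A" for f
      using U(4)[OF that] that by (simp add: R_def)
    have ut: "u (x *.\<^bsub>A\<^esub> y) $ fc G ((0, x), (0, y)) = fc G' ((0, x), (0, y)) $ (u x ** u y)" if "x \<in> Obj A" "y \<in> Obj A" for x y
      using monoidal_nat_trans.t_tensor[OF u(2) that] that by (simp add: R_def)
    have uu: "u (Unit A) $ fi G = fi G'"
      using monoidal_nat_trans.t_unit[OF u(2)] by (simp add: R_def)
    define t where "t = (\<lambda>(a, x) \<in> Obj A.E. fmor G' (0, Ident A x, a) $ u x $ fmor G (a, Ident A x, 0))"
    have t: "t (a, x) = fmor G' (0, Ident A x, a) $ u x $ fmor G (a, Ident A x, 0)" if "x \<in> Obj A" for a x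
      using that by (simp add: t_def)
    have t0 [simp]: "t (0, x) = u x" if "x \<in> Obj A" for x using that by (simp add: t)
    have "monoidal_nat_trans A.E B G G' t"
    proof (rule monoidal_nat_transI[OF B.supercategory_axioms _ _ _ _ _ A.E.linear_category_axioms])
      show "t \<in> extensional (Obj A.E)" by (auto simp: t_def extensional_def)
      show "t (Unit A.E) $ fi G = fi G'" using uu by simp
      fix X assume "X \<in> Obj A.E"
      then obtain a x where X: "X = (a, x)" "x \<in> Obj A" by auto
      have "hmg B (0 + a + (0 + (a + 0))) (t (a, x))"
        unfolding t[OF X(2)] by (intro B.hmg_comp_gen G.shift_arrow G'.shift_arrow u') (use X in simp_all)
      then show "hmg B 0 (t X) \<and> source B (t X) = fob G X \<and> target B (t X) = fob G' X"
        using X by (simp add: t)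
    next
      fix F assume "F \<in> arrows A.E"
      then obtain a f b where F: "F = (a, f, b)" and f [simp]: "f \<in> arrows A" by (rule A.envelope_arrowE)
      have "t (b, target A f) $ fmor G (a, f, b) = fmor G' (0, Ident A (target A f), b) $ u (target A f) $
         (fmor G (b, Ident A (target A f), 0) $ fmor G (a, f, b))"
        by (simp add: t del: G.shift_comp)
      also have "fmor G (b, Ident A (target A f), 0) $ fmor G (a, f, b) = fmor G (0, f, 0) $ fmor G (a, Ident A (source A f), 0)"
        by simp
      also have "fmor G' (0, Ident A (target A f), b) $ u (target A f) $ ...
         = fmor G' (0, Ident A (target A f), b) $ (u (target A f) $ fmor G (0, f, 0)) $ fmor G (a, Ident A (source A f), 0)"
        by (simp del: G.shift_comp)
      also have "... = (fmor G' (0, Ident A (target A f), b) $ fmor G' (0, f, 0)) $ u (source A f) $ fmor G (a, Ident A (source A f), 0)"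
        unfolding un[OF f] by (simp del: G.shift_comp G'.shift_comp)
      also have "fmor G' (0, Ident A (target A f), b) $ fmor G' (0, f, 0) = fmor G' (a, f, b) $ fmor G' (0, Ident A (source A f), a)"
        by simp
      also have "... $ u (source A f) $ fmor G (a, Ident A (source A f), 0) = fmor G' (a, f, b) $ t (a, source A f)"
        by (simp add: t del: G'.shift_comp)
      finally show "t (target A.E F) $ fmor G F = fmor G' F $ t (source A.E F)" by (simp add: F)
    next
      fix X Y assume "X \<in> Obj A.E" "Y \<in> Obj A.E"
      then obtain a x b y where X: "X = (a, x)" and Y: "Y = (b, y)" and [simp]: "x \<in> Obj A" "y \<in> Obj A" by auto
      let ?vx = "fmor G (a, Ident A x, 0)" and ?vy = "fmor G (b, Ident A y, 0)"
      let ?wx = "fmor G' (0, Ident A x, a)" and ?wy = "fmor G' (0, Ident A y, b)"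
      let ?w = "fmor G' (0, Ident A (x *.\<^bsub>A\<^esub> y), a + b)" and ?v = "fmor G (a + b, Ident A (x *.\<^bsub>A\<^esub> y), 0)"
      have "t (TensO A.E X Y) $ fc G (X, Y) = ?w $ u (x *.\<^bsub>A\<^esub> y) $ (?v $ fc G ((a, x), (b, y)))"
        by (simp add: X Y t)
      also have "?v $ fc G ((a, x), (b, y)) = sgn_arr B (a * b) (fc G ((0, x), (0, y)) $ (?vx ** ?vy))"
        by (subst G.fc_shift_source) simp_all
      also have "?w $ u (x *.\<^bsub>A\<^esub> y) $ ...
         = sgn_arr B (a * b) (?w $ (u (x *.\<^bsub>A\<^esub> y) $ fc G ((0, x), (0, y))) $ (?vx ** ?vy))"
        by simp
      also have "... = sgn_arr B (a * b) ((?w $ fc G' ((0, x), (0, y))) $ ((u x $ ?vx) ** (u y $ ?vy)))"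
        by (simp add: ut)
      also have "?w $ fc G' ((0, x), (0, y)) = fc G' ((a, x), (b, y)) $ (?wx ** ?wy)"
        by (subst G'.fc_shift_target) simp_all
      also have "sgn_arr B (a * b) ((fc G' ((a, x), (b, y)) $ (?wx ** ?wy)) $ ((u x $ ?vx) ** (u y $ ?vy)))
         = fc G' ((a, x), (b, y)) $ sgn_arr B (a * b) ((?wx ** ?wy) $ ((u x $ ?vx) ** (u y $ ?vy)))"
        by simp
      \<comment> \<open>The interchange of \<open>?wy\<close>, of parity \<open>b\<close>, with
        \<open>u x $ ?vx\<close>, of parity \<open>a\<close>, produces the sign that cancels the one
        left by \<open>fc_shift_source\<close>.\<close>
      also have "sgn_arr B (a * b) ((?wx ** ?wy) $ ((u x $ ?vx) ** (u y $ ?vy))) = t (a, x) ** t (b, y)"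
      proof -
        have h: "hmg B (0 + b) ?wy" "hmg B (0 + (a + 0)) (u x $ ?vx)"
          by (intro B.hmg_comp_gen G.shift_arrow G'.shift_arrow; simp)+
        show ?thesis by (subst B.TensM_comp_gen[OF _ h]) (simp_all add: t mult.commute)
      qed
      finally show "t (TensO A.E X Y) $ fc G (X, Y) = fc G' (X, Y) $ (t X ** t Y)" by (simp add: X Y)
    qed
    moreover have "(\<lambda>x\<in>Obj A. t (0, x)) = u"
      by (rule extensionalityI[OF _ monoidal_nat_trans.t_ext[OF u(2)]]) auto
    ultimately show "\<exists>f \<in> arr (HomCat K ?E B) G G'. fmor \<Psi> f = h"
      by (intro bexI[of _ "(G, t, G')"]) (auto simp: arr \<Psi>_def u(1))
  next
    fix F assume "F \<in> ob (HomCat K A B)"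
    then have F: "monoidal_superfunctor K A B F" by (simp add: HomCat_simps)
    have z: "invertible B z" "hmg B 1 z" "source B z = p" "target B z = Unit B"
      using B.isomD[OF iso p] B.hmgI[OF odd p] by simp_all
    interpret X: envelope_extension K A B F p z
      by (intro envelope_extension.intro superfun_between[OF A B F] envelope_extension_axioms.intro p z) unfold_locales
    have e: "monoidal_superfunctor K A.E B X.ext" by (rule X.monoidal_superfunctor_ext)
    interpret G: envelope_functor_to K A B X.ext by (rule env) fact
    \<comment> \<open>The extension restricts to \<open>F\<close> exactly, since \<open>th 0\<close>
      is an identity; hence the identity of \<open>F\<close> can serve as the required
      isomorphism.\<close>
    have "R X.ext = F"
    proof (rule monfun_eqI)
      show "fob (R X.ext) = fob F"
        by (rule extensionalityI[OF _ X.F.fob_ext]) (auto simp: R_def comp_monfun_def)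
      show "fmor (R X.ext) = fmor F"
        by (rule extensionalityI[OF _ X.F.fmor_ext]) (auto simp: R_def comp_monfun_def)
      show "fc (R X.ext) = fc F"
      proof (rule extensionalityI[OF _ X.F.fc_ext])
        show "fc (R X.ext) \<in> extensional (Obj A \<times> Obj A)" by (auto simp: R_def comp_monfun_def extensional_def)
        fix q assume "q \<in> Obj A \<times> Obj A"
        then obtain x y where q: "q = (x, y)" "x \<in> Obj A" "y \<in> Obj A" by auto
        show "fc (R X.ext) q = fc F q" unfolding R_def q(1) G.restr_simps(2)[OF q(2,3)] using q by simp
      qed
      show "fi (R X.ext) = fi F" unfolding R_def G.restr_simps(3) by simp
    qed
    moreover have "cat_iso (HomCat K A B) F F (idn (HomCat K A B) F)"
      using category.idn_closed[OF category_HomCat[OF A B], of F] category.idn_left[OF category_HomCat[OF A B], of F F] F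
      unfolding cat_iso_def by (auto simp: HomCat_simps(1))
    ultimately show "\<exists>x\<in>ob (HomCat K ?E B). \<exists>s. cat_iso (HomCat K A B) (fob \<Psi> x) F s"
      using e by (intro bexI[of _ X.ext] exI[of _ "idn (HomCat K A B) F"]) (simp_all add: ob \<Psi>_def)
  qed
  then show ?thesis using is_equivalence_sym by blast
qed

section \<open>The underlying monoidal $\Pi$-category\<close>

lemma even_space_simps [simp]:
  "carrier (even_space V) = hpart V 0" "\<zero>\<^bsub>even_space V\<^esub> = \<zero>\<^bsub>V\<^esub>"
  "u \<oplus>\<^bsub>even_space V\<^esub> v = u \<oplus>\<^bsub>V\<^esub> v" "k \<odot>\<^bsub>even_space V\<^esub> v = k \<odot>\<^bsub>V\<^esub> v"
  by (simp_all add: even_space_def module.defs)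

lemma module_even_space:
  fixes V :: "('k, 'm) superspace"
  assumes "superspace K V"
  shows "module K (even_space V)"
proof -
  interpret superspace K V by fact
  show ?thesis
  proof (rule moduleI)
    show "abelian_group (even_space V)"
    proof (rule abelian_groupI)
      fix x assume "x \<in> carrier (even_space V)"
      then show "\<exists>y\<in>carrier (even_space V). y \<oplus>\<^bsub>even_space V\<^esub> x = \<zero>\<^bsub>even_space V\<^esub>"
        by (intro bexI[of _ "\<ominus>\<^bsub>V\<^esub> x"]) (auto simp: M.l_neg hpart_carrier)
    qed (auto simp: M.a_ac hpart_carrier)
  qed (auto simp: smult_l_distr smult_r_distr smult_assoc1 R.is_cring hpart_carrier)
qed

lemma neg_even_space:
  fixes V :: "('k, 'm) superspace"
  assumes "superspace K V" "v \<in> hpart V 0"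
  shows "\<ominus>\<^bsub>even_space V\<^esub> v = \<ominus>\<^bsub>V\<^esub> v"
proof -
  interpret superspace K V by fact
  interpret E: module K "even_space V" by (rule module_even_space) fact
  show ?thesis using assms(2) by (intro E.M.minus_equality) (auto simp: hpart_carrier M.l_neg)
qed

lemma linear_map_even_space:
  fixes V :: "('k, 'm) superspace" and W :: "('k, 'n) superspace"
  assumes "superspace K V" "linear_map K V W f" "!!v. v \<in> hpart V 0 ==> f v \<in> hpart W 0"
  shows "linear_map K (even_space V) (even_space W) f"
proof -
  interpret superspace K V by fact
  show ?thesis using assms(2,3) unfolding linear_map_def by (auto simp: hpart_carrier)
qed

locale pi_super = even_monoidal K A + monoidal_pi_supercategory K A
  for K :: "'k ring" and A :: "('k, 'o, 'm) pi_monsupercat" (structure)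
begin

abbreviation "U \<equiv> underlying A"

lemma underlying_simps [simp]:
  "Obj U = Obj A" "Hom U x y = even_space (Hm x y)" "Comp U = Comp A" "Ident U = I"
  "TensO U = TensO A" "TensM U = TensM A" "Unit U = Unit A" "Assoc U = Assoc A" "Lun U = Lun A" "Run U = Run A"
  "pi_ob U = pi_obj A" "xi U = Lun A (Unit A) $ (zeta A ** zeta A)"
  by (simp_all add: underlying_def)

lemma category_underlying: "category (cat_of U)"
proof (unfold_locales; (unfold cat_of_simps underlying_simps even_space_simps)?)
  fix w x y z f g h
  assume "Ob w" "Ob x" "Ob y" "Ob z" "f \<in> hpart (Hm w x) 0" "g \<in> hpart (Hm x y) 0" "h \<in> hpart (Hm y z) 0"
  then show "(h $ g) $ f = h $ (g $ f)" by (auto simp: hpart_iff_hmg hmg_arrow)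
qed (auto simp: hpart_iff_hmg hmg_arrow)

lemma linear_category_underlying: "linear_category K U"
proof (intro linear_category.intro category_underlying linear_category_axioms.intro)
  fix x y assume "x \<in> Obj U" "y \<in> Obj U"
  then show "module K (Hom U x y)" by (auto intro!: module_even_space superspace_Hom)
next
  fix x y z assume "x \<in> Obj U" "y \<in> Obj U" "z \<in> Obj U"
  then show "bilinear_map K (Hom U y z) (Hom U x y) (Hom U x z) (Comp U)"
    unfolding bilinear_map_def
    by (auto intro!: linear_map_even_space superspace_Hom linear_comp_left linear_comp_right
      simp: hpart_iff_hmg hmg_arrow)
qed

sublocale U: linear_category K U by (rule linear_category_underlying)

lemma underlying_arrows [simp]: "f \<in> arrows U \<longleftrightarrow> hmg A 0 f"
  unfolding arrows_def by (auto simp: hpart_iff_hmg dest: hmg_arrow)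

lemma underlying_source [simp]:
  assumes "hmg A 0 f"
  shows "source U f = src f" "target U f = tgt f"
  using U.homD[of f "src f" "tgt f"] hmg_hpart[OF assms] hmg_arrow[OF assms] by simp_all

lemma underlying_invertible:
  assumes "hmg A 0 f" "invertible A f"
  shows "invertible U f" "inverse_of U f = ivs f"
  by (rule U.inverse_of_eqI(2)[of f "ivs f"]; use assms in simp)
     (rule U.inverse_of_eqI(1); use assms in simp)

lemma underlying_isom:
  "[|hmg A 0 f; invertible A f; src f = x; tgt f = y|] ==> isom U x y f"
  by (rule U.invertible_isom) (simp_all add: underlying_invertible)

lemma invertible_if_underlying:
  assumes "invertible U f"
  shows "invertible A f" "hmg A 0 f"
proof -
  show f: "hmg A 0 f" using U.invertible_arrow[OF assms] by simp
  have g: "hmg A 0 (inverse_of U f)" using U.inverse_of_arrow(1)[OF assms] by simp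
  show "invertible A f"
    by (rule inverse_of_eqI(2)[of f "inverse_of U f"])
       (use f g hmg_arrow U.inverse_of_arrow[OF assms] U.inverse_comp[OF assms] in auto)
qed

text \<open>Coherence maps are even, and between even morphisms the interchange law has no
  sign.\<close>

lemma linear_monoidal_underlying: "linear_monoidal_category K U"
proof (intro linear_monoidal_category.intro linear_category_underlying monoidal_coherence.intro
    linear_monoidal_category_axioms.intro)
  fix x x' y y' assume "x \<in> Obj U" "x' \<in> Obj U" "y \<in> Obj U" "y' \<in> Obj U"
  then show "bilinear_map K (Hom U x x') (Hom U y y') (Hom U (TensO U x y) (TensO U x' y')) (TensM U)"
    unfolding bilinear_map_def
    by (auto intro!: linear_map_even_space superspace_Hom linear_TensM_left linear_TensM_right
      simp: hpart_iff_hmg hmg_arrow)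
next
  fix x y z x' y' z' f g h
  assume "x \<in> Obj U" "y \<in> Obj U" "z \<in> Obj U" "x' \<in> Obj U" "y' \<in> Obj U" "z' \<in> Obj U"
    "f \<in> homset U x x'" "g \<in> homset U y y'" "h \<in> homset U z z'"
  then show "Comp U (Assoc U x' y' z') (TensM U (TensM U f g) h) = Comp U (TensM U f (TensM U g h)) (Assoc U x y z)"
    using Assoc_nat_refl[of f g h] by (auto simp: hpart_iff_hmg hmg_arrow)
next
  fix x y f assume "x \<in> Obj U" "y \<in> Obj U" "f \<in> homset U x y"
  then show "Comp U (Lun U y) (TensM U (Ident U (Unit U)) f) = Comp U f (Lun U x)"
    "Comp U (Run U y) (TensM U f (Ident U (Unit U))) = Comp U f (Run U x)"
    using Lun_nat_refl[of f] Run_nat_refl[of f] by (auto simp: hpart_iff_hmg hmg_arrow)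
next
  fix w x y z assume "w \<in> Obj U" "x \<in> Obj U" "y \<in> Obj U" "z \<in> Obj U"
  then show "Comp U (Assoc U w x (TensO U y z)) (Assoc U (TensO U w x) y z)
        = Comp U (TensM U (Ident U w) (Assoc U x y z)) (Comp U (Assoc U w (TensO U x y) z) (TensM U (Assoc U w x y) (Ident U z)))"
    using pentagon[of w x y z] by (simp del: TensM_comp_assoc_even_left TensM_comp_assoc_even_right)
next
  fix x y assume "x \<in> Obj U" "y \<in> Obj U"
  then show "Comp U (TensM U (Ident U x) (Lun U y)) (Assoc U x (Unit U) y) = TensM U (Run U x) (Ident U y)"
    using triangle[of x y] by simp
next
  fix x x' x'' y y' y'' f g h k
  assume "x \<in> Obj U" "x' \<in> Obj U" "x'' \<in> Obj U" "y \<in> Obj U" "y' \<in> Obj U" "y'' \<in> Obj U"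
    "f \<in> homset U x' x''" "g \<in> homset U y' y''" "h \<in> homset U x x'" "k \<in> homset U y y'"
  then show "Comp U (TensM U f g) (TensM U h k) = TensM U (Comp U f h) (Comp U g k)"
    by (auto simp: hpart_iff_hmg hmg_arrow)
qed (simp_all add: underlying_isom)

sublocale UM: linear_monoidal_category K U by (rule linear_monoidal_underlying)

text \<open>Kelly's identities concern even morphisms only, so they are inherited from the
  underlying linear monoidal category, where they were proved without signs.\<close>

lemma Lun_TensO: "[|Ob x; Ob y|] ==> Lun A (x *. y) $ Assoc A (Unit A) x y = Lun A x ** I y"
  and Run_TensO: "[|Ob x; Ob y|] ==> (I x ** Run A y) $ Assoc A x y (Unit A) = Run A (x *. y)"
  and Lun_Unit: "Lun A (Unit A) = Run A (Unit A)"
  using UM.Lun_TensO[of x y] UM.Run_TensO[of x y] UM.Lun_Unit by simp_all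

abbreviation "\<pi> \<equiv> pi_obj A"
abbreviation "\<zeta> \<equiv> zeta A"

lemma pi_Obj [simp]: "Ob \<pi>"
  by (rule pi_obj_closed)

lemma zeta [simp]: "invertible A \<zeta>" "hmg A 1 \<zeta>" "src \<zeta> = \<pi>" "tgt \<zeta> = Unit A"
  using isomD[OF zeta_iso] hmgI[OF zeta_odd] by simp_all

text \<open>The odd isomorphisms \<open>\<pi> \<otimes> x \<rightarrow> x\<close> and \<open>x \<otimes> \<pi> \<rightarrow> x\<close>; every odd morphism out of \<open>x\<close> is an even
  morphism out of \<open>\<pi> \<otimes> x\<close> composed with the inverse of the former.\<close>

definition kp :: "'o \<Rightarrow> 'm" where "kp x = Lun A x $ (\<zeta> ** I x)"
definition kp' :: "'o \<Rightarrow> 'm" where "kp' x = Run A x $ (I x ** \<zeta>)"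

lemma whisker_invertible:
  assumes "Ob x" "invertible A f"
  shows "invertible A (f ** I x)" "invertible A (I x ** f)"
    "ivs (f ** I x) = ivs f ** I x"
    "ivs (I x ** f) = I x ** ivs f"
  by (rule inverse_of_eqI(2)[of _ "ivs f ** I x"]; use assms in simp)
     (rule inverse_of_eqI(2)[of _ "I x ** ivs f"] inverse_of_eqI(1); use assms in simp)+

lemma kappa [simp]:
  assumes "Ob x"
  shows "invertible A (kp x)" "hmg A 1 (kp x)" "src (kp x) = \<pi> *. x" "tgt (kp x) = x"
    "invertible A (kp' x)" "hmg A 1 (kp' x)" "src (kp' x) = x *. \<pi>" "tgt (kp' x) = x"
  using assms by (simp_all add: kp_def kp'_def whisker_invertible)

text \<open>The sign appears when \<open>f\<close> passes the odd \<zeta>; the left unitor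
  contributes none.\<close>

lemma kappa_natural:
  assumes "hmg A p f" "src f = x" "tgt f = y"
  shows "kp y $ (I \<pi> ** f) = sgn_arr A p (f $ kp x)"
proof -
  note f [simp] = hmg_arrow[OF assms(1)]
  have [simp]: "Ob x" "Ob y" using assms by auto
  have "(I (Unit A) ** f) $ (\<zeta> ** I x) = sgn_arr A p (\<zeta> ** f)"
    using TensM_comp_gen[of "I (Unit A)" p f 1 \<zeta> "I x"] assms by simp
  then have e: "\<zeta> ** f = sgn_arr A p ((I (Unit A) ** f) $ (\<zeta> ** I x))"
    by (subst sgn_arr_eq_iff[symmetric]) (use assms in simp_all)
  have "kp y $ (I \<pi> ** f) = Lun A y $ (\<zeta> ** f)" using assms by (simp add: kp_def)
  also have "... = sgn_arr A p ((Lun A y $ (I (Unit A) ** f)) $ (\<zeta> ** I x))"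
    unfolding e using assms by (simp del: TensM_comp_even_left TensM_comp_even_right)
  also have "... = sgn_arr A p (f $ kp x)"
    unfolding Lun_nat[OF f assms(2,3)] using assms by (simp add: kp_def)
  finally show ?thesis .
qed

lemma kappa'_natural:
  assumes "hmg A 0 f" "src f = x" "tgt f = y"
  shows "kp' y $ (f ** I \<pi>) = f $ kp' x"
proof -
  note f [simp] = hmg_arrow[OF assms(1)]
  have [simp]: "Ob x" "Ob y" using assms by auto
  have "kp' y $ (f ** I \<pi>) = (Run A y $ (f ** I (Unit A))) $ (I x ** \<zeta>)"
    using assms by (simp add: kp'_def)
  also have "... = f $ kp' x"
    unfolding Run_nat[OF f assms(2,3)] using assms by (simp add: kp'_def)
  finally show ?thesis .
qed

context
  fixes x y assumes o [simp]: "Ob x" "Ob y"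
begin

text \<open>Naturality of the associator together with Kelly's identity for \<open>Lun\<close>. The
  next two lemmas use the one for \<open>Run\<close> and the triangle: \<zeta> is absorbed at the
  left, at the right and in the middle.\<close>

lemma kappa_TensO: "kp (x *. y) $ Assoc A \<pi> x y = kp x ** I y"
proof -
  have "kp (x *. y) $ Assoc A \<pi> x y = Lun A (x *. y) $ ((\<zeta> ** (I x ** I y)) $ Assoc A \<pi> x y)"
    by (simp add: kp_def)
  also have "... = (Lun A (x *. y) $ Assoc A (Unit A) x y) $ ((\<zeta> ** I x) ** I y)"
    using Assoc_nat_refl[of \<zeta> "I x" "I y"] by simp
  also have "... = kp x ** I y" unfolding Lun_TensO[OF o] by (simp add: kp_def)
  finally show ?thesis .
qed

lemma kappa'_TensO: "(I x ** kp' y) $ Assoc A x y \<pi> = kp' (x *. y)"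
proof -
  have "(I x ** kp' y) $ Assoc A x y \<pi> = (I x ** Run A y) $ ((I x ** (I y ** \<zeta>)) $ Assoc A x y \<pi>)"
    by (simp add: kp'_def)
  also have "... = ((I x ** Run A y) $ Assoc A x y (Unit A)) $ ((I x ** I y) ** \<zeta>)"
    using Assoc_nat_refl[of "I x" "I y" \<zeta>] by simp
  also have "... = kp' (x *. y)" unfolding Run_TensO[OF o] by (simp add: kp'_def)
  finally show ?thesis .
qed

lemma kappa_kappa': "(I x ** kp y) $ Assoc A x \<pi> y = kp' x ** I y"
proof -
  have "(I x ** kp y) $ Assoc A x \<pi> y = (I x ** Lun A y) $ ((I x ** (\<zeta> ** I y)) $ Assoc A x \<pi> y)"
    by (simp add: kp_def)
  also have "... = ((I x ** Lun A y) $ Assoc A x (Unit A) y) $ ((I x ** \<zeta>) ** I y)"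
    using Assoc_nat_refl[of "I x" \<zeta> "I y"] by simp
  also have "... = kp' x ** I y" unfolding triangle[OF o] by (simp add: kp'_def)
  finally show ?thesis .
qed

lemma kappa_twice: "kp x $ (I \<pi> ** kp x) $ Assoc A \<pi> \<pi> x = Lun A x $ (xi U ** I x)"
proof -
  have "kp x $ (I \<pi> ** kp x) $ Assoc A \<pi> \<pi> x
     = Lun A x $ (I (Unit A) ** Lun A x) $ ((\<zeta> ** (\<zeta> ** I x)) $ Assoc A \<pi> \<pi> x)"
    by (simp add: kp_def)
  also have "... = Lun A x $ ((I (Unit A) ** Lun A x) $ Assoc A (Unit A) (Unit A) x) $ ((\<zeta> ** \<zeta>) ** I x)"
    using Assoc_nat_refl[of \<zeta> \<zeta> "I x"] by (simp del: TensM_comp_even_left TensM_comp_even_right)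
  also have "... = Lun A x $ (xi U ** I x)"
    unfolding triangle[OF Unit_Obj o(1)] Lun_Unit[symmetric] by simp
  finally show ?thesis .
qed

text \<open>Here two copies of \<zeta>, both on the right, have to be interchanged, and odd past odd
  gives -1. On the left, in \<open>kappa_twice\<close>, no odd morphism passes another.\<close>

lemma kappa'_twice: "kp' x $ (kp' x ** I \<pi>) = sgn_arr A 1 (Run A x $ (I x ** xi U) $ Assoc A x \<pi> \<pi>)"
proof -
  have 1: "(I (x *. Unit A) ** \<zeta>) $ ((I x ** \<zeta>) ** I \<pi>) = sgn_arr A 1 ((I x ** \<zeta>) ** \<zeta>)"
    by (subst TensM_comp_odd) simp_all
  have w: "kp' x ** I \<pi> = (Run A x ** I \<pi>) $ ((I x ** \<zeta>) ** I \<pi>)"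
    by (simp add: kp'_def)
  have w2: "(I x ** \<zeta>) $ (Run A x ** I \<pi>) = (Run A x ** I (Unit A)) $ (I (x *. Unit A) ** \<zeta>)"
    by simp
  have "kp' x $ (kp' x ** I \<pi>)
     = Run A x $ ((I x ** \<zeta>) $ (Run A x ** I \<pi>)) $ ((I x ** \<zeta>) ** I \<pi>)"
    unfolding w by (simp add: kp'_def del: TensM_comp_even_left TensM_comp_even_right
        TensM_comp_assoc_even_left TensM_comp_assoc_even_right)
  also have "... = Run A x $ (Run A x ** I (Unit A)) $ ((I (x *. Unit A) ** \<zeta>) $ ((I x ** \<zeta>) ** I \<pi>))"
    unfolding w2 by (simp del: TensM_comp_even_left TensM_comp_even_right
        TensM_comp_assoc_even_left TensM_comp_assoc_even_right)
  also have "... = sgn_arr A 1 (Run A x $ ((Run A x ** I (Unit A)) $ ((I x ** \<zeta>) ** \<zeta>)))"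
    unfolding 1 by (simp del: TensM_comp_even_left TensM_comp_even_right)
  also have "... = sgn_arr A 1 (Run A x $ (I x ** Lun A (Unit A)) $ (Assoc A x (Unit A) (Unit A) $ ((I x ** \<zeta>) ** \<zeta>)))"
    unfolding triangle[OF o(1) Unit_Obj, symmetric] by (simp del: TensM_comp_even_left TensM_comp_even_right)
  also have "... = sgn_arr A 1 (Run A x $ (I x ** xi U) $ Assoc A x \<pi> \<pi>)"
    using Assoc_nat_refl[of "I x" \<zeta> \<zeta>] by simp
  finally show ?thesis .
qed

end

text \<open>The product of two odd isomorphisms is the composite of two whiskered ones, each of
  which is invertible without a sign.\<close>

lemma xi_underlying [simp]:
  "invertible A (xi U)" "hmg A 0 (xi U)" "src (xi U) = \<pi> *. \<pi>" "tgt (xi U) = Unit A"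
proof -
  have e: "\<zeta> ** \<zeta> = (\<zeta> ** I (Unit A)) $ (I \<pi> ** \<zeta>)" by simp
  have "invertible A (\<zeta> ** \<zeta>)" unfolding e
    by (rule invertible_comp) (simp_all add: whisker_invertible)
  then show "invertible A (xi U)" "hmg A 0 (xi U)" "src (xi U) = \<pi> *. \<pi>" "tgt (xi U) = Unit A" by simp_all
qed

declare underlying_simps(12) [simp del]

abbreviation "\<beta> \<equiv> half_braiding U"

text \<open>The half braiding compares the two ways of absorbing \<pi>. Its axioms become statements
  about \<open>kp\<close> and \<open>kp'\<close>, proved by cancelling the invertible
  \<open>kp'\<close>.\<close>

lemma half_braiding_kappa:
  assumes [simp]: "Ob x"
  shows "\<beta> x = ivs (kp' x) $ kp x"
  by (simp add: underlying_def kp'_def kp_def whisker_invertible)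

lemma beta [simp]:
  assumes "Ob x"
  shows "invertible A (\<beta> x)" "hmg A 0 (\<beta> x)" "src (\<beta> x) = \<pi> *. x" "tgt (\<beta> x) = x *. \<pi>"
  using assms by (simp_all add: half_braiding_kappa)

lemma kappa'_beta [simp]:
  assumes "Ob x"
  shows "kp' x $ \<beta> x = kp x"
  using assms by (simp add: half_braiding_kappa)

lemma kappa_Unit: "kp (Unit A) = \<zeta> $ Run A \<pi>" "kp' (Unit A) = \<zeta> $ Lun A \<pi>"
  using Run_nat_refl[of \<zeta>] Lun_nat_refl[of \<zeta>] by (simp_all add: kp_def kp'_def Lun_Unit)

text \<open>After composition with \<zeta>, naturality of \<open>kp\<close> at the odd morphism
  \<zeta> itself supplies the minus sign. This is the axiom that \<beta> at \<pi> equals -1.\<close>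

lemma kappa_pi: "kp' \<pi> = sgn_arr A 1 (kp \<pi>)"
proof (rule comp_cancel_left[of \<zeta>])
  have "sgn_arr A 1 (\<zeta> $ kp \<pi>) = kp (Unit A) $ (I \<pi> ** \<zeta>)"
    using kappa_natural[of 1 \<zeta>] by simp
  also have "... = \<zeta> $ kp' \<pi>" by (simp add: kappa_Unit kp'_def)
  finally show "\<zeta> $ kp' \<pi> = \<zeta> $ sgn_arr A 1 (kp \<pi>)" by simp
qed simp_all

text \<open>Composed with the invertible \<open>I x ** kp' y\<close>, both sides become
  \<open>kp x ** I y\<close>.\<close>

lemma beta_TensO:
  assumes [simp]: "Ob x" "Ob y"
  shows "Assoc A x y \<pi> $ \<beta> (x *. y) $ Assoc A \<pi> x y = (I x ** \<beta> y) $ Assoc A x \<pi> y $ (\<beta> x ** I y)"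
proof (rule comp_cancel_left[of "I x ** kp' y"])
  have "(I x ** kp' y) $ Assoc A x y \<pi> $ \<beta> (x *. y) $ Assoc A \<pi> x y
     = ((I x ** kp' y) $ Assoc A x y \<pi>) $ \<beta> (x *. y) $ Assoc A \<pi> x y" by simp
  also have "... = (kp' (x *. y) $ \<beta> (x *. y)) $ Assoc A \<pi> x y"
    unfolding kappa'_TensO[OF assms] by (simp del: kappa'_beta)
  also have "... = kp x ** I y" by (simp add: kappa_TensO)
  also have "... = (kp' x ** I y) $ (\<beta> x ** I y)" by simp
  also have "... = (I x ** kp y) $ Assoc A x \<pi> y $ (\<beta> x ** I y)"
    unfolding kappa_kappa'[OF assms, symmetric] by simp
  also have "... = (I x ** kp' y) $ (I x ** \<beta> y) $ Assoc A x \<pi> y $ (\<beta> x ** I y)"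
    by simp
  finally show "(I x ** kp' y) $ Assoc A x y \<pi> $ \<beta> (x *. y) $ Assoc A \<pi> x y
     = (I x ** kp' y) $ (I x ** \<beta> y) $ Assoc A x \<pi> y $ (\<beta> x ** I y)" .
qed (simp_all add: whisker_invertible)

text \<open>Two minus signs cancel: one from \<open>kappa'_twice\<close> and one from naturality of
  \<open>kp\<close> at the odd morphism \<open>kp x\<close>. The axiom on \<xi> and \<beta> follows
  by moving two isomorphisms to the other side.\<close>

lemma xi_beta_eq:
  assumes [simp]: "Ob x"
  shows "Run A x $ (I x ** xi U) $ Assoc A x \<pi> \<pi> $ (\<beta> x ** I \<pi>) $ ivs (Assoc A \<pi> x \<pi>)
      $ (I \<pi> ** \<beta> x) $ Assoc A \<pi> \<pi> x = Lun A x $ (xi U ** I x)"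
proof -
  let ?t = "ivs (Assoc A \<pi> x \<pi>) $ (I \<pi> ** \<beta> x) $ Assoc A \<pi> \<pi> x"
  have k: "Run A x $ (I x ** xi U) $ Assoc A x \<pi> \<pi> = sgn_arr A 1 (kp' x $ (kp' x ** I \<pi>))"
    unfolding kappa'_twice[OF assms assms] by simp
  have "Run A x $ (I x ** xi U) $ Assoc A x \<pi> \<pi> $ (\<beta> x ** I \<pi>) $ ?t
     = (Run A x $ (I x ** xi U) $ Assoc A x \<pi> \<pi>) $ (\<beta> x ** I \<pi>) $ ?t" by simp
  also have "... = sgn_arr A 1 (kp' x $ (kp x ** I \<pi>) $ ?t)"
    unfolding k by simp
  also have "kp x ** I \<pi> = kp (x *. \<pi>) $ Assoc A \<pi> x \<pi>" by (simp add: kappa_TensO)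
  also have "sgn_arr A 1 (kp' x $ (kp (x *. \<pi>) $ Assoc A \<pi> x \<pi>) $ ?t)
    = sgn_arr A 1 (kp' x $ (kp (x *. \<pi>) $ (I \<pi> ** \<beta> x)) $ Assoc A \<pi> \<pi> x)" by simp
  also have "kp (x *. \<pi>) $ (I \<pi> ** \<beta> x) = \<beta> x $ kp (\<pi> *. x)" using kappa_natural[of 0 "\<beta> x"] by simp
  also have "sgn_arr A 1 (kp' x $ (\<beta> x $ kp (\<pi> *. x)) $ Assoc A \<pi> \<pi> x)
     = sgn_arr A 1 ((kp' x $ \<beta> x) $ kp (\<pi> *. x) $ Assoc A \<pi> \<pi> x)"
    by (simp del: kappa'_beta)
  also have "... = sgn_arr A 1 (kp x $ kp (\<pi> *. x)) $ Assoc A \<pi> \<pi> x"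
    by simp
  also have "... = (kp x $ (I \<pi> ** kp x)) $ Assoc A \<pi> \<pi> x"
    using kappa_natural[of 1 "kp x"] by simp
  also have "... = Lun A x $ (xi U ** I x)" using kappa_twice[OF assms assms] by simp
  finally show ?thesis .
qed

lemma monoidal_pi_category_underlying: "monoidal_pi_category K U"
proof (intro monoidal_pi_category.intro linear_monoidal_underlying, unfold_locales)
  fix x y f assume "x \<in> Obj U" "y \<in> Obj U" "f \<in> homset U x y"
  then have f [simp]: "Ob x" "Ob y" "hmg A 0 f" "src f = x" "tgt f = y"
    by (auto simp: hpart_iff_hmg)
  note [simp] = hmg_arrow[OF f(3)]
  have "kp' y $ \<beta> y $ (I \<pi> ** f) = kp' y $ (f ** I \<pi>) $ \<beta> x"
  proof -
    have "kp' y $ \<beta> y $ (I \<pi> ** f) = (kp' y $ \<beta> y) $ (I \<pi> ** f)" by (simp del: kappa'_beta)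
    also have "... = f $ (kp' x $ \<beta> x)" using kappa_natural[of 0 f] by simp
    also have "... = (kp' y $ (f ** I \<pi>)) $ \<beta> x" using kappa'_natural[of f] by (simp del: kappa'_beta)
    finally show ?thesis by simp
  qed
  then have "\<beta> y $ (I \<pi> ** f) = (f ** I \<pi>) $ \<beta> x"
    by (intro comp_cancel_left[of "kp' y" "\<beta> y $ (I \<pi> ** f)" "(f ** I \<pi>) $ \<beta> x"]) simp_all
  then show "Comp U (\<beta> y) (TensM U (Ident U (pi_ob U)) f) = Comp U (TensM U f (Ident U (pi_ob U))) (\<beta> x)" by simp
next
  show "Comp U (Lun U (pi_ob U)) (\<beta> (Unit U)) = Run U (pi_ob U)"
    by (simp add: half_braiding_kappa kappa_Unit)
next
  have "\<beta> \<pi> = sgn_arr A 1 (I (\<pi> *. \<pi>))"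
    by (simp add: half_braiding_kappa kappa_pi)
  also have "... = \<ominus>\<^bsub>Hm (\<pi> *. \<pi>) (\<pi> *. \<pi>)\<^esub> I (\<pi> *. \<pi>)"
    by (simp add: sgn_arr_def signed_def hom_of_def)
  also have "... = \<ominus>\<^bsub>even_space (Hm (\<pi> *. \<pi>) (\<pi> *. \<pi>))\<^esub> I (\<pi> *. \<pi>)"
    by (rule neg_even_space[symmetric, OF superspace_Hom]) (simp_all add: hpart_iff_hmg)
  finally show "\<beta> (pi_ob U) = \<ominus>\<^bsub>Hom U (TensO U (pi_ob U) (pi_ob U)) (TensO U (pi_ob U) (pi_ob U))\<^esub>
      Ident U (TensO U (pi_ob U) (pi_ob U))"
    by simp
next
  fix x assume "x \<in> Obj U"
  then have [simp]: "Ob x" by simp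
  let ?Q = "Assoc A x \<pi> \<pi> $ (\<beta> x ** I \<pi>) $ ivs (Assoc A \<pi> x \<pi>)
            $ (I \<pi> ** \<beta> x) $ Assoc A \<pi> \<pi> x"
  have e: "inverse_of U (xi U) = ivs (xi U)" "inverse_of U (Run A x) = ivs (Run A x)"
    "inverse_of U (Assoc A \<pi> x \<pi>) = ivs (Assoc A \<pi> x \<pi>)"
    by (simp_all add: underlying_invertible)
  have "(I x ** ivs (xi U)) $ ivs (Run A x) $ Lun A x $ (xi U ** I x)
    = (I x ** ivs (xi U)) $ ivs (Run A x) $ Run A x $ (I x ** xi U) $ ?Q"
    using xi_beta_eq[of x] by simp
  also have "... = ?Q" by simp
  finally show "Comp U (TensM U (Ident U x) (inverse_of U (xi U)))
     (Comp U (inverse_of U (Run U x)) (Comp U (Lun U x) (TensM U (xi U) (Ident U x))))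
    = Comp U (Assoc U x (pi_ob U) (pi_ob U)) (Comp U (TensM U (\<beta> x) (Ident U (pi_ob U)))
        (Comp U (inverse_of U (Assoc U (pi_ob U) x (pi_ob U)))
          (Comp U (TensM U (Ident U (pi_ob U)) (\<beta> x)) (Assoc U (pi_ob U) (pi_ob U) x))))"
    by (simp add: e)
qed (simp_all add: underlying_isom beta_TensO)

lemma inverse_kappa_natural:
  assumes [simp]: "hmg A 0 f" "src f = x" "tgt f = y"
  shows "ivs (kp y) $ f = (I \<pi> ** f) $ ivs (kp x)"
proof -
  note [simp] = hmg_arrow[OF assms(1)]
  have [simp]: "Ob x" "Ob y" using source_Obj[of f] target_Obj[of f] by simp_all
  have "f = (f $ kp x) $ ivs (kp x)" by simp
  also have "f $ kp x = kp y $ (I \<pi> ** f)" using kappa_natural[of 0 f x y] by simp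
  finally show ?thesis by (intro inverse_switch[symmetric]) simp_all
qed

text \<open>Absorption of \<pi> into a tensor product happens either in the left factor or, after
  braiding past \<open>x\<close>, in the right one. This governs the tensor product of odd morphisms
  with objects and is the pattern for \<open>lam\<close> and \<open>\<sigma>\<close>.\<close>

lemma kappa_split:
  assumes [simp]: "Ob x" "Ob y"
  shows "kp (x *. y) = (kp x ** I y) $ ivs (Assoc A \<pi> x y)"
    and "kp (x *. y) = (I x ** kp y) $ Assoc A x \<pi> y $ (\<beta> x ** I y) $ ivs (Assoc A \<pi> x y)"
proof -
  have "kp (x *. y) = (kp (x *. y) $ Assoc A \<pi> x y) $ ivs (Assoc A \<pi> x y)" by simp
  also have "... = (kp x ** I y) $ ivs (Assoc A \<pi> x y)" by (subst kappa_TensO) simp_all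
  finally show 1: "kp (x *. y) = (kp x ** I y) $ ivs (Assoc A \<pi> x y)" .
  also have "... = ((kp' x ** I y) $ (\<beta> x ** I y)) $ ivs (Assoc A \<pi> x y)" by simp
  also have "... = (I x ** kp y) $ Assoc A x \<pi> y $ (\<beta> x ** I y) $ ivs (Assoc A \<pi> x y)"
    by (subst kappa_kappa'[symmetric]) simp_all
  finally show "kp (x *. y) = (I x ** kp y) $ Assoc A x \<pi> y $ (\<beta> x ** I y) $ ivs (Assoc A \<pi> x y)" .
qed

text \<open>Naturality of \<open>kp\<close> at the odd \<open>kp x\<close> turns
  \<open>kappa_twice\<close> into this form at the cost of a sign. The inverse of the right-hand
  side reappears as \<open>\<omega>\<close>.\<close>

lemma kappa_kappa:
  assumes [simp]: "Ob x"
  shows "kp x $ kp (\<pi> *. x) = sgn_arr A 1 ((Lun A x $ (xi U ** I x)) $ ivs (Assoc A \<pi> \<pi> x))"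
proof -
  have "sgn_arr A 1 ((Lun A x $ (xi U ** I x)) $ ivs (Assoc A \<pi> \<pi> x)) = sgn_arr A 1 (kp x $ (I \<pi> ** kp x))"
    unfolding kappa_twice[OF assms assms, symmetric] by simp
  then show ?thesis using kappa_natural[of 1 "kp x"] by simp
qed

text \<open>The even morphism that encodes \<zeta> is minus \<xi>. This explains the sign of \<zeta>
  in the supercategory constructed from a \<Pi>-category.\<close>

lemma zeta_kappa: "\<zeta> $ kp \<pi> = sgn_arr A 1 (xi U)"
proof -
  have "kp (Unit A) $ (I \<pi> ** \<zeta>) = xi U" by (simp add: underlying_def kp_def)
  then have "sgn_arr A 1 (\<zeta> $ kp \<pi>) = xi U" using kappa_natural[of 1 \<zeta> \<pi> "Unit A"] by simp
  from arg_cong[OF this, of "sgn_arr A 1"] show ?thesis by simp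
qed

end

lemma pi_super: "monoidal_pi_supercategory K A ==> pi_super K A"
  by (intro pi_super.intro even_monoidal monoidal_supercategory_if_pi)

section \<open>From monoidal superfunctors to \<Pi>-functors\<close>

locale pi_super_functor = A: pi_super K A + B: pi_super K B + superfun_between K A B F
  for K :: "'k ring" and A :: "('k, 'o, 'm) pi_monsupercat" and B :: "('k, 'p, 'n) pi_monsupercat" (structure)
    and F :: "('o, 'm, 'p, 'n) monfun"
begin

abbreviation "UF \<equiv> underlying_monfun A B F"

lemma underlying_monfun_simps [simp]:
  "fob UF = fob F" "hmg A 0 f ==> fmor UF f = fmor F f" "fc UF = fc F" "fi UF = fi F"
  by (simp_all add: underlying_monfun_def)

lemma underlying_fj [simp]:
  "invertible B (fj UF)" "hmg B 0 (fj UF)" "B.src (fj UF) = pi_obj B" "B.tgt (fj UF) = fob F (pi_obj A)"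
  using fmor_hmg[of 1 "zeta A"] by (simp_all add: underlying_monfun_def del: fmor_invertible(2))

text \<open>The defining equation of j, freed from the inverse; given the other coherence maps, it
  determines j from the image of \<zeta> and conversely.\<close>

lemma zeta_fj: "fmor F (zeta A) $ fj UF = fi F $ zeta B"
  by (simp add: underlying_monfun_def del: fmor_invertible(2))

text \<open>\<open>F\<close> respects the absorption of \<pi> on either side, up to its coherence
  maps; this rests on \<open>zeta_fj\<close> and the unit axioms. Since \<beta> is a quotient of the
  two absorptions, compatibility with \<beta> follows.\<close>

lemma kappa_fj:
  assumes [simp]: "A.Ob x"
  shows "fmor F (A.kp x) $ fc F (pi_obj A, x) $ (fj UF ** B.I (fob F x)) = B.kp (fob F x)"
    "fmor F (A.kp' x) $ fc F (x, pi_obj A) $ (B.I (fob F x) ** fj UF) = B.kp' (fob F x)"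
proof -
  have "fmor F (A.kp x) $ fc F (pi_obj A, x) $ (fj UF ** B.I (fob F x))
    = fmor F (Lun A x) $ (fmor F (zeta A **\<^bsub>A\<^esub> A.I x) $ fc F (pi_obj A, x)) $ (fj UF ** B.I (fob F x))"
    by (simp add: A.kp_def fmor_comp)
  also have "fmor F (zeta A **\<^bsub>A\<^esub> A.I x) $ fc F (pi_obj A, x)
      = fc F (Unit A, x) $ (fmor F (zeta A) ** B.I (fob F x))"
    using fc_nat_refl[of "zeta A" "A.I x"] by simp
  also have "fmor F (Lun A x) $ ... $ (fj UF ** B.I (fob F x))
     = fmor F (Lun A x) $ fc F (Unit A, x) $ ((fmor F (zeta A) $ fj UF) ** B.I (fob F x))"
    by simp
  also have "... = (fmor F (Lun A x) $ fc F (Unit A, x) $ (fi F ** B.I (fob F x))) $ (zeta B ** B.I (fob F x))"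
    unfolding zeta_fj by simp
  finally show "fmor F (A.kp x) $ fc F (pi_obj A, x) $ (fj UF ** B.I (fob F x)) = B.kp (fob F x)"
    unfolding fc_Lun[OF assms] by (simp add: B.kp_def)
  have "fmor F (A.kp' x) $ fc F (x, pi_obj A) $ (B.I (fob F x) ** fj UF)
    = fmor F (Run A x) $ (fmor F (A.I x **\<^bsub>A\<^esub> zeta A) $ fc F (x, pi_obj A)) $ (B.I (fob F x) ** fj UF)"
    by (simp add: A.kp'_def fmor_comp)
  also have "fmor F (A.I x **\<^bsub>A\<^esub> zeta A) $ fc F (x, pi_obj A)
      = fc F (x, Unit A) $ (B.I (fob F x) ** fmor F (zeta A))"
    using fc_nat_refl[of "A.I x" "zeta A"] by simp
  also have "fmor F (Run A x) $ ... $ (B.I (fob F x) ** fj UF)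
     = fmor F (Run A x) $ fc F (x, Unit A) $ (B.I (fob F x) ** (fmor F (zeta A) $ fj UF))"
    by simp
  also have "... = (fmor F (Run A x) $ fc F (x, Unit A) $ (B.I (fob F x) ** fi F)) $ (B.I (fob F x) ** zeta B)"
    unfolding zeta_fj by simp
  finally show "fmor F (A.kp' x) $ fc F (x, pi_obj A) $ (B.I (fob F x) ** fj UF) = B.kp' (fob F x)"
    unfolding fc_Run[OF assms] by (simp add: B.kp'_def)
qed

lemma linear_functor_underlying: "linear_functor K A.U B.U UF"
proof (intro linear_functor.intro is_functor.intro linear_functor_axioms.intro; (unfold cat_of_simps)?)
  fix x y assume o: "x \<in> Obj A.U" "y \<in> Obj A.U"
  then have "linear_map K (even_space (Hom A x y)) (even_space (Hom B (fob F x) (fob F y))) (fmor F)"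
    using parity_fmor[of x y _ 0] linear_fmor[of x y] by (intro linear_map_even_space A.superspace_Hom) auto
  moreover have "fmor F f = fmor UF f" if "f \<in> carrier (even_space (Hom A x y))" for f
    using that o by (simp add: A.hpart_iff_hmg)
  ultimately show "linear_map K (Hom A.U x y) (Hom B.U (fob UF x) (fob UF y)) (fmor UF)"
    using linear_map_cong[of "even_space (Hom A x y)" "fmor F" "fmor UF" K] o
    by (auto intro: module_even_space A.superspace_Hom)
qed (auto simp: A.hpart_iff_hmg B.hpart_iff_hmg A.hmg_arrow fmor_comp)

lemma coherence_underlying: "monoidal_functor_coherence A.U B.U UF"
proof (intro monoidal_functor_coherence.intro)
  show "fob UF \<in> extensional (Obj A.U)" "fc UF \<in> extensional (Obj A.U \<times> Obj A.U)"
    using fob_ext fc_ext by simp_all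
  show "fmor UF \<in> extensional (arrows A.U)" by (simp add: underlying_monfun_def)
next
  fix x y assume "x \<in> Obj A.U" "y \<in> Obj A.U"
  then show "isom B.U (TensO B.U (fob UF x) (fob UF y)) (fob UF (TensO A.U x y)) (fc UF (x, y))"
    by (intro B.underlying_isom) simp_all
next
  show "isom B.U (Unit B.U) (fob UF (Unit A.U)) (fi UF)" by (intro B.underlying_isom) simp_all
next
  fix x x' y y' f g assume "x \<in> Obj A.U" "x' \<in> Obj A.U" "y \<in> Obj A.U" "y' \<in> Obj A.U" "f \<in> homset A.U x x'" "g \<in> homset A.U y y'"
  then show "Comp B.U (fc UF (x', y')) (TensM B.U (fmor UF f) (fmor UF g)) = Comp B.U (fmor UF (TensM A.U f g)) (fc UF (x, y))"
    using fc_nat_refl[of f g] by (auto simp: A.hpart_iff_hmg A.hmg_arrow)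
next
  fix x y z assume "x \<in> Obj A.U" "y \<in> Obj A.U" "z \<in> Obj A.U"
  then show "Comp B.U (fmor UF (Assoc A.U x y z)) (Comp B.U (fc UF (TensO A.U x y, z)) (TensM B.U (fc UF (x, y)) (Ident B.U (fob UF z))))
    = Comp B.U (fc UF (x, TensO A.U y z)) (Comp B.U (TensM B.U (Ident B.U (fob UF x)) (fc UF (y, z))) (Assoc B.U (fob UF x) (fob UF y) (fob UF z)))"
    using fc_Assoc[of x y z] by simp
next
  fix x assume "x \<in> Obj A.U"
  then show "Comp B.U (fmor UF (Lun A.U x)) (Comp B.U (fc UF (Unit A.U, x)) (TensM B.U (fi UF) (Ident B.U (fob UF x)))) = Lun B.U (fob UF x)"
    "Comp B.U (fmor UF (Run A.U x)) (Comp B.U (fc UF (x, Unit A.U)) (TensM B.U (Ident B.U (fob UF x)) (fi UF))) = Run B.U (fob UF x)"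
    using fc_Lun[of x] fc_Run[of x] by simp_all
qed

lemma monoidal_pi_functor_underlying: "monoidal_pi_functor K A.U B.U UF"
proof (intro monoidal_pi_functor.intro linear_monoidal_functor.intro linear_functor_underlying coherence_underlying
    monoidal_pi_functor_axioms.intro)
  show "isom B.U (pi_ob B.U) (fob UF (pi_ob A.U)) (fj UF)" by (intro B.underlying_isom) simp_all
next
  fix x assume "x \<in> Obj A.U"
  then have [simp]: "A.Ob x" by simp
  let ?p = "pi_obj A" and ?i = "B.I (fob F x)"
  \<comment> \<open>Both sides of the axiom are compared after composition with the isomorphism
    \<open>fmor F (A.kp' x)\<close>, where each becomes \<open>B.kp (fob F x)\<close>.\<close>
  have "fmor F (A.kp' x) $ fmor F (A.\<beta> x) $ fc F (?p, x) $ (fj UF ** ?i)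
     = fmor F (A.kp' x $\<^bsub>A\<^esub> A.\<beta> x) $ fc F (?p, x) $ (fj UF ** ?i)"
    by (simp add: fmor_comp del: A.kappa'_beta)
  also have "... = B.kp' (fob F x) $ B.\<beta> (fob F x)" by (simp add: kappa_fj)
  also have "... = fmor F (A.kp' x) $ fc F (x, ?p) $ (?i ** fj UF) $ B.\<beta> (fob F x)"
    unfolding kappa_fj(2)[of x, OF \<open>x \<in> Obj A\<close>, symmetric] by simp
  finally have "fmor F (A.\<beta> x) $ fc F (?p, x) $ (fj UF ** ?i) = fc F (x, ?p) $ (?i ** fj UF) $ B.\<beta> (fob F x)"
    by (intro B.comp_cancel_left[of "fmor F (A.kp' x)" "fmor F (A.\<beta> x) $ fc F (?p, x) $ (fj UF ** ?i)"
       "fc F (x, ?p) $ (?i ** fj UF) $ B.\<beta> (fob F x)"]) simp_all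
  then show "Comp B.U (fmor UF (half_braiding A.U x)) (Comp B.U (fc UF (pi_ob A.U, x)) (TensM B.U (fj UF) (Ident B.U (fob UF x))))
    = Comp B.U (fc UF (x, pi_ob A.U)) (Comp B.U (TensM B.U (Ident B.U (fob UF x)) (fj UF)) (half_braiding B.U (fob UF x)))"
    by simp
next
  let ?p = "pi_obj A" and ?j = "fj UF"
  have x: "xi A.U = Lun A (Unit A) $\<^bsub>A\<^esub> (zeta A **\<^bsub>A\<^esub> zeta A)" "xi B.U = Lun B (Unit B) $ (zeta B ** zeta B)"
    by (simp_all add: underlying_def)
  have "fmor F (xi A.U) $ fc F (?p, ?p) $ (?j ** ?j)
     = fmor F (Lun A (Unit A)) $ (fmor F (zeta A **\<^bsub>A\<^esub> zeta A) $ fc F (?p, ?p)) $ (?j ** ?j)"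
    unfolding x by (simp add: fmor_comp)
  also have "fmor F (zeta A **\<^bsub>A\<^esub> zeta A) $ fc F (?p, ?p) = fc F (Unit A, Unit A) $ (fmor F (zeta A) ** fmor F (zeta A))"
    using fc_nat_refl[of "zeta A" "zeta A"] by simp
  also have "fmor F (Lun A (Unit A)) $ ... $ (?j ** ?j)
     = fmor F (Lun A (Unit A)) $ fc F (Unit A, Unit A) $ ((fmor F (zeta A) $ ?j) ** (fmor F (zeta A) $ ?j))"
    by simp
  also have "... = (fmor F (Lun A (Unit A)) $ fc F (Unit A, Unit A) $ (fi F ** B.I (fob F (Unit A))))
      $ (B.I (Unit B) ** fi F) $ (zeta B ** zeta B)"
    unfolding zeta_fj by simp
  also have "... = (Lun B (fob F (Unit A)) $ (B.I (Unit B) ** fi F)) $ (zeta B ** zeta B)"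
    unfolding fc_Lun[OF A.Unit_Obj] by simp
  also have "... = fi F $ xi B.U" using B.Lun_nat_refl[of "fi F"] unfolding x by simp
  finally show "Comp B.U (fi UF) (xi B.U) = Comp B.U (fmor UF (xi A.U)) (Comp B.U (fc UF (pi_ob A.U, pi_ob A.U)) (TensM B.U ?j ?j))"
    by simp
qed

end

lemma pi_super_functor:
  assumes "monoidal_pi_supercategory K A" "monoidal_pi_supercategory K B" "monoidal_superfunctor K A B F"
  shows "pi_super_functor K A B F"
  by (intro pi_super_functor.intro pi_super superfun_between assms monoidal_supercategory_if_pi)

lemma underlying_monfun_id:
  assumes "monoidal_pi_supercategory K A"
  shows "underlying_monfun A A (id_monfun A) = id_pi_monfun (underlying A)"
proof -
  interpret A: pi_super K A by (rule pi_super) fact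
  have "fmor (underlying_monfun A A (id_monfun A)) = fmor (id_pi_monfun (underlying A))"
    by (auto simp: underlying_monfun_def id_monfun_def fun_eq_iff A.hmg_arrow)
  then show ?thesis
    by (intro pi_monfun_eqI) (auto simp: underlying_monfun_def id_monfun_def)
qed

lemma underlying_monfun_comp:
  fixes B (structure)
  assumes A: "monoidal_pi_supercategory K A" and B: "monoidal_pi_supercategory K B" and C: "monoidal_pi_supercategory K C"
    and F: "monoidal_superfunctor K A B F" and G: "monoidal_superfunctor K B C G"
  shows "underlying_monfun A C (comp_monfun A C G F)
    = comp_pi_monfun (underlying A) (underlying C) (underlying_monfun B C G) (underlying_monfun A B F)"
proof -
  interpret F: pi_super_functor K A B F by (rule pi_super_functor[OF A B F])
  interpret G: pi_super_functor K B C G by (rule pi_super_functor[OF B C G])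
  interpret FG: composable K A B C F G ..
  have j: "fj G.UF = inverse_of C (fmor G (zeta B)) $\<^bsub>C\<^esub> fi G $\<^bsub>C\<^esub> zeta C"
    "fj F.UF = inverse_of B (fmor F (zeta A)) $ fi F $ zeta B" by (simp_all add: underlying_monfun_def)
  show ?thesis
  proof (rule pi_monfun_eqI)
    have "fmor G.UF (fj F.UF) $\<^bsub>C\<^esub> fj G.UF = fmor G (fj F.UF) $\<^bsub>C\<^esub> fj G.UF" by simp
    also have "... = fmor G (fmor F (inverse_of A (zeta A))) $\<^bsub>C\<^esub> fmor G (fi F) $\<^bsub>C\<^esub> fmor G (zeta B) $\<^bsub>C\<^esub> fmor G (inverse_of B (zeta B)) $\<^bsub>C\<^esub> fi G $\<^bsub>C\<^esub> zeta C"
      unfolding j by (simp add: G.fmor_comp)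
    also have "... = fmor G (fmor F (inverse_of A (zeta A))) $\<^bsub>C\<^esub> fmor G (fi F) $\<^bsub>C\<^esub> (fmor G (zeta B) $\<^bsub>C\<^esub> inverse_of C (fmor G (zeta B))) $\<^bsub>C\<^esub> fi G $\<^bsub>C\<^esub> zeta C"
      by (simp del: G.B.inverse_comp)
    also have "... = fmor G (fmor F (inverse_of A (zeta A))) $\<^bsub>C\<^esub> fmor G (fi F) $\<^bsub>C\<^esub> fi G $\<^bsub>C\<^esub> zeta C"
      by (subst G.B.inverse_comp(2)) simp_all
    finally show "fj (underlying_monfun A C (comp_monfun A C G F)) = fj (comp_pi_monfun F.A.U G.B.U G.UF F.UF)"
      by (simp add: underlying_monfun_def[of A C])
  next
    show "fmor (underlying_monfun A C FG.GF) = fmor (comp_pi_monfun F.A.U G.B.U G.UF F.UF)"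
      by (auto simp: fun_eq_iff underlying_monfun_def[of A C] comp_monfun_def F.A.hmg_arrow)
  qed (auto simp: underlying_monfun_def[of A C] fun_eq_iff comp_monfun_def)
qed

lemma underlying_functor_is_functor:
  "is_functor (Pi_SMon K :: (('k, 'o, 'm) pi_monsupercat, _) cat) (Pi_Mon K) underlying_functor"
proof (unfold_locales, unfold Pi_SMon_def Pi_Mon_def underlying_functor_def)
qed (auto simp: underlying_monfun_id underlying_monfun_comp
    intro!: pi_super.monoidal_pi_category_underlying pi_super pi_super_functor.monoidal_pi_functor_underlying pi_super_functor)

text \<open>The coherence maps i and j determine the image of \<zeta>, hence by compatibility with
  tensor products that of every \<open>kp x\<close>. An odd \<open>f\<close> is the even morphism
  \<open>f\<close> after \<open>kp\<close>, composed with the inverse of \<open>kp\<close>.\<close>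

lemma underlying_functor_faithful:
  fixes B (structure)
  assumes A: "monoidal_pi_supercategory K A" and B: "monoidal_pi_supercategory K B"
    and F: "monoidal_superfunctor K A B F" and G: "monoidal_superfunctor K A B G"
    and e: "underlying_monfun A B F = underlying_monfun A B G"
  shows "F = G"
proof -
  interpret F: pi_super_functor K A B F by (rule pi_super_functor[OF A B F])
  interpret G: pi_super_functor K A B G by (rule pi_super_functor[OF A B G])
  have f: "fob F = fob G" "fc F = fc G" "fi F = fi G"
    using arg_cong[OF e, of fob] arg_cong[OF e, of fc] arg_cong[OF e, of fi] by simp_all
  have even: "fmor F f = fmor G f" if "hmg A 0 f" for f
    using fun_cong[OF arg_cong[OF e, of fmor], of f] that by simp
  have "fmor F (zeta A) $ fj F.UF = fmor G (zeta A) $ fj F.UF"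
    using F.zeta_fj G.zeta_fj unfolding e f by simp
  then have z: "fmor F (zeta A) = fmor G (zeta A)"
    by (rule F.B.comp_cancel_right[rotated 5]) (simp_all add: f)
  have k: "fmor F (F.A.kp x) = fmor G (F.A.kp x)" if x [simp]: "x \<in> Obj A" for x
  proof -
    have fo [simp]: "fob G y \<in> Obj B" if "y \<in> Obj A" for y using G.fob_Obj[OF that] .
    have "fmor F (zeta A **\<^bsub>A\<^esub> Ident A x) $ fc F (pi_obj A, x) = fmor G (zeta A **\<^bsub>A\<^esub> Ident A x) $ fc F (pi_obj A, x)"
      using F.fc_nat_refl[of "zeta A" "Ident A x"] G.fc_nat_refl[of "zeta A" "Ident A x"] by (simp add: z f)
    then have "fmor F (zeta A **\<^bsub>A\<^esub> Ident A x) = fmor G (zeta A **\<^bsub>A\<^esub> Ident A x)"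
      by (rule F.B.comp_cancel_right[rotated 5]) (simp_all add: f)
    then show ?thesis using even[of "Lun A x"] by (simp add: F.A.kp_def F.fmor_comp G.fmor_comp)
  qed
  have odd: "fmor F f = fmor G f" if h: "hmg A 1 f" for f
  proof -
    have [simp]: "f \<in> arrows A" using h F.A.hmg_arrow by blast
    have "f = (f $\<^bsub>A\<^esub> F.A.kp (source A f)) $\<^bsub>A\<^esub> inverse_of A (F.A.kp (source A f))" by simp
    moreover have "fmor F (inverse_of A (F.A.kp (source A f))) = fmor G (inverse_of A (F.A.kp (source A f)))"
      using k[of "source A f"] F.fmor_invertible(2)[of "F.A.kp (source A f)"] G.fmor_invertible(2)[of "F.A.kp (source A f)"] by simp
    moreover have "fmor F (f $\<^bsub>A\<^esub> F.A.kp (source A f)) = fmor G (f $\<^bsub>A\<^esub> F.A.kp (source A f))"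
      by (rule even) (use h in simp)
    ultimately show ?thesis
      using F.fmor_comp[of "inverse_of A (F.A.kp (source A f))" "f $\<^bsub>A\<^esub> F.A.kp (source A f)"]
        G.fmor_comp[of "inverse_of A (F.A.kp (source A f))" "f $\<^bsub>A\<^esub> F.A.kp (source A f)"] h by simp
  qed
  have "fmor F f = fmor G f" if "f \<in> arrows A" for f
  proof (rule F.A.homogeneous_eqI[where f = f and \<phi> = "fmor F" and \<psi> = "fmor G"])
    show "linear_map K (Hom A (source A f) (target A f)) (Hom B (fob F (source A f)) (fob F (target A f))) (fmor F)"
      using F.linear_fmor that by simp
    show "linear_map K (Hom A (source A f) (target A f)) (Hom B (fob F (source A f)) (fob F (target A f))) (fmor G)"
      using G.linear_fmor that by (simp add: f)
    show "fmor F g = fmor G g" if "hmg A p g" for p g using even odd that by (cases p) auto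
  qed (use that in simp_all)
  then have "fmor F = fmor G" by (intro extensionalityI[OF F.fmor_ext G.fmor_ext]) simp
  then show ?thesis using f by (intro monfun_eqI) simp_all
qed

section \<open>Lifting monoidal $\Pi$-functors\<close>

lemma linear_map_to_even_space:
  "[|linear_map K V W f; !!v. v \<in> carrier V ==> f v \<in> hpart W 0|] ==> linear_map K V (even_space W) f"
  unfolding linear_map_def by auto

lemma linear_map_from_even_space:
  assumes "superspace K W" "linear_map K V (even_space W) f"
  shows "linear_map K V W f"
  using assms(2) superspace.hpart_carrier[OF assms(1)] unfolding linear_map_def by (auto simp: Pi_iff)

locale pi_lift = A: pi_super K A + B: pi_super K B + H: monoidal_pi_functor K "underlying A" "underlying B" H
  for K :: "'k ring" and A :: "('k, 'o, 'm) pi_monsupercat" and B :: "('k, 'p, 'n) pi_monsupercat" (structure)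
    and H :: "('o, 'm, 'p, 'n) pi_monfun"
begin

abbreviation compA (infixr "$\<^sub>A" 60) where "g $\<^sub>A f \<equiv> g $\<^bsub>A\<^esub> f"
abbreviation tensA (infixl "**\<^sub>A" 70) where "f **\<^sub>A g \<equiv> f **\<^bsub>A\<^esub> g"
abbreviation objA (infixl "*.\<^sub>A" 70) where "x *.\<^sub>A y \<equiv> x *.\<^bsub>A\<^esub> y"

sublocale HM: monoidal_functor_between K "underlying A" "underlying B" H
  by (rule monoidal_functor_between_linear[OF A.linear_monoidal_underlying B.linear_monoidal_underlying]) unfold_locales

abbreviation "p \<equiv> pi_obj A"
abbreviation "q \<equiv> pi_obj B"

lemma H_Obj [simp]: "A.Ob x ==> fob H x \<in> Obj B"
  using HM.fob_Obj[of x] by simp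

text \<open>The axioms of \<open>H\<close> speak of arrows of the underlying categories. Here and
  below they are restated for even arrows of \<open>A\<close> and \<open>B\<close>, where the rules
  for signs and odd isomorphisms are at hand.\<close>

lemma H_arrow [simp]:
  assumes "hmg A 0 f"
  shows "hmg B 0 (fmor H f)" "B.src (fmor H f) = fob H (A.src f)" "B.tgt (fmor H f) = fob H (A.tgt f)"
  using HM.fmor_arrow[of f] assms by simp_all

lemma H_arrows [simp]: "hmg A 0 f ==> fmor H f \<in> B.Arr"
  using H_arrow(1) B.hmg_arrow by blast

lemma H_comp: "[|hmg A 0 f; hmg A 0 g; A.tgt f = A.src g|] ==> fmor H (g $\<^sub>A f) = fmor H g $ fmor H f"
  using HM.fmor_comp[of f g] by simp

lemma H_Ident [simp]: "A.Ob x ==> fmor H (A.I x) = B.I (fob H x)"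
  using HM.fmor_Ident[of x] by simp

lemma H_sgn [simp]: "hmg A 0 f ==> fmor H (sgn_arr A e f) = sgn_arr B e (fmor H f)"
proof -
  assume f: "hmg A 0 f"
  have n: "sgn_arr A.U e f = sgn_arr A e f" "sgn_arr B.U e (fmor H f) = sgn_arr B e (fmor H f)"
    using neg_even_space[OF A.superspace_Hom, of "A.src f" "A.tgt f" f] A.hmg_hpart[OF f]
      neg_even_space[OF B.superspace_Hom, of "fob H (A.src f)" "fob H (A.tgt f)" "fmor H f"] f A.hmg_arrow[OF f]
      B.hmg_hpart[OF H_arrow(1)[OF f]]
    by (simp_all add: sgn_arr_def signed_def hom_of_def)
  then show ?thesis using HM.fmor_sgn[of f e] f by simp
qed

lemma H_inverse:
  assumes "hmg A 0 f" "invertible A f"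
  shows "invertible B (fmor H f)" "B.ivs (fmor H f) = fmor H (A.ivs f)"
  using HM.fmor_invertible[of f] A.underlying_invertible[OF assms] B.invertible_if_underlying[of "fmor H f"]
    B.underlying_invertible[of "fmor H f"] assms by simp_all

lemma H_fc [simp]:
  assumes "A.Ob x" "A.Ob y"
  shows "invertible B (fc H (x, y))" "hmg B 0 (fc H (x, y))" "B.src (fc H (x, y)) = fob H x *. fob H y"
    "B.tgt (fc H (x, y)) = fob H (x *.\<^sub>A y)"
proof -
  show i: "invertible B (fc H (x, y))" "hmg B 0 (fc H (x, y))"
    using B.invertible_if_underlying[of "fc H (x, y)"] HM.fc_arrow(1)[of x y] assms by simp_all
  show "B.src (fc H (x, y)) = fob H x *. fob H y" "B.tgt (fc H (x, y)) = fob H (x *.\<^sub>A y)"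
    using HM.fc_arrow[of x y] assms i by simp_all
qed

lemma H_fi [simp]: "invertible B (fi H)" "hmg B 0 (fi H)" "B.src (fi H) = Unit B" "B.tgt (fi H) = fob H (Unit A)"
proof -
  show i: "invertible B (fi H)" "hmg B 0 (fi H)"
    using B.invertible_if_underlying[of "fi H"] HM.fi_arrow by simp_all
  show "B.src (fi H) = Unit B" "B.tgt (fi H) = fob H (Unit A)"
    using HM.fi_arrow(2,3) i by (simp_all del: HM.fi_arrow)
qed

lemma H_fj [simp]: "invertible B (fj H)" "hmg B 0 (fj H)" "B.src (fj H) = q" "B.tgt (fj H) = fob H p"
proof -
  have j: "invertible B.U (fj H)" "source B.U (fj H) = q" "target B.U (fj H) = fob H p"
    using B.U.isomD[OF H.fj_iso] by simp_all
  show i: "invertible B (fj H)" "hmg B 0 (fj H)"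
    using B.invertible_if_underlying[OF j(1)] by simp_all
  show "B.src (fj H) = q" "B.tgt (fj H) = fob H p"
    using j i by simp_all
qed

lemma H_fc_nat:
  assumes "hmg A 0 f" "hmg A 0 g"
  shows "fc H (A.tgt f, A.tgt g) $ (fmor H f ** fmor H g) = fmor H (f **\<^sub>A g) $ fc H (A.src f, A.src g)"
  using HM.fc_nat_refl[of f g] assms by simp

lemma H_fc_Assoc:
  assumes "A.Ob x" "A.Ob y" "A.Ob z"
  shows "fmor H (Assoc A x y z) $ fc H (x *.\<^sub>A y, z) $ (fc H (x, y) ** B.I (fob H z))
    = fc H (x, y *.\<^sub>A z) $ (B.I (fob H x) ** fc H (y, z)) $ Assoc B (fob H x) (fob H y) (fob H z)"
  using H.fc_Assoc[of x y z] assms by simp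

lemma H_fc_Lun: "A.Ob x ==>
    fmor H (Lun A x) $ fc H (Unit A, x) $ (fi H ** B.I (fob H x)) = Lun B (fob H x)"
  and H_fc_Run: "A.Ob x ==>
    fmor H (Run A x) $ fc H (x, Unit A) $ (B.I (fob H x) ** fi H) = Run B (fob H x)"
  and H_fj_beta: "A.Ob x ==> fmor H (A.\<beta> x) $ fc H (p, x) $ (fj H ** B.I (fob H x))
        = fc H (x, p) $ (B.I (fob H x) ** fj H) $ B.\<beta> (fob H x)"
  and H_fj_xi: "fi H $ xi B.U = fmor H (xi A.U) $ fc H (p, p) $ (fj H ** fj H)"
  using H.fc_Lun[of x] H.fc_Run[of x] H.fj_beta[of x] H.fj_xi by simp_all

text \<open>\<open>H\<close> is not defined on the odd maps \<open>kp\<close>, but it is on their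
  sources: this isomorphism relates the source of \<open>kp\<close> at \<open>H x\<close> to the
  image of the source of \<open>kp\<close> at \<open>x\<close>.\<close>

definition J :: "'o \<Rightarrow> 'n" where
  "J x = fc H (p, x) $ (fj H ** B.I (fob H x))"

lemma J [simp]:
  assumes "A.Ob x"
  shows "invertible B (J x)" "hmg B 0 (J x)" "B.src (J x) = q *. fob H x" "B.tgt (J x) = fob H (p *.\<^sub>A x)"
  using assms by (simp_all add: J_def B.whisker_invertible)

lemma J_natural:
  assumes "hmg A 0 f"
  shows "fmor H (A.I p **\<^sub>A f) $ J (A.src f) = J (A.tgt f) $ (B.I q ** fmor H f)"
proof -
  note [simp] = A.hmg_arrow[OF assms]
  have "fmor H (A.I p **\<^sub>A f) $ J (A.src f)
     = (fmor H (A.I p **\<^sub>A f) $ fc H (p, A.src f)) $ (fj H ** B.I (fob H (A.src f)))"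
    using assms by (simp add: J_def)
  also have "fmor H (A.I p **\<^sub>A f) $ fc H (p, A.src f) = fc H (p, A.tgt f) $ (B.I (fob H p) ** fmor H f)"
    using H_fc_nat[of "A.I p" f] assms by simp
  finally show ?thesis using assms by (simp add: J_def)
qed

text \<open>The associativity axiom of \<open>H\<close> at \<pi>, \<open>x\<close>,
  \<open>y\<close>, combined with j in the first slot.\<close>

lemma J_TensO:
  assumes [simp]: "A.Ob x" "A.Ob y"
  shows "fmor H (A.ivs (Assoc A p x y)) $ J (x *.\<^sub>A y) $ (B.I q ** fc H (x, y))
    = fc H (p *.\<^sub>A x, y) $ (J x ** B.I (fob H y)) $ B.ivs (Assoc B q (fob H x) (fob H y))"
proof -
  let ?Hx = "fob H x" and ?Hy = "fob H y" and ?Hp = "fob H p"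
  let ?a = "fmor H (Assoc A p x y)"
  have i: "invertible B ?a" "fmor H (A.ivs (Assoc A p x y)) = B.ivs ?a" by (simp_all add: H_inverse)
  have "?a $ fc H (p *.\<^sub>A x, y) $ (J x ** B.I ?Hy)
     = (?a $ fc H (p *.\<^sub>A x, y) $ (fc H (p, x) ** B.I ?Hy)) $ ((fj H ** B.I ?Hx) ** B.I ?Hy)"
    by (simp add: J_def)
  also have "... = fc H (p, x *.\<^sub>A y) $ (B.I ?Hp ** fc H (x, y)) $
       (Assoc B ?Hp ?Hx ?Hy $ ((fj H ** B.I ?Hx) ** B.I ?Hy))"
    using H_fc_Assoc[of p x y] by simp
  also have "Assoc B ?Hp ?Hx ?Hy $ ((fj H ** B.I ?Hx) ** B.I ?Hy)
     = (fj H ** (B.I ?Hx ** B.I ?Hy)) $ Assoc B q ?Hx ?Hy"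
    using B.Assoc_nat_refl[of "fj H" "B.I ?Hx" "B.I ?Hy"] by simp
  also have "fc H (p, x *.\<^sub>A y) $ (B.I ?Hp ** fc H (x, y)) $ ...
     = J (x *.\<^sub>A y) $ (B.I q ** fc H (x, y)) $ Assoc B q ?Hx ?Hy"
    by (simp add: J_def)
  finally have e: "?a $ fc H (p *.\<^sub>A x, y) $ (J x ** B.I ?Hy)
    = J (x *.\<^sub>A y) $ (B.I q ** fc H (x, y)) $ Assoc B q ?Hx ?Hy" .
  have "B.ivs ?a $ J (x *.\<^sub>A y) $ (B.I q ** fc H (x, y))
     = B.ivs ?a $ (J (x *.\<^sub>A y) $ (B.I q ** fc H (x, y)) $ Assoc B q ?Hx ?Hy) $ B.ivs (Assoc B q ?Hx ?Hy)"
    using i(1) by simp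
  also have "... = fc H (p *.\<^sub>A x, y) $ (J x ** B.I ?Hy) $ B.ivs (Assoc B q ?Hx ?Hy)"
    unfolding e[symmetric] using i(1) by simp
  finally show ?thesis unfolding i(2) .
qed

text \<open>A composite of two maps \<open>kp\<close> is even, so \<open>H\<close> applies to it. By
  \<open>kappa_kappa\<close> it is a matter of \<xi>, and the axiom on j and \<xi> shows that
  \<open>H\<close> preserves it up to \<open>J\<close>.\<close>

lemma J_kappa:
  assumes [simp]: "A.Ob x"
  shows "fmor H (A.kp x $\<^sub>A A.kp (p *.\<^sub>A x)) $ J (p *.\<^sub>A x) $ (B.I q ** J x)
     = B.kp (fob H x) $ B.kp (q *. fob H x)"
proof -
  let ?Hx = "fob H x" and ?Hp = "fob H p"
  note kA = A.kappa_kappa[OF assms] and kB = B.kappa_kappa[OF H_Obj[OF assms]]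
  have Jx: "B.I q ** J x = (B.I q ** fc H (p, x)) $ (B.I q ** (fj H ** B.I ?Hx))"
    by (simp add: J_def)
  have 1: "B.ivs (Assoc B q ?Hp ?Hx) $ (B.I q ** (fj H ** B.I ?Hx))
     = ((B.I q ** fj H) ** B.I ?Hx) $ B.ivs (Assoc B q q ?Hx)"
  proof -
    have "Assoc B q ?Hp ?Hx $ ((B.I q ** fj H) ** B.I ?Hx) $ B.ivs (Assoc B q q ?Hx)
       = (Assoc B q ?Hp ?Hx $ ((B.I q ** fj H) ** B.I ?Hx)) $ B.ivs (Assoc B q q ?Hx)" by simp
    also have "... = B.I q ** (fj H ** B.I ?Hx)"
      using B.Assoc_nat_refl[of "B.I q" "fj H" "B.I ?Hx"] by simp
    finally show ?thesis by (intro B.inverse_switch[symmetric]) simp_all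
  qed
  have "fmor H (A.ivs (Assoc A p p x)) $ J (p *.\<^sub>A x) $ (B.I q ** J x)
     = (fmor H (A.ivs (Assoc A p p x)) $ J (p *.\<^sub>A x) $ (B.I q ** fc H (p, x))) $ (B.I q ** (fj H ** B.I ?Hx))"
    unfolding Jx by simp
  also have "... = fc H (p *.\<^sub>A p, x) $ (J p ** B.I ?Hx) $ (B.ivs (Assoc B q ?Hp ?Hx) $ (B.I q ** (fj H ** B.I ?Hx)))"
    using J_TensO[of p x] by simp
  also have "... = fc H (p *.\<^sub>A p, x) $ ((fc H (p, p) $ (fj H ** fj H)) ** B.I ?Hx) $ B.ivs (Assoc B q q ?Hx)"
    unfolding 1 by (simp add: J_def)
  finally have 2: "fmor H (A.ivs (Assoc A p p x)) $ J (p *.\<^sub>A x) $ (B.I q ** J x)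
     = fc H (p *.\<^sub>A p, x) $ ((fc H (p, p) $ (fj H ** fj H)) ** B.I ?Hx) $ B.ivs (Assoc B q q ?Hx)" .
  have 3: "fmor H (xi A.U **\<^sub>A A.I x) $ fc H (p *.\<^sub>A p, x) = fc H (Unit A, x) $ (fmor H (xi A.U) ** B.I ?Hx)"
    using H_fc_nat[of "xi A.U" "A.I x"] by simp
  have "fmor H (A.kp x $\<^sub>A A.kp (p *.\<^sub>A x)) $ J (p *.\<^sub>A x) $ (B.I q ** J x)
     = sgn_arr B 1 (fmor H (Lun A x) $ fmor H (xi A.U **\<^sub>A A.I x) $
         (fmor H (A.ivs (Assoc A p p x)) $ J (p *.\<^sub>A x) $ (B.I q ** J x)))"
    unfolding kA by (simp add: H_comp)
  also have "... = sgn_arr B 1 (fmor H (Lun A x) $ (fmor H (xi A.U **\<^sub>A A.I x) $ fc H (p *.\<^sub>A p, x)) $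
         ((fc H (p, p) $ (fj H ** fj H)) ** B.I ?Hx) $ B.ivs (Assoc B q q ?Hx))"
    unfolding 2 by simp
  also have "... = sgn_arr B 1 (fmor H (Lun A x) $ fc H (Unit A, x) $
         ((fmor H (xi A.U) $ fc H (p, p) $ (fj H ** fj H)) ** B.I ?Hx) $ B.ivs (Assoc B q q ?Hx))"
    unfolding 3 by simp
  also have "... = sgn_arr B 1 ((fmor H (Lun A x) $ fc H (Unit A, x) $ (fi H ** B.I ?Hx)) $
         (xi B.U ** B.I ?Hx) $ B.ivs (Assoc B q q ?Hx))"
    unfolding H_fj_xi[symmetric] by simp
  also have "... = B.kp ?Hx $ B.kp (q *. ?Hx)"
    unfolding H_fc_Lun[OF assms] kB by simp
  finally show ?thesis .
qed

end

section \<open>Extending a \<Pi>-functor to odd morphisms\<close>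

context pi_lift
begin

text \<open>The value that a lift of \<open>H\<close> has to take at the inverse of
  \<open>kp x\<close>.\<close>

definition Jkp :: "'o \<Rightarrow> 'n" where
  "Jkp x = J x $ B.ivs (B.kp (fob H x))"

lemma Jkp [simp]:
  assumes "A.Ob x"
  shows "invertible B (Jkp x)" "hmg B 1 (Jkp x)" "B.src (Jkp x) = fob H x" "B.tgt (Jkp x) = fob H (p *.\<^sub>A x)"
  using assms by (simp_all add: Jkp_def)

lemma Jkp_natural:
  assumes "hmg A 0 f"
  shows "fmor H (A.I p **\<^sub>A f) $ Jkp (A.src f) = Jkp (A.tgt f) $ fmor H f"
proof -
  note [simp] = A.hmg_arrow[OF assms]
  let ?x = "fob H (A.src f)" and ?y = "fob H (A.tgt f)"
  have k: "B.ivs (B.kp ?y) $ fmor H f = (B.I q ** fmor H f) $ B.ivs (B.kp ?x)"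
  proof (rule B.inverse_switch[symmetric])
    have "B.kp ?y $ (B.I q ** fmor H f) $ B.ivs (B.kp ?x)
      = (B.kp ?y $ (B.I q ** fmor H f)) $ B.ivs (B.kp ?x)" using assms by simp
    also have "... = fmor H f" using B.kappa_natural[of 0 "fmor H f"] assms by simp
    finally show "B.kp ?y $ (B.I q ** fmor H f) $ B.ivs (B.kp ?x) = fmor H f" .
  qed (use assms in simp_all)
  have "fmor H (A.I p **\<^sub>A f) $ Jkp (A.src f)
     = (fmor H (A.I p **\<^sub>A f) $ J (A.src f)) $ B.ivs (B.kp ?x)"
    using assms by (simp add: Jkp_def)
  also have "... = J (A.tgt f) $ ((B.I q ** fmor H f) $ B.ivs (B.kp ?x))"
    unfolding J_natural[OF assms] using assms by simp
  finally show ?thesis unfolding k[symmetric] using assms by (simp add: Jkp_def)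
qed

text \<open>\<open>J_kappa\<close> in terms of \<open>Jkp\<close>: the prospective images of two
  inverses of \<open>kp\<close> compose to the inverse of the image of the composite. This is
  functoriality on a product of two odd morphisms.\<close>

lemma Jkp_twice:
  assumes [simp]: "A.Ob x"
  shows "fmor H (A.kp x $\<^sub>A A.kp (p *.\<^sub>A x)) $ Jkp (p *.\<^sub>A x) $ Jkp x = B.I (fob H x)"
proof -
  let ?k = "B.ivs (B.kp (fob H x))"
  have 1: "B.ivs (B.kp (fob H (p *.\<^sub>A x))) $ J x
      = (B.I q ** J x) $ B.ivs (B.kp (q *. fob H x))"
  proof (rule B.inverse_switch[symmetric])
    have "B.kp (fob H (p *.\<^sub>A x)) $ (B.I q ** J x) $ B.ivs (B.kp (q *. fob H x))
      = (B.kp (fob H (p *.\<^sub>A x)) $ (B.I q ** J x)) $ B.ivs (B.kp (q *. fob H x))" by simp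
    also have "... = J x" using B.kappa_natural[of 0 "J x"] by simp
    finally show "B.kp (fob H (p *.\<^sub>A x)) $ (B.I q ** J x) $ B.ivs (B.kp (q *. fob H x)) = J x" .
  qed simp_all
  have "fmor H (A.kp x $\<^sub>A A.kp (p *.\<^sub>A x)) $ Jkp (p *.\<^sub>A x) $ Jkp x
    = fmor H (A.kp x $\<^sub>A A.kp (p *.\<^sub>A x)) $ J (p *.\<^sub>A x) $ (B.ivs (B.kp (fob H (p *.\<^sub>A x))) $ J x) $ ?k"
    by (simp add: Jkp_def)
  also have "... = (fmor H (A.kp x $\<^sub>A A.kp (p *.\<^sub>A x)) $ J (p *.\<^sub>A x) $ (B.I q ** J x))
      $ B.ivs (B.kp (q *. fob H x)) $ ?k"
    unfolding 1 by simp
  also have "... = B.I (fob H x)" unfolding J_kappa[OF assms] by simp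
  finally show ?thesis .
qed

text \<open>Forced by functoriality, as \<open>f\<close> is the even morphism \<open>f\<close> after
  \<open>kp\<close>, followed in the factorisation by the inverse of \<open>kp\<close> on its
  right.\<close>

definition odd_lift :: "'m \<Rightarrow> 'n" where
  "odd_lift f = fmor H (f $\<^sub>A A.kp (A.src f)) $ Jkp (A.src f)"

definition lift :: "('o, 'm, 'p, 'n) monfun" where
  "lift = \<lparr>fob = fob H, fmor = (\<lambda>f \<in> arrows A. fmor H (hcomp (hom_of A f) 0 f)
       \<oplus>\<^bsub>Hom B (fob H (A.src f)) (fob H (A.tgt f))\<^esub> odd_lift (hcomp (hom_of A f) 1 f)),
     fc = fc H, fi = fi H\<rparr>"

lemma lift_simps [simp]: "fob lift = fob H" "fc lift = fc H" "fi lift = fi H"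
  by (simp_all add: lift_def)

lemma odd_lift [simp]:
  assumes "hmg A 1 f"
  shows "hmg B 1 (odd_lift f)" "B.src (odd_lift f) = fob H (A.src f)" "B.tgt (odd_lift f) = fob H (A.tgt f)"
  using assms A.hmg_arrow[OF assms] by (simp_all add: odd_lift_def)

lemma linear_lift:
  assumes o: "A.Ob x" "A.Ob y"
  shows "linear_map K (Hom A x y) (Hom B (fob H x) (fob H y)) (%f. fmor H (hcomp (Hom A x y) 0 f))"
    "linear_map K (Hom A x y) (Hom B (fob H x) (fob H y)) (%f. odd_lift (hcomp (Hom A x y) 1 f))"
    "linear_map K (Hom A x y) (Hom B (fob H x) (fob H y)) (fmor lift)"
proof -
  interpret V: superspace K "Hom A x y" using o by (intro A.superspace_Hom)
  have W: "superspace K (Hom B (fob H u) (fob H v))" if "A.Ob u" "A.Ob v" for u v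
    using that by (intro B.superspace_Hom) auto
  have H: "linear_map K (even_space (Hom A u v)) (Hom B (fob H u) (fob H v)) (fmor H)" if "A.Ob u" "A.Ob v" for u v
    using H.linear_fmor[of u v] that by (intro linear_map_from_even_space[OF W]) simp_all
  show 0: "linear_map K (Hom A x y) (Hom B (fob H x) (fob H y)) (%f. fmor H (hcomp (Hom A x y) 0 f))"
    by (rule lin_compose[OF H linear_map_to_even_space[OF V.linear_map_hcomp]]) (use o in auto)
  have k: "linear_map K (Hom A x y) (even_space (Hom A (p *.\<^sub>A x) y)) (%f. hcomp (Hom A x y) 1 f $\<^sub>A A.kp x)"
  proof (rule linear_map_to_even_space)
    show "linear_map K (Hom A x y) (Hom A (p *.\<^sub>A x) y) (%f. hcomp (Hom A x y) 1 f $\<^sub>A A.kp x)"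
      by (rule lin_compose[OF A.linear_comp_left V.linear_map_hcomp]) (use o in simp_all)
    fix f assume "f \<in> homset A x y"
    then have "hcomp (Hom A x y) 1 f \<in> hpart (Hom A x y) 1" by simp
    then show "hcomp (Hom A x y) 1 f $\<^sub>A A.kp x \<in> hpart (Hom A (p *.\<^sub>A x) y) 0"
      using o A.hmg_arrow by (auto simp: A.hpart_iff_hmg)
  qed
  have 1: "linear_map K (Hom A x y) (Hom B (fob H x) (fob H y)) (%f. fmor H (hcomp (Hom A x y) 1 f $\<^sub>A A.kp x) $ Jkp x)"
    by (rule lin_compose[OF B.linear_comp_left lin_compose[OF H k]]) (use o in simp_all)
  have e: "fmor H (hcomp (Hom A x y) 1 f $\<^sub>A A.kp x) $ Jkp x = odd_lift (hcomp (Hom A x y) 1 f)"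
    if "f \<in> homset A x y" for f
  proof -
    have "hcomp (Hom A x y) 1 f \<in> hpart (Hom A x y) 1" using that by simp
    then have "A.src (hcomp (Hom A x y) 1 f) = x" using o by (simp add: A.hpart_iff_hmg)
    then show ?thesis by (simp add: odd_lift_def)
  qed
  show 2: "linear_map K (Hom A x y) (Hom B (fob H x) (fob H y)) (%f. odd_lift (hcomp (Hom A x y) 1 f))"
    by (rule linear_map_cong[OF e V.module_axioms, THEN iffD1, OF _ 1])
  have m: "module K (Hom B (fob H x) (fob H y))" using o by (intro B.module_Hom) auto
  have l: "fmor H (hcomp (Hom A x y) 0 f) \<oplus>\<^bsub>Hom B (fob H x) (fob H y)\<^esub> odd_lift (hcomp (Hom A x y) 1 f) = fmor lift f"
    if "f \<in> homset A x y" for f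
    using A.homD[OF that o] by (simp add: lift_def hom_of_def)
  show "linear_map K (Hom A x y) (Hom B (fob H x) (fob H y)) (fmor lift)"
    by (rule linear_map_cong[OF l V.module_axioms, THEN iffD1, OF _ linear_map_plus[OF V.module_axioms m 0 2]])
qed

lemma lift_hmg:
  shows "hmg A 0 f ==> fmor lift f = fmor H f" "hmg A 1 f ==> fmor lift f = odd_lift f"
proof -
  assume h: "hmg A 0 f"
  note f [simp] = A.hmg_arrow[OF h]
  let ?V = "Hom A (A.src f) (A.tgt f)" and ?W = "Hom B (fob H (A.src f)) (fob H (A.tgt f))"
  have u: "hom_of A f = ?V" by (simp add: hom_of_def)
  interpret V: superspace K ?V by (intro A.superspace_Hom) simp_all
  interpret W: superspace K ?W by (intro B.superspace_Hom) simp_all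
  have p: "f \<in> hpart ?V 0" by (rule A.hmg_hpart[OF h]) simp_all
  \<comment> \<open>The odd component of \<open>f\<close> is that of the zero vector, so
    \<open>linear_lift(2)\<close> can be evaluated at zero; the same device removes the even summand
    for odd \<open>f\<close>.\<close>
  have "hcomp ?V 1 f = hcomp ?V 1 \<zero>\<^bsub>?V\<^esub>" using V.hcomp_other[OF p, of 1] by simp
  then have "odd_lift (hcomp ?V 1 f) = \<zero>\<^bsub>?W\<^esub>"
    using linear_map_zero[OF V.module_axioms W.module_axioms linear_lift(2)] by simp
  then show "fmor lift f = fmor H f"
    using V.hcomp_same[OF p] B.homI[OF B.hmg_arrow[OF H_arrow(1)[OF h]]] h by (simp add: lift_def u)
next
  assume h: "hmg A 1 f"
  note f [simp] = A.hmg_arrow[OF h]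
  let ?V = "Hom A (A.src f) (A.tgt f)" and ?W = "Hom B (fob H (A.src f)) (fob H (A.tgt f))"
  have u: "hom_of A f = ?V" by (simp add: hom_of_def)
  interpret V: superspace K ?V by (intro A.superspace_Hom) simp_all
  interpret W: superspace K ?W by (intro B.superspace_Hom) simp_all
  have p: "f \<in> hpart ?V 1" by (rule A.hmg_hpart[OF h]) simp_all
  have "hcomp ?V 0 f = hcomp ?V 0 \<zero>\<^bsub>?V\<^esub>" using V.hcomp_other[OF p, of 0] by simp
  then have "fmor H (hcomp ?V 0 f) = \<zero>\<^bsub>?W\<^esub>"
    using linear_map_zero[OF V.module_axioms W.module_axioms linear_lift(1)] by simp
  then show "fmor lift f = odd_lift f"
    using V.hcomp_same[OF p] B.homI[OF B.hmg_arrow[OF odd_lift(1)[OF h]]] h by (simp add: lift_def u)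
qed

lemma odd_comp_kappa:
  assumes "hmg A 1 g" "hmg A 0 f" "A.tgt f = A.src g"
  shows "(g $\<^sub>A f) $\<^sub>A A.kp (A.src f) = (g $\<^sub>A A.kp (A.src g)) $\<^sub>A (A.I p **\<^sub>A f)"
proof -
  note [simp] = A.hmg_arrow[OF assms(1)] A.hmg_arrow[OF assms(2)]
  have "A.kp (A.src g) $\<^sub>A (A.I p **\<^sub>A f) = f $\<^sub>A A.kp (A.src f)"
    using A.kappa_natural[OF assms(2)] assms by simp
  then show ?thesis using assms by simp
qed

text \<open>With one odd factor the law is functoriality of \<open>H\<close> and naturality of
  \<open>Jkp\<close>. With two, \<open>Jkp\<close> is first moved past the inner morphism and
  \<open>Jkp_twice\<close> then collapses both copies.\<close>

lemma lift_comp: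
  assumes "hmg A s f" "hmg A r g" "A.tgt f = A.src g"
  shows "fmor lift (g $\<^sub>A f) = fmor lift g $ fmor lift f"
proof -
  note a [simp] = A.hmg_arrow[OF assms(1)] A.hmg_arrow[OF assms(2)] and t [simp] = assms(3)
  consider (ee) "r = 0" "s = 0" | (eo) "r = 0" "s = 1" | (oe) "r = 1" "s = 0" | (oo) "r = 1" "s = 1"
    by (cases r; cases s) auto
  then show ?thesis
  proof cases
    case ee
    then show ?thesis using assms by (simp add: lift_hmg H_comp)
  next
    case eo
    then have h: "hmg A 0 g" "hmg A 1 f" using assms by auto
    have "odd_lift (g $\<^sub>A f) = fmor H (g $\<^sub>A (f $\<^sub>A A.kp (A.src f))) $ Jkp (A.src f)"
      using h by (simp add: odd_lift_def)
    also have "... = fmor H g $ odd_lift f" using h by (subst H_comp) (simp_all add: odd_lift_def)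
    finally show ?thesis using h by (simp add: lift_hmg)
  next
    case oe
    then have h: "hmg A 1 g" "hmg A 0 f" using assms by auto
    have "odd_lift (g $\<^sub>A f) = fmor H ((g $\<^sub>A A.kp (A.src g)) $\<^sub>A (A.I p **\<^sub>A f)) $ Jkp (A.src f)"
      using odd_comp_kappa[OF h t] h by (simp add: odd_lift_def)
    also have "... = fmor H (g $\<^sub>A A.kp (A.src g)) $ (fmor H (A.I p **\<^sub>A f) $ Jkp (A.src f))"
      using h by (subst H_comp) simp_all
    also have "... = odd_lift g $ fmor H f"
      unfolding Jkp_natural[OF h(2)] using h by (simp add: odd_lift_def)
    finally show ?thesis using h by (simp add: lift_hmg)
  next
    case oo
    then have h: "hmg A 1 g" "hmg A 1 f" using assms by auto
    let ?x = "A.src f"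
    let ?h = "f $\<^sub>A A.kp ?x"
    have e: "(g $\<^sub>A A.kp (A.src g)) $\<^sub>A (A.I p **\<^sub>A ?h) = (g $\<^sub>A f) $\<^sub>A (A.kp ?x $\<^sub>A A.kp (p *.\<^sub>A ?x))"
      using odd_comp_kappa[of g ?h] h by simp
    have "odd_lift g $ odd_lift f = fmor H (g $\<^sub>A A.kp (A.src g)) $ (Jkp (A.src g) $ fmor H ?h) $ Jkp ?x"
      using h by (simp add: odd_lift_def)
    also have "Jkp (A.src g) $ fmor H ?h = fmor H (A.I p **\<^sub>A ?h) $ Jkp (p *.\<^sub>A ?x)"
      using Jkp_natural[of ?h] h by simp
    also have "fmor H (g $\<^sub>A A.kp (A.src g)) $ ... $ Jkp ?x
       = fmor H ((g $\<^sub>A A.kp (A.src g)) $\<^sub>A (A.I p **\<^sub>A ?h)) $ Jkp (p *.\<^sub>A ?x) $ Jkp ?x"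
      using h by (subst H_comp) simp_all
    also have "... = fmor H (g $\<^sub>A f) $ (fmor H (A.kp ?x $\<^sub>A A.kp (p *.\<^sub>A ?x)) $ Jkp (p *.\<^sub>A ?x) $ Jkp ?x)"
      unfolding e using h by (subst H_comp) simp_all
    also have "... = fmor H (g $\<^sub>A f)" using h by (subst Jkp_twice) simp_all
    finally show ?thesis using h by (simp add: lift_hmg)
  qed
qed

lemma fmor_lift_hmg [simp]:
  assumes "hmg A r f"
  shows "hmg B r (fmor lift f)" "B.src (fmor lift f) = fob H (A.src f)" "B.tgt (fmor lift f) = fob H (A.tgt f)"
  using assms by (cases r; simp add: lift_hmg)+

lemma superfunctor_lift: "superfunctor K A B lift"
  by (rule superfunctorI[OF A.supercategory_axioms B.supercategory_axioms])
     (use linear_lift lift_comp in \<open>simp_all add: lift_hmg\<close>)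

text \<open>\<open>kappa_split(1)\<close> reduces \<open>kp\<close> on the tensor product to
  \<open>kp\<close> on the source of \<open>f\<close>, and \<open>J_TensO\<close> does the same for
  \<open>J\<close>.\<close>

lemma lift_whisker_right:
  assumes h: "hmg A 1 f" and [simp]: "A.Ob y"
  shows "fc H (A.tgt f, y) $ (odd_lift f ** B.I (fob H y)) = odd_lift (f **\<^sub>A A.I y) $ fc H (A.src f, y)"
proof -
  note [simp] = A.hmg_arrow[OF h]
  let ?x = "A.src f" and ?x' = "A.tgt f"
  let ?Hx = "fob H ?x" and ?Hy = "fob H y"
  let ?a = "Assoc A p ?x y"
  have k: "(f **\<^sub>A A.I y) $\<^sub>A A.kp (?x *.\<^sub>A y) = ((f $\<^sub>A A.kp ?x) **\<^sub>A A.I y) $\<^sub>A A.ivs ?a"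
    unfolding A.kappa_split(1)[OF A.source_Obj[OF A.hmg_arrow[OF h]] assms(2)] using h by simp
  have i: "B.ivs (B.kp (fob H (?x *.\<^sub>A y))) $ fc H (?x, y)
      = (B.I q ** fc H (?x, y)) $ B.ivs (B.kp (?Hx *. ?Hy))"
    using B.inverse_kappa_natural[of "fc H (?x, y)"] by simp
  have l: "B.ivs (Assoc B q ?Hx ?Hy) $ B.ivs (B.kp (?Hx *. ?Hy)) = B.ivs (B.kp ?Hx) ** B.I ?Hy"
  proof -
    have "B.ivs (Assoc B q ?Hx ?Hy) $ B.ivs (B.kp (?Hx *. ?Hy)) = B.ivs (B.kp (?Hx *. ?Hy) $ Assoc B q ?Hx ?Hy)"
      by simp
    also have "... = B.ivs (B.kp ?Hx) ** B.I ?Hy"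
      by (subst B.kappa_TensO) (simp_all add: B.whisker_invertible)
    finally show ?thesis .
  qed
  have "odd_lift (f **\<^sub>A A.I y) $ fc H (?x, y)
     = fmor H ((f $\<^sub>A A.kp ?x) **\<^sub>A A.I y) $ fmor H (A.ivs ?a) $ J (?x *.\<^sub>A y) $
        (B.ivs (B.kp (fob H (?x *.\<^sub>A y))) $ fc H (?x, y))"
    using h k by (simp add: odd_lift_def Jkp_def H_comp)
  also have "... = fmor H ((f $\<^sub>A A.kp ?x) **\<^sub>A A.I y) $ (fmor H (A.ivs ?a) $ J (?x *.\<^sub>A y) $
        (B.I q ** fc H (?x, y))) $ B.ivs (B.kp (?Hx *. ?Hy))"
    unfolding i using h by simp
  also have "... = (fmor H ((f $\<^sub>A A.kp ?x) **\<^sub>A A.I y) $ fc H (p *.\<^sub>A ?x, y)) $ (J ?x ** B.I ?Hy) $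
        (B.ivs (Assoc B q ?Hx ?Hy) $ B.ivs (B.kp (?Hx *. ?Hy)))"
    using J_TensO[of ?x y] h by simp
  also have "fmor H ((f $\<^sub>A A.kp ?x) **\<^sub>A A.I y) $ fc H (p *.\<^sub>A ?x, y) = fc H (?x', y) $ (fmor H (f $\<^sub>A A.kp ?x) ** B.I ?Hy)"
    using H_fc_nat[of "f $\<^sub>A A.kp ?x" "A.I y"] h by simp
  finally show ?thesis unfolding l using h by (simp add: odd_lift_def Jkp_def)
qed

text \<open>Now \<pi> has to be carried past the object on the left, so
  \<open>kappa_split(2)\<close> brings in the half braiding, and the axiom relating j and \<beta>
  enters.\<close>

lemma lift_whisker_left:
  assumes h: "hmg A 1 g" and [simp]: "A.Ob x"
  shows "fc H (x, A.tgt g) $ (B.I (fob H x) ** odd_lift g) = odd_lift (A.I x **\<^sub>A g) $ fc H (x, A.src g)"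
proof -
  note [simp] = A.hmg_arrow[OF h]
  let ?y = "A.src g" and ?y' = "A.tgt g"
  let ?Hx = "fob H x" and ?Hy = "fob H ?y"
  let ?gk = "g $\<^sub>A A.kp ?y"
  let ?bA = "A.\<beta> x **\<^sub>A A.I ?y" and ?bB = "B.\<beta> ?Hx ** B.I ?Hy"
  let ?a = "Assoc A p x ?y"
  note y = A.source_Obj[OF A.hmg_arrow[OF h]]
  note kA = A.kappa_split(2)[OF assms(2) y] and kB = B.kappa_split(2)[OF H_Obj[OF assms(2)] H_Obj[OF y]]
  have l: "Assoc B ?Hx q ?Hy $ ?bB $ B.ivs (Assoc B q ?Hx ?Hy) $ B.ivs (B.kp (?Hx *. ?Hy))
     = B.I ?Hx ** B.ivs (B.kp ?Hy)"
  proof -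
    let ?t = "Assoc B ?Hx q ?Hy $ ?bB $ B.ivs (Assoc B q ?Hx ?Hy)"
    have "(B.I ?Hx ** B.kp ?Hy) $ ?t $ B.ivs (B.kp (?Hx *. ?Hy)) = B.kp (?Hx *. ?Hy) $ B.ivs (B.kp (?Hx *. ?Hy))"
      by (subst (2) kB) simp
    then have "?t $ B.ivs (B.kp (?Hx *. ?Hy)) = B.ivs (B.I ?Hx ** B.kp ?Hy) $ B.I (?Hx *. ?Hy)"
      by (intro B.inverse_switch) (simp_all add: B.whisker_invertible)
    then show ?thesis by (simp add: B.whisker_invertible)
  qed
  have i: "B.ivs (B.kp (fob H (x *.\<^sub>A ?y))) $ fc H (x, ?y)
      = (B.I q ** fc H (x, ?y)) $ B.ivs (B.kp (?Hx *. ?Hy))"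
    using B.inverse_kappa_natural[of "fc H (x, ?y)"] by simp
  have k: "(A.I x **\<^sub>A g) $\<^sub>A A.kp (x *.\<^sub>A ?y) = (A.I x **\<^sub>A ?gk) $\<^sub>A Assoc A x p ?y $\<^sub>A ?bA $\<^sub>A A.ivs ?a"
    unfolding kA using h by simp
  have 1: "fmor H ?bA $ fc H (p *.\<^sub>A x, ?y) = fc H (x *.\<^sub>A p, ?y) $ (fmor H (A.\<beta> x) ** B.I ?Hy)"
    using H_fc_nat[of "A.\<beta> x" "A.I ?y"] by simp
  have 2: "fmor H (A.\<beta> x) $ J x = fc H (x, p) $ (B.I ?Hx ** fj H) $ B.\<beta> ?Hx"
    using H_fj_beta[of x] by (simp add: J_def)
  have 3: "Assoc B ?Hx (fob H p) ?Hy $ ((B.I ?Hx ** fj H) ** B.I ?Hy)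
     = (B.I ?Hx ** (fj H ** B.I ?Hy)) $ Assoc B ?Hx q ?Hy"
    using B.Assoc_nat_refl[of "B.I ?Hx" "fj H" "B.I ?Hy"] by simp
  have "odd_lift (A.I x **\<^sub>A g) $ fc H (x, ?y)
     = fmor H (A.I x **\<^sub>A ?gk) $ fmor H (Assoc A x p ?y) $ fmor H ?bA $ fmor H (A.ivs ?a) $ J (x *.\<^sub>A ?y) $
        (B.ivs (B.kp (fob H (x *.\<^sub>A ?y))) $ fc H (x, ?y))"
    using h k by (simp add: odd_lift_def Jkp_def H_comp)
  also have "... = fmor H (A.I x **\<^sub>A ?gk) $ fmor H (Assoc A x p ?y) $ fmor H ?bA $ (fmor H (A.ivs ?a) $ J (x *.\<^sub>A ?y) $
        (B.I q ** fc H (x, ?y))) $ B.ivs (B.kp (?Hx *. ?Hy))"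
    unfolding i using h by simp
  also have "... = fmor H (A.I x **\<^sub>A ?gk) $ fmor H (Assoc A x p ?y) $ (fmor H ?bA $ fc H (p *.\<^sub>A x, ?y)) $
       (J x ** B.I ?Hy) $ B.ivs (Assoc B q ?Hx ?Hy) $ B.ivs (B.kp (?Hx *. ?Hy))"
    using J_TensO[of x ?y] h by simp
  also have "... = fmor H (A.I x **\<^sub>A ?gk) $ fmor H (Assoc A x p ?y) $ fc H (x *.\<^sub>A p, ?y) $
       ((fmor H (A.\<beta> x) $ J x) ** B.I ?Hy) $ B.ivs (Assoc B q ?Hx ?Hy) $ B.ivs (B.kp (?Hx *. ?Hy))"
    unfolding 1 using h by simp
  also have "... = fmor H (A.I x **\<^sub>A ?gk) $ (fmor H (Assoc A x p ?y) $ fc H (x *.\<^sub>A p, ?y) $ (fc H (x, p) ** B.I ?Hy)) $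
       ((B.I ?Hx ** fj H) ** B.I ?Hy) $ ?bB $ B.ivs (Assoc B q ?Hx ?Hy) $ B.ivs (B.kp (?Hx *. ?Hy))"
    unfolding 2 using h by simp
  also have "... = fmor H (A.I x **\<^sub>A ?gk) $ fc H (x, p *.\<^sub>A ?y) $ (B.I ?Hx ** fc H (p, ?y)) $
       (Assoc B ?Hx (fob H p) ?Hy $ ((B.I ?Hx ** fj H) ** B.I ?Hy)) $ ?bB $ B.ivs (Assoc B q ?Hx ?Hy) $ B.ivs (B.kp (?Hx *. ?Hy))"
    using H_fc_Assoc[of x p ?y] h by simp
  also have "... = (fmor H (A.I x **\<^sub>A ?gk) $ fc H (x, p *.\<^sub>A ?y)) $ (B.I ?Hx ** J ?y) $
       (Assoc B ?Hx q ?Hy $ ?bB $ B.ivs (Assoc B q ?Hx ?Hy) $ B.ivs (B.kp (?Hx *. ?Hy)))"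
    unfolding 3 using h by (simp add: J_def)
  also have "fmor H (A.I x **\<^sub>A ?gk) $ fc H (x, p *.\<^sub>A ?y) = fc H (x, ?y') $ (B.I ?Hx ** fmor H ?gk)"
    using H_fc_nat[of "A.I x" ?gk] h by simp
  finally show ?thesis unfolding l using h by (simp add: odd_lift_def Jkp_def)
qed

text \<open>The tensor product of two morphisms is a right whiskering after a left one, without a
  sign in this order, so the two whiskered cases suffice.\<close>

lemma lift_fc_natural:
  assumes f: "hmg A r f" and g: "hmg A s g"
  shows "fc H (A.tgt f, A.tgt g) $ (fmor lift f ** fmor lift g)
    = fmor lift (f **\<^sub>A g) $ fc H (A.src f, A.src g)"
proof -
  note [simp] = A.hmg_arrow[OF f] A.hmg_arrow[OF g]
  let ?x = "A.src f" and ?x' = "A.tgt f" and ?y = "A.src g" and ?y' = "A.tgt g"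
  have lf: "fmor lift f \<in> B.Arr" "fmor lift g \<in> B.Arr"
    using B.hmg_arrow fmor_lift_hmg(1)[OF f] fmor_lift_hmg(1)[OF g] by blast+
  note [simp] = lf fmor_lift_hmg(2,3)[OF f] fmor_lift_hmg(2,3)[OF g]
  have r: "fc H (?x', ?y') $ (fmor lift f ** B.I (fob H ?y')) = fmor lift (f **\<^sub>A A.I ?y') $ fc H (?x, ?y')"
    using H_fc_nat[of f "A.I ?y'"] lift_whisker_right[of f ?y'] f by (cases r) (simp_all add: lift_hmg)
  have l: "fc H (?x, ?y') $ (B.I (fob H ?x) ** fmor lift g) = fmor lift (A.I ?x **\<^sub>A g) $ fc H (?x, ?y)"
    using H_fc_nat[of "A.I ?x" g] lift_whisker_left[of g ?x] g by (cases s) (simp_all add: lift_hmg)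
  have hw: "hmg A r (f **\<^sub>A A.I ?y')" "hmg A s (A.I ?x **\<^sub>A g)"
    using A.hmg_TensM_gen[OF f, of 0 "A.I ?y'"] A.hmg_TensM_gen[OF _ g, of 0 "A.I ?x"] by simp_all
  have hwa: "fmor lift (f **\<^sub>A A.I ?y') \<in> B.Arr" "fmor lift (A.I ?x **\<^sub>A g) \<in> B.Arr"
    using B.hmg_arrow fmor_lift_hmg(1)[OF hw(1)] fmor_lift_hmg(1)[OF hw(2)] by blast+
  note [simp] = hwa fmor_lift_hmg(2,3)[OF hw(1)] fmor_lift_hmg(2,3)[OF hw(2)]
  have "fc H (?x', ?y') $ (fmor lift f ** fmor lift g)
    = (fc H (?x', ?y') $ (fmor lift f ** B.I (fob H ?y'))) $ (B.I (fob H ?x) ** fmor lift g)"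
    by simp
  also have "... = fmor lift (f **\<^sub>A A.I ?y') $ (fc H (?x, ?y') $ (B.I (fob H ?x) ** fmor lift g))"
    unfolding r by simp
  also have "... = (fmor lift (f **\<^sub>A A.I ?y') $ fmor lift (A.I ?x **\<^sub>A g)) $ fc H (?x, ?y)"
    unfolding l by simp
  also have "fmor lift (f **\<^sub>A A.I ?y') $ fmor lift (A.I ?x **\<^sub>A g) = fmor lift (f **\<^sub>A g)"
    using lift_comp[OF hw(2,1)] by simp
  finally show ?thesis .
qed

lemma monoidal_superfunctor_lift: "monoidal_superfunctor K A B lift"
proof (rule monoidal_superfunctorI[OF A.monoidal_supercategory_axioms B.monoidal_supercategory_axioms superfunctor_lift])
  show "fob lift \<in> extensional (Obj A)" "fc lift \<in> extensional (Obj A \<times> Obj A)"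
    using H.fob_ext H.fc_ext by simp_all
  show "fmor lift \<in> extensional (A.Arr)" by (simp add: lift_def)
qed (use H_fc_Assoc H_fc_Lun H_fc_Run lift_fc_natural in \<open>simp_all add: lift_hmg\<close>)

text \<open>Only j requires an argument. By \<open>zeta_fj\<close> it is determined by the image of
  \<zeta>, which is invertible; the signs in \<open>zeta_kappa\<close> for \<open>A\<close> and
  \<open>B\<close> cancel.\<close>

lemma underlying_lift: "underlying_monfun A B lift = H"
proof (rule pi_monfun_eqI)
  show "fmor (underlying_monfun A B lift) = fmor H"
    by (rule extensionalityI[OF _ H.fmor_ext]) (simp_all add: underlying_monfun_def lift_hmg)
next
  note zA = A.zeta_kappa and zB = B.zeta_kappa
  have i: "B.ivs (B.kp (fob H p)) $ fj H = (B.I q ** fj H) $ B.ivs (B.kp q)"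
    using B.inverse_kappa_natural[of "fj H"] by simp
  have o: "odd_lift (zeta A) = fmor lift (zeta A)" by (simp add: lift_hmg)
  interpret L: pi_super_functor K A B lift
    by (intro pi_super_functor.intro superfun_between A.pi_super_axioms B.pi_super_axioms
      A.monoidal_supercategory_axioms B.monoidal_supercategory_axioms monoidal_superfunctor_lift)
  have "odd_lift (zeta A) $ fj H = fmor H (zeta A $\<^sub>A A.kp p) $ J p $ (B.ivs (B.kp (fob H p)) $ fj H)"
    by (simp add: odd_lift_def Jkp_def)
  also have "... = sgn_arr B 1 ((fmor H (xi A.U) $ fc H (p, p) $ (fj H ** fj H)) $ B.ivs (B.kp q))"
    unfolding i zA by (simp add: J_def)
  also have "... = fi H $ sgn_arr B 1 (xi B.U) $ B.ivs (B.kp q)"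
    unfolding H_fj_xi[symmetric] by simp
  also have "... = fi H $ zeta B" unfolding zB[symmetric] by simp
  finally have "fmor lift (zeta A) $ fj H = fmor lift (zeta A) $ fj L.UF"
    using L.zeta_fj by (simp add: o)
  then show "fj (underlying_monfun A B lift) = fj H"
    using B.comp_cancel_left[of "fmor lift (zeta A)" "fj H" "fj L.UF"] by (simp del: L.fmor_invertible(2))
qed (simp_all add: underlying_monfun_def)

end

lemma underlying_functor_full:
  assumes "monoidal_pi_supercategory K A" "monoidal_pi_supercategory K B"
    and "monoidal_pi_functor K (underlying A) (underlying B) H"
  shows "\<exists>F. monoidal_superfunctor K A B F \<and> underlying_monfun A B F = H"
proof -
  interpret pi_lift K A B H by (intro pi_lift.intro pi_super assms)
  show ?thesis using monoidal_superfunctor_lift underlying_lift by blast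
qed

section \<open>The odd morphisms of a monoidal $\Pi$-category\<close>

context monoidal_pi_category
begin

abbreviation "a \<equiv> Assoc A"
abbreviation "a' x y z \<equiv> ivs (Assoc A x y z)"

lemma pi_Obj [simp]: "Ob \<pi>" by (rule pi_closed)

lemma beta_arrow [simp]:
  assumes "Ob x"
  shows "invertible A (\<beta> x)" "src (\<beta> x) = \<pi> *. x" "tgt (\<beta> x) = x *. \<pi>"
  using isomD[OF beta_iso[OF assms]] assms by simp_all

lemma xi_arrow [simp]: "invertible A \<xi>" "src \<xi> = \<pi> *. \<pi>" "tgt \<xi> = Unit A"
  using isomD[OF xi_iso] by simp_all

text \<open>A morphism of parity \<open>p\<close> from \<open>x\<close> to \<open>y\<close> is going to be a morphism \<open>P p x \<rightarrow> y\<close>.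
  Composition uses \<open>\<delta>\<close>; tensoring with an object on the right and on the left uses
  \<open>%\<close> and \<open>\<rho>\<close>.\<close>

definition "P p x = (if p = (0::bit) then x else \<pi> *. x)"
definition "Pm p f = (if p = (0::bit) then f else I \<pi> ** f)"
text \<open>The inverse of \<open>kp x\<close> composed with \<open>kp\<close> at \<pi> \<otimes> x,
  read off from \<open>kappa_kappa\<close> with its sign.\<close>

definition "\<omega> x = sgn_arr A 1 (a \<pi> \<pi> x $ (ivs \<xi> ** I x) $ ivs (Lun A x))"
text \<open>Carries \<pi> past \<open>x\<close>. In a \<Pi>-supercategory,
  \<open>kappa_split(2)\<close> says that \<open>kp\<close> on a tensor product is \<open>kp\<close>
  on the right factor after this map.\<close>

definition "\<sigma> x y = a x \<pi> y $ (\<beta> x ** I y) $ a' \<pi> x y"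
definition "\<delta> q p x = (if q = (0::bit) \<or> p = (0::bit) then I (P (q + p) x) else \<omega> x)"
definition "lam p x y = (if p = (0::bit) then I (x *. y) else a' \<pi> x y)"
definition "rho p x y = (if p = (0::bit) then I (x *. y) else \<sigma> x y)"

lemma P_simps [simp]:
  "P 0 x = x" "P 1 x = \<pi> *. x" "Pm 0 f = f" "Pm 1 f = I \<pi> ** f"
  "\<delta> 0 p x = I (P p x)" "\<delta> p 0 x = I (P p x)" "\<delta> 1 1 x = \<omega> x"
  "lam 0 x y = I (x *. y)" "lam 1 x y = a' \<pi> x y" "rho 0 x y = I (x *. y)" "rho 1 x y = \<sigma> x y"
  by (simp_all add: P_def Pm_def \<delta>_def lam_def rho_def)

lemma P_Obj [simp]: "Ob x ==> P p x \<in> Obj A"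
  by (simp add: P_def)

lemma Pm_arrow [simp]:
  assumes "ar f"
  shows "Pm p f \<in> Arr" "src (Pm p f) = P p (src f)" "tgt (Pm p f) = P p (tgt f)"
  using assms by (simp_all add: P_def Pm_def)

lemma omega_arrow [simp]:
  assumes "Ob x"
  shows "\<omega> x \<in> Arr" "src (\<omega> x) = x" "tgt (\<omega> x) = \<pi> *. (\<pi> *. x)"
  using assms by (simp_all add: \<omega>_def)

lemma sigma_arrow [simp]:
  assumes "Ob x" "Ob y"
  shows "\<sigma> x y \<in> Arr" "src (\<sigma> x y) = \<pi> *. (x *. y)" "tgt (\<sigma> x y) = x *. (\<pi> *. y)"
  using assms by (simp_all add: \<sigma>_def)

lemma delta_arrow [simp]:
  assumes "Ob x"
  shows "\<delta> q p x \<in> Arr" "src (\<delta> q p x) = P (q + p) x" "tgt (\<delta> q p x) = P q (P p x)"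
  using assms by (cases q; cases p; simp)+

lemma lam_arrow [simp]:
  assumes "Ob x" "Ob y"
  shows "lam p x y \<in> Arr" "src (lam p x y) = P p (x *. y)" "tgt (lam p x y) = P p x *. y"
  using assms by (cases p; simp)+

lemma rho_arrow [simp]:
  assumes "Ob x" "Ob y"
  shows "rho p x y \<in> Arr" "src (rho p x y) = P p (x *. y)" "tgt (rho p x y) = x *. P p y"
  using assms by (cases p; simp)+

text \<open>The pentagon solved for the combinations of associators and inverses that arise below
  when \<pi> is moved through a bracketing.\<close>

lemma pent:
  assumes "Ob w" "Ob x" "Ob y" "Ob z"
  shows "(I w ** a x y z) $ a w (x *. y) z $ (a w x y ** I z) = a w x (y *. z) $ a (w *. x) y z"
    and "a' w x (y *. z) $ (I w ** a x y z) $ a w (x *. y) z = a (w *. x) y z $ (a' w x y ** I z)"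
    and "(I w ** a' x y z) $ a w x (y *. z) $ a (w *. x) y z = a w (x *. y) z $ (a w x y ** I z)"
    and "a' w x (y *. z) $ (I w ** a x y z) = a (w *. x) y z $ (a' w x y ** I z) $ a' w (x *. y) z"
    and "a w x (y *. z) $ a (w *. x) y z $ (a' w x y ** I z) = (I w ** a x y z) $ a w (x *. y) z"
proof -
  note [simp] = assms
  show 1: "(I w ** a x y z) $ a w (x *. y) z $ (a w x y ** I z) = a w x (y *. z) $ a (w *. x) y z"
    by (rule pentagon[symmetric]) simp_all
  then have *: "a w x (y *. z) $ a (w *. x) y z $ (a' w x y ** I z)
      = ((I w ** a x y z) $ a w (x *. y) z $ (a w x y ** I z)) $ (a' w x y ** I z)" by simp
  then show 2: "a w x (y *. z) $ a (w *. x) y z $ (a' w x y ** I z) = (I w ** a x y z) $ a w (x *. y) z" by simp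
  show 3: "a' w x (y *. z) $ (I w ** a x y z) $ a w (x *. y) z = a (w *. x) y z $ (a' w x y ** I z)"
    unfolding 2[symmetric] by simp
  have "a' w x (y *. z) $ (I w ** a x y z)
      = (a' w x (y *. z) $ (I w ** a x y z) $ a w (x *. y) z) $ a' w (x *. y) z" by simp
  then show "a' w x (y *. z) $ (I w ** a x y z) = a (w *. x) y z $ (a' w x y ** I z) $ a' w (x *. y) z"
    unfolding 3 by simp
  show "(I w ** a' x y z) $ a w x (y *. z) $ a (w *. x) y z = a w (x *. y) z $ (a w x y ** I z)"
    unfolding 1[symmetric] by simp
qed

lemma omega_natural:
  assumes [simp]: "ar f"
  shows "\<omega> (tgt f) $ f = (I \<pi> ** (I \<pi> ** f)) $ \<omega> (src f)"
proof -
  let ?x = "src f" and ?y = "tgt f"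
  have l: "ivs (Lun A ?y) $ f = (I (Unit A) ** f) $ ivs (Lun A ?x)"
  proof (rule inverse_switch[symmetric])
    have "Lun A ?y $ (I (Unit A) ** f) $ ivs (Lun A ?x) = (Lun A ?y $ (I (Unit A) ** f)) $ ivs (Lun A ?x)" by simp
    then show "Lun A ?y $ (I (Unit A) ** f) $ ivs (Lun A ?x) = f" unfolding Lun_nat_refl[OF assms] by simp
  qed simp_all
  have "\<omega> ?y $ f = sgn_arr A 1 ((a \<pi> \<pi> ?y $ ((I \<pi> ** I \<pi>) ** f)) $ (ivs \<xi> ** I ?x) $ ivs (Lun A ?x))"
    by (simp add: \<omega>_def l)
  also have "a \<pi> \<pi> ?y $ ((I \<pi> ** I \<pi>) ** f) = (I \<pi> ** (I \<pi> ** f)) $ a \<pi> \<pi> ?x"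
    using Assoc_nat_refl[of "I \<pi>" "I \<pi>" f] by simp
  finally show ?thesis by (simp add: \<omega>_def)
qed

lemma inverse_Assoc_natural:
  assumes [simp]: "ar f" "ar g" "ar h"
  shows "a' (tgt f) (tgt g) (tgt h) $ (f ** (g ** h)) = ((f ** g) ** h) $ a' (src f) (src g) (src h)"
proof (rule inverse_switch[symmetric])
  have "a (tgt f) (tgt g) (tgt h) $ ((f ** g) ** h) $ a' (src f) (src g) (src h)
    = (a (tgt f) (tgt g) (tgt h) $ ((f ** g) ** h)) $ a' (src f) (src g) (src h)" by simp
  then show "a (tgt f) (tgt g) (tgt h) $ ((f ** g) ** h) $ a' (src f) (src g) (src h) = f ** (g ** h)"
    unfolding Assoc_nat_refl[OF assms] by simp
qed simp_all

lemma sigma_natural: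
  assumes [simp]: "ar f" "ar g"
  shows "\<sigma> (tgt f) (tgt g) $ (I \<pi> ** (f ** g)) = (f ** (I \<pi> ** g)) $ \<sigma> (src f) (src g)"
proof -
  let ?x = "src f" and ?y = "src g" and ?x' = "tgt f" and ?y' = "tgt g"
  have "\<sigma> ?x' ?y' $ (I \<pi> ** (f ** g)) = a ?x' \<pi> ?y' $ (\<beta> ?x' ** I ?y') $ (a' \<pi> ?x' ?y' $ (I \<pi> ** (f ** g)))"
    by (simp add: \<sigma>_def)
  also have "a' \<pi> ?x' ?y' $ (I \<pi> ** (f ** g)) = ((I \<pi> ** f) ** g) $ a' \<pi> ?x ?y"
    using inverse_Assoc_natural[of "I \<pi>" f g] by simp
  also have "a ?x' \<pi> ?y' $ (\<beta> ?x' ** I ?y') $ ... = a ?x' \<pi> ?y' $ ((\<beta> ?x' $ (I \<pi> ** f)) ** g) $ a' \<pi> ?x ?y" by simp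
  also have "\<beta> ?x' $ (I \<pi> ** f) = (f ** I \<pi>) $ \<beta> ?x" by (rule beta_natural) (simp_all add: hom_iff)
  also have "a ?x' \<pi> ?y' $ (... ** g) $ a' \<pi> ?x ?y = (a ?x' \<pi> ?y' $ ((f ** I \<pi>) ** g)) $ (\<beta> ?x ** I ?y) $ a' \<pi> ?x ?y"
    by simp
  also have "a ?x' \<pi> ?y' $ ((f ** I \<pi>) ** g) = (f ** (I \<pi> ** g)) $ a ?x \<pi> ?y" using Assoc_nat_refl[of f "I \<pi>" g] by simp
  finally show ?thesis by (simp add: \<sigma>_def)
qed

text \<open>The axiom on \<xi> and \<beta> at the object \<pi>: since \<beta> is -1 there, the two
  half braidings cancel to a bare associator.\<close>

lemma xi_pi: "a \<pi> \<pi> \<pi> $ (ivs \<xi> ** I \<pi>) $ ivs (Lun A \<pi>) = (I \<pi> ** ivs \<xi>) $ ivs (Run A \<pi>)"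
proof -
  have b: "\<beta> \<pi> = sgn_arr A 1 (I (\<pi> *. \<pi>))" unfolding beta_pi sgn_arr_def signed_def hom_of_def by simp
  have "(I \<pi> ** ivs \<xi>) $ ivs (Run A \<pi>) $ Lun A \<pi> $ (\<xi> ** I \<pi>) = a \<pi> \<pi> \<pi>"
    using xi_beta[OF pi_closed] unfolding b by simp
  then show ?thesis by (auto simp flip: \<open>_ = a \<pi> \<pi> \<pi>\<close>)
qed

text \<open>Associativity for three odd morphisms: one bracketing inserts \<open>\<omega>\<close> at
  \<pi> \<otimes> x, the other inserts it under a tensor product with \<pi>. The proof extends
  \<open>xi_pi\<close> from \<pi> to \<pi> \<otimes> x by the pentagon, the triangle and Kelly's
  identity.\<close>

lemma omega_pi:
  assumes [simp]: "Ob x"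
  shows "\<omega> (\<pi> *. x) = I \<pi> ** \<omega> x"
proof -
  let ?l = "ivs (Lun A \<pi>)" and ?r = "ivs (Run A \<pi>)" and ?x = "ivs \<xi>" and ?U = "Unit A"
  have l: "ivs (Lun A (\<pi> *. x)) = a ?U \<pi> x $ (?l ** I x)"
    using arg_cong[OF Lun_TensO[of \<pi> x], of "%f. a ?U \<pi> x $ ivs f"] by simp
  have r: "I \<pi> ** ivs (Lun A x) = a \<pi> ?U x $ (?r ** I x)"
    using arg_cong[OF triangle[of \<pi> x], of "%f. a \<pi> ?U x $ ivs f"] by simp
  have "a \<pi> \<pi> (\<pi> *. x) $ (?x ** I (\<pi> *. x)) $ ivs (Lun A (\<pi> *. x))
    = a \<pi> \<pi> (\<pi> *. x) $ ((?x ** I (\<pi> *. x)) $ a ?U \<pi> x) $ (?l ** I x)" unfolding l by simp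
  also have "(?x ** I (\<pi> *. x)) $ a ?U \<pi> x = a (\<pi> *. \<pi>) \<pi> x $ ((?x ** I \<pi>) ** I x)"
    using Assoc_nat_refl[of ?x "I \<pi>" "I x"] by simp
  also have "a \<pi> \<pi> (\<pi> *. x) $ ... $ (?l ** I x)
    = (a \<pi> \<pi> (\<pi> *. x) $ a (\<pi> *. \<pi>) \<pi> x) $ (((?x ** I \<pi>) $ ?l) ** I x)" by simp
  also have "a \<pi> \<pi> (\<pi> *. x) $ a (\<pi> *. \<pi>) \<pi> x = (I \<pi> ** a \<pi> \<pi> x) $ a \<pi> (\<pi> *. \<pi>) x $ (a \<pi> \<pi> \<pi> ** I x)"
    by (rule pentagon) simp_all
  also have "... $ (((?x ** I \<pi>) $ ?l) ** I x) = (I \<pi> ** a \<pi> \<pi> x) $ a \<pi> (\<pi> *. \<pi>) x $ ((a \<pi> \<pi> \<pi> $ (?x ** I \<pi>) $ ?l) ** I x)" by simp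
  also have "... = (I \<pi> ** a \<pi> \<pi> x) $ (a \<pi> (\<pi> *. \<pi>) x $ ((I \<pi> ** ?x) ** I x)) $ (?r ** I x)" unfolding xi_pi by simp
  also have "a \<pi> (\<pi> *. \<pi>) x $ ((I \<pi> ** ?x) ** I x) = (I \<pi> ** (?x ** I x)) $ a \<pi> ?U x"
    using Assoc_nat_refl[of "I \<pi>" ?x "I x"] by simp
  also have "(I \<pi> ** a \<pi> \<pi> x) $ ... $ (?r ** I x) = (I \<pi> ** a \<pi> \<pi> x) $ (I \<pi> ** (?x ** I x)) $ (I \<pi> ** ivs (Lun A x))"
    unfolding r by simp
  finally show ?thesis by (simp add: \<omega>_def)
qed

text \<open>The first form makes right whiskering respect composites of odd morphisms; the second
  keeps two adjacent associators, as \<open>sigma_omega\<close> needs them.\<close>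

lemma omega_TensO:
  assumes [simp]: "Ob x" "Ob y"
  shows "\<omega> (x *. y) = (I \<pi> ** a \<pi> x y) $ a \<pi> (\<pi> *. x) y $ (\<omega> x ** I y)"
    and "\<omega> (x *. y) = sgn_arr A 1 (a \<pi> \<pi> (x *. y) $ a (\<pi> *. \<pi>) x y $ (((ivs \<xi> ** I x) $ ivs (Lun A x)) ** I y))"
proof -
  let ?x = "ivs \<xi>" and ?U = "Unit A"
  have l: "ivs (Lun A (x *. y)) = a ?U x y $ (ivs (Lun A x) ** I y)"
    using arg_cong[OF Lun_TensO[of x y], of "%f. a ?U x y $ ivs f"] by simp
  have "\<omega> (x *. y) = sgn_arr A 1 (a \<pi> \<pi> (x *. y) $ ((?x ** I (x *. y)) $ a ?U x y) $ (ivs (Lun A x) ** I y))"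
    unfolding \<omega>_def l by simp
  also have "(?x ** I (x *. y)) $ a ?U x y = a (\<pi> *. \<pi>) x y $ ((?x ** I x) ** I y)"
    using Assoc_nat_refl[of ?x "I x" "I y"] by simp
  finally show 1: "\<omega> (x *. y) = sgn_arr A 1 (a \<pi> \<pi> (x *. y) $ a (\<pi> *. \<pi>) x y $ (((?x ** I x) $ ivs (Lun A x)) ** I y))"
    by simp
  have "\<omega> (x *. y) = sgn_arr A 1 ((a \<pi> \<pi> (x *. y) $ a (\<pi> *. \<pi>) x y) $ (((?x ** I x) $ ivs (Lun A x)) ** I y))"
    unfolding 1 by simp
  also have "a \<pi> \<pi> (x *. y) $ a (\<pi> *. \<pi>) x y = (I \<pi> ** a \<pi> x y) $ a \<pi> (\<pi> *. x) y $ (a \<pi> \<pi> x ** I y)"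
    by (rule pentagon) simp_all
  finally show "\<omega> (x *. y) = (I \<pi> ** a \<pi> x y) $ a \<pi> (\<pi> *. x) y $ (\<omega> x ** I y)" by (simp add: \<omega>_def)
qed

text \<open>Left whiskering respects composites of odd morphisms. Two passages of \<pi> by
  \<open>x\<close> assemble to one side of \<open>xi_beta\<close>; the other side contains \<xi>,
  which cancels its inverse in \<open>\<omega>\<close>.\<close>

lemma sigma_omega:
  assumes [simp]: "Ob x" "Ob y"
  shows "\<sigma> x (\<pi> *. y) $ (I \<pi> ** \<sigma> x y) $ \<omega> (x *. y) = I x ** \<omega> y"
proof -
  let ?x = "ivs \<xi>" and ?U = "Unit A"
  define th where "th = a x \<pi> \<pi> $ (\<beta> x ** I \<pi>) $ a' \<pi> x \<pi> $ (I \<pi> ** \<beta> x) $ a \<pi> \<pi> x"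
  have th: "th = (I x ** ?x) $ ivs (Run A x) $ Lun A x $ (\<xi> ** I x)"
    unfolding th_def by (rule xi_beta[symmetric]) simp
  have "\<sigma> x (\<pi> *. y) $ (I \<pi> ** \<sigma> x y) $ a \<pi> \<pi> (x *. y) $ a (\<pi> *. \<pi>) x y
    = a x \<pi> (\<pi> *. y) $ (\<beta> x ** I (\<pi> *. y)) $ a' \<pi> x (\<pi> *. y) $ (I \<pi> ** a x \<pi> y) $ (I \<pi> ** (\<beta> x ** I y))
      $ ((I \<pi> ** a' \<pi> x y) $ a \<pi> \<pi> (x *. y) $ a (\<pi> *. \<pi>) x y)"
    by (simp add: \<sigma>_def)
  also have "... = a x \<pi> (\<pi> *. y) $ (\<beta> x ** I (\<pi> *. y)) $ a' \<pi> x (\<pi> *. y) $ (I \<pi> ** a x \<pi> y)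
      $ ((I \<pi> ** (\<beta> x ** I y)) $ a \<pi> (\<pi> *. x) y) $ (a \<pi> \<pi> x ** I y)"
    by (subst pent(3)) simp_all
  also have "(I \<pi> ** (\<beta> x ** I y)) $ a \<pi> (\<pi> *. x) y = a \<pi> (x *. \<pi>) y $ ((I \<pi> ** \<beta> x) ** I y)"
    using Assoc_nat_refl[of "I \<pi>" "\<beta> x" "I y"] by simp
  also have "a x \<pi> (\<pi> *. y) $ (\<beta> x ** I (\<pi> *. y)) $ a' \<pi> x (\<pi> *. y) $ (I \<pi> ** a x \<pi> y) $ ... $ (a \<pi> \<pi> x ** I y)
    = a x \<pi> (\<pi> *. y) $ (\<beta> x ** I (\<pi> *. y)) $ (a' \<pi> x (\<pi> *. y) $ (I \<pi> ** a x \<pi> y) $ a \<pi> (x *. \<pi>) y)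
      $ (((I \<pi> ** \<beta> x) $ a \<pi> \<pi> x) ** I y)" by simp
  also have "... = a x \<pi> (\<pi> *. y) $ ((\<beta> x ** I (\<pi> *. y)) $ a (\<pi> *. x) \<pi> y) $ ((a' \<pi> x \<pi> $ (I \<pi> ** \<beta> x) $ a \<pi> \<pi> x) ** I y)"
    by (subst pent(2)) simp_all
  also have "(\<beta> x ** I (\<pi> *. y)) $ a (\<pi> *. x) \<pi> y = a (x *. \<pi>) \<pi> y $ ((\<beta> x ** I \<pi>) ** I y)"
    using Assoc_nat_refl[of "\<beta> x" "I \<pi>" "I y"] by simp
  also have "a x \<pi> (\<pi> *. y) $ ... $ ((a' \<pi> x \<pi> $ (I \<pi> ** \<beta> x) $ a \<pi> \<pi> x) ** I y)
    = (a x \<pi> (\<pi> *. y) $ a (x *. \<pi>) \<pi> y) $ (((\<beta> x ** I \<pi>) $ a' \<pi> x \<pi> $ (I \<pi> ** \<beta> x) $ a \<pi> \<pi> x) ** I y)" by simp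
  also have "a x \<pi> (\<pi> *. y) $ a (x *. \<pi>) \<pi> y = (I x ** a \<pi> \<pi> y) $ a x (\<pi> *. \<pi>) y $ (a x \<pi> \<pi> ** I y)"
    by (rule pentagon) simp_all
  finally have claim: "\<sigma> x (\<pi> *. y) $ (I \<pi> ** \<sigma> x y) $ a \<pi> \<pi> (x *. y) $ a (\<pi> *. \<pi>) x y = (I x ** a \<pi> \<pi> y) $ a x (\<pi> *. \<pi>) y $ (th ** I y)"
    by (simp add: th_def)
  have t: "(ivs (Run A x) ** I y) = a' x ?U y $ (I x ** ivs (Lun A y))"
    using arg_cong[OF triangle[of x y], of "ivs"] by simp
  have "\<sigma> x (\<pi> *. y) $ (I \<pi> ** \<sigma> x y) $ \<omega> (x *. y)
    = sgn_arr A 1 ((\<sigma> x (\<pi> *. y) $ (I \<pi> ** \<sigma> x y) $ a \<pi> \<pi> (x *. y) $ a (\<pi> *. \<pi>) x y) $ (((?x ** I x) $ ivs (Lun A x)) ** I y))"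
    unfolding omega_TensO(2)[OF assms] by simp
  also have "... = sgn_arr A 1 ((I x ** a \<pi> \<pi> y) $ (a x (\<pi> *. \<pi>) y $ ((I x ** ?x) ** I y)) $ (ivs (Run A x) ** I y))"
    unfolding claim th by simp
  also have "a x (\<pi> *. \<pi>) y $ ((I x ** ?x) ** I y) = (I x ** (?x ** I y)) $ a x ?U y"
    using Assoc_nat_refl[of "I x" ?x "I y"] by simp
  finally show ?thesis unfolding t by (simp add: \<omega>_def)
qed

text \<open>\<open>beta_tensor\<close> at \<pi> and \<open>x\<close>, with \<beta> equal to -1 at
  \<pi>, computes \<beta> at \<pi> \<otimes> x. The sign obtained here is that of the interchange of
  two odd morphisms.\<close>

lemma sigma_pi:
  assumes [simp]: "Ob x" "Ob y"
  shows "a' \<pi> x (\<pi> *. y) $ (I \<pi> ** \<sigma> x y) = sgn_arr A 1 (\<sigma> (\<pi> *. x) y $ (I \<pi> ** a' \<pi> x y))"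
proof -
  have b: "\<beta> \<pi> = sgn_arr A 1 (I (\<pi> *. \<pi>))" unfolding beta_pi sgn_arr_def signed_def hom_of_def by simp
  have "(a \<pi> x \<pi> $ \<beta> (\<pi> *. x)) $ a \<pi> \<pi> x = (sgn_arr A 1 (I \<pi> ** \<beta> x)) $ a \<pi> \<pi> x"
    using beta_tensor[of \<pi> x] unfolding b by simp
  then have "a \<pi> x \<pi> $ \<beta> (\<pi> *. x) = sgn_arr A 1 (I \<pi> ** \<beta> x)"
    by (rule comp_cancel_right[rotated 5, where f = "a \<pi> \<pi> x"]) simp_all
  then have bp: "\<beta> (\<pi> *. x) = a' \<pi> x \<pi> $ sgn_arr A 1 (I \<pi> ** \<beta> x)"
    by (rule inverse_switch[rotated 4]) simp_all
  have "\<sigma> (\<pi> *. x) y $ (I \<pi> ** a' \<pi> x y)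
    = sgn_arr A 1 (a (\<pi> *. x) \<pi> y $ (a' \<pi> x \<pi> ** I y) $ (((I \<pi> ** \<beta> x) ** I y) $ a' \<pi> (\<pi> *. x) y) $ (I \<pi> ** a' \<pi> x y))"
    unfolding \<sigma>_def bp by simp
  also have "((I \<pi> ** \<beta> x) ** I y) $ a' \<pi> (\<pi> *. x) y = a' \<pi> (x *. \<pi>) y $ (I \<pi> ** (\<beta> x ** I y))"
    using inverse_Assoc_natural[of "I \<pi>" "\<beta> x" "I y"] by simp
  also have "sgn_arr A 1 (a (\<pi> *. x) \<pi> y $ (a' \<pi> x \<pi> ** I y) $ ... $ (I \<pi> ** a' \<pi> x y))
    = sgn_arr A 1 ((a (\<pi> *. x) \<pi> y $ (a' \<pi> x \<pi> ** I y) $ a' \<pi> (x *. \<pi>) y) $ (I \<pi> ** (\<beta> x ** I y)) $ (I \<pi> ** a' \<pi> x y))" by simp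
  also have "... = sgn_arr A 1 (a' \<pi> x (\<pi> *. y) $ (I \<pi> ** \<sigma> x y))"
    by (subst pent(4)[symmetric]) (simp_all add: \<sigma>_def)
  finally show ?thesis by simp
qed

text \<open>Needed for naturality of the associator at an odd morphism in the second and in the
  third slot. The second slot takes the pentagon only; the third involves \<beta> at a tensor
  product, hence \<open>beta_tensor\<close>.\<close>

lemma sigma_Assoc:
  assumes [simp]: "Ob x" "Ob y" "Ob z"
  shows "a x (\<pi> *. y) z $ (\<sigma> x y ** I z) $ a' \<pi> (x *. y) z = (I x ** a' \<pi> y z) $ \<sigma> x (y *. z) $ (I \<pi> ** a x y z)"
    and "a x y (\<pi> *. z) $ \<sigma> (x *. y) z = (I x ** \<sigma> y z) $ \<sigma> x (y *. z) $ (I \<pi> ** a x y z)"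
proof -
  have "(I x ** a' \<pi> y z) $ \<sigma> x (y *. z) $ (I \<pi> ** a x y z)
    = (I x ** a' \<pi> y z) $ a x \<pi> (y *. z) $ (\<beta> x ** I (y *. z)) $ (a' \<pi> x (y *. z) $ (I \<pi> ** a x y z))"
    by (simp add: \<sigma>_def)
  also have "... = (I x ** a' \<pi> y z) $ a x \<pi> (y *. z) $ ((\<beta> x ** I (y *. z)) $ a (\<pi> *. x) y z) $ (a' \<pi> x y ** I z) $ a' \<pi> (x *. y) z"
    by (subst pent(4)) simp_all
  also have "(\<beta> x ** I (y *. z)) $ a (\<pi> *. x) y z = a (x *. \<pi>) y z $ ((\<beta> x ** I y) ** I z)"
    using Assoc_nat_refl[of "\<beta> x" "I y" "I z"] by simp
  also have "(I x ** a' \<pi> y z) $ a x \<pi> (y *. z) $ ... $ (a' \<pi> x y ** I z) $ a' \<pi> (x *. y) z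
    = ((I x ** a' \<pi> y z) $ a x \<pi> (y *. z) $ a (x *. \<pi>) y z) $ (((\<beta> x ** I y) $ a' \<pi> x y) ** I z) $ a' \<pi> (x *. y) z" by simp
  also have "... = a x (\<pi> *. y) z $ (\<sigma> x y ** I z) $ a' \<pi> (x *. y) z"
    by (subst pent(3)) (simp_all add: \<sigma>_def)
  finally show 1: "a x (\<pi> *. y) z $ (\<sigma> x y ** I z) $ a' \<pi> (x *. y) z = (I x ** a' \<pi> y z) $ \<sigma> x (y *. z) $ (I \<pi> ** a x y z)"
    by simp
  have "(a x y \<pi> $ \<beta> (x *. y)) $ a \<pi> x y = ((I x ** \<beta> y) $ \<sigma> x y) $ a \<pi> x y"
    using beta_tensor[of x y] by (simp add: \<sigma>_def)
  then have "a x y \<pi> $ \<beta> (x *. y) = (I x ** \<beta> y) $ \<sigma> x y"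
    by (rule comp_cancel_right[rotated 5, where f = "a \<pi> x y"]) simp_all
  then have b: "\<beta> (x *. y) = a' x y \<pi> $ (I x ** \<beta> y) $ \<sigma> x y" by (rule inverse_switch[rotated 4]) simp_all
  have "a x y (\<pi> *. z) $ \<sigma> (x *. y) z
    = (a x y (\<pi> *. z) $ a (x *. y) \<pi> z $ (a' x y \<pi> ** I z)) $ ((I x ** \<beta> y) ** I z) $ (\<sigma> x y ** I z) $ a' \<pi> (x *. y) z"
    by (simp add: \<sigma>_def[of "x *. y"] b)
  also have "... = (I x ** a y \<pi> z) $ (a x (y *. \<pi>) z $ ((I x ** \<beta> y) ** I z)) $ (\<sigma> x y ** I z) $ a' \<pi> (x *. y) z"
    by (subst pent(5)) simp_all
  also have "a x (y *. \<pi>) z $ ((I x ** \<beta> y) ** I z) = (I x ** (\<beta> y ** I z)) $ a x (\<pi> *. y) z"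
    using Assoc_nat_refl[of "I x" "\<beta> y" "I z"] by simp
  also have "(I x ** a y \<pi> z) $ ... $ (\<sigma> x y ** I z) $ a' \<pi> (x *. y) z
    = (I x ** (a y \<pi> z $ (\<beta> y ** I z))) $ (a x (\<pi> *. y) z $ (\<sigma> x y ** I z) $ a' \<pi> (x *. y) z)" by simp
  also have "... = (I x ** \<sigma> y z) $ \<sigma> x (y *. z) $ (I \<pi> ** a x y z)"
    unfolding 1 by (simp add: \<sigma>_def[of y])
  finally show "a x y (\<pi> *. z) $ \<sigma> (x *. y) z = (I x ** \<sigma> y z) $ \<sigma> x (y *. z) $ (I \<pi> ** a x y z)" .
qed

text \<open>The axiom \<open>beta_Unit\<close>, spread over \<open>y\<close> by Kelly's identity and
  the triangle; it gives naturality of the left unitor at odd morphisms.\<close>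

lemma sigma_Lun:
  assumes [simp]: "Ob y"
  shows "Lun A (\<pi> *. y) $ \<sigma> (Unit A) y = I \<pi> ** Lun A y"
proof -
  have "Lun A (\<pi> *. y) $ \<sigma> (Unit A) y = (Lun A (\<pi> *. y) $ a (Unit A) \<pi> y) $ (\<beta> (Unit A) ** I y) $ a' \<pi> (Unit A) y"
    by (simp add: \<sigma>_def)
  also have "... = ((Lun A \<pi> $ \<beta> (Unit A)) ** I y) $ a' \<pi> (Unit A) y" by (subst Lun_TensO) simp_all
  also have "... = ((I \<pi> ** Lun A y) $ a \<pi> (Unit A) y) $ a' \<pi> (Unit A) y" unfolding beta_Unit by (subst triangle) simp_all
  finally show ?thesis by simp
qed

end

section \<open>The structure maps uniformly in the parity\<close>

context monoidal_pi_category
begin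

lemma Pm_comp: "[|ar f; ar g; tgt f = src g|] ==> Pm p (g $ f) = Pm p g $ Pm p f"
  by (cases p) simp_all

lemma Pm_Ident [simp]: "Ob x ==> Pm p (I x) = I (P p x)"
  by (cases p) simp_all

lemma lam_natural:
  "[|ar f; ar g|]
    ==> lam p (tgt f) (tgt g) $ Pm p (f ** g) = (Pm p f ** g) $ lam p (src f) (src g)"
  using inverse_Assoc_natural[of "I \<pi>" f g] by (cases p) simp_all

lemma rho_natural:
  "[|ar f; ar g|]
    ==> rho p (tgt f) (tgt g) $ Pm p (f ** g) = (f ** Pm p g) $ rho p (src f) (src g)"
  by (cases p) (simp_all add: sigma_natural)

text \<open>Compatibility of right whiskering with composition for all parities at once;
  \<open>rho_delta\<close> is the version on the left. Only the case of two odd morphisms is more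
  than identities.\<close>

lemma lam_delta:
  assumes "Ob x" "Ob y"
  shows "(\<delta> q p x ** I y) $ lam (q + p) x y = lam q (P p x) y $ Pm q (lam p x y) $ \<delta> q p (x *. y)"
  using assms by (cases q; cases p) (simp_all add: omega_TensO(1))

lemma rho_delta:
  assumes "Ob x" "Ob y"
  shows "(I x ** \<delta> q p y) $ rho (q + p) x y = rho q x (P p y) $ Pm q (rho p x y) $ \<delta> q p (x *. y)"
  using assms by (cases q; cases p) (simp_all add: sigma_omega)

text \<open>The structure maps in the two orders of applying a morphism on the left factor and one
  on the right. They differ only when both are odd, through \<open>sigma_pi\<close>.\<close>

lemma lam_rho:
  assumes [simp]: "Ob x" "Ob y"
  shows "lam p x (P q y) $ Pm p (rho q x y) $ \<delta> p q (x *. y)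
    = sgn_arr A (p * q) (rho q (P p x) y $ Pm q (lam p x y) $ \<delta> q p (x *. y))"
proof -
  have "a' \<pi> x (\<pi> *. y) $ (I \<pi> ** \<sigma> x y) $ \<omega> (x *. y) = (a' \<pi> x (\<pi> *. y) $ (I \<pi> ** \<sigma> x y)) $ \<omega> (x *. y)" by simp
  also have "... = sgn_arr A 1 (\<sigma> (\<pi> *. x) y $ (I \<pi> ** a' \<pi> x y) $ \<omega> (x *. y))" unfolding sigma_pi[OF assms] by simp
  finally show ?thesis by (cases p; cases q) simp_all
qed

lemma lam_Assoc:
  assumes "Ob x" "Ob y" "Ob z"
  shows "a (P p x) y z $ (lam p x y ** I z) $ lam p (x *. y) z = lam p x (y *. z) $ Pm p (a x y z)"
  using assms pent(4)[of \<pi> x y z] by (cases p) simp_all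

lemma rho_Assoc:
  assumes "Ob x" "Ob y" "Ob z"
  shows "a x (P p y) z $ (rho p x y ** I z) $ lam p (x *. y) z = (I x ** lam p y z) $ rho p x (y *. z) $ Pm p (a x y z)"
    and "a x y (P p z) $ rho p (x *. y) z = (I x ** rho p y z) $ rho p x (y *. z) $ Pm p (a x y z)"
  using assms by (cases p; simp add: sigma_Assoc)+

lemma rho_Lun: "Ob y ==> Lun A (P p y) $ rho p (Unit A) y = Pm p (Lun A y)"
  by (cases p) (simp_all add: sigma_Lun)

lemma lam_Run: "Ob x ==> Run A (P p x) $ lam p x (Unit A) = Pm p (Run A x)"
  by (cases p) (simp_all flip: Run_TensO)

end

context linear_monoidal_category
begin

lemma lin_TensM:
  "[|ar f; src f = u; tgt f = v; Ob x; Ob y|]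
    ==> linear_map K (Hm x y) (Hm (u *. x) (v *. y)) (TensM A f)"
  "[|ar f; src f = u; tgt f = v; Ob x; Ob y|]
    ==> linear_map K (Hm x y) (Hm (x *. u) (y *. v)) (%g. g ** f)"
  using bilinear_map_right[OF bilinear_TensM[of u v x y]] bilinear_map_left[OF bilinear_TensM[of x y u v]] arrows_hom[of f]
  by auto

lemma TensM_add_arr [simp]:
  assumes "ar f" "ar g" "ar h" "src g = src f" "tgt g = tgt f"
  shows "h ** add_arr A f g = add_arr A (h ** f) (h ** g)" "add_arr A f g ** h = add_arr A (f ** h) (g ** h)"
  by (rule add_arr_map[OF lin_TensM(1)]; use assms in simp)
     (rule add_arr_map[OF lin_TensM(2)]; use assms in simp)

lemma TensM_zero_arr [simp]:
  "[|ar h; Ob x; Ob y|] ==> h ** zero_arr A x y = zero_arr A (src h *. x) (tgt h *. y)"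
  "[|ar h; Ob x; Ob y|] ==> zero_arr A x y ** h = zero_arr A (x *. src h) (y *. tgt h)"
  by (rule zero_arr_map[OF lin_TensM(1)]; simp) (rule zero_arr_map[OF lin_TensM(2)]; simp)

end

section \<open>Direct sums of two modules as superspaces\<close>

text \<open>A morphism of the new supercategory consists of an even and an odd part but must have
  the type of the given morphisms, so pairs are coded by an injection.\<close>

locale pairing =
  fixes e :: "'m \<times> 'm \<Rightarrow> 'm"
  assumes inj_e: "inj e"
begin

definition "d0 f = fst (inv_into UNIV e f)"
definition "d1 f = snd (inv_into UNIV e f)"

lemma d_e [simp]: "d0 (e (u, v)) = u" "d1 (e (u, v)) = v"
  by (simp_all add: d0_def d1_def inj_e)

lemma e_eq [simp]: "e u = e v \<longleftrightarrow> u = v"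
  using inj_e by (simp add: inj_eq)

definition pair_space :: "('k, 'm) module \<Rightarrow> ('k, 'm) module \<Rightarrow> ('k, 'm) superspace" where
  "pair_space V W =
    \<lparr>carrier = e ` (carrier V \<times> carrier W), monoid.mult = undefined, one = undefined,
     ring.zero = e (\<zero>\<^bsub>V\<^esub>, \<zero>\<^bsub>W\<^esub>), add = (%u v. e (d0 u \<oplus>\<^bsub>V\<^esub> d0 v, d1 u \<oplus>\<^bsub>W\<^esub> d1 v)),
     smult = (%k u. e (k \<odot>\<^bsub>V\<^esub> d0 u, k \<odot>\<^bsub>W\<^esub> d1 u)),
     hpart = (%p. if p = 0 then e ` (carrier V \<times> {\<zero>\<^bsub>W\<^esub>}) else e ` ({\<zero>\<^bsub>V\<^esub>} \<times> carrier W))\<rparr>"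

lemma pair_space_simps [simp]:
  "carrier (pair_space V W) = e ` (carrier V \<times> carrier W)"
  "\<zero>\<^bsub>pair_space V W\<^esub> = e (\<zero>\<^bsub>V\<^esub>, \<zero>\<^bsub>W\<^esub>)"
  "u \<oplus>\<^bsub>pair_space V W\<^esub> v = e (d0 u \<oplus>\<^bsub>V\<^esub> d0 v, d1 u \<oplus>\<^bsub>W\<^esub> d1 v)"
  "k \<odot>\<^bsub>pair_space V W\<^esub> u = e (k \<odot>\<^bsub>V\<^esub> d0 u, k \<odot>\<^bsub>W\<^esub> d1 u)"
  "hpart (pair_space V W) 0 = e ` (carrier V \<times> {\<zero>\<^bsub>W\<^esub>})" "hpart (pair_space V W) 1 = e ` ({\<zero>\<^bsub>V\<^esub>} \<times> carrier W)"
  by (simp_all add: pair_space_def)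

lemma superspace_pair_space:
  assumes "module K V" "module K W"
  shows "superspace K (pair_space V W)"
proof -
  interpret V: module K V by fact
  interpret W: module K W by fact
  have m: "module K (pair_space V W)"
  proof (rule moduleI)
    show "abelian_group (pair_space V W)"
    proof (rule abelian_groupI)
      fix x assume "x \<in> carrier (pair_space V W)"
      then obtain u v where uv: "x = e (u, v)" "u \<in> carrier V" "v \<in> carrier W" by auto
      show "\<exists>y\<in>carrier (pair_space V W). y \<oplus>\<^bsub>pair_space V W\<^esub> x = \<zero>\<^bsub>pair_space V W\<^esub>"
        by (intro bexI[of _ "e (\<ominus>\<^bsub>V\<^esub> u, \<ominus>\<^bsub>W\<^esub> v)"]) (use uv in \<open>auto simp: V.M.l_neg W.M.l_neg\<close>)
    qed (auto simp: V.M.a_ac W.M.a_ac)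
  qed (auto simp: V.smult_l_distr V.smult_r_distr V.smult_assoc1 W.smult_l_distr W.smult_r_distr W.smult_assoc1 V.R.is_cring)
  interpret P: module K "pair_space V W" by (rule m)
  have neg: "\<ominus>\<^bsub>pair_space V W\<^esub> e (u, v) = e (\<ominus>\<^bsub>V\<^esub> u, \<ominus>\<^bsub>W\<^esub> v)" if "u \<in> carrier V" "v \<in> carrier W" for u v
    using that by (intro P.M.minus_equality) (auto simp: V.M.l_neg W.M.l_neg)
  show ?thesis
  proof (intro superspace.intro m superspace_axioms.intro)
    fix p show "submodule (hpart (pair_space V W) p) K (pair_space V W)"
      by (cases p) (intro P.submoduleI; force simp: neg)+
  next
    fix v assume "v \<in> carrier (pair_space V W)"
    then show "\<exists>!(u, w). u \<in> hpart (pair_space V W) 0 \<and> w \<in> hpart (pair_space V W) 1 \<and> v = u \<oplus>\<^bsub>pair_space V W\<^esub> w"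
      by (intro ex1I[of _ "(e (d0 v, \<zero>\<^bsub>W\<^esub>), e (\<zero>\<^bsub>V\<^esub>, d1 v))"]) auto
  qed
qed

lemma linear_map_pair_space:
  "[|linear_map K U V f; linear_map K U W g|] ==> linear_map K U (pair_space V W) (%u. e (f u, g u))"
  unfolding linear_map_def by auto

lemma linear_map_d: "linear_map K (pair_space V W) V d0" "linear_map K (pair_space V W) W d1"
  unfolding linear_map_def by auto

end

section \<open>The monoidal $\Pi$-supercategory of a monoidal $\Pi$-category\<close>

locale pi_twist = monoidal_pi_category K C \<pi> \<beta> \<xi> + pairing e
  for K :: "'k ring" and C :: "('k, 'o, 'm) pi_moncat" (structure) and \<pi> \<beta> \<xi> and e :: "'m \<times> 'm \<Rightarrow> 'm"
begin

text \<open>\<open>inc p x f\<close> is \<open>f : P p x \<rightarrow> y\<close> regarded as a morphism of parity \<open>p\<close> from \<open>x\<close> to \<open>y\<close>.\<close>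

definition "inc p x f = (if p = (0::bit) then e (f, zero_arr C (\<pi> *. x) (tgt f)) else e (zero_arr C x (tgt f), f))"

text \<open>Multiplication by parities: two odd parts compose to an even one through
  \<open>\<omega>\<close>, and an even part met by an odd one is first tensored with \<pi>.\<close>

definition "tcomp G F =
  e (add_arr C (d0 G $ d0 F) (d1 G $ (I \<pi> ** d1 F) $ \<omega> (src (d0 F))),
     add_arr C (d1 G $ (I \<pi> ** d0 F)) (d0 G $ d1 F))"

text \<open>Tensoring with an object on the right, and below on the left. The odd parts are
  corrected by the maps that reduce \<pi> on a tensor product to \<pi> on one factor.\<close>

definition "wr F y = e (d0 F ** I y, (d1 F ** I y) $ a' \<pi> (src (d0 F)) y)"
definition "wl x F = e (I x ** d0 F, (I x ** d1 F) $ \<sigma> x (src (d0 F)))"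

text \<open>The tensor product is a right whiskering after a left one, the order in which the
  interchange law has no sign. That \<zeta> is given by -\<xi> is prescribed by
  \<open>zeta_kappa\<close>.\<close>

definition Tw :: "('k, 'o, 'm) pi_monsupercat" where
  "Tw = \<lparr>Obj = Obj C, Hom = (%x y. pair_space (Hm x y) (Hm (\<pi> *. x) y)), Comp = tcomp,
     Ident = (%x. inc 0 x (I x)), TensO = TensO C,
     TensM = (%F G. tcomp (wr F (tgt (d0 G))) (wl (src (d0 F)) G)), Unit = Unit C,
     Assoc = (%x y z. inc 0 ((x *. y) *. z) (a x y z)), Lun = (%x. inc 0 (Unit C *. x) (Lun C x)),
     Run = (%x. inc 0 (x *. Unit C) (Run C x)), pi_obj = \<pi>, zeta = inc 1 \<pi> (sgn_arr C 1 \<xi>)\<rparr>"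

lemma Tw_simps [simp]:
  "Obj Tw = Obj C" "Hom Tw x y = pair_space (Hm x y) (Hm (\<pi> *. x) y)" "Comp Tw = tcomp"
  "Ident Tw x = inc 0 x (I x)" "TensO Tw = TensO C"
  "TensM Tw F G = tcomp (wr F (tgt (d0 G))) (wl (src (d0 F)) G)" "Unit Tw = Unit C"
  "Assoc Tw x y z = inc 0 ((x *. y) *. z) (a x y z)" "Lun Tw x = inc 0 (Unit C *. x) (Lun C x)"
  "Run Tw x = inc 0 (x *. Unit C) (Run C x)" "pi_obj Tw = \<pi>" "zeta Tw = inc 1 \<pi> (sgn_arr C 1 \<xi>)"
  by (simp_all add: Tw_def)

lemma TwE:
  assumes "F \<in> homset Tw x y" "Ob x" "Ob y"
  obtains f0 f1 where "F = e (f0, f1)" "ar f0" "src f0 = x" "tgt f0 = y"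
    "ar f1" "src f1 = \<pi> *. x" "tgt f1 = y"
  using assms by (auto simp: hom_iff)

lemma TwI:
  "[|ar f0; src f0 = x; tgt f0 = y; ar f1; src f1 = \<pi> *. x; tgt f1 = y|]
    ==> e (f0, f1) \<in> homset Tw x y"
  by (auto intro!: homI)

lemma omega_nat:
  "[|ar f; tgt f = y|] ==> \<omega> y $ f = (I \<pi> ** (I \<pi> ** f)) $ \<omega> (src f)"
  "[|ar f; ar h; tgt f = y; tgt h = src f|]
    ==> \<omega> y $ f $ h = (I \<pi> ** (I \<pi> ** f)) $ \<omega> (src f) $ h"
proof -
  show 1: "\<omega> y $ f = (I \<pi> ** (I \<pi> ** f)) $ \<omega> (src f)" if "ar f" "tgt f = y" for f y
    using omega_natural[of f] that by simp
  assume h: "ar f" "ar h" "tgt f = y" "tgt h = src f"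
  then have "\<omega> y $ f $ h = (\<omega> y $ f) $ h" by auto
  then show "\<omega> y $ f $ h = (I \<pi> ** (I \<pi> ** f)) $ \<omega> (src f) $ h" using h by (simp add: 1)
qed

lemma tcomp_e:
  "src f0 = x ==> tcomp (e (g0, g1)) (e (f0, f1)) =
    e (add_arr C (g0 $ f0) (g1 $ (I \<pi> ** f1) $ \<omega> x), add_arr C (g1 $ (I \<pi> ** f0)) (g0 $ f1))"
  by (simp add: tcomp_def)

lemma tcomp_arrow:
  assumes "ar f" "src f = P p x" "tgt f = y" "Ob x" "ar g" "src g = P q y"
  shows "g $ Pm q f $ \<delta> q p x \<in> Arr" "src (g $ Pm q f $ \<delta> q p x) = P (q + p) x"
    "tgt (g $ Pm q f $ \<delta> q p x) = tgt g"
  using assms by simp_all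

lemma inc_0: "inc 0 x f = e (f, zero_arr C (\<pi> *. x) (tgt f))"
  and inc_1: "inc 1 x f = e (zero_arr C x (tgt f), f)"
  by (simp_all add: inc_def)

lemma category_Tw: "category (cat_of Tw)"
proof (unfold_locales; (unfold cat_of_simps)?)
  fix x y z F G assume "x \<in> Obj Tw" "y \<in> Obj Tw" "z \<in> Obj Tw" "F \<in> homset Tw x y" "G \<in> homset Tw y z"
  moreover have "tcomp G F \<in> homset Tw x z"
    if "Ob x" "Ob y" "Ob z" "F = e (f0, f1)" "ar f0" "src f0 = x" "tgt f0 = y"
      "ar f1" "src f1 = \<pi> *. x" "tgt f1 = y" "G = e (g0, g1)" "ar g0" "src g0 = y"
      "tgt g0 = z" "ar g1" "src g1 = \<pi> *. y" "tgt g1 = z" for f0 f1 g0 g1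
    unfolding that(4,11) tcomp_e[OF that(6)] by (rule TwI) (use that in simp_all)
  ultimately show "Comp Tw G F \<in> homset Tw x z"
    unfolding Tw_simps(1,3) by (elim TwE) blast+
next
  fix x assume "x \<in> Obj Tw"
  then show "Ident Tw x \<in> homset Tw x x" by (auto simp: inc_0 intro!: homI)
next
  fix w x y z F G H assume "w \<in> Obj Tw" "x \<in> Obj Tw" "y \<in> Obj Tw" "z \<in> Obj Tw"
    "F \<in> homset Tw w x" "G \<in> homset Tw x y" "H \<in> homset Tw y z"
  \<comment> \<open>Of the eight combinations of parities only three odd parts pose a problem: there
    the two sides carry \<open>\<omega>\<close> in the two positions identified by
    \<open>omega_pi\<close>.\<close>
  then show "Comp Tw (Comp Tw H G) F = Comp Tw H (Comp Tw G F)"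
    unfolding Tw_simps(1) by (elim TwE; simp only: Tw_simps(3)) (auto simp: tcomp_e omega_nat omega_pi add_arr_ac)
next
  fix x y F assume "x \<in> Obj Tw" "y \<in> Obj Tw" "F \<in> homset Tw x y"
  then show "Comp Tw (Ident Tw y) F = F" "Comp Tw F (Ident Tw x) = F"
    unfolding Tw_simps(1) by (elim TwE; simp only: Tw_simps(3,4); auto simp: tcomp_e inc_0)+
next
  fix x y x' y' F assume "x \<in> Obj Tw" "y \<in> Obj Tw" "x' \<in> Obj Tw" "y' \<in> Obj Tw" "F \<in> homset Tw x y" "F \<in> homset Tw x' y'"
  then show "x = x' \<and> y = y'"
    unfolding Tw_simps(1) by (elim TwE) auto
qed

lemma superspace_Tw: "[|Ob x; Ob y|] ==> superspace K (Hom Tw x y)"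
  by (auto intro!: superspace_pair_space module_Hom)

lemma module_Tw: "[|Ob x; Ob y|] ==> module K (Hom Tw x y)"
  using superspace_Tw[of x y] by (simp add: superspace_def del: Tw_simps)

lemma linear_sum:
  assumes "Ob x" "Ob y" "linear_map K V (Hm x y) f" "linear_map K V (Hm x y) g" "module K V"
  shows "linear_map K V (Hm x y) (%v. add_arr C (f v) (g v))"
proof (rule linear_map_cong[THEN iffD1, OF _ assms(5) linear_map_plus[OF assms(5) module_Hom[OF assms(1,2)] assms(3,4)]])
  fix v assume "v \<in> carrier V"
  then show "f v \<oplus>\<^bsub>Hm x y\<^esub> g v = add_arr C (f v) (g v)"
    using linear_map_closed[OF assms(3)] assms(1,2) by (intro add_arr_eq) (auto simp: hom_iff)
qed

lemma linear_tcomp: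
  assumes o: "Ob x" "Ob y" "Ob z"
  shows "F \<in> homset Tw x y ==> linear_map K (Hom Tw y z) (Hom Tw x z) (%G. tcomp G F)"
    and "G \<in> homset Tw y z ==> linear_map K (Hom Tw x y) (Hom Tw x z) (tcomp G)"
proof -
  note [simp] = o
  note d = linear_map_d[of K]
  assume "F \<in> homset Tw x y"
  then obtain f0 f1 where f: "F = e (f0, f1)" "ar f0" "src f0 = x" "tgt f0 = y"
    "ar f1" "src f1 = \<pi> *. x" "tgt f1 = y" using TwE o by metis
  have "linear_map K (Hom Tw y z) (Hom Tw x z)
     (%G. e (add_arr C (d0 G $ f0) (d1 G $ ((I \<pi> ** f1) $ \<omega> x)), add_arr C (d1 G $ (I \<pi> ** f0)) (d0 G $ f1)))"
    unfolding Tw_simps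
    by (intro linear_map_pair_space linear_sum lin_compose[OF linear_comp_left d(1)]
        lin_compose[OF linear_comp_left d(2)] module_Tw[unfolded Tw_simps]) (use f in simp_all)
  then show "linear_map K (Hom Tw y z) (Hom Tw x z) (%G. tcomp G F)" using f by (simp add: tcomp_def)
next
  note [simp] = o
  note d = linear_map_d[of K]
  assume "G \<in> homset Tw y z"
  then obtain g0 g1 where g: "G = e (g0, g1)" "ar g0" "src g0 = y" "tgt g0 = z"
    "ar g1" "src g1 = \<pi> *. y" "tgt g1 = z" using TwE o by metis
  have lin: "linear_map K (Hom Tw x y) (Hom Tw x z)
     (%F. e (add_arr C (g0 $ d0 F) (g1 $ ((I \<pi> ** d1 F) $ \<omega> x)), add_arr C (g1 $ (I \<pi> ** d0 F)) (g0 $ d1 F)))"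
    unfolding Tw_simps
    by (intro linear_map_pair_space linear_sum lin_compose[OF linear_comp_right d(1)]
        lin_compose[OF linear_comp_right d(2)] module_Tw[unfolded Tw_simps]
        lin_compose[OF linear_comp_right lin_compose[OF linear_comp_left lin_compose[OF lin_TensM(1) d(2)]]]
        lin_compose[OF linear_comp_right lin_compose[OF lin_TensM(1) d(1)]]) (use g in simp_all)
  have "e (add_arr C (g0 $ d0 F) (g1 $ ((I \<pi> ** d1 F) $ \<omega> x)), add_arr C (g1 $ (I \<pi> ** d0 F)) (g0 $ d1 F)) = tcomp G F"
    if "F \<in> homset Tw x y" for F
    using that o by (elim TwE) (simp_all add: tcomp_e g)
  then show "linear_map K (Hom Tw x y) (Hom Tw x z) (tcomp G)"
    by (rule linear_map_cong[THEN iffD1, OF _ module_Tw[OF o(1,2)] lin])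
qed

lemma hpart_Tw:
  assumes "Ob x" "Ob y"
  shows "F \<in> hpart (Hom Tw x y) p \<longleftrightarrow> (\<exists>f. F = inc p x f \<and> ar f \<and> src f = P p x \<and> tgt f = y)"
  using assms by (cases p) (auto simp: inc_def hom_iff zero_arr_def intro!: homI)

text \<open>One formula replaces the four cases of parity, since \<open>\<delta>\<close> is an
  identity unless both morphisms are odd. The laws below are proved uniformly from it.\<close>

lemma tcomp_inc:
  assumes "ar f" "ar g" "Ob x" "src f = P p x" "src g = P q (tgt f)"
  shows "tcomp (inc q (tgt f) g) (inc p x f) = inc (q + p) x (g $ Pm q f $ \<delta> q p x)"
  using assms by (cases p; cases q) (simp_all add: inc_def tcomp_e)

lemma supercategory_Tw: "supercategory K Tw"
proof (intro supercategory.intro linear_category.intro category_Tw linear_category_axioms.intro supercategory_axioms.intro)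
  fix x y assume "x \<in> Obj Tw" "y \<in> Obj Tw"
  then show "module K (Hom Tw x y)" "superspace K (Hom Tw x y)" using module_Tw superspace_Tw by simp_all
next
  fix x y z assume "x \<in> Obj Tw" "y \<in> Obj Tw" "z \<in> Obj Tw"
  then show "bilinear_map K (Hom Tw y z) (Hom Tw x y) (Hom Tw x z) (Comp Tw)"
    unfolding bilinear_map_def using linear_tcomp[of x y z] by simp
next
  fix x y z G F p q assume o: "x \<in> Obj Tw" "y \<in> Obj Tw" "z \<in> Obj Tw" "G \<in> hpart (Hom Tw y z) p" "F \<in> hpart (Hom Tw x y) q"
  then obtain f g where "F = inc q x f" "ar f" "src f = P q x" "tgt f = y"
    "G = inc p y g" "ar g" "src g = P p y" "tgt g = z" by (auto simp: hpart_Tw simp del: Tw_simps(2))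
  then show "Comp Tw G F \<in> hpart (Hom Tw x z) (p + q)"
    using o(1-3) tcomp_inc[of f g x q p] tcomp_arrow[of f q x y g p]
    unfolding Tw_simps(1,3) hpart_Tw[OF o(1,3)[unfolded Tw_simps(1)]] by metis
qed

sublocale T: supercategory K Tw by (rule supercategory_Tw)

lemma inc_arrow [simp]:
  assumes "ar f" "Ob x" "src f = P p x"
  shows "hmg Tw p (inc p x f)" "inc p x f \<in> arrows Tw" "source Tw (inc p x f) = x" "target Tw (inc p x f) = tgt f"
proof -
  have "inc p x f \<in> hpart (Hom Tw x (tgt f)) p" using assms by (subst hpart_Tw) auto
  then show "hmg Tw p (inc p x f)" "inc p x f \<in> arrows Tw" "source Tw (inc p x f) = x" "target Tw (inc p x f) = tgt f"
    using assms T.hpart_iff_hmg[of x "tgt f" "inc p x f" p] T.hmg_arrow by auto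
qed

lemma hmg_TwE:
  assumes "hmg Tw p F"
  obtains f where "F = inc p (source Tw F) f" "ar f" "src f = P p (source Tw F)" "tgt f = target Tw F"
    "source Tw F \<in> Obj C" "target Tw F \<in> Obj C"
  using T.hmg_hpart[OF assms HOL.refl HOL.refl] T.source_Obj[OF T.hmg_arrow[OF assms]] T.target_Obj[OF T.hmg_arrow[OF assms]]
  by (auto simp: hpart_Tw simp del: Tw_simps(2))

lemma linear_inc:
  assumes o: "Ob x" "Ob y"
  shows "linear_map K (Hm (P p x) y) (Hom Tw x y) (inc p x)"
proof -
  have z: "linear_map K (Hm (P p x) y) (Hm u y) (%_. zero_arr C u y)" if "Ob u" for u
    unfolding zero_arr_def by (rule linear_map_zero_const) (use o that in \<open>auto intro: module_Hom\<close>)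
  have lin: "linear_map K (Hm (P p x) y) (Hom Tw x y)
      (%f. if p = 0 then e (f, zero_arr C (\<pi> *. x) y) else e (zero_arr C x y, f))"
    using linear_map_pair_space[OF linear_map_id z] linear_map_pair_space[OF z linear_map_id] o by (cases p) auto
  show ?thesis
    by (rule linear_map_cong[THEN iffD1, OF _ module_Hom lin]) (use o in \<open>auto simp: inc_def hom_iff\<close>)
qed

lemma sgn_inc [simp]:
  assumes "ar f" "Ob x" "src f = P p x"
  shows "sgn_arr Tw r (inc p x f) = inc p x (sgn_arr C r f)"
  using linear_map_signed[OF module_Hom module_Tw linear_inc, of p x "tgt f" f r] assms arrows_hom[of f]
  by (simp add: sgn_arr_def hom_of_def del: Tw_simps(2))

end

section \<open>Whiskering and interchange in the constructed supercategory\<close>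

context pi_twist
begin

lemma tcomp_inc':
  "[|ar f; ar g; Ob x; src f = P p x; tgt f = y; src g = P q y|]
    ==> tcomp (inc q y g) (inc p x f) = inc (q + p) x (g $ Pm q f $ \<delta> q p x)"
  using tcomp_inc by blast

lemma wr_inc:
  "[|ar f; Ob x; Ob y; src f = P p x|]
    ==> wr (inc p x f) y = inc p (x *. y) ((f ** I y) $ lam p x y)"
  by (cases p) (simp_all add: wr_def inc_def)

lemma wl_inc:
  "[|ar f; Ob x; Ob y; src f = P p x|]
    ==> wl y (inc p x f) = inc p (y *. x) ((I y ** f) $ rho p y x)"
  by (cases p) (simp_all add: wl_def inc_def)

lemma wr_arrow [simp]:
  assumes "hmg Tw p F" "Ob y"
  shows "hmg Tw p (wr F y)" "source Tw (wr F y) = source Tw F *. y" "target Tw (wr F y) = target Tw F *. y"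
proof -
  obtain x f where "F = inc p x f" "ar f" "src f = P p x" "Ob x"
    using hmg_TwE[OF assms(1)] by metis
  then show "hmg Tw p (wr F y)" "source Tw (wr F y) = source Tw F *. y" "target Tw (wr F y) = target Tw F *. y"
    using assms(2) by (simp_all add: wr_inc)
qed

lemma wl_arrow [simp]:
  assumes "hmg Tw p F" "Ob y"
  shows "hmg Tw p (wl y F)" "source Tw (wl y F) = y *. source Tw F" "target Tw (wl y F) = y *. target Tw F"
proof -
  obtain x f where "F = inc p x f" "ar f" "src f = P p x" "Ob x"
    using hmg_TwE[OF assms(1)] by metis
  then show "hmg Tw p (wl y F)" "source Tw (wl y F) = y *. source Tw F" "target Tw (wl y F) = y *. target Tw F"
    using assms(2) by (simp_all add: wl_inc)
qed

text \<open>Naturality of \<open>lam\<close> brings the structure maps together, where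
  \<open>lam_delta\<close> applies.\<close>

lemma wr_tcomp:
  assumes "hmg Tw p F" "hmg Tw q G" "target Tw F = source Tw G" and y [simp]: "Ob y"
  shows "wr (tcomp G F) y = tcomp (wr G y) (wr F y)"
proof (rule hmg_TwE[OF assms(1)]; rule hmg_TwE[OF assms(2)])
  let ?x = "source Tw F" and ?x' = "target Tw F"
  fix f g assume f: "F = inc p ?x f" "ar f" "src f = P p ?x" "tgt f = ?x'" "Ob ?x" "Ob ?x'"
    and "G = inc q (source Tw G) g" "ar g" "src g = P q (source Tw G)"
  then have g: "G = inc q ?x' g" "src g = P q ?x'" by (simp_all add: assms(3))
  note [simp] = f(2-6) g(2) \<open>g \<in> Arr\<close>
  have "((g $ Pm q f $ \<delta> q p ?x) ** I y) $ lam (q + p) ?x y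
    = (g ** I y) $ (Pm q f ** I y) $ ((\<delta> q p ?x ** I y) $ lam (q + p) ?x y)" by simp
  also have "... = (g ** I y) $ ((Pm q f ** I y) $ lam q (P p ?x) y) $ Pm q (lam p ?x y) $ \<delta> q p (?x *. y)"
    by (subst lam_delta) simp_all
  also have "(Pm q f ** I y) $ lam q (P p ?x) y = lam q ?x' y $ Pm q (f ** I y)" using lam_natural[of f "I y" q] by simp
  finally have eq: "((g $ Pm q f $ \<delta> q p ?x) ** I y) $ lam (q + p) ?x y
    = ((g ** I y) $ lam q ?x' y) $ Pm q ((f ** I y) $ lam p ?x y) $ \<delta> q p (?x *. y)" by (simp add: Pm_comp)
  show ?thesis
    by (subst (1 2) f(1), subst (1 2) g(1)) (simp add: tcomp_inc' wr_inc eq del: TensM_comp TensM_comp_assoc comp_assoc)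
qed

lemma wl_tcomp:
  assumes "hmg Tw p F" "hmg Tw q G" "target Tw F = source Tw G" and y [simp]: "Ob y"
  shows "wl y (tcomp G F) = tcomp (wl y G) (wl y F)"
proof (rule hmg_TwE[OF assms(1)]; rule hmg_TwE[OF assms(2)])
  let ?x = "source Tw F" and ?x' = "target Tw F"
  fix f g assume f: "F = inc p ?x f" "ar f" "src f = P p ?x" "tgt f = ?x'" "Ob ?x" "Ob ?x'"
    and "G = inc q (source Tw G) g" "ar g" "src g = P q (source Tw G)"
  then have g: "G = inc q ?x' g" "src g = P q ?x'" by (simp_all add: assms(3))
  note [simp] = f(2-6) g(2) \<open>g \<in> Arr\<close>
  have "(I y ** (g $ Pm q f $ \<delta> q p ?x)) $ rho (q + p) y ?x
    = (I y ** g) $ (I y ** Pm q f) $ ((I y ** \<delta> q p ?x) $ rho (q + p) y ?x)" by simp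
  also have "... = (I y ** g) $ ((I y ** Pm q f) $ rho q y (P p ?x)) $ Pm q (rho p y ?x) $ \<delta> q p (y *. ?x)"
    by (subst rho_delta) simp_all
  also have "(I y ** Pm q f) $ rho q y (P p ?x) = rho q y ?x' $ Pm q (I y ** f)" using rho_natural[of "I y" f q] by simp
  finally have eq: "(I y ** (g $ Pm q f $ \<delta> q p ?x)) $ rho (q + p) y ?x
    = ((I y ** g) $ rho q y ?x') $ Pm q ((I y ** f) $ rho p y ?x) $ \<delta> q p (y *. ?x)" by (simp add: Pm_comp)
  show ?thesis
    by (subst (1 2) f(1), subst (1 2) g(1)) (simp add: tcomp_inc' wl_inc eq del: TensM_comp TensM_comp_assoc comp_assoc)
qed

text \<open>The super interchange law in whiskered form. Naturality of \<open>rho\<close> and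
  \<open>lam\<close> isolates the composites of structure maps, and \<open>lam_rho\<close> exchanges
  them with the sign.\<close>

lemma wl_wr:
  assumes "hmg Tw p F" "hmg Tw q G"
  shows "tcomp (wl (target Tw F) G) (wr F (source Tw G))
    = sgn_arr Tw (p * q) (tcomp (wr F (target Tw G)) (wl (source Tw F) G))"
proof (rule hmg_TwE[OF assms(1)]; rule hmg_TwE[OF assms(2)])
  let ?x = "source Tw F" and ?x' = "target Tw F" and ?y = "source Tw G" and ?y' = "target Tw G"
  fix f g assume f: "F = inc p ?x f" "ar f" "src f = P p ?x" "tgt f = ?x'" "Ob ?x" "Ob ?x'"
    and g: "G = inc q ?y g" "ar g" "src g = P q ?y" "tgt g = ?y'" "Ob ?y" "Ob ?y'"
  note [simp] = f(2-6) g(2-6)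
  have "((I ?x' ** g) $ rho q ?x' ?y) $ Pm q ((f ** I ?y) $ lam p ?x ?y) $ \<delta> q p (?x *. ?y)
    = (I ?x' ** g) $ (rho q ?x' ?y $ Pm q (f ** I ?y)) $ Pm q (lam p ?x ?y) $ \<delta> q p (?x *. ?y)" by (simp add: Pm_comp)
  also have "rho q ?x' ?y $ Pm q (f ** I ?y) = (f ** I (P q ?y)) $ rho q (P p ?x) ?y" using rho_natural[of f "I ?y" q] by simp
  also have "(I ?x' ** g) $ ... $ Pm q (lam p ?x ?y) $ \<delta> q p (?x *. ?y)
    = (f ** g) $ (rho q (P p ?x) ?y $ Pm q (lam p ?x ?y) $ \<delta> q p (?x *. ?y))" by simp
  also have "... = (f ** g) $ sgn_arr C (p * q) (lam p ?x (P q ?y) $ Pm p (rho q ?x ?y) $ \<delta> p q (?x *. ?y))"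
    by (subst lam_rho) (simp_all add: add.commute)
  also have "... = sgn_arr C (p * q) ((f ** I ?y') $ ((I (P p ?x) ** g) $ lam p ?x (P q ?y)) $ Pm p (rho q ?x ?y) $ \<delta> p q (?x *. ?y))"
    by (simp add: add.commute)
  also have "(I (P p ?x) ** g) $ lam p ?x (P q ?y) = lam p ?x ?y' $ Pm p (I ?x ** g)" using lam_natural[of "I ?x" g p] by simp
  finally have eq: "((I ?x' ** g) $ rho q ?x' ?y) $ Pm q ((f ** I ?y) $ lam p ?x ?y) $ \<delta> q p (?x *. ?y)
    = sgn_arr C (p * q) (((f ** I ?y') $ lam p ?x ?y') $ Pm p ((I ?x ** g) $ rho q ?x ?y) $ \<delta> p q (?x *. ?y))"
    by (simp add: Pm_comp)
  show ?thesis
    by (subst (2 3) f(1), subst (1 4) g(1)) (simp add: tcomp_inc' wr_inc wl_inc eq add.commute[of q p] del: TensM_comp TensM_comp_assoc comp_assoc)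
qed

lemma tcomp_inc_0:
  "[|ar f; ar h; Ob x; src f = P p x; tgt f = y; src h = y|]
    ==> tcomp (inc 0 y h) (inc p x f) = inc p x (h $ f)"
  "[|ar f; ar h; tgt f = y; src f = x; src h = P p y|]
    ==> tcomp (inc p y h) (inc 0 x f) = inc p x (h $ Pm p f)"
  using tcomp_inc'[of f h x p y 0] tcomp_inc'[of f h x 0 y p] by auto

text \<open>As tensor products are composites of whiskerings, naturality of the associator is
  checked in each slot separately: here in the first, then in the second and the third.\<close>

lemma Assoc_wr_wr:
  assumes "hmg Tw p F" and [simp]: "Ob y" "Ob z"
  shows "tcomp (Assoc Tw (target Tw F) y z) (wr (wr F y) z) = tcomp (wr F (y *. z)) (Assoc Tw (source Tw F) y z)"
proof (rule hmg_TwE[OF assms(1)])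
  let ?x = "source Tw F" and ?x' = "target Tw F"
  fix f assume f: "F = inc p ?x f" "ar f" "src f = P p ?x" "tgt f = ?x'" "Ob ?x" "Ob ?x'"
  note [simp] = f(2-6)
  have "a ?x' y z $ (((f ** I y) $ lam p ?x y) ** I z) $ lam p (?x *. y) z
    = (a ?x' y z $ ((f ** I y) ** I z)) $ (lam p ?x y ** I z) $ lam p (?x *. y) z" by simp
  also have "a ?x' y z $ ((f ** I y) ** I z) = (f ** I (y *. z)) $ a (P p ?x) y z" using Assoc_nat_refl[of f "I y" "I z"] by simp
  also have "... $ (lam p ?x y ** I z) $ lam p (?x *. y) z = (f ** I (y *. z)) $ lam p ?x (y *. z) $ Pm p (a ?x y z)"
    using lam_Assoc[of ?x y z p] by simp
  finally have eq: "a ?x' y z $ (((f ** I y) $ lam p ?x y) ** I z) $ lam p (?x *. y) z = (f ** I (y *. z)) $ lam p ?x (y *. z) $ Pm p (a ?x y z)" .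
  show ?thesis by (subst (2 3) f(1)) (simp add: tcomp_inc_0 wr_inc eq del: TensM_comp TensM_comp_assoc)
qed

lemma Assoc_wr_wl:
  assumes "hmg Tw p F" and [simp]: "Ob x" "Ob z"
  shows "tcomp (Assoc Tw x (target Tw F) z) (wr (wl x F) z) = tcomp (wl x (wr F z)) (Assoc Tw x (source Tw F) z)"
proof (rule hmg_TwE[OF assms(1)])
  let ?y = "source Tw F" and ?y' = "target Tw F"
  fix f assume f: "F = inc p ?y f" "ar f" "src f = P p ?y" "tgt f = ?y'" "Ob ?y" "Ob ?y'"
  note [simp] = f(2-6)
  have "a x ?y' z $ (((I x ** f) $ rho p x ?y) ** I z) $ lam p (x *. ?y) z
    = (a x ?y' z $ ((I x ** f) ** I z)) $ (rho p x ?y ** I z) $ lam p (x *. ?y) z" by simp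
  also have "a x ?y' z $ ((I x ** f) ** I z) = (I x ** (f ** I z)) $ a x (P p ?y) z" using Assoc_nat_refl[of "I x" f "I z"] by simp
  also have "... $ (rho p x ?y ** I z) $ lam p (x *. ?y) z = (I x ** (f ** I z)) $ (I x ** lam p ?y z) $ rho p x (?y *. z) $ Pm p (a x ?y z)"
    using rho_Assoc(1)[of x ?y z p] by simp
  finally have eq: "a x ?y' z $ (((I x ** f) $ rho p x ?y) ** I z) $ lam p (x *. ?y) z
    = ((I x ** ((f ** I z) $ lam p ?y z)) $ rho p x (?y *. z)) $ Pm p (a x ?y z)" by simp
  show ?thesis
    by (subst (2 3) f(1)) (simp add: tcomp_inc_0 wr_inc wl_inc eq del: TensM_comp TensM_comp_assoc comp_assoc)
qed

lemma Assoc_wl_wl: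
  assumes "hmg Tw p F" and [simp]: "Ob x" "Ob y"
  shows "tcomp (Assoc Tw x y (target Tw F)) (wl (x *. y) F) = tcomp (wl x (wl y F)) (Assoc Tw x y (source Tw F))"
proof (rule hmg_TwE[OF assms(1)])
  let ?z = "source Tw F" and ?z' = "target Tw F"
  fix f assume f: "F = inc p ?z f" "ar f" "src f = P p ?z" "tgt f = ?z'" "Ob ?z" "Ob ?z'"
  note [simp] = f(2-6)
  have "a x y ?z' $ (I (x *. y) ** f) $ rho p (x *. y) ?z = (a x y ?z' $ ((I x ** I y) ** f)) $ rho p (x *. y) ?z" by simp
  also have "a x y ?z' $ ((I x ** I y) ** f) = (I x ** (I y ** f)) $ a x y (P p ?z)" using Assoc_nat_refl[of "I x" "I y" f] by simp
  also have "... $ rho p (x *. y) ?z = (I x ** (I y ** f)) $ (I x ** rho p y ?z) $ rho p x (y *. ?z) $ Pm p (a x y ?z)"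
    using rho_Assoc(2)[of x y ?z p] by simp
  finally have eq: "a x y ?z' $ (I (x *. y) ** f) $ rho p (x *. y) ?z
    = ((I x ** ((I y ** f) $ rho p y ?z)) $ rho p x (y *. ?z)) $ Pm p (a x y ?z)" by simp
  show ?thesis
    by (subst (2 3) f(1)) (simp add: tcomp_inc_0 wl_inc eq del: TensM_comp TensM_comp_assoc comp_assoc)
qed

lemma Lun_wl:
  assumes "hmg Tw p F"
  shows "tcomp (Lun Tw (target Tw F)) (wl (Unit C) F) = tcomp F (Lun Tw (source Tw F))"
proof (rule hmg_TwE[OF assms(1)])
  let ?x = "source Tw F" and ?x' = "target Tw F"
  fix f assume f: "F = inc p ?x f" "ar f" "src f = P p ?x" "tgt f = ?x'" "Ob ?x" "Ob ?x'"
  note [simp] = f(2-6)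
  have "Lun C ?x' $ (I (Unit C) ** f) $ rho p (Unit C) ?x = (Lun C ?x' $ (I (Unit C) ** f)) $ rho p (Unit C) ?x" by simp
  also have "... = f $ Pm p (Lun C ?x)" using Lun_nat_refl[of f] by (simp add: rho_Lun)
  finally have eq: "Lun C ?x' $ (I (Unit C) ** f) $ rho p (Unit C) ?x = f $ Pm p (Lun C ?x)" .
  show ?thesis by (subst (2 3) f(1)) (simp add: tcomp_inc_0 wl_inc eq)
qed

lemma Run_wr:
  assumes "hmg Tw p F"
  shows "tcomp (Run Tw (target Tw F)) (wr F (Unit C)) = tcomp F (Run Tw (source Tw F))"
proof (rule hmg_TwE[OF assms(1)])
  let ?x = "source Tw F" and ?x' = "target Tw F"
  fix f assume f: "F = inc p ?x f" "ar f" "src f = P p ?x" "tgt f = ?x'" "Ob ?x" "Ob ?x'"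
  note [simp] = f(2-6)
  have "Run C ?x' $ (f ** I (Unit C)) $ lam p ?x (Unit C) = (Run C ?x' $ (f ** I (Unit C))) $ lam p ?x (Unit C)" by simp
  also have "... = f $ Pm p (Run C ?x)" using Run_nat_refl[of f] by (simp add: lam_Run)
  finally have eq: "Run C ?x' $ (f ** I (Unit C)) $ lam p ?x (Unit C) = f $ Pm p (Run C ?x)" .
  show ?thesis by (subst (2 3) f(1)) (simp add: tcomp_inc_0 wr_inc eq)
qed

end

section \<open>The constructed monoidal \<Pi>-supercategory\<close>

context pi_twist
begin

lemma TwE_arrow:
  assumes "F \<in> arrows Tw"
  obtains f0 f1 where "F = e (f0, f1)" "ar f0" "ar f1" "src f1 = \<pi> *. src f0"
    "tgt f1 = tgt f0" "source Tw F = src f0" "target Tw F = tgt f0"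
  using T.arrows_hom[OF assms] unfolding Tw_simps(1) by (elim TwE) auto

lemma TwI_arrow:
  assumes "ar f0" "ar f1" "src f1 = \<pi> *. src f0" "tgt f1 = tgt f0"
  shows "e (f0, f1) \<in> arrows Tw" "source Tw (e (f0, f1)) = src f0" "target Tw (e (f0, f1)) = tgt f0"
  using T.homD[OF TwI[OF assms(1) HOL.refl HOL.refl assms(2-4)]] assms by simp_all

lemma wr_arrow' [simp]:
  assumes "F \<in> arrows Tw" "Ob y"
  shows "wr F y \<in> arrows Tw" "source Tw (wr F y) = source Tw F *. y" "target Tw (wr F y) = target Tw F *. y"
proof -
  obtain f0 f1 where "F = e (f0, f1)" "ar f0" "ar f1" "src f1 = \<pi> *. src f0"
    "tgt f1 = tgt f0" "source Tw F = src f0" "target Tw F = tgt f0" using assms(1) by (rule TwE_arrow)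
  then show "wr F y \<in> arrows Tw" "source Tw (wr F y) = source Tw F *. y" "target Tw (wr F y) = target Tw F *. y"
    using assms(2) by (simp_all add: wr_def TwI_arrow)
qed

lemma wl_arrow' [simp]:
  assumes "F \<in> arrows Tw" "Ob y"
  shows "wl y F \<in> arrows Tw" "source Tw (wl y F) = y *. source Tw F" "target Tw (wl y F) = y *. target Tw F"
proof -
  obtain f0 f1 where "F = e (f0, f1)" "ar f0" "ar f1" "src f1 = \<pi> *. src f0"
    "tgt f1 = tgt f0" "source Tw F = src f0" "target Tw F = tgt f0" using assms(1) by (rule TwE_arrow)
  then show "wl y F \<in> arrows Tw" "source Tw (wl y F) = y *. source Tw F" "target Tw (wl y F) = y *. target Tw F"
    using assms(2) by (simp_all add: wl_def TwI_arrow)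
qed

lemma linear_wr:
  assumes o: "Ob x" "Ob x'" "Ob y"
  shows "linear_map K (Hom Tw x x') (Hom Tw (x *. y) (x' *. y)) (%F. wr F y)"
proof (rule linear_map_cong[THEN iffD1, OF _ module_Tw[OF o(1,2)]])
  show "linear_map K (Hom Tw x x') (Hom Tw (x *. y) (x' *. y)) (%F. e (d0 F ** I y, (d1 F ** I y) $ a' \<pi> x y))"
    unfolding Tw_simps by (intro linear_map_pair_space lin_compose[OF lin_TensM(2) linear_map_d(1)]
      lin_compose[OF linear_comp_left lin_compose[OF lin_TensM(2) linear_map_d(2)]]) (use o in simp_all)
  show "e (d0 F ** I y, (d1 F ** I y) $ a' \<pi> x y) = wr F y" if "F \<in> homset Tw x x'" for F
    using that o by (elim TwE) (simp_all add: wr_def)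
qed

lemma linear_wl:
  assumes o: "Ob x" "Ob x'" "Ob y"
  shows "linear_map K (Hom Tw x x') (Hom Tw (y *. x) (y *. x')) (wl y)"
proof (rule linear_map_cong[THEN iffD1, OF _ module_Tw[OF o(1,2)]])
  show "linear_map K (Hom Tw x x') (Hom Tw (y *. x) (y *. x')) (%F. e (I y ** d0 F, (I y ** d1 F) $ \<sigma> y x))"
    unfolding Tw_simps by (intro linear_map_pair_space lin_compose[OF lin_TensM(1) linear_map_d(1)]
      lin_compose[OF linear_comp_left lin_compose[OF lin_TensM(1) linear_map_d(2)]]) (use o in simp_all)
  show "e (I y ** d0 F, (I y ** d1 F) $ \<sigma> y x) = wl y F" if "F \<in> homset Tw x x'" for F
    using that o by (elim TwE) (simp_all add: wl_def)
qed

text \<open>The definition reads the endpoints off the even components; on arrows of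
  \<open>Tw\<close> these are the endpoints in \<open>Tw\<close>, so the calculus of sources and
  targets becomes available.\<close>

lemma TensM_Tw:
  "[|F \<in> arrows Tw; G \<in> arrows Tw|] ==> TensM Tw F G = Comp Tw (wr F (target Tw G)) (wl (source Tw F) G)"
  unfolding Tw_simps(3,6) by (elim TwE_arrow) simp

lemma inc_invertible:
  assumes "invertible C f" "src f = x"
  shows "invertible Tw (inc 0 x f)" "inverse_of Tw (inc 0 x f) = inc 0 (tgt f) (ivs f)"
  by (rule T.inverse_of_eqI[of "inc 0 x f" "inc 0 (tgt f) (ivs f)"];
      use assms in \<open>auto simp: tcomp_inc_0\<close>)+

lemma TensM_inc_0:
  "[|ar f; ar g; src f = x; src g = y|] ==> TensM Tw (inc 0 x f) (inc 0 y g) = inc 0 (x *. y) (f ** g)"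
  by (subst TensM_Tw) (auto simp: wr_inc wl_inc tcomp_inc_0)

lemma whisker_Ident:
  assumes "Ob x" "Ob y"
  shows "wr (Ident Tw x) y = Ident Tw (x *. y)" "wl x (Ident Tw y) = Ident Tw (x *. y)"
  using assms by (simp_all add: wr_inc wl_inc)

text \<open>Every tensor product is expanded into whiskerings. Interchange then exchanges one left
  whiskering with one right whiskering, and the associator is moved through them one at a
  time.\<close>

lemma graded_tensor_Tw: "graded_tensor K Tw"
proof (intro graded_tensor.intro supercategory_Tw graded_tensor_axioms.intro)
  fix x x' y y' assume o: "x \<in> Obj Tw" "x' \<in> Obj Tw" "y \<in> Obj Tw" "y' \<in> Obj Tw"
  then have [simp]: "Ob x" "Ob x'" "Ob y" "Ob y'" by simp_all
  note m = module_Tw[of x x'] module_Tw[of y y']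
  have t: "Comp Tw (wr F y') (wl x G) = TensM Tw F G" if "F \<in> homset Tw x x'" "G \<in> homset Tw y y'" for F G
    using T.homD[OF that(1)] T.homD[OF that(2)] by (simp add: TensM_Tw del: Tw_simps(2-))
  show "bilinear_map K (Hom Tw x x') (Hom Tw y y') (Hom Tw (TensO Tw x y) (TensO Tw x' y')) (TensM Tw)"
    unfolding bilinear_map_def
  proof (intro conjI ballI)
    fix F assume F: "F \<in> homset Tw x x'"
    show "linear_map K (Hom Tw y y') (Hom Tw (TensO Tw x y) (TensO Tw x' y')) (TensM Tw F)"
    proof (rule linear_map_cong[THEN iffD1, OF _ m(2)])
      show "linear_map K (Hom Tw y y') (Hom Tw (TensO Tw x y) (TensO Tw x' y')) (%G. Comp Tw (wr F y') (wl x G))"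
        using T.homD[OF F] unfolding Tw_simps(5) by (intro lin_compose[OF T.linear_comp_right[of _ "x *. y'"] linear_wl]) (simp_all del: Tw_simps(2,3,6))
    qed (assumption | rule t[OF F] | simp)+
  next
    fix G assume G: "G \<in> homset Tw y y'"
    show "linear_map K (Hom Tw x x') (Hom Tw (TensO Tw x y) (TensO Tw x' y')) (%F. TensM Tw F G)"
    proof (rule linear_map_cong[THEN iffD1, OF _ m(1)])
      show "linear_map K (Hom Tw x x') (Hom Tw (TensO Tw x y) (TensO Tw x' y')) (%F. Comp Tw (wr F y') (wl x G))"
        using T.homD[OF G] unfolding Tw_simps(5) by (intro lin_compose[OF T.linear_comp_left[of _ _ "x *. y'"] linear_wr]) (simp_all del: Tw_simps(2,3,6))
    qed (assumption | rule t[OF _ G] | simp)+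
  qed
next
  fix p q F G assume h: "hmg Tw p F" "hmg Tw q G"
  note [simp] = T.hmg_arrow[OF h(1)] T.hmg_arrow[OF h(2)]
  have "source Tw F \<in> Obj C" "target Tw G \<in> Obj C" using T.source_Obj[of F] T.target_Obj[of G] by simp_all
  then show "hmg Tw (p + q) (TensM Tw F G)"
    unfolding TensM_Tw[OF T.hmg_arrow[OF h(1)] T.hmg_arrow[OF h(2)]]
    by (intro T.hmg_comp_gen) (use h in simp_all)
next
  fix r p q s F G H L assume h: "hmg Tw r F" "hmg Tw p G" "hmg Tw q H" "hmg Tw s L"
    and c: "target Tw H = source Tw F" "target Tw L = source Tw G"
  note [simp] = T.hmg_arrow[OF h(1)] T.hmg_arrow[OF h(2)] T.hmg_arrow[OF h(3)] T.hmg_arrow[OF h(4)]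
  have [simp]: "source Tw F \<in> Obj C" "target Tw G \<in> Obj C" "source Tw G \<in> Obj C" "source Tw H \<in> Obj C"
    using T.source_Obj[of F] T.target_Obj[of G] T.source_Obj[of G] T.source_Obj[of H] by simp_all
  note [simp del] = Tw_simps(2-)
  have "Comp Tw (TensM Tw F G) (TensM Tw H L)
    = Comp Tw (wr F (target Tw G)) (Comp Tw (Comp Tw (wl (target Tw H) G) (wr H (source Tw G))) (wl (source Tw H) L))"
    by (simp add: TensM_Tw c)
  also have "... = sgn_arr Tw (p * q) (Comp Tw (Comp Tw (wr F (target Tw G)) (wr H (target Tw G)))
      (Comp Tw (wl (source Tw H) G) (wl (source Tw H) L)))"
    unfolding wl_wr[OF h(3,2), folded Tw_simps(3)] by (simp add: c mult.commute)
  also have "... = sgn_arr Tw (p * q) (Comp Tw (wr (Comp Tw F H) (target Tw G)) (wl (source Tw H) (Comp Tw G L)))"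
    using wr_tcomp[OF h(3,1) c(1), of "target Tw G"] wl_tcomp[OF h(4,2) c(2), of "source Tw H"] by (simp add: Tw_simps(3))
  finally show "Comp Tw (TensM Tw F G) (TensM Tw H L) = sgn_arr Tw (p * q) (TensM Tw (Comp Tw F H) (Comp Tw G L))"
    by (simp add: TensM_Tw c)
next
  fix p q r F G H assume h: "hmg Tw p F" "hmg Tw q G" "hmg Tw r H"
  note [simp] = T.hmg_arrow[OF h(1)] T.hmg_arrow[OF h(2)] T.hmg_arrow[OF h(3)]
  let ?x = "source Tw F" and ?y = "source Tw G" and ?z = "source Tw H" and ?x' = "target Tw F" and ?y' = "target Tw G" and ?z' = "target Tw H"
  have o [simp]: "Ob ?x" "Ob ?y" "Ob ?z" "Ob ?x'" "Ob ?y'" "Ob ?z'"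
    using T.source_Obj[of F] T.source_Obj[of G] T.source_Obj[of H] T.target_Obj[of F] T.target_Obj[of G] T.target_Obj[of H] by simp_all
  have A [simp]: "Assoc Tw x y z \<in> arrows Tw" "source Tw (Assoc Tw x y z) = (x *. y) *. z" "target Tw (Assoc Tw x y z) = x *. (y *. z)"
    if "Ob x" "Ob y" "Ob z" for x y z using that by simp_all
  note [simp del] = Tw_simps(2-4,6,8-12)
  have "Comp Tw (Assoc Tw ?x' ?y' ?z') (TensM Tw (TensM Tw F G) H)
    = Comp Tw (Comp Tw (Assoc Tw ?x' ?y' ?z') (wr (wr F ?y') ?z')) (Comp Tw (wr (wl ?x G) ?z') (wl (?x *. ?y) H))"
    using wr_tcomp[of q "wl ?x G" p "wr F ?y'" ?z'] h by (simp add: TensM_Tw Tw_simps(3)[symmetric])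
  also have "... = Comp Tw (wr F (?y' *. ?z')) (Comp Tw (Comp Tw (Assoc Tw ?x ?y' ?z') (wr (wl ?x G) ?z')) (wl (?x *. ?y) H))"
    unfolding Assoc_wr_wr[OF h(1) o(5,6), folded Tw_simps(3)] by simp
  also have "... = Comp Tw (wr F (?y' *. ?z')) (Comp Tw (wl ?x (wr G ?z')) (Comp Tw (Assoc Tw ?x ?y ?z') (wl (?x *. ?y) H)))"
    unfolding Assoc_wr_wl[OF h(2) o(1,6), folded Tw_simps(3)] by simp
  also have "... = Comp Tw (wr F (?y' *. ?z')) (Comp Tw (wl ?x (wr G ?z')) (Comp Tw (wl ?x (wl ?y H)) (Assoc Tw ?x ?y ?z)))"
    unfolding Assoc_wl_wl[OF h(3) o(1,2), folded Tw_simps(3)] by simp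
  also have "... = Comp Tw (TensM Tw F (TensM Tw G H)) (Assoc Tw ?x ?y ?z)"
    using wl_tcomp[of r "wl ?y H" q "wr G ?z'" ?x] h by (simp add: TensM_Tw Tw_simps(3)[symmetric])
  finally show "Comp Tw (Assoc Tw ?x' ?y' ?z') (TensM Tw (TensM Tw F G) H) = Comp Tw (TensM Tw F (TensM Tw G H)) (Assoc Tw ?x ?y ?z)" .
next
  fix p F assume h: "hmg Tw p F"
  note [simp] = T.hmg_arrow[OF h] and [simp del] = Tw_simps(2-4,6,8-12)
  have [simp]: "source Tw F \<in> Obj C" "target Tw F \<in> Obj C" "Ident Tw (Unit C) \<in> arrows Tw"
    "source Tw (Ident Tw (Unit C)) = Unit C" "target Tw (Ident Tw (Unit C)) = Unit C"
    using T.source_Obj[of F] T.target_Obj[of F] T.Ident_arrow[of "Unit C"] by simp_all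
  show "Comp Tw (Lun Tw (target Tw F)) (TensM Tw (Ident Tw (Unit Tw)) F) = Comp Tw F (Lun Tw (source Tw F))"
    "Comp Tw (Run Tw (target Tw F)) (TensM Tw F (Ident Tw (Unit Tw))) = Comp Tw F (Run Tw (source Tw F))"
    using Lun_wl[OF h] Run_wr[OF h] by (simp_all add: TensM_Tw whisker_Ident Tw_simps(3)[symmetric])
next
  fix x y assume "x \<in> Obj Tw" "y \<in> Obj Tw"
  then show "TensM Tw (Ident Tw x) (Ident Tw y) = Ident Tw (TensO Tw x y)"
    "Comp Tw (TensM Tw (Ident Tw x) (Lun Tw y)) (Assoc Tw x (Unit Tw) y) = TensM Tw (Run Tw x) (Ident Tw y)"
    using triangle[of x y] by (simp_all add: TensM_inc_0 tcomp_inc_0 del: Tw_simps(6))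
next
  fix w x y z assume "w \<in> Obj Tw" "x \<in> Obj Tw" "y \<in> Obj Tw" "z \<in> Obj Tw"
  then show "Comp Tw (Assoc Tw w x (TensO Tw y z)) (Assoc Tw (TensO Tw w x) y z)
    = Comp Tw (TensM Tw (Ident Tw w) (Assoc Tw x y z)) (Comp Tw (Assoc Tw w (TensO Tw x y) z) (TensM Tw (Assoc Tw w x y) (Ident Tw z)))"
    using pentagon[of w x y z] by (simp add: TensM_inc_0 tcomp_inc_0 del: Tw_simps(6))
qed (simp_all add: inc_invertible)

text \<open>The right unitor of \<pi>, read as an odd morphism from the unit to \<pi>, inverts
  \<zeta>: each composite contains one \<open>\<omega>\<close>, whose sign cancels that of
  -\<xi>.\<close>

lemma zeta_Tw:
  shows "invertible Tw (zeta Tw)" "inverse_of Tw (zeta Tw) = inc 1 (Unit C) (Run C \<pi>)"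
proof -
  have "\<xi> $ (I \<pi> ** Run C \<pi>) $ a \<pi> \<pi> (Unit C) $ (ivs \<xi> ** I (Unit C)) $ ivs (Lun C (Unit C))
    = \<xi> $ ((I \<pi> ** Run C \<pi>) $ a \<pi> \<pi> (Unit C)) $ (ivs \<xi> ** I (Unit C)) $ ivs (Lun C (Unit C))" by simp
  also have "... = \<xi> $ (Run C (\<pi> *. \<pi>) $ (ivs \<xi> ** I (Unit C))) $ ivs (Run C (Unit C))"
    by (subst Run_TensO) (simp_all add: Lun_Unit)
  also have "Run C (\<pi> *. \<pi>) $ (ivs \<xi> ** I (Unit C)) = ivs \<xi> $ Run C (Unit C)"
    using Run_nat_refl[of "ivs \<xi>"] by simp
  finally have 1: "\<xi> $ (I \<pi> ** Run C \<pi>) $ \<omega> (Unit C) = sgn_arr C 1 (I (Unit C))" by (simp add: \<omega>_def)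
  have 2: "Run C \<pi> $ (I \<pi> ** \<xi>) $ \<omega> \<pi> = sgn_arr C 1 (I \<pi>)" by (simp add: \<omega>_def xi_pi)
  show "invertible Tw (zeta Tw)" "inverse_of Tw (zeta Tw) = inc 1 (Unit C) (Run C \<pi>)"
    by (rule T.inverse_of_eqI[of "zeta Tw" "inc 1 (Unit C) (Run C \<pi>)"]; simp add: tcomp_inc' 1 2)+
qed

lemma monoidal_pi_supercategory_Tw: "monoidal_pi_supercategory K Tw"
proof (intro monoidal_pi_supercategory.intro monoidal_pi_supercategory_axioms.intro)
  show "monoidal_supercategory K Tw" by (rule graded_tensor.monoidal_supercategory[OF graded_tensor_Tw])
  show "isom Tw (pi_obj Tw) (Unit Tw) (zeta Tw)" by (rule T.invertible_isom[OF zeta_Tw(1)]) simp_all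
  show "zeta Tw \<in> hpart (Hom Tw (pi_obj Tw) (Unit Tw)) 1" by (rule T.hmg_hpart) simp_all
qed simp

end

section \<open>Recovering the given \<Pi>-category\<close>

context pi_twist
begin

lemma pi_super_Tw: "pi_super K Tw"
  by (rule pi_super[OF monoidal_pi_supercategory_Tw])

lemma kappa_Tw:
  assumes [simp]: "Ob x"
  shows "pi_super.kp Tw x = inc 1 (\<pi> *. x) (sgn_arr C 1 (Lun C x $ (\<xi> ** I x) $ a' \<pi> \<pi> x))"
    and "pi_super.kp' Tw x = inc 1 (x *. \<pi>) (sgn_arr C 1 (Run C x $ (I x ** \<xi>) $ \<sigma> x \<pi>))"
proof -
  interpret S: pi_super K Tw by (rule pi_super_Tw)
  have i: "Ident Tw y \<in> arrows Tw" "source Tw (Ident Tw y) = y" "target Tw (Ident Tw y) = y" if "Ob y" for y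
    using T.Ident_arrow[of y] that by simp_all
  have z: "zeta Tw \<in> arrows Tw" "source Tw (zeta Tw) = \<pi>" "target Tw (zeta Tw) = Unit C" by simp_all
  have "TensM Tw (zeta Tw) (Ident Tw x) = wr (zeta Tw) x" "TensM Tw (Ident Tw x) (zeta Tw) = wl x (zeta Tw)"
    unfolding TensM_Tw[OF z(1) i(1)[OF assms]] TensM_Tw[OF i(1)[OF assms] z(1)] i[OF assms] z
    by (simp_all only: whisker_Ident[OF pi_closed assms] whisker_Ident[OF assms Unit_closed],
        simp_all add: wr_inc wl_inc tcomp_inc_0)
  then show "pi_super.kp Tw x = inc 1 (\<pi> *. x) (sgn_arr C 1 (Lun C x $ (\<xi> ** I x) $ a' \<pi> \<pi> x))"
    "pi_super.kp' Tw x = inc 1 (x *. \<pi>) (sgn_arr C 1 (Run C x $ (I x ** \<xi>) $ \<sigma> x \<pi>))"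
    unfolding S.kp_def S.kp'_def by (simp_all add: wr_inc wl_inc tcomp_inc_0 del: Tw_simps(6))
qed

text \<open>Both sides solve the equation that \<open>kp'\<close> after the half braiding is
  \<open>kp\<close>. For the given \<beta> this equation is \<open>xi_beta\<close> with \<xi> moved
  to the other side.\<close>

lemma half_braiding_Tw:
  assumes [simp]: "Ob x"
  shows "half_braiding (underlying Tw) x = inc 0 (\<pi> *. x) (\<beta> x)"
proof -
  interpret S: pi_super K Tw by (rule pi_super_Tw)
  have "((I x ** ivs \<xi>) $ ivs (Run C x)) $ (Lun C x $ (\<xi> ** I x) $ a' \<pi> \<pi> x)
    = ((I x ** ivs \<xi>) $ ivs (Run C x) $ Lun C x $ (\<xi> ** I x)) $ a' \<pi> \<pi> x" by simp
  also have "... = \<sigma> x \<pi> $ (I \<pi> ** \<beta> x)" unfolding xi_beta[OF assms] by (simp add: \<sigma>_def)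
  finally have "\<sigma> x \<pi> $ (I \<pi> ** \<beta> x) = ((I x ** ivs \<xi>) $ ivs (Run C x)) $ (Lun C x $ (\<xi> ** I x) $ a' \<pi> \<pi> x)" by simp
  then have eq: "Run C x $ (I x ** \<xi>) $ \<sigma> x \<pi> $ (I \<pi> ** \<beta> x) = Lun C x $ (\<xi> ** I x) $ a' \<pi> \<pi> x" by simp
  have "Comp Tw (S.kp' x) (inc 0 (\<pi> *. x) (\<beta> x)) = S.kp x" by (simp add: kappa_Tw tcomp_inc_0 eq)
  moreover have "Comp Tw (S.kp' x) (half_braiding S.U x) = S.kp x"
    using S.kappa'_beta[of x] by (simp add: underlying_def del: Tw_simps(2-))
  ultimately show ?thesis
    by (intro T.comp_cancel_left[of "S.kp' x" "half_braiding S.U x" "inc 0 (\<pi> *. x) (\<beta> x)"])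
       (use S.beta[of x] in \<open>simp_all del: Tw_simps(2-4,6,8-10,12)\<close>)
qed

text \<open>\<xi> is recovered through \<open>zeta_kappa\<close>. \<open>omega_pi\<close> puts
  \<open>\<omega>\<close> under the tensor product with \<pi>, where it is inverse, up to sign, to
  the map that defines \<open>kp \<pi>\<close>.\<close>

lemma xi_Tw: "xi (underlying Tw) = inc 0 (\<pi> *. \<pi>) \<xi>"
proof -
  interpret S: pi_super K Tw by (rule pi_super_Tw)
  have "(I \<pi> ** (Lun C \<pi> $ (\<xi> ** I \<pi>) $ a' \<pi> \<pi> \<pi>)) $ \<omega> (\<pi> *. \<pi>) = sgn_arr C 1 (I (\<pi> *. \<pi>))"
    unfolding omega_pi[OF pi_closed] by (simp add: \<omega>_def)
  then have "Comp Tw (zeta Tw) (S.kp \<pi>) = inc 0 (\<pi> *. \<pi>) (sgn_arr C 1 \<xi>)"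
    by (simp add: kappa_Tw tcomp_inc')
  then have "sgn_arr Tw 1 (xi S.U) = sgn_arr Tw 1 (inc 0 (\<pi> *. \<pi>) \<xi>)"
    using S.zeta_kappa by simp
  from arg_cong[OF this, of "sgn_arr Tw 1"] show ?thesis by (simp del: Tw_simps(2-))
qed

end

section \<open>Strict isomorphisms of monoidal $\Pi$-categories\<close>

definition strict_monfun :: "('k, 'o, 'm) pi_moncat \<Rightarrow> ('k, 'o, 'm) pi_moncat \<Rightarrow> ('m \<Rightarrow> 'm) \<Rightarrow> ('o, 'm, 'o, 'm) pi_monfun" where
  "strict_monfun C D \<phi> = \<lparr>fob = (\<lambda>x \<in> Obj C. x), fmor = (\<lambda>f \<in> arrows C. \<phi> f),
     fc = (\<lambda>(x, y) \<in> Obj C \<times> Obj C. Ident D (x *.\<^bsub>C\<^esub> y)), fi = Ident D (Unit D), fj = Ident D (pi_ob D)\<rparr>"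

text \<open>The \<Pi>-category and the one recovered from \<open>Tw\<close> have the same objects,
  with the same tensor products, so a map on morphisms with identity coherence maps is enough to
  compare them.\<close>

locale strict_pi_functor =
  C: monoidal_pi_category K C "\<pi>" "\<beta>" "\<xi>" + D: monoidal_pi_category K D "\<pi>'" "\<beta>'" "\<xi>'"
  for K :: "'k ring" and C :: "('k, 'o, 'm) pi_moncat" and \<pi> \<beta> \<xi> and D :: "('k, 'o, 'm) pi_moncat" and \<pi>' \<beta>' \<xi>' +
  fixes \<phi> :: "'m \<Rightarrow> 'm"
  assumes eq: "Obj D = Obj C" "TensO D = TensO C" "Unit D = Unit C" "pi_ob D = pi_ob C"
    and lin: "[|x \<in> Obj C; y \<in> Obj C|] ==> linear_map K (Hom C x y) (Hom D x y) \<phi>"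
    and comp: "[|f \<in> arrows C; g \<in> arrows C; target C f = source C g|] ==> \<phi> (g $\<^bsub>C\<^esub> f) = \<phi> g $\<^bsub>D\<^esub> \<phi> f"
    and Ident: "x \<in> Obj C ==> \<phi> (Ident C x) = Ident D x"
    and tens: "[|f \<in> arrows C; g \<in> arrows C|] ==> \<phi> (f **\<^bsub>C\<^esub> g) = \<phi> f **\<^bsub>D\<^esub> \<phi> g"
    and coh: "[|x \<in> Obj C; y \<in> Obj C; z \<in> Obj C|] ==> \<phi> (Assoc C x y z) = Assoc D x y z"
      "x \<in> Obj C ==> \<phi> (Lun C x) = Lun D x" "x \<in> Obj C ==> \<phi> (Run C x) = Run D x"
      "x \<in> Obj C ==> \<phi> (half_braiding C x) = half_braiding D x" "\<phi> (xi C) = xi D"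
begin

lemma phi_arrow:
  assumes "f \<in> arrows C"
  shows "\<phi> f \<in> arrows D" "source D (\<phi> f) = source C f" "target D (\<phi> f) = target C f"
  using D.homD[OF linear_map_closed[OF lin[of "source C f" "target C f"] C.arrows_hom(3)[OF assms]]] assms eq(1) by simp_all

lemma pi_D: "pi_ob C \<in> Obj C" "pi_ob C \<in> Obj D" "Unit C \<in> Obj D"
  using C.pi_Obj C.\<pi>_def eq(1) by auto

lemma monoidal_pi_functor_strict: "monoidal_pi_functor K C D (strict_monfun C D \<phi>)"
proof -
  have o: "x \<in> Obj D" if "x \<in> Obj C" for x using that eq(1) by simp
  have ar: "f \<in> arrows C" if "f \<in> homset C x y" "x \<in> Obj C" "y \<in> Obj C" for f x y using C.homD that by blast
  note [simp] = eq(2-) o pi_D phi_arrow strict_monfun_def comp Ident tens coh C.hom_iff D.hom_iff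
  have b: "half_braiding C x \<in> arrows C" "source C (half_braiding C x) = pi_ob C *.\<^bsub>C\<^esub> x" "target C (half_braiding C x) = x *.\<^bsub>C\<^esub> pi_ob C"
    if "x \<in> Obj C" for x using C.beta_arrow[of x] that unfolding C.\<pi>_def C.\<beta>_def by simp_all
  have b': "half_braiding D x \<in> arrows D" "source D (half_braiding D x) = pi_ob C *.\<^bsub>C\<^esub> x" "target D (half_braiding D x) = x *.\<^bsub>C\<^esub> pi_ob C"
    if "x \<in> Obj C" for x using D.beta_arrow[of x] that unfolding D.\<pi>_def D.\<beta>_def by simp_all
  have x: "xi C \<in> arrows C" "source C (xi C) = pi_ob C *.\<^bsub>C\<^esub> pi_ob C" "target C (xi C) = Unit C"
    using C.xi_arrow C.invertible_arrow unfolding C.\<pi>_def C.\<xi>_def by simp_all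
  have x': "xi D \<in> arrows D" "source D (xi D) = pi_ob C *.\<^bsub>C\<^esub> pi_ob C" "target D (xi D) = Unit C"
    using D.xi_arrow D.invertible_arrow unfolding D.\<pi>_def D.\<xi>_def by simp_all
  note [simp] = b b' x x'
  have t: "x *.\<^bsub>C\<^esub> y \<in> Obj D" if "x \<in> Obj C" "y \<in> Obj C" for x y using that by simp
  note [simp] = D.TensM_Ident[unfolded eq] D.TensM_arrow[unfolded eq] D.Assoc_arrow[unfolded eq] D.Lun_arrow[unfolded eq] D.Run_arrow[unfolded eq]
  have d: "fob (strict_monfun C D \<phi>) x = x" "x \<in> Obj C ==> y \<in> Obj C ==> fc (strict_monfun C D \<phi>) (x, y) = Ident D (x *.\<^bsub>C\<^esub> y)"
    if "x \<in> Obj C" for x y using that by simp_all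
  show ?thesis
  proof (intro monoidal_pi_functor.intro linear_monoidal_functor.intro linear_functor.intro is_functor.intro
      linear_functor_axioms.intro monoidal_functor_coherence.intro monoidal_pi_functor_axioms.intro; (unfold cat_of_simps)?)
    fix x y assume [simp]: "x \<in> Obj C" "y \<in> Obj C"
    have "linear_map K (Hom C x y) (Hom D x y) (%f. fmor (strict_monfun C D \<phi>) f)"
      by (rule linear_map_cong[THEN iffD1, OF _ C.module_Hom lin]) simp_all
    then show "linear_map K (Hom C x y) (Hom D (fob (strict_monfun C D \<phi>) x) (fob (strict_monfun C D \<phi>) y)) (fmor (strict_monfun C D \<phi>))"
      by (simp add: restrict_def)
  qed (auto intro!: D.invertible_isom)
qed

end

lemma strict_monfun_inverse:
  assumes "strict_pi_functor K C D \<phi>" "strict_pi_functor K D C \<psi>" "!!f. f \<in> arrows C ==> \<psi> (\<phi> f) = f"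
  shows "comp_pi_monfun C C (strict_monfun D C \<psi>) (strict_monfun C D \<phi>) = id_pi_monfun C"
proof -
  interpret F: strict_pi_functor K C "pi_ob C" "half_braiding C" "xi C" D "pi_ob D" "half_braiding D" "xi D" \<phi> using assms(1) by simp
  interpret G: strict_pi_functor K D "pi_ob D" "half_braiding D" "xi D" C "pi_ob C" "half_braiding C" "xi C" \<psi> using assms(2) by simp
  note [simp] = F.eq F.phi_arrow G.Ident F.pi_D
  have o: "x \<in> Obj D" if "x \<in> Obj C" for x using that F.eq(1) by simp
  have a: "Ident D x \<in> arrows D" if "x \<in> Obj C" for x using F.D.Ident_arrow[of x] that by simp
  show ?thesis
    by (rule pi_monfun_eqI)
       (auto simp: fun_eq_iff comp_pi_monfun_def id_pi_monfun_def comp_monfun_def id_monfun_def strict_monfun_def monfun.defs pi_monfun.defs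
          assms(3) o a restrict_def)
qed

text \<open>An even morphism of \<open>Tw\<close> is a pair with vanishing odd part, so
  \<open>d0\<close> and \<open>inc 0\<close> are mutually inverse and strictly preserve the
  structure.\<close>

lemma (in pi_twist) underlying_Tw_iso:
  "strict_pi_functor K (underlying Tw) C d0" "strict_pi_functor K C (underlying Tw) (%f. inc 0 (source C f) f)"
  "!!f. f \<in> arrows (underlying Tw) ==> inc 0 (source C (d0 f)) (d0 f) = f" "!!f. d0 (inc 0 (source C f) f) = f"
proof -
  interpret S: pi_super K Tw by (rule pi_super_Tw)
  have C: "monoidal_pi_category K C" by unfold_locales
  show d [simp]: "d0 (inc 0 (source C f) f) = f" for f by (simp add: inc_0)
  have d' [simp]: "d0 (inc 0 x f) = f" for x f by (simp add: inc_0)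
  have U: "f \<in> homset S.U x y \<longleftrightarrow> (\<exists>g. f = inc 0 x g \<and> g \<in> arrows C \<and> source C g = x \<and> target C g = y)"
    if "x \<in> Obj C" "y \<in> Obj C" for f x y
    using hpart_Tw[OF that, of f 0] by (simp add: underlying_def del: Tw_simps(2-))
  have UE: "\<exists>g. f = inc 0 (source C g) g \<and> g \<in> arrows C \<and> source S.U f = source C g \<and> target S.U f = target C g"
    if "f \<in> arrows S.U" for f
  proof -
    have "source S.U f \<in> Obj C" "target S.U f \<in> Obj C" using S.U.arrows_hom(1,2)[OF that] by (simp_all add: underlying_def)
    then show ?thesis using U[of "source S.U f" "target S.U f" f] S.U.arrows_hom(3)[OF that] by metis
  qed
  show "inc 0 (source C (d0 f)) (d0 f) = f" if "f \<in> arrows S.U" for f using UE[OF that] by auto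
  have b [simp]: "half_braiding C x = \<beta> x" "xi C = \<xi>" "pi_ob C = \<pi>" for x by (simp_all add: \<beta>_def \<xi>_def \<pi>_def)
  have sU [simp]: "Obj S.U = Obj C" "Comp S.U = tcomp" "TensO S.U = TensO C" "Unit S.U = Unit C" "pi_ob S.U = \<pi>"
     "TensM S.U = TensM Tw" "Ident S.U x = inc 0 x (I x)" "Assoc S.U x y z = inc 0 ((x *. y) *. z) (a x y z)"
     "Lun S.U x = inc 0 (Unit C *. x) (Lun C x)" "Run S.U x = inc 0 (x *. Unit C) (Run C x)" for x y z
    by (simp_all add: underlying_def del: Tw_simps(6))
  note [simp] = half_braiding_Tw xi_Tw
  show "strict_pi_functor K S.U C d0"
  proof (intro strict_pi_functor.intro S.monoidal_pi_category_underlying C strict_pi_functor_axioms.intro)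
    fix x y assume o: "x \<in> Obj S.U" "y \<in> Obj S.U"
    have "linear_map K (even_space (Hom Tw x y)) (Hom C x y) d0"
      using linear_map_d(1)[of K "Hom C x y" "Hom C (\<pi> *. x) y"] unfolding linear_map_def by (auto simp: image_iff)
    then show "linear_map K (Hom S.U x y) (Hom C x y) d0" by (simp add: underlying_def)
  next
    fix f g assume "f \<in> arrows S.U" "g \<in> arrows S.U"
    then obtain f' g' where "f = inc 0 (source C f') f'" "g = inc 0 (source C g') g'" "f' \<in> arrows C" "g' \<in> arrows C"
      "target S.U f = target C f'" "source S.U g = source C g'" using UE by metis
    then show "target S.U f = source S.U g ==> d0 (Comp S.U g f) = d0 g $ d0 f" "d0 (TensM S.U f g) = d0 f ** d0 g"
      by (auto simp: tcomp_inc_0 TensM_inc_0 simp del: Tw_simps(6))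
  qed simp_all
  show "strict_pi_functor K C S.U (%f. inc 0 (source C f) f)"
  proof (intro strict_pi_functor.intro S.monoidal_pi_category_underlying C strict_pi_functor_axioms.intro)
    fix x y assume o: "x \<in> Obj C" "y \<in> Obj C"
    have l: "linear_map K (Hom C x y) (even_space (Hom Tw x y)) (inc 0 x)"
      using linear_inc[OF o, of 0] hpart_Tw[OF o, of _ 0] o homD[OF _ o] unfolding linear_map_def by (auto simp: Pi_iff simp del: Tw_simps(2))
    have "linear_map K (Hom C x y) (even_space (Hom Tw x y)) (%f. inc 0 (source C f) f)"
      by (rule linear_map_cong[THEN iffD1, OF _ module_Hom[OF o] l]) (use homD[OF _ o] in simp)
    then show "linear_map K (Hom C x y) (Hom S.U x y) (%f. inc 0 (source C f) f)" by (simp add: underlying_def)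
  qed (simp_all add: tcomp_inc_0 TensM_inc_0 del: Tw_simps(6))
qed

lemma underlying_functor_surj:
  fixes C :: "('k, 'o, 'm) pi_moncat"
  assumes "infinite (UNIV :: 'm set)" "monoidal_pi_category K C"
  shows "\<exists>A s. monoidal_pi_supercategory K A \<and> cat_iso (Pi_Mon K) (underlying A) C s"
proof -
  \<comment> \<open>An infinite type has as many pairs as elements, by cardinal arithmetic; a
    bijection between them is in particular injective.\<close>
  obtain e :: "'m \<times> 'm \<Rightarrow> 'm" where "inj e"
    using card_of_ordIso[THEN iffD2, OF card_of_Times_same_infinite[OF assms(1)]] bij_betw_imp_inj_on by fastforce
  then interpret pi_twist K C "pi_ob C" "half_braiding C" "xi C" e
    using assms(2) by (intro pi_twist.intro pairing.intro) simp_all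
  let ?U = "underlying Tw" and ?i = "%f. inc 0 (source C f) f"
  have U: "monoidal_pi_category K ?U" using pi_super.monoidal_pi_category_underlying[OF pi_super_Tw] .
  note 1 = underlying_Tw_iso(1) and 2 = underlying_Tw_iso(2)
  have c: "comp_pi_monfun ?U ?U (strict_monfun C ?U ?i) (strict_monfun ?U C d0) = id_pi_monfun ?U"
    "comp_pi_monfun C C (strict_monfun ?U C d0) (strict_monfun C ?U ?i) = id_pi_monfun C"
    by (rule strict_monfun_inverse[OF 1 2 underlying_Tw_iso(3)]; assumption)
       (rule strict_monfun_inverse[OF 2 1 underlying_Tw_iso(4)])
  have "cat_iso (Pi_Mon K) ?U C (?U, strict_monfun ?U C d0, C)"
    unfolding cat_iso_def Pi_Mon_def
    using strict_pi_functor.monoidal_pi_functor_strict[OF 1] strict_pi_functor.monoidal_pi_functor_strict[OF 2] c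
    by (auto intro!: bexI[of _ "(C, strict_monfun C ?U ?i, ?U)"])
  then show ?thesis using monoidal_pi_supercategory_Tw by blast
qed

lemma underlying_functor_equivalence:
  assumes "infinite (UNIV :: 'm set)"
  shows "is_equivalence (Pi_SMon K :: (('k, 'o, 'm) pi_monsupercat, _) cat) (Pi_Mon K) underlying_functor"
proof (rule is_equivalenceI[OF category_Pi_SMon category_Pi_Mon underlying_functor_is_functor])
  fix A B :: "('k, 'o, 'm) pi_monsupercat" and F G
  assume "A \<in> ob (Pi_SMon K)" "B \<in> ob (Pi_SMon K)" "F \<in> arr (Pi_SMon K) A B" "G \<in> arr (Pi_SMon K) A B"
    "fmor underlying_functor F = fmor underlying_functor G"
  then show "F = G"
    using underlying_functor_faithful[of K A B] by (auto simp: Pi_SMon_def underlying_functor_def)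
next
  fix A B :: "('k, 'o, 'm) pi_monsupercat" and H
  assume "A \<in> ob (Pi_SMon K)" "B \<in> ob (Pi_SMon K)" "H \<in> arr (Pi_Mon K) (fob underlying_functor A) (fob underlying_functor B)"
  then show "\<exists>F \<in> arr (Pi_SMon K) A B. fmor underlying_functor F = H"
    using underlying_functor_full[of K A B] by (fastforce simp: Pi_SMon_def Pi_Mon_def underlying_functor_def)
next
  fix C :: "('k, 'o, 'm) pi_moncat"
  assume "C \<in> ob (Pi_Mon K)"
  then show "\<exists>A \<in> ob (Pi_SMon K). \<exists>s. cat_iso (Pi_Mon K) (fob underlying_functor A) C s"
    using underlying_functor_surj[OF assms, of K C] by (simp add: Pi_SMon_def Pi_Mon_def underlying_functor_def)
qed

theorem theorem1p15:
  fixes K :: "'k ring"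
  assumes "field K"
    and "\<one>\<^bsub>K\<^esub> \<oplus>\<^bsub>K\<^esub> \<one>\<^bsub>K\<^esub> \<noteq> \<zero>\<^bsub>K\<^esub>"
    and "infinite (UNIV :: 'm set)"
  shows
    "is_functor (SMon K :: (('k, 'o1, 'm1) monsupercat, _) cat) (Pi_SMon K) envelope_functor \<and>
     is_functor (Pi_SMon K :: (('k, 'o2, 'm2) pi_monsupercat, _) cat) (SMon K) nu_functor \<and>
     (\<forall>(A :: ('k, 'o1, 'm1) monsupercat) (B :: ('k, 'o2, 'm2) pi_monsupercat).
        monoidal_supercategory K A \<and> monoidal_pi_supercategory K B \<longrightarrow>
        (\<exists>\<Phi>. is_equivalence (HomCat K A (forget_pi B)) (HomCat K (forget_pi (envelope A)) (forget_pi B)) \<Phi>))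
     \<and>
     is_equivalence (Pi_SMon K :: (('k, 'o, 'm) pi_monsupercat, _) cat) (Pi_Mon K) underlying_functor"

proof (intro conjI allI impI)
  show "is_functor (SMon K :: (('k, 'o1, 'm1) monsupercat, _) cat) (Pi_SMon K) envelope_functor"
    by (rule envelope_functor_is_functor)
  show "is_functor (Pi_SMon K :: (('k, 'o2, 'm2) pi_monsupercat, _) cat) (SMon K) nu_functor"
    by (rule nu_functor_is_functor)
  show "is_equivalence (Pi_SMon K :: (('k, 'o, 'm) pi_monsupercat, _) cat) (Pi_Mon K) underlying_functor"
    by (rule underlying_functor_equivalence) fact
next
  fix A :: "('k, 'o1, 'm1) monsupercat" and B :: "('k, 'o2, 'm2) pi_monsupercat"
  assume a: "monoidal_supercategory K A \<and> monoidal_pi_supercategory K B"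
  then interpret B: monoidal_pi_supercategory K B by blast
  \<comment> \<open>\<open>forget_pi B\<close> no longer carries \<pi> and \<zeta>; they are handed
    over as an object with an odd isomorphism onto the unit.\<close>
  show "\<exists>\<Phi>. is_equivalence (HomCat K A (forget_pi B)) (HomCat K (forget_pi (envelope A)) (forget_pi B)) \<Phi>"
    using envelope_equivalence[of K A "forget_pi B" "pi_obj B" "zeta B"] a B.pi_obj_closed B.zeta_iso B.zeta_odd
      monoidal_supercategory_if_pi[of K B]
    by (simp add: monoidal_supercategory_forget_pi)
qed

end
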